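(* Let $\alpha\ge1$ be an integer, $1\le r\le d$, $C>0$, and consider the location-scale regression model of the context on $[0,1]^d$, with covariate density class $\mathcal H$, scale function class $\Sigma$ and error density $f$ as specified there, and with regression function $\mu$ in the class $T_r(\alpha;C)$, where $\sup_{\mu\in T_r(\alpha;C)}\|\mu\|_\infty<\infty$. Then the minimax rate of convergence under the squared $L_2$ loss for estimating the regression function is $n^{-\frac{2\alpha}{2\alpha+r}}$, that is, $$\inf_{\hat\mu}\ \sup_{\mu\in T_r(\alpha;C),\ \sigma\in\Sigma,\ h\in\mathcal H}\mathbb E\|\mu-\hat\mu\|_{2,h}^2\asymp n^{-\frac{2\alpha}{2\alpha+r}},$$ the infimum being over all estimators based on $(X_i,Y_i)_{i=1}^n$.
   Context: Model. $(X_i,Y_i)_{i=1}^n$ are i.i.d. with $Y_i=\mu(X_i)+\sigma(X_i)\epsilon_i$, $X_i\in[0,1]^d$ with density $h\in\mathcal H$, and $\epsilon_i$ independent of $X_i$ with known density $f$ on $\mathbb R$. $\mathcal H$ is the class of all densities $h$ on $[0,1]^d$ with $1/\overline C\le h(x)\le\overline C$, for a fixed constant $\overline C>1$. $\Sigma=\{x\mapsto\exp(\sum_{i=1}^dc_ix_i):\max_{1\le i\le d}|c_i|\le C'\}$ for a known constant $C'>0$. The error density $f$ is any one of the following, where $\rho_\tau(y)=y(\tau-I(y<0))$ and $\Gamma(t,k)=\int_k^\infty x^{t-1}e^{-x}dx$: (a) $f(y)=\tau(1-\tau)\exp[-\rho_\tau(y)]$, $0<\tau<1$; (b) $f(y)=\frac{\tau(1-\tau)}{\Gamma(a+1,a)}[a+\rho_\tau(y)]^a\exp\{-[a+\rho_\tau(y)]\}$,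 $0<\tau<1$, $a\ge0$; (c) $f(y)=\frac{2\tau}{\sqrt{2\pi}}e^{-y^2/2}I(y\le0)+\frac{1-\tau}{\beta}e^{-y/\beta}I(y>0)$, $0<\tau<1$, $\beta>0$, $\frac{1-\tau}{\beta}=\frac{2\tau}{\sqrt{2\pi}}$; (d) $f(y)=\frac1{\pi(1+y^2)}$; (e) $f(y)=\frac{2}{\sqrt\pi}\frac{\sqrt{\phi(1-\phi)}}{\sqrt\phi+\sqrt{1-\phi}}\exp[-\phi y^2I(y\ge0)-(1-\phi)y^2I(y<0)]$, $0<\phi<1$. Function classes. For $r\ge1$, $\mathbf z=(z_1,\dots,z_r)\in[0,1]^r$ and $\mathbf k=(k_1,\dots,k_r)$ with nonnegative integers $k_i$, let $D^{\mathbf k}=\frac{\partial^{\|\mathbf k\|_1}}{\partial z_1^{k_1}\cdots\partial z_r^{k_r}}$. The $r$-dimensional Sobolev norm is $$\|g\|_{\mathcal G_2^{\alpha,r}}=\|g\|_2+\left(\sum_{\|\mathbf k\|_1=\alpha}\int_{[0,1]^r}|D^{\mathbf k}g|^2\,d\mathbf z\right)^{1/2},$$ and $\mathcal G_2^{\alpha,r}(C)$ is the set of functions $g$ on $[0,1]^r$ with $\|g\|_{\mathcal G_2^{\alpha,r}}\le C$. Then $$T_r(\alpha;C)=\left\{\sum_{1\le i_1<\cdots<i_r\le d}g_{i_1,\dots,i_r}(x_{i_1},\dots,x_{i_r}):\ g_{i_1,\dots,i_r}\in\mathcal G_2^{\alpha,r}(C)\right\},$$ so $T_1(\alpha;C)$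 consists of additive functions and $T_d(\alpha;C)=\mathcal G_2^{\alpha,d}(C)$. Notation. $\|\mu-\upsilon\|_{2,h}^2=\int(\mu(x)-\upsilon(x))^2h(x)\,dx$; $k_n\asymp s_n$ means $k_n=O(s_n)$ and $s_n=O(k_n)$ as $n\to\infty$, with $d,r,\alpha$, the constants and $f$ fixed. *)

theory Defs
  imports "HOL-Probability.Probability" "HOL-Library.Landau_Symbols"
begin

section \<open>Unit cube and Sobolev balls\<close>

text \<open>
  The dimensions \<open>d\<close> and \<open>r\<close> are the cardinalities of finite linearly ordered index types.
  On \<open>real ^ 'a\<close> the constant \<open>1\<close> is the all-ones vector, so \<open>cbox 0 1\<close> is the closed unit cube
  and \<open>box 0 1\<close> is its interior. Functions on the cube are total functions whose values outside
  the cube are never used.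
\<close>

abbreviation unit_cube :: "(real ^ 'a::finite) set" where
  "unit_cube \<equiv> cbox 0 1"

definition cube_measure :: "(real ^ 'a::finite) measure" where
  "cube_measure = restrict_space lborel unit_cube"

definition square_integrable :: "(real ^ 'a::finite \<Rightarrow> real) \<Rightarrow> bool" where
  "square_integrable g \<longleftrightarrow>
     g \<in> borel_measurable cube_measure \<and> integrable cube_measure (\<lambda>z. (g z)\<^sup>2)"

definition partial :: "'a::finite \<Rightarrow> (real ^ 'a \<Rightarrow> real) \<Rightarrow> real ^ 'a \<Rightarrow> real" where
  "partial i g = (\<lambda>z. frechet_derivative g (at z) (axis i 1))"

text \<open>The classical \<open>D\<close>-operator for a multi-index \<open>k\<close>; it is only applied to smooth functions.\<close>

definition multi_partial ::
    "('a::{finite,linorder} \<Rightarrow> nat) \<Rightarrow> ((real, 'a) vec \<Rightarrow> real) \<Rightarrow> (real, 'a) vec \<Rightarrow> real" where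
  "multi_partial k g = foldr (\<lambda>i. partial i ^^ k i) (sorted_list_of_set UNIV) g"

text \<open>
  Infinite differentiability: every iterated partial derivative (including \<open>g\<close> itself) is
  differentiable everywhere, hence also continuous.
\<close>

definition smooth :: "(real ^ 'a::finite \<Rightarrow> real) \<Rightarrow> bool" where
  "smooth g \<longleftrightarrow> (\<forall>ds z. foldr partial ds g differentiable (at z))"

definition test_function :: "(real ^ 'a::finite \<Rightarrow> real) \<Rightarrow> bool" where
  "test_function \<phi> \<longleftrightarrow>
     smooth \<phi> \<and> (\<exists>K. compact K \<and> K \<subseteq> box 0 1 \<and> (\<forall>z. z \<notin> K \<longrightarrow> \<phi> z = 0))"

text \<open>\<open>v\<close> is a square-integrable weak derivative of \<open>g\<close> on the cube, for the multi-index \<open>k\<close>.\<close>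

definition has_weak_deriv ::
    "('a::{finite,linorder} \<Rightarrow> nat) \<Rightarrow> ((real, 'a) vec \<Rightarrow> real) \<Rightarrow> ((real, 'a) vec \<Rightarrow> real) \<Rightarrow> bool" where
  "has_weak_deriv k g v \<longleftrightarrow> square_integrable v \<and>
     (\<forall>\<phi>. test_function \<phi> \<longrightarrow>
        (\<integral>z. g z * multi_partial k \<phi> z \<partial>cube_measure)
          = (- 1) ^ (\<Sum>i\<in>UNIV. k i) * (\<integral>z. v z * \<phi> z \<partial>cube_measure))"

text \<open>Weak derivatives are unique almost everywhere, so the choice does not affect integrals.\<close>

definition weak_deriv ::
    "('a::{finite,linorder} \<Rightarrow> nat) \<Rightarrow> ((real, 'a) vec \<Rightarrow> real) \<Rightarrow> (real, 'a) vec \<Rightarrow> real" where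
  "weak_deriv k g = (SOME v. has_weak_deriv k g v)"

definition multi_indices :: "nat \<Rightarrow> ('a::finite \<Rightarrow> nat) set" where
  "multi_indices \<alpha> = {k. (\<Sum>i\<in>UNIV. k i) = \<alpha>}"

lemma finite_multi_indices: "finite (multi_indices \<alpha> :: ('a::finite \<Rightarrow> nat) set)"
proof (rule finite_subset)
  show "(multi_indices \<alpha> :: ('a \<Rightarrow> nat) set) \<subseteq> (\<Pi>\<^sub>E i\<in>UNIV. {..\<alpha>})"
    by (auto simp: multi_indices_def PiE_UNIV_domain intro: member_le_sum)
  show "finite (\<Pi>\<^sub>E i\<in>(UNIV :: 'a set). {..\<alpha>})"
    by (intro finite_PiE) auto
qed

definition sobolev_space :: "nat \<Rightarrow> ((real, 'a::{finite,linorder}) vec \<Rightarrow> real) set" where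
  "sobolev_space \<alpha> =
     {g. square_integrable g \<and> (\<forall>k\<in>multi_indices \<alpha>. \<exists>v. has_weak_deriv k g v)}"

definition sobolev_norm :: "nat \<Rightarrow> ((real, 'a::{finite,linorder}) vec \<Rightarrow> real) \<Rightarrow> real" where
  "sobolev_norm \<alpha> g =
     sqrt (\<integral>z. (g z)\<^sup>2 \<partial>cube_measure)
     + sqrt (\<Sum>k\<in>multi_indices \<alpha>. \<integral>z. \<bar>weak_deriv k g z\<bar>\<^sup>2 \<partial>cube_measure)"

definition sobolev_ball :: "nat \<Rightarrow> real \<Rightarrow> ((real, 'a::{finite,linorder}) vec \<Rightarrow> real) set" where
  "sobolev_ball \<alpha> C = {g \<in> sobolev_space \<alpha>. sobolev_norm \<alpha> g \<le> C}"

text \<open>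
  The class \<open>T\<^sub>r(\<alpha>; C)\<close> with \<open>r = CARD('r)\<close>, \<open>d = CARD('d)\<close>. A strictly monotone map
  \<open>\<iota> :: 'r \<Rightarrow> 'd\<close> is an index tuple \<open>i\<^sub>1 < \<dots> < i\<^sub>r\<close>.
\<close>

definition interaction_class ::
    "'r::{finite,linorder} itself \<Rightarrow> nat \<Rightarrow> real \<Rightarrow> ((real, 'd::{finite,linorder}) vec \<Rightarrow> real) set" where
  "interaction_class _ \<alpha> C =
     {\<mu>. \<exists>g :: ('r \<Rightarrow> 'd) \<Rightarrow> (real, 'r) vec \<Rightarrow> real.
        (\<forall>\<iota>. strict_mono \<iota> \<longrightarrow> g \<iota> \<in> sobolev_ball \<alpha> C) \<and>
        (\<forall>x\<in>unit_cube. \<mu> x = (\<Sum>\<iota> | strict_mono \<iota>. g \<iota> (\<chi> j. x $ \<iota> j)))}"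

section \<open>Covariate densities, scale functions and error densities\<close>

definition density_class :: "real \<Rightarrow> (real ^ 'd::finite \<Rightarrow> real) set" where
  "density_class B =
     {h. h \<in> borel_measurable cube_measure \<and> (\<integral>x. h x \<partial>cube_measure) = 1 \<and>
         (\<forall>x\<in>unit_cube. 1 / B \<le> h x \<and> h x \<le> B)}"

definition scale_class :: "real \<Rightarrow> (real ^ 'd::finite \<Rightarrow> real) set" where
  "scale_class B =
     {\<sigma>. \<exists>c :: real ^ 'd. Max (range (\<lambda>i. \<bar>c $ i\<bar>)) \<le> B \<and>
           \<sigma> = (\<lambda>x. exp (\<Sum>i\<in>UNIV. c $ i * x $ i))}"

definition check_loss :: "real \<Rightarrow> real \<Rightarrow> real" where
  "check_loss \<tau> y = y * (\<tau> - (if y < 0 then 1 else 0))"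

definition upper_Gamma :: "real \<Rightarrow> real \<Rightarrow> real" where
  "upper_Gamma t k = (LBINT x:{k..}. x powr (t - 1) * exp (- x))"

text \<open>
  In the second family \<open>0 powr 0 = 0\<close> matters only for \<open>a = 0\<close> and \<open>y = 0\<close>, a single point.
\<close>

inductive error_density :: "(real \<Rightarrow> real) \<Rightarrow> bool" where
  asymmetric_laplace:
    "0 < \<tau> \<Longrightarrow> \<tau> < 1 \<Longrightarrow>
     error_density (\<lambda>y. \<tau> * (1 - \<tau>) * exp (- check_loss \<tau> y))"
| gamma_tail:
    "0 < \<tau> \<Longrightarrow> \<tau> < 1 \<Longrightarrow> 0 \<le> a \<Longrightarrow>
     error_density (\<lambda>y. \<tau> * (1 - \<tau>) / upper_Gamma (a + 1) a
       * (a + check_loss \<tau> y) powr a * exp (- (a + check_loss \<tau> y)))"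
| half_normal_exponential:
    "0 < \<tau> \<Longrightarrow> \<tau> < 1 \<Longrightarrow> 0 < \<beta> \<Longrightarrow> (1 - \<tau>) / \<beta> = 2 * \<tau> / sqrt (2 * pi) \<Longrightarrow>
     error_density (\<lambda>y. if y \<le> 0 then 2 * \<tau> / sqrt (2 * pi) * exp (- (y\<^sup>2) / 2)
                        else (1 - \<tau>) / \<beta> * exp (- y / \<beta>))"
| cauchy:
    "error_density (\<lambda>y. 1 / (pi * (1 + y\<^sup>2)))"
| asymmetric_normal:
    "0 < \<phi> \<Longrightarrow> \<phi> < 1 \<Longrightarrow>
     error_density (\<lambda>y. 2 / sqrt pi * (sqrt (\<phi> * (1 - \<phi>)) / (sqrt \<phi> + sqrt (1 - \<phi>)))
       * exp (if y \<ge> 0 then - \<phi> * y\<^sup>2 else - (1 - \<phi>) * y\<^sup>2))"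

section \<open>Regression model and minimax risk\<close>

text \<open>Law of one observation \<open>(X, \<mu> X + \<sigma> X * \<epsilon>)\<close> with \<open>X\<close> and \<open>\<epsilon>\<close> independent.\<close>

definition obs_law ::
    "(real \<Rightarrow> real) \<Rightarrow> (real ^ 'd::finite \<Rightarrow> real) \<Rightarrow> (real ^ 'd \<Rightarrow> real) \<Rightarrow> (real ^ 'd \<Rightarrow> real)
      \<Rightarrow> ((real ^ 'd) \<times> real) measure" where
  "obs_law f \<mu> \<sigma> h =
     distr (density cube_measure (\<lambda>x. ennreal (h x)) \<Otimes>\<^sub>M density lborel (\<lambda>e. ennreal (f e)))
       borel (\<lambda>(x, e). (x, \<mu> x + \<sigma> x * e))"

definition sample_law ::
    "(real \<Rightarrow> real) \<Rightarrow> nat \<Rightarrow> (real ^ 'd::finite \<Rightarrow> real) \<Rightarrow> (real ^ 'd \<Rightarrow> real) \<Rightarrow> (real ^ 'd \<Rightarrow> real)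
      \<Rightarrow> (nat \<Rightarrow> (real ^ 'd) \<times> real) measure" where
  "sample_law f n \<mu> \<sigma> h = (\<Pi>\<^sub>M i\<in>{..<n}. obs_law f \<mu> \<sigma> h)"

text \<open>
  An estimator maps the sample to a function on the cube; joint measurability in the sample and
  the evaluation point makes its risk well defined.
\<close>

definition estimators ::
    "nat \<Rightarrow> ((nat \<Rightarrow> (real ^ 'd::finite) \<times> real) \<Rightarrow> real ^ 'd \<Rightarrow> real) set" where
  "estimators n =
     {m. (\<lambda>(s, x). m s x) \<in> borel_measurable ((\<Pi>\<^sub>M i\<in>{..<n}. borel) \<Otimes>\<^sub>M cube_measure)}"

text \<open>The squared \<open>L\<^sub>2(h)\<close> distance and the risk are extended nonnegative reals, possibly infinite.\<close>

definition sq_dist ::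
    "(real ^ 'd::finite \<Rightarrow> real) \<Rightarrow> (real ^ 'd \<Rightarrow> real) \<Rightarrow> (real ^ 'd \<Rightarrow> real) \<Rightarrow> ennreal" where
  "sq_dist h \<mu> \<upsilon> = (\<integral>\<^sup>+x. ennreal ((\<mu> x - \<upsilon> x)\<^sup>2 * h x) \<partial>cube_measure)"

definition minimax_risk ::
    "(real \<Rightarrow> real) \<Rightarrow> (real ^ 'd::finite \<Rightarrow> real) set \<Rightarrow> (real ^ 'd \<Rightarrow> real) set
      \<Rightarrow> (real ^ 'd \<Rightarrow> real) set \<Rightarrow> nat \<Rightarrow> ennreal" where
  "minimax_risk f \<M> \<S> \<H> n =
     (INF m\<in>estimators n. SUP \<mu>\<in>\<M>. SUP \<sigma>\<in>\<S>. SUP h\<in>\<H>.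
        (\<integral>\<^sup>+s. sq_dist h \<mu> (m s) \<partial>sample_law f n \<mu> \<sigma> h))"

end

theory Submission imports Defs begin

text \<open>
  Upper bound: empirical risk minimisation over a finite net, with the check loss at level
  \<open>p = P(\<epsilon> < 0)\<close>, for which no moment of the errors is needed. Differences of check losses are
  bounded, their mean is comparable to \<open>(u - \<mu>)\<^sup>2\<close>, and an exponential moment argument gives the
  risk \<open>log N / n + \<delta>\<^sup>2\<close> for a \<open>\<delta>\<close>-net of \<open>N\<close> functions. The net comes from Legendre expansions:
  pairing \<open>D\<^sup>\<alpha> g\<close> with the \<open>\<alpha>\<close>-fold primitives of Legendre polynomials, which vanish to order \<open>\<alpha>\<close> at
  the boundary and are orthogonal for the weight \<open>(x (1 - x))\<^sup>-\<^sup>\<alpha>\<close>, places a Sobolev ball in the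
  ellipsoid \<open>\<Sum> (1 + max N)\<^sup>2\<^sup>\<alpha> c\<^sub>N\<^sup>2 \<le> const\<close>. Rounding the coefficients with \<open>max N < m\<close> to multiples
  of \<open>m\<^sup>-\<^sup>\<alpha>\<^sup>-\<^sup>r\<^sup>/\<^sup>2\<close> leaves \<open>exp (O(m\<^sup>r))\<close> functions at squared distance \<open>O(m\<^sup>-\<^sup>2\<^sup>\<alpha>)\<close>.

  Lower bound: Assouad's method with \<open>m\<^sup>r\<close> disjoint smooth bumps of height of order \<open>m\<^sup>-\<^sup>\<alpha>\<close> in
  \<open>r\<close> of the coordinates. For all five error densities \<open>\<surd>f\<close> is Lipschitz up to a factor
  \<open>1 / (1 + y\<^sup>2)\<close>, so the squared Hellinger distance of two shifts is at most quadratic in the shift.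
\<close>

section \<open>Smooth functions of one variable\<close>

text \<open>The class imposes no condition on the faces of the cube, and weak derivatives are tested
  only against functions with compact support in the open cube. Periodic series are therefore of no
  use, and the weight \<open>(x (1 - x)) ^ \<alpha>\<close> is the key: a cutoff near a face costs
  one factor \<open>1 / (x (1 - x))\<close> per derivative, exactly what the zeros of the primitives
  pay for, and since the weight is at most 1, the weighted Bessel inequality is still dominated by
  the plain norm of the weak derivative. Enclosing the ellipsoid in a box before counting rounded
  coefficients would cost a factor ln m in the exponent; the exponential moment count uses the
  quadratic constraint as a whole and avoids it. At the level p the true \<mu> minimises the
  expected check loss, although the errors are in general neither centred nor of median zero. Scale
  and design density then enter only through upper and lower bounds and are never estimated. The
  lower bound compares hypotheses pointwise in x through the Hellinger affinity, so no test has to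
  be built from an estimator.\<close>

definition derivs :: "(nat \<Rightarrow> real \<Rightarrow> real) \<Rightarrow> bool" where
  "derivs F \<longleftrightarrow> (\<forall>k x. (F k has_real_derivative F (Suc k) x) (at x))"

lemma derivsD: "derivs F \<Longrightarrow> (F k has_real_derivative F (Suc k) x) (at x)"
  by (simp add: derivs_def)

lemma derivs_continuous: "derivs F \<Longrightarrow> continuous_on A (F k)"
  by (meson DERIV_isCont continuous_at_imp_continuous_on derivsD)

lemma derivs_poly: "derivs (\<lambda>k. poly ((pderiv ^^ k) p))"
  by (simp add: derivs_def)

lemma derivs_affine:
  assumes "derivs F" shows "derivs (\<lambda>k x. c ^ k * F k (c * x + b))"
  unfolding derivs_def
proof (intro allI)
  fix k x
  have "((\<lambda>x. F k (c * x + b)) has_real_derivative F (Suc k) (c * x + b) * c) (at x)"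
    by (rule DERIV_chain2[OF derivsD[OF assms]]) (auto intro!: derivative_eq_intros)
  from DERIV_cmult[OF this, of "c ^ k"]
  show "((\<lambda>x. c ^ k * F k (c * x + b)) has_real_derivative c ^ Suc k * F (Suc k) (c * x + b)) (at x)"
    by (simp add: mult_ac)
qed

text \<open>Smooth functions of one variable are handled as whole derivative sequences:
  \<open>F k\<close> is the k-th derivative of \<open>F 0\<close>. In this encoding
  \<open>leibniz F G\<close> is the derivative sequence of the product \<open>F 0 * G 0\<close>, so
  that products, rescalings and tensor products keep explicit derivatives of every order.\<close>

definition leibniz :: "(nat \<Rightarrow> real \<Rightarrow> real) \<Rightarrow> (nat \<Rightarrow> real \<Rightarrow> real) \<Rightarrow> nat \<Rightarrow> real \<Rightarrow> real" where
  "leibniz F G k x = (\<Sum>l\<le>k. real (k choose l) * (F l x * G (k - l) x))"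

lemma leibniz_0 [simp]: "leibniz F G 0 x = F 0 x * G 0 x"
  by (simp add: leibniz_def)

lemma derivs_leibniz:
  assumes F: "derivs F" and G: "derivs G" shows "derivs (leibniz F G)"
  unfolding derivs_def
proof (intro allI)
  fix k x
  let ?a = "\<lambda>l. F (Suc l) x * G (k - l) x" and ?b = "\<lambda>l. F l x * G (Suc k - l) x"
  have "((\<lambda>x. \<Sum>l\<le>k. real (k choose l) * (F l x * G (k - l) x)) has_real_derivative
          (\<Sum>l\<le>k. real (k choose l) * (F l x * G (Suc (k - l)) x + F (Suc l) x * G (k - l) x))) (at x)"
    by (intro DERIV_sum DERIV_cmult DERIV_mult' derivsD F G)
  also have "(\<Sum>l\<le>k. real (k choose l) * (F l x * G (Suc (k - l)) x + F (Suc l) x * G (k - l) x))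
     = (\<Sum>l\<le>k. real (k choose l) * ?b l) + (\<Sum>l\<le>k. real (k choose l) * ?a l)"
    unfolding sum.distrib[symmetric] by (intro sum.cong) (auto simp: Suc_diff_le distrib_left)
  \<comment> \<open>The sum is extended by the term l = k + 1, whose binomial coefficient is zero,
    and then shifted by one, so that Pascal's rule merges it with the other sum.\<close>
  also have "(\<Sum>l\<le>k. real (k choose l) * ?b l) = ?b 0 + (\<Sum>l\<le>k. real (k choose Suc l) * ?b (Suc l))"
  proof -
    have "(\<Sum>l\<le>k. real (k choose l) * ?b l) = (\<Sum>l\<le>Suc k. real (k choose l) * ?b l)"
      by simp
    also have "\<dots> = ?b 0 + (\<Sum>l\<le>k. real (k choose Suc l) * ?b (Suc l))"
      unfolding sum.atMost_Suc_shift by simp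
    finally show ?thesis .
  qed
  also have "?b 0 + (\<Sum>l\<le>k. real (k choose Suc l) * ?b (Suc l)) + (\<Sum>l\<le>k. real (k choose l) * ?a l)
    = leibniz F G (Suc k) x"
    unfolding leibniz_def sum.atMost_Suc_shift
    by (simp add: sum.distrib[symmetric] algebra_simps)
  finally show "(leibniz F G k has_real_derivative leibniz F G (Suc k) x) (at x)"
    unfolding leibniz_def .
qed

section \<open>Flat functions, bumps and boundary cutoffs\<close>

lemma power_le_fact_exp:
  assumes "0 \<le> (y::real)" shows "y ^ n \<le> fact n * exp y"
proof -
  have "(\<Sum>k\<in>{n}. y ^ k /\<^sub>R fact k) \<le> (\<Sum>k. y ^ k /\<^sub>R fact k)"
    using assms by (intro sum_le_suminf summable_exp_generic) auto
  then show ?thesis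
    unfolding exp_def by (simp add: field_simps)
qed

lemma poly_le_exp: "\<exists>K. \<forall>y\<ge>0. \<bar>poly p y\<bar> \<le> K * exp (y::real)"
proof (intro exI allI impI)
  fix y :: real assume y: "y \<ge> 0"
  have "\<bar>poly p y\<bar> \<le> (\<Sum>i\<le>degree p. \<bar>coeff p i * y ^ i\<bar>)"
    unfolding poly_altdef by (rule sum_abs)
  also have "\<dots> \<le> (\<Sum>i\<le>degree p. \<bar>coeff p i\<bar> * (fact i * exp y))"
    using y by (intro sum_mono) (auto simp: abs_mult intro!: mult_left_mono power_le_fact_exp)
  finally show "\<bar>poly p y\<bar> \<le> (\<Sum>i\<le>degree p. \<bar>coeff p i\<bar> * fact i) * exp y"
    by (simp add: sum_distrib_left sum_distrib_right mult_ac)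
qed

text \<open>On the positive half-line the k-th derivative of \<open>exp (- (1 / x))\<close> is P(1 /
  x) times this function for a polynomial P. With y = 1 / x, differentiation in x is - y^2 times
  differentiation in y, which turns P into y^2 (P - P').\<close>

primrec flat_poly :: "nat \<Rightarrow> real poly" where
  "flat_poly 0 = 1"
| "flat_poly (Suc k) = [:0, 0, 1:] * (flat_poly k - pderiv (flat_poly k))"

definition flat :: "nat \<Rightarrow> real \<Rightarrow> real" where
  "flat k x = (if x > 0 then poly (flat_poly k) (1 / x) * exp (- (1 / x)) else 0)"

lemma flat_nonpos [simp]: "x \<le> 0 \<Longrightarrow> flat k x = 0"
  by (simp add: flat_def)

lemma flat_0_pos: "x > 0 \<Longrightarrow> flat 0 x > 0"
  by (simp add: flat_def)

text \<open>The quadratic bound makes the difference quotient at 0 vanish, which settles the only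
  point where differentiability of \<open>flat k\<close> needs an argument. Two extra powers of 1 /
  x are put into the polynomial before it is dominated by the exponential; they become the factor
  \<open>x\<^sup>2\<close>.\<close>

lemma flat_bound: "\<exists>K. \<forall>x. \<bar>flat k x\<bar> \<le> K * x\<^sup>2"
proof -
  obtain K where K: "\<And>y. y \<ge> 0 \<Longrightarrow> \<bar>poly ([:0,0,1:] * flat_poly k) y\<bar> \<le> K * exp y"
    using poly_le_exp by blast
  have K0: "K \<ge> 0" using K[of 0] by simp
  have "\<bar>flat k x\<bar> \<le> K * x\<^sup>2" for x
  proof (cases "x > 0")
    case True
    have "\<bar>flat k x\<bar> = \<bar>poly ([:0,0,1:] * flat_poly k) (1/x)\<bar> * exp (- (1/x)) * x\<^sup>2"
      using True by (simp add: flat_def abs_mult power2_eq_square field_simps)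
    also have "\<dots> \<le> (K * exp (1/x)) * exp (- (1/x)) * x\<^sup>2"
      using True by (intro mult_right_mono K) auto
    finally show ?thesis using True by (simp add: exp_minus field_simps)
  qed (use K0 in auto)
  then show ?thesis by blast
qed

lemma derivs_flat: "derivs flat"
  unfolding derivs_def
proof (intro allI)
  fix k and x :: real
  consider "x > 0" | "x < 0" | "x = 0" by linarith
  then show "(flat k has_real_derivative flat (Suc k) x) (at x)"
  proof cases
    case 1
    have "((\<lambda>x. poly (flat_poly k) (1 / x) * exp (- (1 / x))) has_real_derivative flat (Suc k) x) (at x)"
      using 1 by (auto intro!: derivative_eq_intros DERIV_chain2[OF poly_DERIV]
          simp: flat_def power2_eq_square field_simps)
    then show ?thesis
      by (rule has_field_derivative_transform_within_open[of _ _ _ "{0<..}"]) (use 1 in \<open>auto simp: flat_def\<close>)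
  next
    case 2
    have "((\<lambda>x. 0) has_real_derivative flat (Suc k) x) (at x)" using 2 by simp
    then show ?thesis
      by (rule has_field_derivative_transform_within_open[of _ _ _ "{..<0}"]) (use 2 in auto)
  next
    case 3
    obtain K where K: "\<And>x. \<bar>flat k x\<bar> \<le> K * x\<^sup>2" using flat_bound by blast
    have "((\<lambda>h. flat k h / h) \<longlongrightarrow> 0) (at 0)"
    proof (rule Lim_null_comparison)
      show "\<forall>\<^sub>F h in at 0. norm (flat k h / h) \<le> K * \<bar>h\<bar>"
      proof (rule always_eventually, intro allI)
        fix h :: real
        show "norm (flat k h / h) \<le> K * \<bar>h\<bar>"
          using K[of h] by (cases "h = 0") (auto simp: field_simps power2_eq_square)
      qed
      have "((\<lambda>h. K * \<bar>h\<bar>) \<longlongrightarrow> K * \<bar>0\<bar>) (at (0::real))"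
        by (intro tendsto_intros)
      then show "((\<lambda>h. K * \<bar>h\<bar>) \<longlongrightarrow> 0) (at (0::real))" by simp
    qed
    then show ?thesis using 3 by (simp add: DERIV_def)
  qed
qed

text \<open>The derivative sequence of \<open>flat 0 x * flat 0 (1 - x)\<close>, which is positive
  exactly on the open unit interval. It is both the slope of the smooth step used for cutoffs and
  the perturbation used in the lower bound.\<close>

definition bump :: "nat \<Rightarrow> real \<Rightarrow> real" where
  "bump = leibniz flat (\<lambda>k x. (- 1) ^ k * flat k ((- 1) * x + 1))"

lemma derivs_bump: "derivs bump"
  unfolding bump_def by (intro derivs_leibniz derivs_flat derivs_affine)

lemma bump_eq_0: "x \<le> 0 \<or> x \<ge> 1 \<Longrightarrow> bump k x = 0"
  by (auto simp: bump_def leibniz_def)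

lemma bump_pos: "0 < x \<Longrightarrow> x < 1 \<Longrightarrow> bump 0 x > 0"
  by (auto simp: bump_def flat_0_pos)

lemma bounded_of_support:
  fixes f :: "real \<Rightarrow> real"
  assumes "continuous_on {0..1} f" "\<And>x. x \<notin> {0..1} \<Longrightarrow> \<bar>f x\<bar> \<le> L"
  shows "\<exists>K. \<forall>x. \<bar>f x\<bar> \<le> K"
proof -
  obtain K where "\<forall>x\<in>{0..1}. norm (f x) \<le> K"
    using compact_continuous_image[OF assms(1) compact_Icc] compact_imp_bounded bounded_iff
    by (metis imageI)
  then have "\<bar>f x\<bar> \<le> max K L" for x
    using assms(2)[of x] by (cases "x \<in> {0..1}") (auto intro: max.coboundedI1 max.coboundedI2)
  then show ?thesis by blast
qed

lemma bump_bounded: "\<exists>K. \<forall>x. \<bar>bump k x\<bar> \<le> K"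
  by (rule bounded_of_support[where L = 0]) (auto intro: derivs_continuous derivs_bump simp: bump_eq_0)

text \<open>\<open>S 0\<close> is the normalised antiderivative of the bump, and
  \<open>S (Suc j)\<close> is the j-th derivative of the bump over the same constant; hence every
  positive order vanishes outside (0, 1).\<close>

lemma smooth_step_exists:
  obtains S where "derivs S" "\<And>x. x \<le> 0 \<Longrightarrow> S 0 x = 0" "\<And>x. x \<ge> 1 \<Longrightarrow> S 0 x = 1"
    "\<And>k x. k > 0 \<Longrightarrow> x \<le> 0 \<or> x \<ge> 1 \<Longrightarrow> S k x = 0"
    "\<And>k. \<exists>K. \<forall>x. \<bar>S k x\<bar> \<le> K"
proof -
  have "\<exists>B. \<forall>x::real. -\<infinity> < ereal x \<longrightarrow> ereal x < \<infinity> \<longrightarrow> (B has_vector_derivative bump 0 x) (at x)"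
    by (rule einterval_antiderivative)
      (use derivs_continuous[OF derivs_bump, of UNIV 0] in \<open>auto simp: continuous_on_eq_continuous_at\<close>)
  then obtain B where B: "\<And>x. (B has_real_derivative bump 0 x) (at x)"
    by (auto simp: has_real_derivative_iff_has_vector_derivative)
  have low: "B x = B 0" if "x \<le> 0" for x
  proof (cases "x = 0")
    case False
    with that have "x < 0" by simp
    from MVT2[OF this B] obtain z where "z < 0" "B 0 - B x = (0 - x) * bump 0 z" by blast
    then show ?thesis by (simp add: bump_eq_0)
  qed simp
  have high: "B x = B 1" if "x \<ge> 1" for x
  proof (cases "x = 1")
    case False
    with that have "1 < x" by simp
    from MVT2[OF this B] obtain z where "z > 1" "B x - B 1 = (x - 1) * bump 0 z" by blast
    then show ?thesis by (simp add: bump_eq_0)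
  qed simp
  have lt: "B 0 < B 1"
  proof -
    obtain z where z: "z > 0" "z < 1" "B 1 - B 0 = (1 - 0) * bump 0 z"
      using MVT2[OF zero_less_one B] by blast
    have "bump 0 z > 0" using z(1,2) by (rule bump_pos)
    then have "B 1 - B 0 > 0" unfolding z(3) by simp
    then show ?thesis by simp
  qed
  define S where "S k x = (case k of 0 \<Rightarrow> (B x - B 0) / (B 1 - B 0) | Suc j \<Rightarrow> bump j x / (B 1 - B 0))" for k x
  show ?thesis
  proof (rule that[of S])
    show S: "derivs S"
      unfolding derivs_def
    proof (intro allI)
      fix k x
      show "(S k has_real_derivative S (Suc k) x) (at x)"
      proof (cases k)
        case 0
        have "((\<lambda>x. (B x - B 0) / (B 1 - B 0)) has_real_derivative bump 0 x / (B 1 - B 0)) (at x)"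
          using DERIV_cdivide[OF DERIV_diff[OF B[of x] DERIV_const[of "B 0"]], of "B 1 - B 0"] by simp
        then show ?thesis unfolding S_def 0 by simp
      next
        case (Suc j)
        have "((\<lambda>x. bump j x / (B 1 - B 0)) has_real_derivative bump (Suc j) x / (B 1 - B 0)) (at x)"
          by (rule DERIV_cdivide[OF derivsD[OF derivs_bump]])
        then show ?thesis unfolding S_def Suc by simp
      qed
    qed
    show S0: "x \<le> 0 \<Longrightarrow> S 0 x = 0" for x using low[of x] by (simp add: S_def)
    show S1: "x \<ge> 1 \<Longrightarrow> S 0 x = 1" for x using lt high[of x] by (simp add: S_def)
    show Sk: "k > 0 \<Longrightarrow> x \<le> 0 \<or> x \<ge> 1 \<Longrightarrow> S k x = 0" for k x
      by (cases k) (auto simp: S_def bump_eq_0)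
    show "\<exists>K. \<forall>x. \<bar>S k x\<bar> \<le> K" for k
    proof (rule bounded_of_support[where L = 1])
      fix x :: real assume "x \<notin> {0..1}"
      then show "\<bar>S k x\<bar> \<le> 1" using S0[of x] S1[of x] Sk[of k x] by (cases "k = 0") auto
    qed (rule derivs_continuous[OF S])
  qed
qed

text \<open>Here \<open>s\<close> stands for the distance to the boundary: growth of order
  \<open>1 / s ^ l\<close> in the l-th derivative is inherited by products, because
  \<open>s ^ k\<close> splits as \<open>s ^ l * s ^ (k - l)\<close> in every term of the Leibniz
  sum.\<close>

lemma leibniz_scaled_bound:
  assumes "\<And>l. l \<le> k \<Longrightarrow> \<bar>F l x\<bar> * s ^ l \<le> K l" "\<And>l. l \<le> k \<Longrightarrow> \<bar>G l x\<bar> * s ^ l \<le> L l" "0 \<le> (s::real)"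
  shows "\<bar>leibniz F G k x\<bar> * s ^ k \<le> (\<Sum>l\<le>k. real (k choose l) * (K l * L (k - l)))"
proof -
  have "\<bar>leibniz F G k x\<bar> * s ^ k \<le> (\<Sum>l\<le>k. \<bar>real (k choose l) * (F l x * G (k - l) x)\<bar>) * s ^ k"
    unfolding leibniz_def using assms(3) by (intro mult_right_mono sum_abs) auto
  also have "\<dots> = (\<Sum>l\<le>k. real (k choose l) * ((\<bar>F l x\<bar> * s ^ l) * (\<bar>G (k - l) x\<bar> * s ^ (k - l))))"
    unfolding sum_distrib_right
  proof (intro sum.cong refl)
    fix l assume "l \<in> {..k}"
    then have "s ^ k = s ^ l * s ^ (k - l)" by (simp flip: power_add)
    then show "\<bar>real (k choose l) * (F l x * G (k - l) x)\<bar> * s ^ k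
      = real (k choose l) * ((\<bar>F l x\<bar> * s ^ l) * (\<bar>G (k - l) x\<bar> * s ^ (k - l)))"
      by (simp add: abs_mult mult_ac)
  qed
  also have "\<dots> \<le> (\<Sum>l\<le>k. real (k choose l) * (K l * L (k - l)))"
  proof (intro sum_mono mult_left_mono mult_mono)
    fix l assume l: "l \<in> {..k}"
    show "0 \<le> K l" using assms(1)[of l] assms(3) l
      by (meson abs_ge_zero atMost_iff mult_nonneg_nonneg order_trans zero_le_power)
  qed (use assms in auto)
  finally show ?thesis .
qed

text \<open>Cutting off at distance \<open>1 / n\<close> costs a factor \<open>n\<close> per derivative, which a zero of the
  same order at the boundary compensates.\<close>

lemma cutoff_exists:
  obtains H :: "nat \<Rightarrow> nat \<Rightarrow> real \<Rightarrow> real" where "\<And>n. derivs (H n)"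
    "\<And>n k x. x \<le> 1 / real (Suc n) \<or> x \<ge> 1 - 1 / real (Suc n) \<Longrightarrow> H n k x = 0"
    "\<And>x k. 0 < x \<Longrightarrow> x < 1 \<Longrightarrow> \<forall>\<^sub>F n in sequentially. H n k x = (if k = 0 then 1 else 0)"
    "\<And>k. \<exists>K. \<forall>n. \<forall>x\<in>{0..1}. \<bar>H n k x\<bar> * (x * (1 - x)) ^ k \<le> K"
proof -
  obtain S where S: "derivs S" "\<And>x. x \<le> 0 \<Longrightarrow> S 0 x = 0" "\<And>x. x \<ge> 1 \<Longrightarrow> S 0 x = 1"
    "\<And>k x. k > 0 \<Longrightarrow> x \<le> 0 \<or> x \<ge> 1 \<Longrightarrow> S k x = 0"
    "\<And>k. \<exists>K. \<forall>x. \<bar>S k x\<bar> \<le> K"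
    using smooth_step_exists by blast
  obtain K where K: "\<And>k x. \<bar>S k x\<bar> \<le> K k" using S(5) by metis
  \<comment> \<open>\<open>F n\<close> climbs from 0 to 1 between 1 / (n + 1) and 2 / (n + 1), and
    \<open>G n\<close> is its mirror image at the right end. The shift by 1 keeps the product zero
    up to distance 1 / (n + 1) from the end points, so its support is compact in (0, 1).\<close>
  define F G where "F n k x = real (Suc n) ^ k * S k (real (Suc n) * x + - 1)"
    and "G n k x = (- real (Suc n)) ^ k * S k (- real (Suc n) * x + (real (Suc n) - 1))" for n k x
  have S0: "S k x = 0" if "x \<le> 0" for k x using S(2,4) that by (cases "k = 0") auto
  \<comment> \<open>A derivative of positive order is nonzero only if y - 1 is in (0, 1), hence y <
    2; at order 0 the power of y is 1.\<close>
  have bound: "y ^ k * \<bar>S k (y - 1)\<bar> \<le> 2 ^ k * K k" if "y \<ge> 0" for y k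
  proof (cases "k = 0 \<or> y \<le> 2")
    case True
    then have "y ^ k \<le> 2 ^ k" using that by (auto intro: power_mono)
    then show ?thesis using K[of k] that by (intro mult_mono) auto
  next
    case False
    then have "S k (y - 1) = 0" by (intro S(4)) auto
    then show ?thesis using K[of k 0] by auto
  qed
  show ?thesis
  proof (rule that[of "\<lambda>n. leibniz (F n) (G n)"])
    show "derivs (leibniz (F n) (G n))" for n
      unfolding F_def G_def by (intro derivs_leibniz derivs_affine S(1))
    show "leibniz (F n) (G n) k x = 0" if "x \<le> 1 / real (Suc n) \<or> x \<ge> 1 - 1 / real (Suc n)" for n k x
    proof -
      have "F n l x = 0 \<or> G n l' x = 0" for l l'
      proof (cases "x \<le> 1 / real (Suc n)")
        case True
        then have "real (Suc n) * x + - 1 \<le> 0" by (simp add: field_simps)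
        then show ?thesis by (simp add: F_def S0 del: of_nat_Suc)
      next
        case False
        then have "x \<ge> 1 - 1 / real (Suc n)" using that by auto
        then have "- real (Suc n) * x + (real (Suc n) - 1) \<le> 0" by (simp add: field_simps)
        then show ?thesis by (simp add: G_def S0 del: of_nat_Suc)
      qed
      then show ?thesis by (auto simp: leibniz_def intro!: sum.neutral)
    qed
    show "\<forall>\<^sub>F n in sequentially. leibniz (F n) (G n) k x = (if k = 0 then 1 else 0)"
      if x: "0 < x" "x < 1" for x k
    proof -
      obtain M1 where M1: "2 / x \<le> real M1" using real_arch_simple by blast
      obtain M2 where M2: "2 / (1 - x) \<le> real M2" using real_arch_simple by blast
      show ?thesis
      proof (rule eventually_sequentiallyI[of "M1 + M2"])
        fix n assume n: "M1 + M2 \<le> n"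
        have "2 / x \<le> real (Suc n)" "2 / (1 - x) \<le> real (Suc n)" using n M1 M2 by linarith+
        then have a: "real (Suc n) * x + - 1 \<ge> 1" "- real (Suc n) * x + (real (Suc n) - 1) \<ge> 1"
          using x by (auto simp: field_simps)
        have "F n l x = (if l = 0 then 1 else 0)" "G n l x = (if l = 0 then 1 else 0)" for l
          unfolding F_def G_def using S(3)[OF a(1)] S(3)[OF a(2)] S(4)[of l] a by auto
        then show "leibniz (F n) (G n) k x = (if k = 0 then 1 else 0)"
          by (auto simp: leibniz_def intro!: sum.neutral)
      qed
    qed
    show "\<exists>L. \<forall>n. \<forall>x\<in>{0..1}. \<bar>leibniz (F n) (G n) k x\<bar> * (x * (1 - x)) ^ k \<le> L" for k
    proof (intro exI allI ballI)
      fix n and x :: real assume x: "x \<in> {0..1}"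
      show "\<bar>leibniz (F n) (G n) k x\<bar> * (x * (1 - x)) ^ k
          \<le> (\<Sum>l\<le>k. real (k choose l) * ((2 ^ l * K l) * (2 ^ (k - l) * K (k - l))))"
      proof (rule leibniz_scaled_bound[where K = "\<lambda>l. 2 ^ l * K l" and L = "\<lambda>l. 2 ^ l * K l"])
        fix l
        have "\<bar>F n l x\<bar> * (x * (1 - x)) ^ l \<le> \<bar>F n l x\<bar> * x ^ l"
          using x by (intro mult_left_mono power_mono) (auto simp: mult_left_le)
        also have "\<dots> = (real (Suc n) * x) ^ l * \<bar>S l (real (Suc n) * x - 1)\<bar>"
          using x by (simp add: F_def abs_mult power_mult_distrib)
        also have "\<dots> \<le> 2 ^ l * K l" using x by (intro bound) auto
        finally show "\<bar>F n l x\<bar> * (x * (1 - x)) ^ l \<le> 2 ^ l * K l" .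
        have "\<bar>G n l x\<bar> * (x * (1 - x)) ^ l \<le> \<bar>G n l x\<bar> * (1 - x) ^ l"
          using x by (intro mult_left_mono power_mono) (auto simp: mult_left_le_one_le)
        also have "\<dots> = (real (Suc n) * (1 - x)) ^ l * \<bar>S l (real (Suc n) * (1 - x) - 1)\<bar>"
        proof -
          have eq: "- real (Suc n) * x + (real (Suc n) - 1) = real (Suc n) * (1 - x) - 1"
            by (simp add: algebra_simps)
          show ?thesis unfolding G_def eq by (simp add: abs_mult power_mult_distrib power_abs del: of_nat_Suc)
        qed
        also have "\<dots> \<le> 2 ^ l * K l" using x by (intro bound) auto
        finally show "\<bar>G n l x\<bar> * (x * (1 - x)) ^ l \<le> 2 ^ l * K l" .
      qed (use x in auto)
    qed
  qed
qed

section \<open>Square integrable functions and weak derivatives on the cube\<close>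

lemma integrable_mult_of_squares:
  fixes f g :: "'a \<Rightarrow> real"
  assumes "f \<in> borel_measurable M" "integrable M (\<lambda>x. (f x)\<^sup>2)"
    "g \<in> borel_measurable M" "integrable M (\<lambda>x. (g x)\<^sup>2)"
  shows "integrable M (\<lambda>x. f x * g x)"
proof (rule Bochner_Integration.integrable_bound)
  show "integrable M (\<lambda>x. (f x)\<^sup>2 + (g x)\<^sup>2)" using assms by auto
  show "AE x in M. norm (f x * g x) \<le> norm ((f x)\<^sup>2 + (g x)\<^sup>2)"
  proof (intro AE_I2)
    fix x
    have "0 \<le> (\<bar>f x\<bar> - \<bar>g x\<bar>)\<^sup>2" "0 \<le> (f x)\<^sup>2" "0 \<le> (g x)\<^sup>2" by auto
    then have "2 * (\<bar>f x\<bar> * \<bar>g x\<bar>) \<le> (f x)\<^sup>2 + (g x)\<^sup>2" by (simp add: power2_diff)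
    moreover have "0 \<le> \<bar>f x\<bar> * \<bar>g x\<bar>" by simp
    ultimately have "\<bar>f x\<bar> * \<bar>g x\<bar> \<le> (f x)\<^sup>2 + (g x)\<^sup>2" by linarith
    then show "norm (f x * g x) \<le> norm ((f x)\<^sup>2 + (g x)\<^sup>2)" by (simp add: abs_mult)
  qed
qed (use assms in auto)

lemma square_integrable_mult:
  "square_integrable f \<Longrightarrow> square_integrable g \<Longrightarrow> integrable cube_measure (\<lambda>z. f z * g z)"
  by (auto simp: square_integrable_def intro: integrable_mult_of_squares)

lemma square_integrable_add:
  assumes "square_integrable f" "square_integrable g" shows "square_integrable (\<lambda>z. f z + g z)"
  using assms square_integrable_mult[OF assms] unfolding square_integrable_def
  by (auto simp: power2_sum mult.assoc)

lemma square_integrable_cmult: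
  assumes "square_integrable f" shows "square_integrable (\<lambda>z. c * f z)"
  using assms unfolding square_integrable_def by (auto simp: power_mult_distrib)

lemma square_integrable_diff:
  "square_integrable f \<Longrightarrow> square_integrable g \<Longrightarrow> square_integrable (\<lambda>z. f z - g z)"
  using square_integrable_add[of f "\<lambda>z. (- 1) * g z"] square_integrable_cmult[of g "- 1"] by simp

lemma square_integrable_sum:
  "finite A \<Longrightarrow> (\<And>a. a \<in> A \<Longrightarrow> square_integrable (f a)) \<Longrightarrow> square_integrable (\<lambda>z. \<Sum>a\<in>A. f a z)"
proof (induction A rule: finite_induct)
  case (insert a A)
  then have "square_integrable (\<lambda>z. f a z + (\<Sum>a\<in>A. f a z))" by (intro square_integrable_add) auto
  with insert(1,2) show ?case by simp
qed (simp add: square_integrable_def)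

lemma space_cube_measure [simp]: "space cube_measure = unit_cube"
  by (simp add: cube_measure_def space_restrict_space)

lemma measurable_cube_measure_borel: "f \<in> borel_measurable borel \<Longrightarrow> f \<in> borel_measurable cube_measure"
  unfolding cube_measure_def by (rule measurable_restrict_space1) simp

lemma integral_cube_measure:
  "integral\<^sup>L cube_measure f = integral\<^sup>L lborel (\<lambda>x. indicator unit_cube x *\<^sub>R (f x :: real))"
  unfolding cube_measure_def by (rule integral_restrict_space) simp

lemma prob_space_cube_measure: "prob_space (cube_measure :: (real ^ 'a::finite) measure)"
proof
  have "emeasure (cube_measure :: (real ^ 'a) measure) (space cube_measure) = emeasure lborel (unit_cube :: (real ^ 'a) set)"
    unfolding cube_measure_def by (subst emeasure_restrict_space) (auto simp: space_restrict_space)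
  also have "\<dots> = ennreal (\<Prod>b\<in>Basis. (1 - 0 :: real ^ 'a) \<bullet> b)"
    by (rule emeasure_lborel_cbox) (auto simp: Basis_vec_def inner_axis)
  also have "(\<Prod>b\<in>Basis. (1 - 0 :: real ^ 'a) \<bullet> b) = 1"
    by (intro prod.neutral) (auto simp: Basis_vec_def inner_axis)
  finally show "emeasure (cube_measure :: (real ^ 'a) measure) (space cube_measure) = 1" by simp
qed

interpretation cube: prob_space "cube_measure :: (real ^ 'a::finite) measure"
  by (rule prob_space_cube_measure)

lemma bounded_on_cube:
  assumes "continuous_on unit_cube (f :: real ^ 'a::finite \<Rightarrow> real)"
  shows "\<exists>K. \<forall>z\<in>unit_cube. \<bar>f z\<bar> \<le> K"
proof -
  obtain K where "\<forall>x\<in>unit_cube. norm (f x) \<le> K"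
    using compact_continuous_image[OF assms compact_cbox] compact_imp_bounded bounded_iff
    by (metis imageI)
  then show ?thesis by auto
qed

lemma square_integrable_bounded:
  assumes "f \<in> borel_measurable cube_measure" "\<And>z. z \<in> unit_cube \<Longrightarrow> \<bar>f z\<bar> \<le> K"
  shows "square_integrable f"
  unfolding square_integrable_def
proof
  show "integrable cube_measure (\<lambda>z. (f z)\<^sup>2)"
  proof (rule cube.integrable_const_bound[where B = "K\<^sup>2"])
    show "AE x in cube_measure. norm ((f x)\<^sup>2) \<le> K\<^sup>2"
    proof (rule AE_I2)
      fix x :: "real ^ 'a" assume "x \<in> space cube_measure"
      then have "\<bar>f x\<bar> \<le> K" using assms(2) by simp
      then have "\<bar>f x\<bar>\<^sup>2 \<le> K\<^sup>2" by (intro power_mono) auto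
      then show "norm ((f x)\<^sup>2) \<le> K\<^sup>2" by simp
    qed
  qed (use assms(1) in auto)
qed (rule assms(1))

lemma square_integrable_continuous:
  assumes "continuous_on UNIV (f :: real ^ 'a::finite \<Rightarrow> real)" shows "square_integrable f"
proof -
  obtain K where "\<forall>z\<in>unit_cube. \<bar>f z\<bar> \<le> K"
    using bounded_on_cube continuous_on_subset[OF assms] by blast
  then show ?thesis
    using assms by (intro square_integrable_bounded[of f K] measurable_cube_measure_borel borel_measurable_continuous_onI) auto
qed

section \<open>Partial derivatives and integration by parts on the cube\<close>

lemma partial_eq:
  assumes "(f has_derivative D) (at z)" shows "partial i f z = D (axis i 1)"
  unfolding partial_def using frechet_derivative_at[OF assms] by simp

lemma smooth_differentiable: "smooth g \<Longrightarrow> g differentiable (at z)"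
  unfolding smooth_def by (metis foldr.simps(1) id_apply)

lemma smooth_continuous: "smooth g \<Longrightarrow> continuous_on A g"
  by (simp add: continuous_at_imp_continuous_on differentiable_imp_continuous_within smooth_differentiable)

lemma smooth_partial: "smooth g \<Longrightarrow> smooth (partial i g)"
  unfolding smooth_def
proof (intro allI)
  fix ds z assume "\<forall>ds z. foldr partial ds g differentiable at z"
  then have "foldr partial (ds @ [i]) g differentiable at z" by blast
  then show "foldr partial ds (partial i g) differentiable at z" by simp
qed

lemma partial_eq_0_outside:
  assumes "closed K" "\<And>z. z \<notin> K \<Longrightarrow> f z = 0" "z \<notin> K" shows "partial i f z = 0"
proof -
  have "(f has_derivative (\<lambda>h. 0)) (at z)"
    by (rule has_derivative_transform_within_open[of "\<lambda>z. 0" _ _ _ "- K"]) (use assms in auto)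
  from partial_eq[OF this] show ?thesis by simp
qed

lemma test_function_partial: "test_function \<phi> \<Longrightarrow> test_function (partial i \<phi>)"
  unfolding test_function_def by (metis compact_imp_closed partial_eq_0_outside smooth_partial)

lemma test_function_foldr: "test_function \<phi> \<Longrightarrow> test_function (foldr partial ds \<phi>)"
  by (induction ds) (auto intro: test_function_partial)

lemma integral_lborel_translate:
  fixes f :: "'a::euclidean_space \<Rightarrow> real"
  assumes "f \<in> borel_measurable borel"
  shows "integral\<^sup>L lborel (\<lambda>x. f (a + x)) = integral\<^sup>L lborel f"
  using integral_distr[of "(+) a" lborel borel f] assms by (simp add: lborel_distr_plus)

text \<open>The mean value theorem along the i-th axis; it supplies the dominating constant for
  difference quotients.\<close>

lemma difference_quotient_bound:
  fixes F :: "real ^ 'a::finite \<Rightarrow> real"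
  assumes diff: "\<And>z. F differentiable (at z)" and M: "\<And>z. \<bar>partial i F z\<bar> \<le> M" and h: "h > 0"
  shows "\<bar>F (z + h *\<^sub>R axis i 1) - F z\<bar> \<le> h * M"
proof -
  let ?e = "axis i 1 :: real ^ 'a"
  have d: "((\<lambda>t. F (z + t *\<^sub>R ?e)) has_real_derivative partial i F (z + t *\<^sub>R ?e)) (at t)" for t
  proof -
    let ?D = "frechet_derivative F (at (z + t *\<^sub>R ?e))"
    have F: "(F has_derivative ?D) (at (z + t *\<^sub>R ?e))"
      using diff frechet_derivative_works by blast
    have "((\<lambda>t. F (z + t *\<^sub>R ?e)) has_derivative (\<lambda>s. ?D (s *\<^sub>R ?e))) (at t)"
      using F by (intro has_derivative_compose[of "\<lambda>t. z + t *\<^sub>R ?e" "\<lambda>s. s *\<^sub>R ?e" t UNIV F ?D])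
        (auto intro!: derivative_eq_intros)
    moreover have "?D (s *\<^sub>R ?e) = partial i F (z + t *\<^sub>R ?e) * s" for s
      using linear_scale[OF has_derivative_linear[OF F], of s ?e] by (simp add: partial_def)
    ultimately show ?thesis by (simp add: has_field_derivative_def)
  qed
  obtain t where "F (z + h *\<^sub>R ?e) - F (z + 0 *\<^sub>R ?e) = (h - 0) * partial i F (z + t *\<^sub>R ?e)"
    using MVT2[OF h, of "\<lambda>t. F (z + t *\<^sub>R ?e)" "\<lambda>t. partial i F (z + t *\<^sub>R ?e)"] d by blast
  then show ?thesis using M[of "z + t *\<^sub>R ?e"] h by (simp add: abs_mult)
qed

text \<open>Translation invariance makes the integral of every difference quotient vanish; this avoids
  Fubini's theorem along the coordinate \<open>i\<close>.\<close>

lemma integral_partial_eq_0: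
  fixes F :: "real ^ 'a::finite \<Rightarrow> real"
  assumes diff: "\<And>z. F differentiable (at z)" and cont: "continuous_on UNIV (partial i F)"
    and K: "compact K" "K \<subseteq> unit_cube" "\<And>z. z \<notin> K \<Longrightarrow> F z = 0"
  shows "integral\<^sup>L lborel (partial i F) = 0"
proof -
  let ?e = "axis i 1 :: real ^ 'a"
  define h where "h n = 1 / real (Suc n)" for n
  have h: "h n > 0" "h n \<le> 1" for n by (auto simp: h_def)
  have contF: "continuous_on UNIV F"
    by (simp add: continuous_at_imp_continuous_on diff differentiable_imp_continuous_within)
  then have mF: "F \<in> borel_measurable borel" by (rule borel_measurable_continuous_onI)
  have p0: "partial i F z = 0" if "z \<notin> K" for z
    using partial_eq_0_outside[OF compact_imp_closed[OF K(1)] K(3) that] .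
  have "integrable lborel (\<lambda>x. indicator unit_cube x *\<^sub>R F x)"
    by (rule borel_integrable_compact) (auto intro: continuous_on_subset[OF contF])
  moreover have "(\<lambda>x. indicator unit_cube x *\<^sub>R F x) = F"
    using K by (auto simp: indicator_def fun_eq_iff)
  ultimately have intF: "integrable lborel F" by simp
  have intFt: "integrable lborel (\<lambda>x. F (a + x))" for a
    using integrable_distr[of "(+) a" lborel borel F] intF by (simp add: lborel_distr_plus)
  obtain M where "\<forall>z\<in>unit_cube. \<bar>partial i F z\<bar> \<le> M"
    using bounded_on_cube[OF continuous_on_subset[OF cont]] by blast
  then have M: "\<bar>partial i F z\<bar> \<le> max M 0" for z
    using p0[of z] K(2) by (cases "z \<in> K") (auto simp: le_max_iff_disj)
  define D where "D n z = (F (h n *\<^sub>R ?e + z) - F z) / h n" for n z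
  have D0: "integral\<^sup>L lborel (D n) = 0" for n
    unfolding D_def using intF intFt[of "h n *\<^sub>R ?e"] integral_lborel_translate[OF mF, of "h n *\<^sub>R ?e"] by simp
  \<comment> \<open>The steps \<open>h n\<close> are at most 1, so a point outside
    \<open>cbox (- 1) 1\<close> is not moved into the unit cube; all difference quotients vanish
    there, and one constant on this box dominates them.\<close>
  have "(\<lambda>n. integral\<^sup>L lborel (D n)) \<longlonglongrightarrow> integral\<^sup>L lborel (partial i F)"
  proof (rule integral_dominated_convergence[where w = "\<lambda>z. indicator (cbox (-1) 1) z *\<^sub>R max M 0"])
    show "partial i F \<in> borel_measurable lborel" using cont by (simp add: borel_measurable_continuous_onI)
    show "D n \<in> borel_measurable lborel" for n unfolding D_def using mF by measurable
    show "integrable lborel (\<lambda>z. indicator (cbox (-1) 1 :: (real ^ 'a) set) z *\<^sub>R max M 0)"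
      by (rule borel_integrable_compact) auto
    show "AE x in lborel. (\<lambda>n. D n x) \<longlonglongrightarrow> partial i F x"
    proof (rule AE_I2)
      fix x
      have F: "(F has_derivative frechet_derivative F (at x)) (at x)"
        using diff frechet_derivative_works by blast
      have "((\<lambda>t. F (t *\<^sub>R ?e + x)) has_derivative (\<lambda>s. frechet_derivative F (at x) (s *\<^sub>R ?e))) (at 0)"
        using F by (intro has_derivative_compose[of "\<lambda>t. t *\<^sub>R ?e + x" "\<lambda>s. s *\<^sub>R ?e" 0 UNIV F])
          (auto intro!: derivative_eq_intros)
      moreover have "frechet_derivative F (at x) (s *\<^sub>R ?e) = partial i F x * s" for s
        using linear_scale[OF has_derivative_linear[OF F], of s ?e] by (simp add: partial_def)
      ultimately have "((\<lambda>t. F (t *\<^sub>R ?e + x)) has_real_derivative partial i F x) (at 0)"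
        by (simp add: has_field_derivative_def)
      then have lim: "((\<lambda>t. (F (t *\<^sub>R ?e + x) - F x) / t) \<longlongrightarrow> partial i F x) (at 0)"
        by (simp add: DERIV_def)
      have "h = (\<lambda>n. inverse (real (Suc n)))" by (simp add: h_def fun_eq_iff inverse_eq_divide)
      then have "h \<longlonglongrightarrow> 0" using LIMSEQ_inverse_real_of_nat by simp
      moreover have "\<forall>\<^sub>F n in sequentially. h n \<noteq> 0"
        using h(1) by (intro always_eventually allI) (metis less_irrefl)
      ultimately have "filterlim h (at 0) sequentially" by (simp add: filterlim_at)
      from filterlim_compose[OF lim this] show "(\<lambda>n. D n x) \<longlonglongrightarrow> partial i F x"
        unfolding D_def .
    qed
    show "AE x in lborel. norm (D n x) \<le> indicator (cbox (-1) 1) x *\<^sub>R max M 0" for n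
    proof (rule AE_I2)
      fix x
      show "norm (D n x) \<le> indicator (cbox (-1) 1) x *\<^sub>R max M 0"
      proof (cases "x \<in> cbox (-1) 1")
        case True
        have "\<bar>F (x + h n *\<^sub>R ?e) - F x\<bar> \<le> h n * max M 0"
          by (rule difference_quotient_bound[OF diff M h(1)])
        then show ?thesis using True h(1)[of n] by (simp add: D_def field_simps)
      next
        case False
        then obtain j where j: "\<not> (-1 \<le> x $ j \<and> x $ j \<le> 1)" by (auto simp: mem_box_cart)
        have "x \<notin> unit_cube" using j order_trans[of "-1" 0 "x $ j"] by (auto simp: mem_box_cart intro!: exI[of _ j])
        moreover have "h n *\<^sub>R ?e + x \<notin> unit_cube"
        proof
          assume "h n *\<^sub>R ?e + x \<in> unit_cube"
          then have "0 \<le> (h n *\<^sub>R ?e + x) $ j" "(h n *\<^sub>R ?e + x) $ j \<le> 1" by (auto simp: mem_box_cart)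
          then show False using j h[of n] by (auto simp: axis_def split: if_splits)
        qed
        moreover have "F z = 0" if "z \<notin> unit_cube" for z using K that by blast
        ultimately show ?thesis using False by (simp add: D_def)
      qed
    qed
  qed
  then have "(\<lambda>n. 0) \<longlonglongrightarrow> integral\<^sup>L lborel (partial i F)" by (simp add: D0)
  then show ?thesis using LIMSEQ_unique[OF _ tendsto_const] by blast
qed

text \<open>The product of \<Psi> and \<phi> inherits the compact support of the test function, so
  the integral of its partial derivative is zero; the product rule does the rest.\<close>

lemma integral_by_parts_partial:
  assumes \<Psi>: "smooth \<Psi>" and \<phi>: "test_function \<phi>"
  shows "(\<integral>z. \<Psi> z * partial i \<phi> z \<partial>cube_measure) = - (\<integral>z. partial i \<Psi> z * \<phi> z \<partial>cube_measure)"
proof -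
  obtain K where K: "compact K" "K \<subseteq> box 0 1" "\<And>z. z \<notin> K \<Longrightarrow> \<phi> z = 0" and s: "smooth \<phi>"
    using \<phi> by (auto simp: test_function_def)
  have Kc: "K \<subseteq> unit_cube" using K(2) box_subset_cbox by blast
  have p0: "partial i \<phi> z = 0" if "z \<notin> K" for z
    using partial_eq_0_outside[OF compact_imp_closed[OF K(1)] K(3) that] .
  let ?F = "\<lambda>z. \<Psi> z * \<phi> z"
  have der: "(?F has_derivative (\<lambda>h. \<Psi> z * frechet_derivative \<phi> (at z) h + frechet_derivative \<Psi> (at z) h * \<phi> z)) (at z)" for z
    by (rule has_derivative_mult; rule iffD1[OF frechet_derivative_works]; rule smooth_differentiable; fact)
  have pF: "partial i ?F = (\<lambda>z. \<Psi> z * partial i \<phi> z + partial i \<Psi> z * \<phi> z)"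
    using partial_eq[OF der] by (auto simp: partial_def)
  have c: "continuous_on UNIV (\<lambda>z. \<Psi> z * partial i \<phi> z)" "continuous_on UNIV (\<lambda>z. partial i \<Psi> z * \<phi> z)"
    by (intro continuous_intros smooth_continuous smooth_partial s \<Psi>)+
  have "integral\<^sup>L lborel (partial i ?F) = 0"
  proof (rule integral_partial_eq_0[OF _ _ K(1) Kc])
    show "?F differentiable (at z)" for z using der by (auto simp: differentiable_def)
    show "continuous_on UNIV (partial i ?F)" unfolding pF using c by (intro continuous_on_add)
  qed (use K in auto)
  moreover have "integral\<^sup>L lborel (partial i ?F) = (\<integral>z. \<Psi> z * partial i \<phi> z + partial i \<Psi> z * \<phi> z \<partial>cube_measure)"
    unfolding pF integral_cube_measure
  proof (intro Bochner_Integration.integral_cong refl)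
    fix z show "\<Psi> z * partial i \<phi> z + partial i \<Psi> z * \<phi> z
      = indicator unit_cube z *\<^sub>R (\<Psi> z * partial i \<phi> z + partial i \<Psi> z * \<phi> z)"
      using p0[of z] K(3)[of z] Kc by (cases "z \<in> K") auto
  qed
  moreover have "\<dots> = (\<integral>z. \<Psi> z * partial i \<phi> z \<partial>cube_measure) + (\<integral>z. partial i \<Psi> z * \<phi> z \<partial>cube_measure)"
    by (intro Bochner_Integration.integral_add square_integrable_mult square_integrable_continuous
        smooth_continuous smooth_partial s \<Psi>)
  ultimately show ?thesis by simp
qed

text \<open>The outermost derivative of \<phi> is moved first and becomes the innermost one of
  \<Psi>, which is why the list is reversed.\<close>

lemma integral_by_parts_foldr:
  assumes "smooth \<Psi>" "test_function \<phi>"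
  shows "(\<integral>z. \<Psi> z * foldr partial ds \<phi> z \<partial>cube_measure)
    = (- 1) ^ length ds * (\<integral>z. foldr partial (rev ds) \<Psi> z * \<phi> z \<partial>cube_measure)"
  using assms(1)
proof (induction ds arbitrary: \<Psi>)
  case (Cons i ds)
  have "(\<integral>z. \<Psi> z * foldr partial (i # ds) \<phi> z \<partial>cube_measure)
      = - (\<integral>z. partial i \<Psi> z * foldr partial ds \<phi> z \<partial>cube_measure)"
    using integral_by_parts_partial[OF Cons.prems test_function_foldr[OF assms(2), of ds], of i] by simp
  also have "\<dots> = (- 1) ^ length (i # ds) * (\<integral>z. foldr partial (rev ds) (partial i \<Psi>) z * \<phi> z \<partial>cube_measure)"
    using Cons.IH[OF smooth_partial[OF Cons.prems], of i] by simp
  finally show ?case by simp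
qed simp

section \<open>Multi-indices and products of functions of one variable\<close>

lemma multi_partial_foldr:
  "multi_partial k \<phi> = foldr partial (concat (map (\<lambda>i. replicate (k i) i) (sorted_list_of_set UNIV))) \<phi>"
proof -
  have "foldr (\<lambda>i. partial i ^^ k i) xs \<phi> = foldr partial (concat (map (\<lambda>i. replicate (k i) i) xs)) \<phi>" for xs
    by (induction xs) auto
  then show ?thesis by (simp add: multi_partial_def)
qed

lemma count_list_replicates:
  "distinct xs \<Longrightarrow> count_list (concat (map (\<lambda>i. replicate (k i) i) xs)) j = (if j \<in> set xs then k j else 0)"
proof -
  have [simp]: "count_list (replicate m i) j = (if i = j then m else 0)" for m and i :: 'a
    by (induction m) auto
  show "distinct xs \<Longrightarrow> ?thesis" by (induction xs) auto
qed

text \<open>The multi-index \<open>k\<close> records how often each factor has been differentiated.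
  A partial derivative merely increments it, so the order of differentiation is irrelevant without
  any appeal to symmetry of second derivatives.\<close>

definition tens :: "('a::finite \<Rightarrow> nat \<Rightarrow> real \<Rightarrow> real) \<Rightarrow> ('a \<Rightarrow> nat) \<Rightarrow> real ^ 'a \<Rightarrow> real" where
  "tens F k z = (\<Prod>j\<in>UNIV. F j (k j) (z $ j))"

lemma has_derivative_tens:
  assumes "\<And>j. derivs (F j)"
  shows "(tens F k has_derivative (\<lambda>h. \<Sum>i\<in>UNIV. h $ i * tens F (k(i := Suc (k i))) z)) (at z)"
proof -
  have der: "(tens F k has_derivative
      (\<lambda>h. \<Sum>i\<in>UNIV. (h $ i * F i (Suc (k i)) (z $ i)) * (\<Prod>j\<in>UNIV - {i}. F j (k j) (z $ j)))) (at z)"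
    unfolding tens_def[abs_def]
  proof (rule has_derivative_prod)
    fix j
    have "((\<lambda>z. z $ j) has_derivative (\<lambda>h. h $ j)) (at z)"
      by (intro bounded_linear_imp_has_derivative bounded_linear_vec_nth)
    from DERIV_compose_FDERIV[OF derivsD[OF assms] this]
    show "((\<lambda>z. F j (k j) (z $ j)) has_derivative (\<lambda>h. h $ j * F j (Suc (k j)) (z $ j))) (at z)" .
  qed
  have eq: "(h $ i * F i (Suc (k i)) (z $ i)) * (\<Prod>j\<in>UNIV - {i}. F j (k j) (z $ j))
      = h $ i * tens F (k(i := Suc (k i))) z" for h :: "real ^ 'a" and i
  proof -
    have "tens F (k(i := Suc (k i))) z = F i (Suc (k i)) (z $ i) * (\<Prod>j\<in>UNIV - {i}. F j ((k(i := Suc (k i))) j) (z $ j))"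
      unfolding tens_def by (subst prod.remove[of _ i]) auto
    also have "(\<Prod>j\<in>UNIV - {i}. F j ((k(i := Suc (k i))) j) (z $ j)) = (\<Prod>j\<in>UNIV - {i}. F j (k j) (z $ j))"
      by (intro prod.cong) auto
    finally show ?thesis by (simp only: mult.assoc)
  qed
  show ?thesis using der unfolding eq .
qed

lemma partial_tens:
  assumes "\<And>j. derivs (F j)" shows "partial i (tens F k) = tens F (k(i := Suc (k i)))"
proof
  fix z
  have "partial i (tens F k) z = (\<Sum>j\<in>UNIV. axis i 1 $ j * tens F (k(j := Suc (k j))) z)"
    by (rule partial_eq[OF has_derivative_tens[OF assms]])
  also have "\<dots> = (\<Sum>j\<in>UNIV. if j = i then tens F (k(j := Suc (k j))) z else 0)"
    by (intro sum.cong) (auto simp: axis_def)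
  finally show "partial i (tens F k) z = tens F (k(i := Suc (k i))) z" by simp
qed

lemma foldr_partial_tens:
  assumes "\<And>j. derivs (F j)"
  shows "foldr partial ds (tens F k) = tens F (\<lambda>j. k j + count_list ds j)"
proof (induction ds)
  case (Cons i ds)
  have "foldr partial (i # ds) (tens F k) = partial i (tens F (\<lambda>j. k j + count_list ds j))"
    by (simp add: Cons)
  also have "\<dots> = tens F ((\<lambda>j. k j + count_list ds j)(i := Suc (k i + count_list ds i)))"
    by (rule partial_tens[of F, OF assms])
  also have "(\<lambda>j. k j + count_list ds j)(i := Suc (k i + count_list ds i)) = (\<lambda>j. k j + count_list (i # ds) j)"
    by auto
  finally show ?case .
qed simp

lemma smooth_tens: "(\<And>j. derivs (F j)) \<Longrightarrow> smooth (tens F k)"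
  unfolding smooth_def differentiable_def by (auto simp: foldr_partial_tens intro!: exI has_derivative_tens)

lemma multi_partial_tens:
  assumes "\<And>j. derivs (F j)" shows "multi_partial m (tens F k) = tens F (\<lambda>j. k j + m j)"
  unfolding multi_partial_foldr foldr_partial_tens[OF assms]
  by (subst count_list_replicates) auto

lemma test_function_tens:
  assumes "\<And>j. derivs (F j)" "0 < a" "b < 1" "\<And>j x. x \<notin> {a..b} \<Longrightarrow> F j (k j) x = 0"
  shows "test_function (tens F k)"
  unfolding test_function_def
proof (intro conjI exI[of _ "cbox (vec a) (vec b)"] allI impI)
  show "smooth (tens F k)" using assms(1) by (rule smooth_tens)
  show "cbox (vec a) (vec b) \<subseteq> (box 0 1 :: (real ^ 'a) set)"
  proof
    fix z :: "real ^ 'a" assume "z \<in> cbox (vec a) (vec b)"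
    then have "a \<le> z $ j" "z $ j \<le> b" for j by (auto simp: mem_box_cart)
    then show "z \<in> box 0 1"
      using assms(2,3) by (auto simp: mem_box_cart intro: less_le_trans le_less_trans)
  qed
  fix z :: "real ^ 'a" assume "z \<notin> cbox (vec a) (vec b)"
  then obtain j where "z $ j \<notin> {a..b}" by (auto simp: mem_box_cart)
  then have "F j (k j) (z $ j) = 0" by (rule assms(4))
  then show "tens F k z = 0" unfolding tens_def by (intro prod_zero) auto
qed simp

lemma smooth_multi_partial: "smooth \<phi> \<Longrightarrow> smooth (multi_partial k \<phi>)"
proof -
  have "smooth \<phi> \<Longrightarrow> smooth (foldr partial ds \<phi>)" for ds
    by (induction ds) (auto intro: smooth_partial)
  then show "smooth \<phi> \<Longrightarrow> ?thesis" by (simp add: multi_partial_foldr)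
qed

text \<open>Integration by parts returns the derivatives in reversed order, but on a product only
  the number of occurrences of each coordinate counts, and this number is the multi-index.\<close>

lemma has_weak_deriv_tens:
  assumes "\<And>j. derivs (F j)" shows "has_weak_deriv m (tens F k) (tens F (\<lambda>j. k j + m j))"
  unfolding has_weak_deriv_def
proof (intro conjI allI impI)
  show "square_integrable (tens F (\<lambda>j. k j + m j))"
    by (intro square_integrable_continuous smooth_continuous smooth_tens assms)
  fix \<phi> :: "(real, 'a) vec \<Rightarrow> real" assume \<phi>: "test_function \<phi>"
  let ?L = "concat (map (\<lambda>i. replicate (m i) i) (sorted_list_of_set UNIV))"
  have len: "length ?L = (\<Sum>i\<in>UNIV. m i)"
    by (simp add: length_concat comp_def sum_list_distinct_conv_sum_set)
  have c: "count_list (rev ?L) j = m j" for j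
    by (simp only: count_list_rev) (simp add: count_list_replicates)
  show "(\<integral>z. tens F k z * multi_partial m \<phi> z \<partial>cube_measure) =
      (- 1) ^ (\<Sum>i\<in>UNIV. m i) * (\<integral>z. tens F (\<lambda>j. k j + m j) z * \<phi> z \<partial>cube_measure)"
    unfolding multi_partial_foldr
      integral_by_parts_foldr[OF smooth_tens[of F, OF assms] \<phi>] foldr_partial_tens[of F, OF assms] len c ..
qed

lemma test_function_square_integrable:
  "test_function \<phi> \<Longrightarrow> square_integrable (multi_partial k \<phi>)" "test_function \<phi> \<Longrightarrow> square_integrable \<phi>"
  by (auto simp: test_function_def intro!: square_integrable_continuous smooth_continuous smooth_multi_partial)

lemma has_weak_deriv_cmult_sum:
  fixes g :: "'b \<Rightarrow> (real, 'a::{finite,linorder}) vec \<Rightarrow> real"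
  assumes "finite A" "\<And>a. a \<in> A \<Longrightarrow> square_integrable (g a)" "\<And>a. a \<in> A \<Longrightarrow> has_weak_deriv k (g a) (v a)"
  shows "has_weak_deriv k (\<lambda>z. \<Sum>a\<in>A. c a * g a z) (\<lambda>z. \<Sum>a\<in>A. c a * v a z)"
  unfolding has_weak_deriv_def
proof (intro conjI allI impI)
  have v: "square_integrable (v a)" if "a \<in> A" for a using assms(3)[OF that] by (simp add: has_weak_deriv_def)
  show "square_integrable (\<lambda>z. \<Sum>a\<in>A. c a * v a z)"
    using assms(1) v by (intro square_integrable_sum square_integrable_cmult)
  fix \<phi> :: "(real, 'a) vec \<Rightarrow> real" assume \<phi>: "test_function \<phi>"
  note \<phi>s = test_function_square_integrable[OF \<phi>]
  have "(\<integral>z. (\<Sum>a\<in>A. c a * g a z) * multi_partial k \<phi> z \<partial>cube_measure)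
     = (\<Sum>a\<in>A. c a * (\<integral>z. g a z * multi_partial k \<phi> z \<partial>cube_measure))"
    unfolding sum_distrib_right mult.assoc
    using assms(2) \<phi>s by (subst Bochner_Integration.integral_sum)
      (auto intro!: integrable_mult_right square_integrable_mult)
  also have "\<dots> = (\<Sum>a\<in>A. (-1) ^ (\<Sum>i\<in>UNIV. k i) * (c a * (\<integral>z. v a z * \<phi> z \<partial>cube_measure)))"
    using assms(3) \<phi> by (intro sum.cong) (auto simp: has_weak_deriv_def)
  also have "\<dots> = (-1) ^ (\<Sum>i\<in>UNIV. k i) * (\<integral>z. (\<Sum>a\<in>A. c a * v a z) * \<phi> z \<partial>cube_measure)"
    unfolding sum_distrib_right mult.assoc sum_distrib_left[symmetric]
    using v \<phi>s by (subst Bochner_Integration.integral_sum)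
      (auto intro!: integrable_mult_right square_integrable_mult)
  finally show "(\<integral>z. (\<Sum>a\<in>A. c a * g a z) * multi_partial k \<phi> z \<partial>cube_measure) =
      (-1) ^ (\<Sum>i\<in>UNIV. k i) * (\<integral>z. (\<Sum>a\<in>A. c a * v a z) * \<phi> z \<partial>cube_measure)" .
qed

section \<open>Legendre polynomials\<close>

text \<open>Integration over [0, 1] as a linear functional on polynomials, so that orthogonality
  reduces to polynomial algebra and one integration by parts.\<close>

definition pint :: "real poly \<Rightarrow> real" where
  "pint p = (\<integral>x. indicator {0..1} x * poly p x \<partial>lborel)"

lemma integrable_pint: "integrable lborel (\<lambda>x. indicator {0..1} x * poly p (x::real))"
  using borel_integrable_compact[of "{0..1::real}" "poly p"] by (simp add: continuous_at_imp_continuous_on)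

lemma pint_add: "pint (p + q) = pint p + pint q"
  using integrable_pint[of p] integrable_pint[of q] by (simp add: pint_def distrib_left)

lemma pint_smult: "pint (smult c p) = c * pint p"
proof -
  have "(\<lambda>x. indicator {0..1} x * poly (smult c p) x) = (\<lambda>x. c * (indicator {0..1} x * poly p (x::real)))"
    by (auto simp: fun_eq_iff)
  then show ?thesis by (simp add: pint_def)
qed

lemma pint_0 [simp]: "pint 0 = 0"
  by (simp add: pint_def)

lemma pint_pderiv: "pint (pderiv p) = poly p 1 - poly p 0"
proof -
  have "(\<integral>x. poly (pderiv p) x * indicator {0..1} x \<partial>lborel) = poly p 1 - poly p 0"
    by (rule integral_FTC_Icc_real) (auto intro!: poly_DERIV)
  then show ?thesis by (simp add: pint_def mult.commute)
qed

lemma pint_by_parts: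
  assumes "poly p 0 = 0" "poly p 1 = 0"
  shows "pint (pderiv p * q) = - pint (p * pderiv q)"
proof -
  have "pint (p * pderiv q) + pint (q * pderiv p) = 0"
    using pint_pderiv[of "p * q"] assms by (simp add: pderiv_mult pint_add)
  then show ?thesis by (simp add: mult.commute)
qed

abbreviation hump :: "real poly" where "hump \<equiv> [:0, 1, -1:]"

lemma poly_hump: "poly hump x = x * (1 - x)"
  by (simp add: algebra_simps)

text \<open>Each differentiation destroys at most one factor \<open>hump\<close>. This yields both
  the boundary zeros of the primitives and the factors that compensate a cutoff.\<close>

lemma hump_power_dvd_pderiv: "j \<le> N \<Longrightarrow> hump ^ (N - j) dvd (pderiv ^^ j) (hump ^ N * q)"
proof (induction j)
  case (Suc j)
  then obtain t where t: "(pderiv ^^ j) (hump ^ N * q) = hump ^ (N - j) * t" by (auto elim: dvdE)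
  obtain M where M: "N - j = Suc M" "N - Suc j = M" using Suc.prems by (metis Suc_diff_Suc Suc_le_lessD)
  have "(pderiv ^^ Suc j) (hump ^ N * q) = hump ^ Suc M * pderiv t + t * (smult (of_nat (Suc M)) (hump ^ M) * pderiv hump)"
    by (simp only: funpow.simps comp_def t M pderiv_mult pderiv_power_Suc)
  also have "\<dots> = hump ^ M * (hump * pderiv t + smult (of_nat (Suc M)) (t * pderiv hump))"
    by (simp only: power_Suc mult_smult_left mult_smult_right ring_distribs mult_ac)
  finally show ?case unfolding M by (metis dvd_triv_left)
qed simp

lemma poly_pderiv_hump_power_eq_0:
  assumes "j < N" "x = 0 \<or> x = 1" shows "poly ((pderiv ^^ j) (hump ^ N)) x = 0"
proof -
  obtain t where "(pderiv ^^ j) (hump ^ N) = hump ^ (N - j) * t"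
    using hump_power_dvd_pderiv[of j N 1] assms by (auto elim: dvdE)
  then show ?thesis using assms by (auto simp: poly_power)
qed

text \<open>All boundary terms vanish, since the derivatives of \<open>hump ^ N\<close> of order
  below N are zero at 0 and 1. With k = N - \<alpha> orthogonality becomes a degree count.\<close>

lemma pint_pderiv_hump_power:
  "k \<le> N \<Longrightarrow> pint ((pderiv ^^ k) (hump ^ N) * q) = (- 1) ^ k * pint (hump ^ N * (pderiv ^^ k) q)"
proof (induction k arbitrary: q)
  case (Suc k)
  have "pint ((pderiv ^^ Suc k) (hump ^ N) * q) = - pint ((pderiv ^^ k) (hump ^ N) * pderiv q)"
    using Suc.prems by (simp add: pint_by_parts poly_pderiv_hump_power_eq_0)
  also have "\<dots> = (- 1) ^ Suc k * pint (hump ^ N * (pderiv ^^ Suc k) q)"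
    using Suc by (simp add: funpow_swap1)
  finally show ?case .
qed simp

lemma fact_mult_pochhammer: "fact n * pochhammer (of_nat (Suc n)) m = (fact (n + m) :: real)"
proof (induction m)
  case (Suc m)
  have "fact n * pochhammer (of_nat (Suc n)) (Suc m) = (fact n * pochhammer (of_nat (Suc n)) m) * (real (Suc n) + real m)"
    by (simp add: pochhammer_Suc)
  then show ?case unfolding Suc by (simp add: mult.commute)
qed simp

lemma higher_pderiv_of_degree_le:
  assumes "degree (q :: real poly) \<le> k" shows "(pderiv ^^ k) q = [:fact k * coeff q k:]"
proof (rule poly_eqI)
  fix n
  show "coeff ((pderiv ^^ k) q) n = coeff [:fact k * coeff q k:] n"
    using assms fact_mult_pochhammer[of 0 k]
    by (cases n) (auto simp: coeff_higher_pderiv coeff_eq_0)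
qed

lemma degree_hump_power: "degree (hump ^ N) = 2 * N"
  by (simp add: degree_power_eq)

lemma coeff_hump_power: "coeff (hump ^ N) (2 * N) = (- 1) ^ N"
  using lead_coeff_power[of hump N] by (simp add: degree_hump_power)

lemma pint_hump_power_pos: "pint (hump ^ N) > 0"
proof -
  have "pint (hump ^ N) \<noteq> 0"
  proof
    assume "pint (hump ^ N) = 0"
    then have "AE x in lborel. indicator {0..1} x * poly (hump ^ N) x = (0::real)"
      unfolding pint_def
      by (subst (asm) integral_nonneg_eq_0_iff_AE[OF integrable_pint])
        (auto simp: poly_power indicator_def poly_hump simp flip: power_mult_distrib)
    then have "AE x in lborel. x \<notin> {0<..<1::real}"
      by eventually_elim (auto simp: poly_power indicator_def split: if_splits)
    then have "emeasure lborel {0<..<1::real} = 0"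
      by (subst (asm) AE_iff_measurable[of "{0<..<1}"]) auto
    then show False by simp
  qed
  moreover have "pint (hump ^ N) \<ge> 0"
    unfolding pint_def by (intro Bochner_Integration.integral_nonneg) (auto simp: poly_power indicator_def poly_hump)
  ultimately show ?thesis by simp
qed

text \<open>\<open>legendre N\<close> is the unnormalised shifted Legendre polynomial (Rodrigues' formula), and
  \<open>colegendre \<alpha> N\<close> its \<open>\<alpha>\<close>-fold primitive that vanishes to order \<open>\<alpha>\<close> at \<open>0\<close> and \<open>1\<close>.\<close>

definition colegendre :: "nat \<Rightarrow> nat \<Rightarrow> real poly" where
  "colegendre \<alpha> N = (pderiv ^^ (N - \<alpha>)) (hump ^ N)"

abbreviation legendre :: "nat \<Rightarrow> real poly" where "legendre \<equiv> colegendre 0"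

text \<open>For \<alpha> \<le> N the division is exact. Up to a factor these are the Gegenbauer
  polynomials on [0, 1], of degree N - \<alpha> and orthogonal for the weight
  \<open>hump ^ \<alpha>\<close>.\<close>

definition colegendre_quot :: "nat \<Rightarrow> nat \<Rightarrow> real poly" where
  "colegendre_quot \<alpha> N = colegendre \<alpha> N div hump ^ \<alpha>"

lemma colegendre_factor: "\<alpha> \<le> N \<Longrightarrow> colegendre \<alpha> N = hump ^ \<alpha> * colegendre_quot \<alpha> N"
  using hump_power_dvd_pderiv[of "N - \<alpha>" N 1] by (auto simp: colegendre_quot_def colegendre_def)

lemma pderiv_colegendre: "\<alpha> \<le> N \<Longrightarrow> (pderiv ^^ \<alpha>) (colegendre \<alpha> N) = legendre N"
  by (simp add: colegendre_def flip: funpow_add[unfolded comp_def, THEN fun_cong])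

lemma degree_higher_pderiv: "degree ((pderiv ^^ m) (p :: real poly)) = degree p - m"
  by (induction m) (auto simp: degree_pderiv)

lemma degree_colegendre: "\<alpha> \<le> N \<Longrightarrow> degree (colegendre \<alpha> N) = N + \<alpha>"
  by (simp add: colegendre_def degree_higher_pderiv degree_hump_power)

lemma coeff_colegendre:
  assumes "\<alpha> \<le> N" shows "coeff (colegendre \<alpha> N) (N + \<alpha>) = (- 1) ^ N * (fact (2 * N) / fact (N + \<alpha>))"
proof -
  have "coeff (colegendre \<alpha> N) (N + \<alpha>) = pochhammer (real (Suc (N + \<alpha>))) (N - \<alpha>) * coeff (hump ^ N) (2 * N)"
    using assms by (simp add: colegendre_def coeff_higher_pderiv mult_2)
  moreover have "pochhammer (real (Suc (N + \<alpha>))) (N - \<alpha>) = fact (2 * N) / fact (N + \<alpha>)"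
    using fact_mult_pochhammer[of "N + \<alpha>" "N - \<alpha>"] assms by (simp add: field_simps mult_2 mult_2_right)
  ultimately show ?thesis by (simp add: coeff_hump_power)
qed

lemma colegendre_nonzero: "\<alpha> \<le> N \<Longrightarrow> colegendre \<alpha> N \<noteq> 0"
  using coeff_colegendre[of \<alpha> N] by auto

lemma degree_colegendre_quot:
  assumes "\<alpha> \<le> N"
  shows "degree (colegendre_quot \<alpha> N) = N - \<alpha>"
    and "coeff (colegendre_quot \<alpha> N) (N - \<alpha>) = (- 1) ^ (N - \<alpha>) * (fact (2 * N) / fact (N + \<alpha>))"
proof -
  have nz: "colegendre_quot \<alpha> N \<noteq> 0"
    using colegendre_factor[OF assms] colegendre_nonzero[OF assms] by auto
  have "degree (colegendre \<alpha> N) = 2 * \<alpha> + degree (colegendre_quot \<alpha> N)"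
    unfolding colegendre_factor[OF assms] using nz by (subst degree_mult_eq) (auto simp: degree_hump_power)
  then show deg: "degree (colegendre_quot \<alpha> N) = N - \<alpha>"
    using assms by (simp add: degree_colegendre)
  have "lead_coeff (colegendre \<alpha> N) = lead_coeff (hump ^ \<alpha>) * lead_coeff (colegendre_quot \<alpha> N)"
    unfolding colegendre_factor[OF assms] by (rule lead_coeff_mult)
  then have "(- 1) ^ N * (fact (2 * N) / fact (N + \<alpha>)) = (- 1) ^ \<alpha> * coeff (colegendre_quot \<alpha> N) (N - \<alpha>)"
    by (simp only: degree_colegendre[OF assms] coeff_colegendre[OF assms] degree_hump_power coeff_hump_power deg)
  then have "(- 1) ^ \<alpha> * ((- 1) ^ N * (fact (2 * N) / fact (N + \<alpha>))) = (- 1) ^ \<alpha> * ((- 1) ^ \<alpha> * coeff (colegendre_quot \<alpha> N) (N - \<alpha>))"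
    by simp
  moreover have "(- 1) ^ \<alpha> * (- 1) ^ N = ((- 1) ^ (N - \<alpha>) :: real)"
  proof -
    have "(- 1 :: real) ^ N = (- 1) ^ \<alpha> * (- 1) ^ (N - \<alpha>)"
      using assms by (simp flip: power_add)
    then have "(- 1) ^ \<alpha> * (- 1) ^ N = ((- 1) ^ \<alpha> * (- 1) ^ \<alpha> * (- 1) ^ (N - \<alpha>) :: real)"
      by (simp only: mult.assoc)
    then show ?thesis by (simp flip: power_mult_distrib)
  qed
  ultimately show "coeff (colegendre_quot \<alpha> N) (N - \<alpha>) = (- 1) ^ (N - \<alpha>) * (fact (2 * N) / fact (N + \<alpha>))"
    by (simp add: mult.assoc[symmetric] flip: power_mult_distrib)
qed

lemma pint_colegendre_less:
  assumes "\<alpha> \<le> M" "M < N" shows "pint (colegendre \<alpha> N * colegendre_quot \<alpha> M) = 0"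
proof -
  have "(pderiv ^^ (N - \<alpha>)) (colegendre_quot \<alpha> M) = 0"
    using assms degree_colegendre_quot(1)[of \<alpha> M]
    by (subst higher_pderiv_of_degree_le) (auto simp: coeff_eq_0)
  then show ?thesis
    unfolding colegendre_def by (subst pint_pderiv_hump_power) auto
qed

text \<open>Integrating by parts N - \<alpha> times kills a quotient of degree M - \<alpha> < N -
  \<alpha>. The integrand is \<open>hump ^ \<alpha>\<close> times two quotients, hence symmetric in
  M and N, which covers the other order. On the diagonal only the leading coefficient of the
  quotient survives, and it produces the ratio of factorials.\<close>

lemma pint_colegendre:
  assumes "\<alpha> \<le> M" "\<alpha> \<le> N"
  shows "pint (colegendre \<alpha> N * colegendre_quot \<alpha> M)
    = (if N = M then fact (N - \<alpha>) / fact (N + \<alpha>) * (fact (2 * N) * pint (hump ^ N)) else 0)"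
proof -
  consider "M < N" | "N < M" | "N = M" by linarith
  then show ?thesis
  proof cases
    case 2
    have "colegendre \<alpha> N * colegendre_quot \<alpha> M = colegendre \<alpha> M * colegendre_quot \<alpha> N"
      using assms by (simp add: colegendre_factor mult_ac)
    then show ?thesis using 2 assms by (simp add: pint_colegendre_less)
  next
    case 3
    have "(pderiv ^^ (N - \<alpha>)) (colegendre_quot \<alpha> N)
        = [:fact (N - \<alpha>) * ((- 1) ^ (N - \<alpha>) * (fact (2 * N) / fact (N + \<alpha>))):]"
      using assms 3 by (subst higher_pderiv_of_degree_le) (auto simp: degree_colegendre_quot)
    then have "pint (colegendre \<alpha> N * colegendre_quot \<alpha> N)
      = (- 1) ^ (N - \<alpha>) * pint (smult (fact (N - \<alpha>) * ((- 1) ^ (N - \<alpha>) * (fact (2 * N) / fact (N + \<alpha>)))) (hump ^ N))"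
      unfolding colegendre_def by (subst pint_pderiv_hump_power) auto
    also have "\<dots> = ((- 1) ^ (N - \<alpha>) * (- 1) ^ (N - \<alpha>)) * (fact (N - \<alpha>) / fact (N + \<alpha>) * (fact (2 * N) * pint (hump ^ N)))"
      by (simp only: pint_smult) simp
    finally show ?thesis using 3 by (simp flip: power_mult_distrib)
  qed (use assms in \<open>simp add: pint_colegendre_less\<close>)
qed

text \<open>The L2 norm of \<open>legendre N\<close>: at \<alpha> = 0 the ratio of factorials in the
  diagonal value is 1. The integral of \<open>hump ^ N\<close> stays symbolic, as it cancels from
  the normalised quantities.\<close>

definition leg_norm :: "nat \<Rightarrow> real" where
  "leg_norm N = sqrt (fact (2 * N) * pint (hump ^ N))"

lemma leg_norm: "leg_norm N > 0" "(leg_norm N)\<^sup>2 = fact (2 * N) * pint (hump ^ N)"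
  using pint_hump_power_pos[of N] by (auto simp: leg_norm_def)

definition leg :: "nat \<Rightarrow> real poly" where "leg N = smult (1 / leg_norm N) (legendre N)"

definition coleg :: "nat \<Rightarrow> nat \<Rightarrow> real poly" where
  "coleg \<alpha> N = smult (1 / leg_norm N) (colegendre \<alpha> N)"

definition coleg_quot :: "nat \<Rightarrow> nat \<Rightarrow> real poly" where
  "coleg_quot \<alpha> N = smult (1 / leg_norm N) (colegendre_quot \<alpha> N)"

text \<open>For \<alpha> \<le> N, the squared norm of \<open>coleg_quot \<alpha> N\<close> for the
  weight \<open>hump ^ \<alpha>\<close>, equivalently of \<open>coleg \<alpha> N\<close> for the
  inverse weight. It is of order N to the power - 2 \<alpha>, the gain from \<alpha>
  integrations.\<close>

definition leg_weight :: "nat \<Rightarrow> nat \<Rightarrow> real" where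
  "leg_weight \<alpha> N = fact (N - \<alpha>) / fact (N + \<alpha>)"

lemma pint_coleg:
  assumes "\<alpha> \<le> M" "\<alpha> \<le> N"
  shows "pint (coleg \<alpha> N * coleg_quot \<alpha> M) = (if N = M then leg_weight \<alpha> N else 0)"
  using pint_colegendre[OF assms] leg_norm[of N]
  by (auto simp: coleg_def coleg_quot_def pint_smult leg_weight_def field_simps power2_eq_square)

lemma pint_leg: "pint (leg N * leg M) = (if N = M then 1 else 0)"
  using pint_coleg[of 0 M N] by (simp add: leg_def coleg_def coleg_quot_def colegendre_quot_def leg_weight_def)

lemma coleg_factor: "\<alpha> \<le> N \<Longrightarrow> coleg \<alpha> N = hump ^ \<alpha> * coleg_quot \<alpha> N"
  by (simp add: coleg_def coleg_quot_def colegendre_factor)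

lemma pderiv_coleg: "\<alpha> \<le> N \<Longrightarrow> (pderiv ^^ \<alpha>) (coleg \<alpha> N) = leg N"
  by (simp add: coleg_def leg_def higher_pderiv_smult pderiv_colegendre)

lemma leg_weight_pos: "leg_weight \<alpha> N > 0"
  by (simp add: leg_weight_def)

text \<open>The reciprocal weight is a product of 2 \<alpha> consecutive integers, the smallest
  being N - \<alpha> + 1, and (N - \<alpha> + 1) (\<alpha> + 1) \<ge> N + 1.\<close>

lemma leg_weight_bound:
  assumes "\<alpha> \<le> N" shows "(real (N + 1) / real (\<alpha> + 1)) ^ (2 * \<alpha>) \<le> 1 / leg_weight \<alpha> N"
proof -
  have fl: "fact m * real (m + 1) ^ k \<le> (fact (m + k) :: real)" for m k
  proof (induction k)
    case (Suc k)
    have "fact m * real (m + 1) ^ Suc k \<le> fact (m + k) * real (m + 1)"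
      using mult_right_mono[OF Suc, of "real (m + 1)"] by (simp add: mult_ac)
    also have "\<dots> \<le> fact (m + k) * real (m + k + 1)" by (intro mult_left_mono) auto
    also have "\<dots> = fact (m + Suc k)" by (simp add: mult_ac)
    finally show ?case .
  qed simp
  have "real (N + 1) \<le> real (N - \<alpha> + 1) * real (\<alpha> + 1)"
    using assms by (simp add: of_nat_diff algebra_simps) (metis le_add_same_cancel1 mult.commute mult_left_mono of_nat_0_le_iff of_nat_mono power2_eq_square)
  then have "real (N + 1) / real (\<alpha> + 1) \<le> real (N - \<alpha> + 1)"
    by (simp add: field_simps)
  then have "(real (N + 1) / real (\<alpha> + 1)) ^ (2 * \<alpha>) \<le> real (N - \<alpha> + 1) ^ (2 * \<alpha>)"
    by (intro power_mono) auto
  also have "\<dots> \<le> fact (N + \<alpha>) / fact (N - \<alpha>)"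
    using fl[of "N - \<alpha>" "2 * \<alpha>"] assms by (simp add: field_simps mult_2)
  finally show ?thesis by (simp add: leg_weight_def)
qed

lemma degree_leg: "degree (leg N) = N"
  using degree_colegendre[of 0 N] leg_norm(1)[of N] by (simp add: leg_def)

lemma leg_span: "degree p < m \<Longrightarrow> \<exists>a. p = (\<Sum>N<m. smult (a N) (leg N))"
proof (induction m arbitrary: p)
  case (Suc m)
  have nz: "coeff (leg m) m \<noteq> 0"
    using degree_leg[of m] colegendre_nonzero[of 0 m] leg_norm(1)[of m]
    by (metis divide_eq_0_iff le0 leading_coeff_0_iff leg_def less_irrefl smult_eq_0_iff zero_neq_one)
  define c where "c = coeff p m / coeff (leg m) m"
  let ?q = "p - smult c (leg m)"
  show ?case
  \<comment> \<open>For m = 0 the remainder is a constant and no smaller degree exists for the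
    induction, so its vanishing is seen directly.\<close>
  proof (cases "m = 0 \<or> ?q = 0")
    case True
    have "?q = 0"
    proof (cases "m = 0")
      case True
      then obtain x y where "p = [:x:]" "leg m = [:y:]"
        using Suc.prems degree_leg[of m] by (metis degree_eq_zeroE less_Suc0)
      then show ?thesis using nz True by (simp add: c_def)
    qed (use \<open>m = 0 \<or> ?q = 0\<close> in simp)
    then have "p = smult c (leg m)" by simp
    then show ?thesis by (intro exI[of _ "\<lambda>N. if N = m then c else 0"]) (simp add: sum.neutral)
  next
    case False
    have "degree ?q \<le> m" using Suc.prems degree_leg[of m] by (intro degree_diff_le) auto
    moreover have "coeff ?q m = 0" using nz by (simp add: c_def)
    ultimately have "degree ?q < m" using False by (metis leading_coeff_0_iff le_neq_implies_less)
    then obtain a where "?q = (\<Sum>N<m. smult (a N) (leg N))" using Suc.IH by blast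
    then have "p = (\<Sum>N<m. smult (a N) (leg N)) + smult c (leg m)" by (simp add: algebra_simps)
    also have "\<dots> = (\<Sum>N<Suc m. smult ((a(m := c)) N) (leg N))" by simp
    finally show ?thesis by blast
  qed
qed simp

section \<open>Legendre expansions on the cube\<close>

lemma AE_cube_measure:
  assumes "AE x in lborel. P x" shows "AE x in cube_measure. P x"
  using assms unfolding cube_measure_def by (subst AE_restrict_space_iff) auto

lemma prob_unit_cube [simp]: "measure cube_measure (unit_cube :: (real ^ 'a::finite) set) = 1"
  using cube.prob_space by simp

text \<open>The faces lie in hyperplanes, which are null sets. Cutoffs converge only at interior
  points, so limits on the cube are taken almost everywhere.\<close>

lemma AE_cube_interior: "AE z in (cube_measure :: (real ^ 'a::finite) measure). \<forall>j. 0 < z $ j \<and> z $ j < 1"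
proof -
  have ae: "AE z in (lborel :: (real ^ 'a) measure). z $ j \<noteq> c" for c j
  proof -
    have "{z :: real ^ 'a. axis j 1 \<bullet> z = c} \<in> null_sets lebesgue"
      using negligible_hyperplane[of "axis j (1::real)" c] negligible_iff_null_sets by (auto simp: axis_eq_0_iff)
    then have "AE z in lebesgue. z \<notin> {z :: real ^ 'a. axis j 1 \<bullet> z = c}" by (rule AE_not_in)
    then show ?thesis by (simp add: AE_completion_iff inner_axis')
  qed
  have "AE z in (lborel :: (real ^ 'a) measure). \<forall>j\<in>UNIV. z $ j \<noteq> 0 \<and> z $ j \<noteq> 1"
    by (intro AE_finite_allI AE_conjI ae) simp
  from AE_space AE_cube_measure[OF this] show ?thesis
  proof eventually_elim
    case (elim z)
    then show ?case by (auto simp: mem_box_cart less_le)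
  qed
qed

text \<open>Lebesgue measure on a Euclidean space is the image of a product measure indexed by
  \<open>Basis\<close>; the work lies in the bijection between \<open>Basis\<close> and the
  coordinate type.\<close>

lemma integral_lborel_prod_vec:
  fixes g :: "'a::finite \<Rightarrow> real \<Rightarrow> real"
  assumes "\<And>j. integrable lborel (g j)"
  shows "(\<integral>z. (\<Prod>j\<in>UNIV. g j (z $ j)) \<partial>lborel) = (\<Prod>j\<in>UNIV. integral\<^sup>L lborel (g j))"
proof -
  interpret product_sigma_finite "\<lambda>b :: real ^ 'a. lborel :: real measure" ..
  have m: "g j \<in> borel_measurable borel" for j using assms[of j] by auto
  define idx :: "real ^ 'a \<Rightarrow> 'a" where "idx b = (THE j. b = axis j 1)" for b
  have idx: "idx (axis j 1) = j" for j by (auto simp: idx_def axis_eq_axis)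
  have bij: "bij_betw (\<lambda>j. axis j (1::real)) UNIV (Basis :: (real ^ 'a) set)"
    by (rule bij_betwI[of _ _ _ idx]) (auto simp: idx Basis_vec_def)
  have re: "(\<Prod>j\<in>UNIV. h j) = (\<Prod>b\<in>(Basis :: (real ^ 'a) set). h (idx b))" for h :: "'a \<Rightarrow> real"
    using prod.reindex_bij_betw[OF bij, of "\<lambda>b. h (idx b)"] by (simp add: idx)
  have "(\<integral>z. (\<Prod>j\<in>UNIV. g j (z $ j)) \<partial>(lborel :: (real ^ 'a) measure))
    = (\<integral>x. (\<Prod>j\<in>UNIV. g j ((\<Sum>b\<in>Basis. x b *\<^sub>R b) $ j)) \<partial>(\<Pi>\<^sub>M b\<in>(Basis :: (real ^ 'a) set). lborel))"
    unfolding lborel_def[where 'a = "real ^ 'a"]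
    by (subst integral_distr) (use m in \<open>auto intro!: borel_measurable_prod measurable_compose[OF _ m] simp: lborel_eq_real\<close>)
  also have "\<dots> = (\<integral>x. (\<Prod>b\<in>Basis. g (idx b) (x b)) \<partial>(\<Pi>\<^sub>M b\<in>(Basis :: (real ^ 'a) set). lborel))"
  proof (intro Bochner_Integration.integral_cong refl)
    fix x :: "real ^ 'a \<Rightarrow> real"
    have "(\<Sum>b\<in>Basis. x b *\<^sub>R b) $ j = x (axis j 1)" for j
    proof -
      have "(\<Sum>b\<in>Basis. x b *\<^sub>R b) $ j = (\<Sum>b\<in>Basis. x b *\<^sub>R b) \<bullet> axis j 1" by (simp add: inner_axis)
      also have "\<dots> = x (axis j 1)" by (rule inner_sum_left_Basis) (auto simp: Basis_vec_def)
      finally show ?thesis .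
    qed
    then show "(\<Prod>j\<in>UNIV. g j ((\<Sum>b\<in>Basis. x b *\<^sub>R b) $ j)) = (\<Prod>b\<in>Basis. g (idx b) (x b))"
      using bij by (subst re) (auto simp: idx Basis_vec_def intro!: prod.cong)
  qed
  also have "\<dots> = (\<Prod>b\<in>Basis. integral\<^sup>L lborel (g (idx b)))"
    by (rule product_integral_prod) (use assms in auto)
  also have "\<dots> = (\<Prod>j\<in>UNIV. integral\<^sup>L lborel (g j))" by (simp only: re)
  finally show ?thesis .
qed

section \<open>Products of polynomials and their density\<close>

definition tpoly :: "('a::finite \<Rightarrow> real poly) \<Rightarrow> real ^ 'a \<Rightarrow> real" where
  "tpoly p z = (\<Prod>j\<in>UNIV. poly (p j) (z $ j))"

lemma continuous_on_tpoly: "continuous_on A (tpoly p)"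
  unfolding tpoly_def[abs_def]
  by (intro continuous_on_prod continuous_intros)

lemma square_integrable_tpoly: "square_integrable (tpoly p)"
  by (intro square_integrable_continuous continuous_on_tpoly)

lemma borel_measurable_tpoly [measurable]: "tpoly p \<in> borel_measurable borel"
  by (intro borel_measurable_continuous_onI continuous_on_tpoly)

lemma tpoly_mult: "tpoly p z * tpoly q z = tpoly (\<lambda>j. p j * q j) z"
  by (simp add: tpoly_def prod.distrib)

lemma integral_tpoly: "integral\<^sup>L cube_measure (tpoly p) = (\<Prod>j\<in>UNIV. pint (p j))"
proof -
  have "indicator unit_cube z *\<^sub>R tpoly p z = (\<Prod>j\<in>UNIV. indicator {0..1} (z $ j) * poly (p j) (z $ j))" for z :: "real ^ 'a"
  proof (cases "z \<in> unit_cube")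
    case True
    then show ?thesis by (auto simp: tpoly_def mem_box_cart indicator_def)
  next
    case False
    then obtain j where "z $ j \<notin> {0..1}" by (auto simp: mem_box_cart)
    then have "(\<Prod>j\<in>UNIV. indicator {0..1} (z $ j) * poly (p j) (z $ j)) = 0"
      by (intro prod_zero bexI[of _ j]) auto
    then show ?thesis using False by simp
  qed
  then show ?thesis
    using integral_lborel_prod_vec[of "\<lambda>j x. indicator {0..1} x * poly (p j) x"] integrable_pint
    by (simp add: integral_cube_measure pint_def)
qed

abbreviation tleg :: "('a::finite \<Rightarrow> nat) \<Rightarrow> real ^ 'a \<Rightarrow> real" where
  "tleg N \<equiv> tpoly (\<lambda>j. leg (N j))"

lemma integral_tleg: "(\<integral>z. tleg N z * tleg M z \<partial>cube_measure) = (if N = M then 1 else 0)"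
proof -
  have "(\<integral>z. tleg N z * tleg M z \<partial>cube_measure) = (\<Prod>j\<in>UNIV. pint (leg (N j) * leg (M j)))"
    unfolding tpoly_mult integral_tpoly ..
  then show ?thesis by (auto simp: pint_leg fun_eq_iff)
qed

definition below :: "nat \<Rightarrow> ('a::finite \<Rightarrow> nat) set" where "below m = (\<Pi>\<^sub>E j\<in>UNIV. {..<m})"

lemma below_iff: "N \<in> below m \<longleftrightarrow> (\<forall>j. N j < m)"
  by (auto simp: below_def PiE_UNIV_domain)

lemma finite_below [simp]: "finite (below m)"
  by (auto simp: below_def intro!: finite_PiE)

lemma card_below: "card (below m :: ('a::finite \<Rightarrow> nat) set) = m ^ CARD('a)"
  by (simp add: below_def card_PiE)

lemma below_mono: "m \<le> n \<Longrightarrow> below m \<subseteq> below n"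
  by (auto simp: below_iff) (meson less_le_trans)

text \<open>Closure under sums suffices: constants are absorbed in one factor of a
  \<open>tpoly\<close>, and the product of two of them is again one. So this is an algebra
  containing the coordinates, hence all polynomial functions.\<close>

inductive_set poly_span :: "(real ^ 'a::finite \<Rightarrow> real) set" where
  tpoly: "tpoly p \<in> poly_span"
| add: "f \<in> poly_span \<Longrightarrow> g \<in> poly_span \<Longrightarrow> (\<lambda>z. f z + g z) \<in> poly_span"

lemma poly_span_mult:
  assumes "f \<in> poly_span" "g \<in> poly_span" shows "(\<lambda>z. f z * g z) \<in> poly_span"
  using assms(1)
proof induction
  case (tpoly p)
  show ?case using assms(2)
  proof induction
    case (tpoly q)
    then show ?case by (simp add: tpoly_mult[abs_def] poly_span.tpoly)
  next
    case (add f g)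
    then show ?case by (simp add: distrib_left poly_span.add)
  qed
next
  case (add f g)
  then show ?case by (simp add: distrib_right poly_span.add)
qed

lemma poly_span_coord: "(\<lambda>z. c * z $ i) \<in> poly_span"
proof -
  have "(\<lambda>z. c * z $ i) = tpoly (\<lambda>j. if j = i then [:0, c:] else 1)"
    by (auto simp: tpoly_def fun_eq_iff if_distrib[of "\<lambda>p. poly p _"] prod.delta cong: if_cong)
  then show ?thesis by (simp add: poly_span.tpoly)
qed

lemma poly_span_const: "(\<lambda>z. c) \<in> (poly_span :: (real ^ 'a::finite \<Rightarrow> real) set)"
proof -
  fix i :: 'a
  have "(\<lambda>z. c) = tpoly (\<lambda>j. if j = i then [:c:] else 1)"
    by (auto simp: tpoly_def fun_eq_iff if_distrib[of "\<lambda>p. poly p _"] prod.delta cong: if_cong)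
  then show ?thesis by (simp add: poly_span.tpoly)
qed

lemma poly_span_sum: "finite A \<Longrightarrow> (\<And>a. a \<in> A \<Longrightarrow> f a \<in> poly_span) \<Longrightarrow> (\<lambda>z. \<Sum>a\<in>A. f a z) \<in> poly_span"
  by (induction A rule: finite_induct) (auto intro: poly_span.add poly_span_const)

lemma real_polynomial_function_poly_span:
  "real_polynomial_function f \<Longrightarrow> f \<in> (poly_span :: (real ^ 'a::finite \<Rightarrow> real) set)"
proof (induction rule: real_polynomial_function.induct)
  case (linear f)
  have "f z = (\<Sum>i\<in>UNIV. f (axis i 1) * z $ i)" for z
  proof -
    have "f z = f (\<Sum>i\<in>UNIV. z $ i *\<^sub>R axis i 1)"
      using basis_expansion[of z] by (simp add: scalar_mult_eq_scaleR)
    also have "\<dots> = (\<Sum>i\<in>UNIV. z $ i *\<^sub>R f (axis i 1))"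
      using bounded_linear.linear[OF linear] by (simp add: linear_sum linear_scale)
    finally show ?thesis by (simp add: mult.commute)
  qed
  then have "f = (\<lambda>z. \<Sum>i\<in>UNIV. f (axis i 1) * z $ i)" by (rule ext)
  also have "\<dots> \<in> poly_span" by (intro poly_span_sum poly_span_coord) auto
  finally show ?case .
qed (auto intro: poly_span_const poly_span_mult poly_span.add)

text \<open>Expanding every factor in one variable and multiplying out gives a sum over all
  multi-indices below a common degree bound. When two expansions are added, both are padded with
  zero coefficients to a common range.\<close>

lemma poly_span_tleg:
  "f \<in> poly_span \<Longrightarrow> \<exists>m a. f = (\<lambda>z. \<Sum>N\<in>below m. a N * tleg N z)"
proof (induction rule: poly_span.induct)
  case (tpoly p)
  define m where "m = Suc (Max (range (\<lambda>j. degree (p j))))"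
  have "degree (p j) < m" for j by (simp add: m_def less_Suc_eq_le)
  then have "\<forall>j. \<exists>b. p j = (\<Sum>N<m. smult (b N) (leg N))" using leg_span by blast
  from choice[OF this] obtain a where a: "\<And>j. p j = (\<Sum>N<m. smult (a j N) (leg N))" by blast
  have "tpoly p z = (\<Sum>N\<in>below m. (\<Prod>j\<in>UNIV. a j (N j)) * tleg N z)" for z
  proof -
    have "tpoly p z = (\<Prod>j\<in>UNIV. \<Sum>N<m. a j N * poly (leg N) (z $ j))"
      by (simp add: tpoly_def a poly_sum)
    also have "\<dots> = (\<Sum>N\<in>below m. \<Prod>j\<in>UNIV. a j (N j) * poly (leg (N j)) (z $ j))"
      unfolding below_def by (rule prod_sum_PiE) auto
    finally show ?thesis by (simp add: prod.distrib tpoly_def)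
  qed
  then have "tpoly p = (\<lambda>z. \<Sum>N\<in>below m. (\<Prod>j\<in>UNIV. a j (N j)) * tleg N z)" by (rule ext)
  then show ?case by (intro exI)
next
  case (add f g)
  then obtain m a n b where f: "f = (\<lambda>z. \<Sum>N\<in>below m. a N * tleg N z)"
    and g: "g = (\<lambda>z. \<Sum>N\<in>below n. b N * tleg N z)" by blast
  have ext: "(\<Sum>N\<in>below m. a N * tleg N z) = (\<Sum>N\<in>below K. (if N \<in> below m then a N else 0) * tleg N z)"
    if "m \<le> K" for m K a and z :: "real ^ 'a"
  proof -
    have "(\<Sum>N\<in>below m. (if N \<in> below m then a N else 0) * tleg N z) = (\<Sum>N\<in>below K. (if N \<in> below m then a N else 0) * tleg N z)"
      by (rule sum.mono_neutral_left) (use below_mono[OF that] in auto)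
    then show ?thesis by simp
  qed
  define K where "K = max m n"
  have "(\<lambda>z. f z + g z) = (\<lambda>z. \<Sum>N\<in>below K. ((if N \<in> below m then a N else 0) + (if N \<in> below n then b N else 0)) * tleg N z)"
  proof
    fix z
    show "f z + g z = (\<Sum>N\<in>below K. ((if N \<in> below m then a N else 0) + (if N \<in> below n then b N else 0)) * tleg N z)"
      unfolding f g ext[of m K, unfolded K_def, OF max.cobounded1, folded K_def]
        ext[of n K, unfolded K_def, OF max.cobounded2, folded K_def]
      by (simp only: distrib_right sum.distrib)
  qed
  then show ?case by (intro exI)
qed

definition clamp :: "real \<Rightarrow> real \<Rightarrow> real" where "clamp K x = max (- K) (min K x)"

lemma clamp_measurable [measurable]: "clamp K \<in> borel_measurable borel"
  unfolding clamp_def[abs_def] by measurable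

lemma clamp_bound: "K \<ge> 0 \<Longrightarrow> \<bar>clamp K x\<bar> \<le> K"
  by (auto simp: clamp_def)

lemma clamp_eq: "\<bar>x\<bar> \<le> K \<Longrightarrow> clamp K x = x"
  by (auto simp: clamp_def)

lemma clamp_contract: "\<bar>clamp K x - clamp K y\<bar> \<le> \<bar>x - y\<bar>"
  by (auto simp: clamp_def min_def max_def)

lemma clamp_nearer: "K \<ge> 0 \<Longrightarrow> \<bar>x - clamp K x\<bar> \<le> \<bar>x\<bar>"
  by (auto simp: clamp_def min_def max_def)

lemma integral_cube_tendsto_0:
  fixes f :: "nat \<Rightarrow> real ^ 'a::finite \<Rightarrow> real"
  assumes "\<And>n. f n \<in> borel_measurable cube_measure" "AE z in cube_measure. (\<lambda>n. f n z) \<longlonglongrightarrow> 0"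
    "integrable cube_measure w" "\<And>n. AE z in cube_measure. norm (f n z) \<le> w z" "e > 0"
  shows "\<exists>n. integral\<^sup>L cube_measure (f n) < e"
proof -
  have "(\<lambda>n. integral\<^sup>L cube_measure (f n)) \<longlonglongrightarrow> (\<integral>z. 0 \<partial>(cube_measure :: (real ^ 'a) measure))"
    by (rule integral_dominated_convergence[OF _ assms(1) assms(3,2,4)]) auto
  then have "\<forall>\<^sub>F n in sequentially. integral\<^sup>L cube_measure (f n) < e"
    using assms(5) by (auto intro: order_tendstoD)
  then show ?thesis by (auto simp: eventually_sequentially)
qed

lemma square_diff_bound: "(a - c)\<^sup>2 \<le> 2 * (a - b)\<^sup>2 + 2 * (b - c)\<^sup>2" for a b c :: real
proof -
  have "0 \<le> (a - 2 * b + c)\<^sup>2" by simp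
  then show ?thesis by (simp add: power2_eq_square algebra_simps)
qed

lemma integral_square_diff_bound:
  assumes "square_integrable f" "square_integrable g" "square_integrable h"
  shows "(\<integral>z. (f z - h z)\<^sup>2 \<partial>cube_measure)
    \<le> 2 * (\<integral>z. (f z - g z)\<^sup>2 \<partial>cube_measure) + 2 * (\<integral>z. (g z - h z)\<^sup>2 \<partial>cube_measure)"
proof -
  have i: "integrable cube_measure (\<lambda>z. (u z - v z)\<^sup>2)" if "square_integrable u" "square_integrable v" for u v
    using square_integrable_diff[OF that] by (simp add: square_integrable_def)
  have "(\<integral>z. (f z - h z)\<^sup>2 \<partial>cube_measure) \<le> (\<integral>z. 2 * (f z - g z)\<^sup>2 + 2 * (g z - h z)\<^sup>2 \<partial>cube_measure)"
    using assms i by (intro integral_mono) (auto simp: square_diff_bound)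
  also have "\<dots> = 2 * (\<integral>z. (f z - g z)\<^sup>2 \<partial>cube_measure) + 2 * (\<integral>z. (g z - h z)\<^sup>2 \<partial>cube_measure)"
    using assms i by (subst Bochner_Integration.integral_add) auto
  finally show ?thesis .
qed

text \<open>A measurable function is almost everywhere a limit of continuous ones. Clamping these to
  [- K, K] keeps them continuous, does not disturb the limit and supplies the dominating
  constant.\<close>

lemma continuous_dense_bounded:
  fixes g :: "real ^ 'a::finite \<Rightarrow> real"
  assumes m: "g \<in> borel_measurable cube_measure" and K: "\<And>z. z \<in> unit_cube \<Longrightarrow> \<bar>g z\<bar> \<le> K" "K \<ge> 0" and e: "e > 0"
  shows "\<exists>f. continuous_on UNIV f \<and> (\<integral>z. (g z - f z)\<^sup>2 \<partial>cube_measure) < e"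
proof -
  let ?G = "\<lambda>z. indicator unit_cube z *\<^sub>R g z"
  have "?G \<in> borel_measurable lborel"
    using m unfolding cube_measure_def by (subst (asm) borel_measurable_restrict_space_iff) auto
  then have "?G \<in> borel_measurable lebesgue" by (rule measurable_completion)
  then have "?G measurable_on UNIV"
    by (intro lebesgue_measurable_imp_measurable_on) auto
  then obtain N h where N: "negligible N" "\<And>n. continuous_on UNIV (h n)"
    and lim: "\<And>x. x \<notin> N \<Longrightarrow> (\<lambda>n. h n x) \<longlonglongrightarrow> ?G x"
    unfolding measurable_on_def by auto
  have "AE x in lebesgue. x \<notin> N" using N(1) negligible_iff_null_sets by (intro AE_not_in) auto
  then have aeN: "AE x in cube_measure. x \<notin> N" by (intro AE_cube_measure) (simp add: AE_completion_iff)
  have ch: "continuous_on UNIV (\<lambda>z. clamp K (h n z))" for n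
    unfolding clamp_def by (intro continuous_intros N(2))
  have "\<exists>n. (\<integral>z. (g z - clamp K (h n z))\<^sup>2 \<partial>cube_measure) < e"
  proof (rule integral_cube_tendsto_0[OF _ _ _ _ e])
    show "(\<lambda>z. (g z - clamp K (h n z))\<^sup>2) \<in> borel_measurable cube_measure" for n
      using m measurable_cube_measure_borel[OF borel_measurable_continuous_onI[OF ch[of n]]] by measurable
    show "AE z in cube_measure. (\<lambda>n. (g z - clamp K (h n z))\<^sup>2) \<longlonglongrightarrow> 0"
      using aeN AE_space
    proof eventually_elim
      case (elim z)
      then have z: "z \<in> unit_cube" by simp
      have "(\<lambda>n. h n z) \<longlonglongrightarrow> g z" using lim[of z] elim z by simp
      then have "(\<lambda>n. (g z - clamp K (h n z))\<^sup>2) \<longlonglongrightarrow> (g z - clamp K (g z))\<^sup>2"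
        unfolding clamp_def by (intro tendsto_intros)
      then show ?case using K(1)[OF z] by (simp add: clamp_eq)
    qed
    show "integrable cube_measure (\<lambda>z :: real ^ 'a. (2 * K)\<^sup>2)" by simp
    show "AE z in cube_measure. norm ((g z - clamp K (h n z))\<^sup>2) \<le> (2 * K)\<^sup>2" for n
    proof (rule AE_I2)
      fix z :: "real ^ 'a" assume "z \<in> space cube_measure"
      then have "\<bar>g z\<bar> \<le> K" using K by simp
      then have "\<bar>g z - clamp K (h n z)\<bar> \<le> 2 * K" using clamp_bound[OF K(2), of "h n z"] by linarith
      then have "\<bar>g z - clamp K (h n z)\<bar>\<^sup>2 \<le> (2 * K)\<^sup>2" by (intro power_mono) auto
      then show "norm ((g z - clamp K (h n z))\<^sup>2) \<le> (2 * K)\<^sup>2" by simp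
    qed
  qed
  then show ?thesis using ch by blast
qed

text \<open>A chain of three approximations: by a bounded truncation, by a continuous function in
  L2, and by a polynomial uniformly on the cube through Stone-Weierstrass. The polynomial is a
  finite Legendre sum.\<close>

lemma tleg_dense:
  fixes g :: "real ^ 'a::finite \<Rightarrow> real"
  assumes g: "square_integrable g" and e: "e > 0"
  shows "\<exists>m a. (\<integral>z. (g z - (\<Sum>N\<in>below m. a N * tleg N z))\<^sup>2 \<partial>cube_measure) < e"
proof -
  have mg: "g \<in> borel_measurable cube_measure" and ig: "integrable cube_measure (\<lambda>z. (g z)\<^sup>2)"
    using g by (auto simp: square_integrable_def)
  have "\<exists>n. (\<integral>z. (g z - clamp (real n) (g z))\<^sup>2 \<partial>cube_measure) < e / 4"
  proof (rule integral_cube_tendsto_0[OF _ _ ig])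
    show "(\<lambda>z. (g z - clamp (real n) (g z))\<^sup>2) \<in> borel_measurable cube_measure" for n using mg by measurable
    show "AE z in cube_measure. norm ((g z - clamp (real n) (g z))\<^sup>2) \<le> (g z)\<^sup>2" for n
      using clamp_nearer[of "real n"] by (intro AE_I2) (auto simp: abs_le_square_iff)
    show "AE z in cube_measure. (\<lambda>n. (g z - clamp (real n) (g z))\<^sup>2) \<longlonglongrightarrow> 0"
    proof (rule AE_I2)
      fix z
      obtain n0 where n0: "\<bar>g z\<bar> \<le> real n0" using real_arch_simple by blast
      have "\<forall>\<^sub>F n in sequentially. (g z - clamp (real n) (g z))\<^sup>2 = 0"
        using n0 by (intro eventually_sequentiallyI[of n0]) (auto simp: clamp_eq)
      then show "(\<lambda>n. (g z - clamp (real n) (g z))\<^sup>2) \<longlonglongrightarrow> 0" by (rule tendsto_eventually)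
    qed
  qed (use e in simp)
  then obtain n where n: "(\<integral>z. (g z - clamp (real n) (g z))\<^sup>2 \<partial>cube_measure) < e / 4" by blast
  have mc: "(\<lambda>z. clamp (real n) (g z)) \<in> borel_measurable cube_measure" using mg by measurable
  \<comment> \<open>Each triangle inequality for squares doubles the errors: 2 e / 16 + 2 e / 32 is
    below e / 4, and two errors below e / 4 then add up to less than e.\<close>
  obtain f where f: "continuous_on UNIV f" "(\<integral>z. (clamp (real n) (g z) - f z)\<^sup>2 \<partial>cube_measure) < e / 16"
    using continuous_dense_bounded[OF mc, of "real n" "e / 16"] clamp_bound[of "real n"] e by auto
  obtain p where p: "real_polynomial_function p" "\<And>z. z \<in> unit_cube \<Longrightarrow> \<bar>f z - p z\<bar> < sqrt (e / 32)"
    using Stone_Weierstrass_real_polynomial_function[of unit_cube f "sqrt (e / 32)"] continuous_on_subset[OF f(1)] e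
    by auto
  obtain m a where ma: "p = (\<lambda>z. \<Sum>N\<in>below m. a N * tleg N z)"
    using poly_span_tleg[OF real_polynomial_function_poly_span[OF p(1)]] by blast
  have sp: "square_integrable p"
    unfolding ma by (intro square_integrable_sum square_integrable_cmult square_integrable_tpoly) auto
  have sf: "square_integrable f" by (rule square_integrable_continuous[OF f(1)])
  have sc: "square_integrable (\<lambda>z. clamp (real n) (g z))"
    using clamp_bound[of "real n"] by (intro square_integrable_bounded[OF mc]) auto
  have "(\<integral>z. (f z - p z)\<^sup>2 \<partial>cube_measure) \<le> (\<integral>z. e / 32 \<partial>(cube_measure :: (real ^ 'a) measure))"
  proof (rule integral_mono)
    show "integrable cube_measure (\<lambda>z. (f z - p z)\<^sup>2)"
      using square_integrable_diff[OF sf sp] by (simp add: square_integrable_def)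
    fix z :: "real ^ 'a" assume "z \<in> space cube_measure"
    then have "\<bar>f z - p z\<bar>\<^sup>2 \<le> (sqrt (e / 32))\<^sup>2" using p(2)[of z] by (intro power_mono) auto
    then show "(f z - p z)\<^sup>2 \<le> e / 32" using e by simp
  qed simp
  then have fp: "(\<integral>z. (f z - p z)\<^sup>2 \<partial>cube_measure) \<le> e / 32" by simp
  have "(\<integral>z. (clamp (real n) (g z) - p z)\<^sup>2 \<partial>cube_measure) < e / 4"
    using integral_square_diff_bound[OF sc sf sp] f(2) fp e by linarith
  then have "(\<integral>z. (g z - p z)\<^sup>2 \<partial>cube_measure) < e"
    using integral_square_diff_bound[OF g sc sp] n by linarith
  then show ?thesis unfolding ma by blast
qed

section \<open>Legendre coefficients and approximation errors\<close>

definition leg_coeff :: "(real ^ 'a::finite \<Rightarrow> real) \<Rightarrow> ('a \<Rightarrow> nat) \<Rightarrow> real" where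
  "leg_coeff g N = (\<integral>z. g z * tleg N z \<partial>cube_measure)"

lemma integral_square_expand:
  assumes g: "square_integrable g" and f: "\<And>N. N \<in> S \<Longrightarrow> square_integrable (f N)" and S: "finite S"
  shows "(\<integral>z. (g z - (\<Sum>N\<in>S. a N * f N z))\<^sup>2 \<partial>cube_measure) = (\<integral>z. (g z)\<^sup>2 \<partial>cube_measure)
    - 2 * (\<Sum>N\<in>S. a N * (\<integral>z. g z * f N z \<partial>cube_measure))
    + (\<Sum>N\<in>S. \<Sum>M\<in>S. a N * a M * (\<integral>z. f N z * f M z \<partial>cube_measure))"
proof -
  have eq: "(g z - (\<Sum>N\<in>S. a N * f N z))\<^sup>2 = (g z)\<^sup>2 - 2 * (\<Sum>N\<in>S. a N * (g z * f N z))
      + (\<Sum>N\<in>S. \<Sum>M\<in>S. a N * a M * (f N z * f M z))" for z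
  proof -
    have "g z * (\<Sum>N\<in>S. a N * f N z) = (\<Sum>N\<in>S. a N * (g z * f N z))"
      by (simp add: sum_distrib_left mult_ac)
    moreover have "(\<Sum>N\<in>S. a N * f N z)\<^sup>2 = (\<Sum>N\<in>S. \<Sum>M\<in>S. a N * a M * (f N z * f M z))"
      by (simp add: power2_eq_square sum_product mult_ac)
    ultimately show ?thesis by (simp add: power2_diff mult.assoc)
  qed
  have i0: "integrable cube_measure (\<lambda>z. g z * f N z)" if "N \<in> S" for N
    using that by (intro square_integrable_mult g f)
  have i00: "integrable cube_measure (\<lambda>z. f N z * f M z)" if "N \<in> S" "M \<in> S" for N M
    using that by (intro square_integrable_mult f)
  have i2: "integrable cube_measure (\<lambda>z. a N * a M * (f N z * f M z))" if "N \<in> S" "M \<in> S" for N M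
    using that by (intro integrable_mult_right square_integrable_mult f)
  have i3: "integrable cube_measure (\<lambda>z. (g z)\<^sup>2)" using g by (simp add: square_integrable_def)
  have j1: "integrable cube_measure (\<lambda>z. 2 * (\<Sum>N\<in>S. a N * (g z * f N z)))"
    using i0 by (intro integrable_mult_right Bochner_Integration.integrable_sum) auto
  have j2: "integrable cube_measure (\<lambda>z. \<Sum>N\<in>S. \<Sum>M\<in>S. a N * a M * (f N z * f M z))"
    using i2 by (intro Bochner_Integration.integrable_sum)
  have "(\<integral>z. 2 * (\<Sum>N\<in>S. a N * (g z * f N z)) \<partial>cube_measure) = 2 * (\<Sum>N\<in>S. a N * (\<integral>z. g z * f N z \<partial>cube_measure))"
    using i0 by (simp add: Bochner_Integration.integral_sum)
  moreover have "(\<integral>z. (\<Sum>N\<in>S. \<Sum>M\<in>S. a N * a M * (f N z * f M z)) \<partial>cube_measure)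
     = (\<Sum>N\<in>S. \<Sum>M\<in>S. a N * a M * (\<integral>z. f N z * f M z \<partial>cube_measure))"
    using i00 by (simp add: Bochner_Integration.integral_sum Bochner_Integration.integrable_sum)
  ultimately show ?thesis
    unfolding eq using i3 j1 j2
    by (simp only: Bochner_Integration.integral_add Bochner_Integration.integral_diff Bochner_Integration.integrable_diff)
qed

text \<open>Pythagoras for an orthonormal system: the error of arbitrary coefficients
  \<open>a\<close> is the error of the projection plus the squared distance of \<open>a\<close> from
  the true coefficients.\<close>

lemma integral_tleg_expand:
  assumes g: "square_integrable g" and S: "finite S"
  shows "(\<integral>z. (g z - (\<Sum>N\<in>S. a N * tleg N z))\<^sup>2 \<partial>cube_measure)
    = (\<integral>z. (g z)\<^sup>2 \<partial>cube_measure) - (\<Sum>N\<in>S. (leg_coeff g N)\<^sup>2) + (\<Sum>N\<in>S. (a N - leg_coeff g N)\<^sup>2)"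
proof -
  have "(\<Sum>N\<in>S. \<Sum>M\<in>S. a N * a M * (\<integral>z. tleg N z * tleg M z \<partial>cube_measure)) = (\<Sum>N\<in>S. (a N)\<^sup>2)"
    using S by (simp add: integral_tleg power2_eq_square if_distrib[of "(*) _"] sum.delta cong: if_cong)
  then show ?thesis
    by (subst integral_square_expand[OF g square_integrable_tpoly S])
      (simp add: leg_coeff_def power2_diff sum.distrib sum_subtractf sum_distrib_left algebra_simps)
qed

lemma leg_coeff_bessel:
  assumes "square_integrable g" "finite S" shows "(\<Sum>N\<in>S. (leg_coeff g N)\<^sup>2) \<le> (\<integral>z. (g z)\<^sup>2 \<partial>cube_measure)"
proof -
  have "0 \<le> (\<integral>z. (g z - (\<Sum>N\<in>S. leg_coeff g N * tleg N z))\<^sup>2 \<partial>cube_measure)"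
    by (intro Bochner_Integration.integral_nonneg) auto
  then show ?thesis using integral_tleg_expand[OF assms, of "leg_coeff g"] by simp
qed

lemma leg_approx:
  fixes g :: "real ^ 'a::finite \<Rightarrow> real"
  assumes g: "square_integrable g" and \<delta>: "\<And>M. m \<le> M \<Longrightarrow> (\<Sum>N\<in>below M - below m. (leg_coeff g N)\<^sup>2) \<le> \<delta>"
  shows "(\<integral>z. (g z - (\<Sum>N\<in>below m. a N * tleg N z))\<^sup>2 \<partial>cube_measure)
    \<le> \<delta> + (\<Sum>N\<in>below m. (a N - leg_coeff g N)\<^sup>2)"
proof (rule field_le_epsilon)
  fix e :: real assume "e > 0"
  then obtain M0 b0 where b0: "(\<integral>z. (g z - (\<Sum>N\<in>below M0. b0 N * tleg N z))\<^sup>2 \<partial>cube_measure) < e"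
    using tleg_dense[OF g] by blast
  let ?M = "max m M0"
  have "(\<integral>z. (g z)\<^sup>2 \<partial>cube_measure) - (\<Sum>N\<in>below M0. (leg_coeff g N)\<^sup>2)
      \<le> (\<integral>z. (g z - (\<Sum>N\<in>below M0. b0 N * tleg N z))\<^sup>2 \<partial>cube_measure)"
    by (subst integral_tleg_expand[OF g]) (auto intro: sum_nonneg)
  then have 1: "(\<integral>z. (g z)\<^sup>2 \<partial>cube_measure) - (\<Sum>N\<in>below M0. (leg_coeff g N)\<^sup>2) \<le> e" using b0 by simp
  have 2: "(\<Sum>N\<in>below M0. (leg_coeff g N)\<^sup>2) \<le> (\<Sum>N\<in>below ?M. (leg_coeff g N)\<^sup>2)"
    by (intro sum_mono2 below_mono) auto
  have 3: "(\<Sum>N\<in>below ?M. (leg_coeff g N)\<^sup>2) = (\<Sum>N\<in>below m. (leg_coeff g N)\<^sup>2) + (\<Sum>N\<in>below ?M - below m. (leg_coeff g N)\<^sup>2)"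
    using sum.subset_diff[OF below_mono[of m ?M], of "\<lambda>N. (leg_coeff g N)\<^sup>2"] by simp
  show "(\<integral>z. (g z - (\<Sum>N\<in>below m. a N * tleg N z))\<^sup>2 \<partial>cube_measure)
    \<le> \<delta> + (\<Sum>N\<in>below m. (a N - leg_coeff g N)\<^sup>2) + e"
    using 1 2 3 \<delta>[of ?M] by (subst integral_tleg_expand[OF g]) auto
qed

lemma leg_coeff_eq_0_imp:
  fixes g :: "real ^ 'a::finite \<Rightarrow> real"
  assumes g: "square_integrable g" and "\<And>N. leg_coeff g N = 0"
  shows "(\<integral>z. (g z)\<^sup>2 \<partial>cube_measure) = 0"
proof -
  have "(\<integral>z. (g z - (\<Sum>N\<in>below 0. 0 * tleg N z))\<^sup>2 \<partial>cube_measure) \<le> 0 + (\<Sum>N\<in>below 0. (0 - leg_coeff g N)\<^sup>2)"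
    using assms(2) by (intro leg_approx[OF g]) auto
  moreover have "(\<integral>z. (g z)\<^sup>2 \<partial>cube_measure) \<ge> 0" by simp
  ultimately show ?thesis using assms(2) by simp
qed

section \<open>The error densities\<close>

text \<open>The factor \<open>1 / (1 + y\<^sup>2)\<close> is exact for the Cauchy density, up to a constant.\<close>

definition regular_density :: "(real \<Rightarrow> real) \<Rightarrow> bool" where
  "regular_density f \<longleftrightarrow> continuous_on UNIV f \<and> (\<forall>y. 0 < f y) \<and> has_bochner_integral lborel f 1 \<and>
     (\<exists>A. \<forall>y t. \<bar>t\<bar> \<le> 1 \<longrightarrow> \<bar>sqrt (f (y + t)) - sqrt (f y)\<bar> \<le> A * \<bar>t\<bar> / (1 + y\<^sup>2))"

text \<open>Both half-lines contain 0, so the glued function may differ at this one point from the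
  sum of the two rescaled pieces; the integral does not see it.\<close>

lemma two_sided_integral:
  fixes g1 g2 :: "real \<Rightarrow> real"
  assumes g1: "has_bochner_integral lborel (\<lambda>x. indicator {0..} x *\<^sub>R g1 x) I1"
    and g2: "has_bochner_integral lborel (\<lambda>x. indicator {0..} x *\<^sub>R g2 x) I2"
    and ab: "a > 0" "b > 0"
  shows "has_bochner_integral lborel (\<lambda>y. if y \<ge> 0 then g1 (a * y) else g2 (- b * y)) (I1 / a + I2 / b)"
proof -
  have h1: "has_bochner_integral lborel (\<lambda>y. indicator {0..} (0 + a * y) *\<^sub>R g1 (0 + a * y)) (I1 /\<^sub>R \<bar>a\<bar>)"
    using lborel_has_bochner_integral_real_affine_iff[of a "\<lambda>x. indicator {0..} x *\<^sub>R g1 x" I1 0] g1 ab by simp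
  have h2: "has_bochner_integral lborel (\<lambda>y. indicator {0..} (0 + (- b) * y) *\<^sub>R g2 (0 + (- b) * y)) (I2 /\<^sub>R \<bar>- b\<bar>)"
    using lborel_has_bochner_integral_real_affine_iff[of "- b" "\<lambda>x. indicator {0..} x *\<^sub>R g2 x" I2 0] g2 ab by simp
  let ?h = "\<lambda>y. indicator {0..} (0 + a * y) *\<^sub>R g1 (0 + a * y) + indicator {0..} (0 + (- b) * y) *\<^sub>R g2 (0 + (- b) * y)"
  have h: "has_bochner_integral lborel ?h (I1 / a + I2 / b)"
    using has_bochner_integral_add[OF h1 h2] ab by (simp add: divide_inverse mult.commute)
  let ?f = "\<lambda>y. if y \<ge> 0 then g1 (a * y) else g2 (- b * y)"
  have m: "?h \<in> borel_measurable lborel" using h by auto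
  have eq: "?f = (\<lambda>y. if y = 0 then g1 0 else ?h y)"
    using ab by (auto simp: fun_eq_iff indicator_def zero_le_mult_iff mult_le_0_iff)
  have mf: "?f \<in> borel_measurable lborel"
    unfolding eq using m by (intro measurable_If) auto
  have "AE y in lborel. ?h y = ?f y"
    using AE_lborel_singleton[of "0::real"]
  proof eventually_elim
    case (elim y)
    then show ?case using fun_cong[OF eq, of y] by simp
  qed
  from has_bochner_integral_cong_AE[OF m mf this] h show ?thesis by simp
qed

section \<open>Decay bounds and a criterion for regularity\<close>

lemma powr_le_exp:
  fixes b \<delta> :: real
  assumes "\<delta> > 0" "b \<ge> 0" shows "\<exists>K>0. \<forall>u\<ge>0. u powr b \<le> K * exp (\<delta> * u)"
proof -
  obtain n :: nat where n: "b \<le> real n" using real_arch_simple by blast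
  have "u powr b \<le> (1 + fact n / \<delta> ^ n) * exp (\<delta> * u)" if "u \<ge> 0" for u
  proof (cases "u \<ge> 1")
    case True
    have "u powr b \<le> u powr real n" using n True by (intro powr_mono) auto
    also have "\<dots> = (\<delta> * u) ^ n / \<delta> ^ n" using True assms by (simp add: powr_realpow power_mult_distrib)
    also have "\<dots> \<le> fact n * exp (\<delta> * u) / \<delta> ^ n"
      using assms that by (intro divide_right_mono power_le_fact_exp) auto
    finally show ?thesis by (simp add: distrib_right add_increasing)
  next
    case False
    then have "u powr b \<le> 1" using that assms by (intro powr_le1) auto
    also have "1 \<le> exp (\<delta> * u)" using that assms by simp
    also have "\<dots> \<le> (1 + fact n / \<delta> ^ n) * exp (\<delta> * u)" using assms by simp
    finally show ?thesis .
  qed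
  then show ?thesis using assms
    by (intro exI[of _ "1 + fact n / \<delta> ^ n"]) (auto simp: add_pos_pos)
qed

lemma exp_decay_bound:
  assumes "(b::real) > 0" shows "\<exists>A. \<forall>y. exp (- (b * \<bar>y\<bar>)) \<le> A / (1 + y\<^sup>2)"
proof (intro exI allI)
  fix y :: real
  have "(b * \<bar>y\<bar>) ^ 2 \<le> fact 2 * exp (b * \<bar>y\<bar>)" using assms by (intro power_le_fact_exp) auto
  then have "y\<^sup>2 \<le> 2 / b\<^sup>2 * exp (b * \<bar>y\<bar>)"
    using assms by (simp add: power_mult_distrib field_simps numeral_2_eq_2)
  moreover have "1 \<le> exp (b * \<bar>y\<bar>)" using assms by simp
  ultimately have "1 + y\<^sup>2 \<le> (1 + 2 / b\<^sup>2) * exp (b * \<bar>y\<bar>)"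
    using add_mono by (simp only: distrib_right mult_1)
  then have "(1 + y\<^sup>2) * exp (- (b * \<bar>y\<bar>)) \<le> 1 + 2 / b\<^sup>2"
    by (simp add: exp_minus field_simps)
  then show "exp (- (b * \<bar>y\<bar>)) \<le> (1 + 2 / b\<^sup>2) / (1 + y\<^sup>2)"
    by (simp add: field_simps add_pos_nonneg)
qed

text \<open>One factor exp |y| absorbs the linear term and a second one provides the decay. The
  Gaussian pays for both, since 2 |y| - b y^2 \<le> 1 / b after completing the square.\<close>

lemma gaussian_decay_bound:
  assumes "(b::real) > 0" shows "\<exists>A. \<forall>y. \<bar>y\<bar> * exp (- (b * y\<^sup>2)) \<le> A / (1 + y\<^sup>2)"
proof -
  obtain A where A: "\<And>y::real. exp (- (1 * \<bar>y\<bar>)) \<le> A / (1 + y\<^sup>2)" using exp_decay_bound[OF zero_less_one] by metis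
  have "\<bar>y\<bar> * exp (- (b * y\<^sup>2)) \<le> exp (1 / b) * A / (1 + y\<^sup>2)" for y
  proof -
    have "0 \<le> b * (\<bar>y\<bar> - 1 / b)\<^sup>2" using assms by simp
    also have "b * (\<bar>y\<bar> - 1 / b)\<^sup>2 = b * y\<^sup>2 - 2 * \<bar>y\<bar> + 1 / b"
      using assms by (simp add: power2_diff power2_eq_square field_simps)
    finally have q: "2 * \<bar>y\<bar> - b * y\<^sup>2 \<le> 1 / b" by simp
    have "\<bar>y\<bar> \<le> exp \<bar>y\<bar>" using exp_ge_add_one_self[of "\<bar>y\<bar>"] by linarith
    then have "\<bar>y\<bar> * exp (- (b * y\<^sup>2)) \<le> exp \<bar>y\<bar> * exp (- (b * y\<^sup>2))" by (intro mult_right_mono) auto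
    also have "\<dots> = exp (2 * \<bar>y\<bar> - b * y\<^sup>2) * exp (- \<bar>y\<bar>)" by (simp flip: exp_add)
    also have "\<dots> \<le> exp (1 / b) * (A / (1 + y\<^sup>2))" using q A[of y] by (intro mult_mono) auto
    finally show ?thesis by simp
  qed
  then show ?thesis by blast
qed

text \<open>The root of an error density may have a kink at 0, so the mean value theorem is applied
  on either side of it.\<close>

lemma lipschitz_off_zero:
  fixes G :: "real \<Rightarrow> real"
  assumes c: "continuous_on UNIV G" and d: "\<And>x. x \<noteq> 0 \<Longrightarrow> (G has_real_derivative G' x) (at x)"
    and le: "a \<le> b" and B: "\<And>x. a \<le> x \<Longrightarrow> x \<le> b \<Longrightarrow> x \<noteq> 0 \<Longrightarrow> \<bar>G' x\<bar> \<le> B"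
  shows "\<bar>G b - G a\<bar> \<le> B * (b - a)"
proof -
  have step: "\<bar>G v - G u\<bar> \<le> B * (v - u)" if uv: "a \<le> u" "u \<le> v" "v \<le> b" "\<not> (u < 0 \<and> 0 < v)" for u v
  proof (cases "u = v")
    case False
    then have lt: "u < v" using uv by simp
    have "\<exists>\<xi>. u < \<xi> \<and> \<xi> < v \<and> G v - G u = (*) (G' \<xi>) (v - u)"
    proof (rule mvt[OF lt continuous_on_subset[OF c]])
      fix x assume "u < x" "x < v"
      then have "x \<noteq> 0" using uv(4) by auto
      then show "(G has_derivative (*) (G' x)) (at x)"
        using d by (auto simp: has_field_derivative_def)
    qed auto
    then obtain \<xi> where xi: "u < \<xi>" "\<xi> < v" "G v - G u = G' \<xi> * (v - u)" by blast
    moreover have "\<bar>G' \<xi>\<bar> \<le> B" using xi uv by (intro B) auto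
    ultimately show ?thesis using lt by (simp add: abs_mult mult_right_mono)
  qed simp
  show ?thesis
  proof (cases "a < 0 \<and> 0 < b")
    case True
    then have "\<bar>G b - G 0\<bar> \<le> B * (b - 0)" "\<bar>G 0 - G a\<bar> \<le> B * (0 - a)" by (intro step; simp)+
    then show ?thesis by (simp add: algebra_simps)
  qed (use step le in auto)
qed

text \<open>The derivative bound is available at an intermediate point within distance 1 of y; this
  moves the weight back to y at the price of a factor 3.\<close>

lemma one_plus_square_shift:
  fixes y z :: real assumes "\<bar>z - y\<bar> \<le> 1" shows "1 / (1 + z\<^sup>2) \<le> 3 / (1 + y\<^sup>2)"
proof -
  have "(y - z)\<^sup>2 \<le> 1\<^sup>2" using assms by (subst abs_le_square_iff[symmetric]) auto
  moreover have "0 \<le> (y - 2 * z)\<^sup>2" by simp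
  ultimately have "y\<^sup>2 \<le> 2 * z\<^sup>2 + 2" by (simp add: power2_diff power2_eq_square algebra_simps)
  then have "1 + y\<^sup>2 \<le> 3 + 2 * z\<^sup>2" by simp
  also have "\<dots> \<le> 3 * (1 + z\<^sup>2)" by simp
  finally have "1 + y\<^sup>2 \<le> 3 * (1 + z\<^sup>2)" .
  then show ?thesis by (simp add: field_simps add_pos_nonneg)
qed

text \<open>\<open>g1\<close> and \<open>g2\<close> are the branches of the root of \<open>f\<close>
  to the right and to the left of 0, \<open>e1\<close> and \<open>e2\<close> their derivatives. The
  weighted Lipschitz condition follows from the derivative bounds by the mean value theorem applied
  to the root itself.\<close>

lemma regular_densityI:
  fixes g1 g2 :: "real \<Rightarrow> real"
  assumes d1: "\<And>y. y \<ge> 0 \<Longrightarrow> (g1 has_real_derivative e1 y) (at y)"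
    and d2: "\<And>y. y \<le> 0 \<Longrightarrow> (g2 has_real_derivative e2 y) (at y)"
    and b1: "\<And>y. y \<ge> 0 \<Longrightarrow> \<bar>e1 y\<bar> \<le> A1 / (1 + y\<^sup>2)"
    and b2: "\<And>y. y \<le> 0 \<Longrightarrow> \<bar>e2 y\<bar> \<le> A2 / (1 + y\<^sup>2)"
    and z: "g1 0 = g2 0"
    and p1: "\<And>y. y \<ge> 0 \<Longrightarrow> g1 y > 0" and p2: "\<And>y. y \<le> 0 \<Longrightarrow> g2 y > 0"
    and f1: "\<And>y. y \<ge> 0 \<Longrightarrow> f y = (g1 y)\<^sup>2" and f2: "\<And>y. y < 0 \<Longrightarrow> f y = (g2 y)\<^sup>2"
    and int: "has_bochner_integral lborel f 1"
  shows "regular_density f"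
proof -
  define G where "G y = (if y \<ge> 0 then g1 y else g2 y)" for y
  have fG: "f y = (G y)\<^sup>2" for y by (simp add: G_def f1 f2)
  have Gp: "G y > 0" for y by (simp add: G_def p1 p2)
  have sq: "sqrt (f y) = G y" for y using Gp[of y] by (simp add: fG)
  have cG: "continuous_on UNIV G"
  proof -
    have "continuous_on ({0..} \<union> {..0}) (\<lambda>y. if y \<in> {0..} then g1 y else g2 y)"
      by (rule continuous_on_If)
        (auto intro!: continuous_at_imp_continuous_on DERIV_isCont d1 d2 simp: z)
    moreover have "{0..} \<union> {..0} = (UNIV :: real set)" by auto
    ultimately show ?thesis by (simp add: G_def[abs_def])
  qed
  define G' where "G' y = (if y \<ge> 0 then e1 y else e2 y)" for y
  have dG: "(G has_real_derivative G' y) (at y)" if "y \<noteq> 0" for y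
  proof (cases "y > 0")
    case True
    then have "(g1 has_real_derivative G' y) (at y)" by (simp add: G'_def d1)
    then show ?thesis
      by (rule has_field_derivative_transform_within_open[of _ _ _ "{0<..}"]) (use True in \<open>auto simp: G_def\<close>)
  next
    case False
    then have "y < 0" using that by simp
    then have "(g2 has_real_derivative G' y) (at y)" by (simp add: G'_def d2)
    then show ?thesis
      by (rule has_field_derivative_transform_within_open[of _ _ _ "{..<0}"]) (use \<open>y < 0\<close> in \<open>auto simp: G_def\<close>)
  qed
  define A where "A = max A1 A2"
  have A0: "A \<ge> 0" using b1[of 0] by (simp add: A_def)
  have bG: "\<bar>G' y\<bar> \<le> A / (1 + y\<^sup>2)" for y
  proof -
    have "A1 / (1 + y\<^sup>2) \<le> A / (1 + y\<^sup>2)" "A2 / (1 + y\<^sup>2) \<le> A / (1 + y\<^sup>2)"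
      by (intro divide_right_mono; simp add: A_def)+
    then show ?thesis using b1[of y] b2[of y] by (cases "y \<ge> 0") (auto simp: G'_def)
  qed
  have lip: "\<bar>G (y + t) - G y\<bar> \<le> 3 * A * \<bar>t\<bar> / (1 + y\<^sup>2)" if t: "\<bar>t\<bar> \<le> 1" for y t
  proof -
    have B: "\<bar>G' x\<bar> \<le> 3 * A / (1 + y\<^sup>2)" if "min y (y + t) \<le> x" "x \<le> max y (y + t)" for x
    proof -
      have "\<bar>x - y\<bar> \<le> 1" using that t by (auto simp: min_def max_def split: if_splits)
      then have "A * (1 / (1 + x\<^sup>2)) \<le> A * (3 / (1 + y\<^sup>2))"
        using A0 one_plus_square_shift by (intro mult_left_mono) auto
      then show ?thesis using bG[of x] by (simp add: mult.commute)
    qed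
    have "\<bar>G (max y (y + t)) - G (min y (y + t))\<bar> \<le> 3 * A / (1 + y\<^sup>2) * (max y (y + t) - min y (y + t))"
      by (rule lipschitz_off_zero[OF cG dG]) (use B in auto)
    then show ?thesis by (cases "t \<ge> 0") (auto simp: min_def max_def abs_minus_commute split: if_splits)
  qed
  have "continuous_on UNIV f" unfolding fG[abs_def] using cG by (intro continuous_intros)
  then show ?thesis
    unfolding regular_density_def sq using lip int Gp by (auto simp: fG zero_less_power2 less_imp_neq[symmetric])
qed

section \<open>The five families of error densities\<close>

lemma exp_half_line:
  assumes "l > 0" shows "has_bochner_integral lborel (\<lambda>x. indicator {0..} x *\<^sub>R exp (- (l * x))) (1 / l :: real)"
proof -
  interpret prob_space "density lborel (exponential_density l)"
    using assms by (rule prob_space_exponential_density)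
  have "(\<integral>\<^sup>+x. ennreal (exponential_density l x) \<partial>lborel) = ennreal 1"
    using emeasure_space_1 by (simp add: emeasure_density)
  then have "has_bochner_integral lborel (exponential_density l) 1"
    using assms by (intro has_bochner_integral_nn_integral) (auto simp: exponential_density_nonneg)
  from has_bochner_integral_mult_right[OF this, of "1 / l"]
  have "has_bochner_integral lborel (\<lambda>x. 1 / l * exponential_density l x) (1 / l)" by simp
  also have "(\<lambda>x. 1 / l * exponential_density l x) = (\<lambda>x. indicator {0..} x *\<^sub>R exp (- (l * x)))"
    using assms by (auto simp: exponential_density_def fun_eq_iff mult.commute)
  finally show ?thesis .
qed

lemma gamma_tail:
  fixes a b :: real
  assumes "a \<ge> 0" "b \<ge> 0" shows "set_integrable lborel {a..} (\<lambda>x. x powr b * exp (- x))"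
    and "(LBINT x:{a..}. x powr b * exp (- x)) > 0"
proof -
  obtain K where K: "K > 0" "\<And>u::real. u \<ge> 0 \<Longrightarrow> u powr b \<le> K * exp (1/2 * u)"
    using powr_le_exp[of "1/2" b] assms by auto
  show i: "set_integrable lborel {a..} (\<lambda>x. x powr b * exp (- x))"
    unfolding set_integrable_def
  proof (rule Bochner_Integration.integrable_bound)
    show "integrable lborel (\<lambda>x. K * (indicator {0..} x *\<^sub>R exp (- (1/2 * x)) :: real))"
      using exp_half_line[of "1/2"] by (intro integrable_mult_right) (auto simp: has_bochner_integral_iff)
    show "AE x in lborel. norm (indicat_real {a..} x *\<^sub>R (x powr b * exp (- x)))
        \<le> norm (K * (indicator {0..} x *\<^sub>R exp (- (1/2 * x))))"
    proof (intro AE_I2)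
      fix x :: real
      have "x powr b * exp (- x) \<le> K * exp (- (1/2 * x))" if "x \<ge> 0"
      proof -
        have "x powr b * exp (- x) \<le> (K * exp (1/2 * x)) * exp (- x)"
          using K(2)[OF that] by (intro mult_right_mono) auto
        also have "\<dots> = K * exp (- (1/2 * x))" by (simp flip: exp_add)
        finally show ?thesis .
      qed
      then show "norm (indicat_real {a..} x *\<^sub>R (x powr b * exp (- x)))
        \<le> norm (K * (indicator {0..} x *\<^sub>R exp (- (1/2 * x))))"
        using assms K(1) by (auto simp: indicator_def abs_mult)
    qed
  qed simp
  have "(LBINT x:{a..}. x powr b * exp (- x)) \<ge> 0"
    unfolding set_lebesgue_integral_def by (intro Bochner_Integration.integral_nonneg) (auto simp: indicator_def)
  moreover have "(LBINT x:{a..}. x powr b * exp (- x)) \<noteq> 0"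
  proof
    assume "(LBINT x:{a..}. x powr b * exp (- x)) = 0"
    then have "AE x in lborel. indicat_real {a..} x *\<^sub>R (x powr b * exp (- x)) = 0"
      unfolding set_lebesgue_integral_def
      by (subst (asm) integral_nonneg_eq_0_iff_AE[OF i[unfolded set_integrable_def]]) (auto simp: indicator_def)
    then have "AE x in lborel. x \<notin> {a<..<a+1}"
      by eventually_elim (use assms in \<open>auto simp: indicator_def split: if_splits\<close>)
    then have "emeasure lborel {a<..<a+1} = 0"
      by (subst (asm) AE_iff_measurable[of "{a<..<a+1}"]) auto
    then show False by simp
  qed
  ultimately show "(LBINT x:{a..}. x powr b * exp (- x)) > 0" by simp
qed

text \<open>Taking the root halves the rates \<tau> and 1 - \<tau> of the two exponential tails. The
  mass is 1 because c / \<tau> + c / (1 - \<tau>) = (1 - \<tau>) + \<tau> for c = \<tau> (1 -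
  \<tau>).\<close>

lemma regular_asymmetric_laplace:
  assumes "0 < \<tau>" "\<tau> < 1"
  shows "regular_density (\<lambda>y. \<tau> * (1 - \<tau>) * exp (- check_loss \<tau> y))"
proof -
  define c where "c = \<tau> * (1 - \<tau>)"
  have c: "c > 0" using assms by (simp add: c_def)
  obtain A1 where A1: "\<And>y::real. exp (- (\<tau> / 2 * \<bar>y\<bar>)) \<le> A1 / (1 + y\<^sup>2)"
    using exp_decay_bound[of "\<tau> / 2"] assms by auto
  obtain A2 where A2: "\<And>y::real. exp (- ((1 - \<tau>) / 2 * \<bar>y\<bar>)) \<le> A2 / (1 + y\<^sup>2)"
    using exp_decay_bound[of "(1 - \<tau>) / 2"] assms by auto
  have i: "has_bochner_integral lborel (\<lambda>x. indicator {0..} x *\<^sub>R (c * exp (- x))) c"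
    using has_bochner_integral_mult_right[OF exp_half_line[of 1], of c] by (simp add: mult.left_commute)
  have "has_bochner_integral lborel (\<lambda>y. if y \<ge> 0 then c * exp (- (\<tau> * y)) else c * exp (- (- (1 - \<tau>) * y))) (c / \<tau> + c / (1 - \<tau>))"
    by (rule two_sided_integral[OF i i]) (use assms in auto)
  also have "c / \<tau> + c / (1 - \<tau>) = 1" using assms by (simp add: c_def field_simps)
  also have "(\<lambda>y. if y \<ge> 0 then c * exp (- (\<tau> * y)) else c * exp (- (- (1 - \<tau>) * y)))
      = (\<lambda>y. \<tau> * (1 - \<tau>) * exp (- check_loss \<tau> y))"
    by (auto simp: check_loss_def c_def fun_eq_iff algebra_simps)
  finally have int: "has_bochner_integral lborel (\<lambda>y. \<tau> * (1 - \<tau>) * exp (- check_loss \<tau> y)) 1" .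
  show ?thesis
  proof (rule regular_densityI[where ?g1.0 = "\<lambda>y. sqrt c * exp (- (\<tau> / 2 * y))" and ?e1.0 = "\<lambda>y. - (\<tau> / 2) * (sqrt c * exp (- (\<tau> / 2 * y)))"
        and ?g2.0 = "\<lambda>y. sqrt c * exp ((1 - \<tau>) / 2 * y)" and ?e2.0 = "\<lambda>y. (1 - \<tau>) / 2 * (sqrt c * exp ((1 - \<tau>) / 2 * y))"
        and ?A1.0 = "\<tau> / 2 * sqrt c * A1" and ?A2.0 = "(1 - \<tau>) / 2 * sqrt c * A2", OF _ _ _ _ _ _ _ _ _ int])
    fix y :: real
    show "((\<lambda>y. sqrt c * exp (- (\<tau> / 2 * y))) has_real_derivative - (\<tau> / 2) * (sqrt c * exp (- (\<tau> / 2 * y)))) (at y)"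
      by (auto intro!: derivative_eq_intros)
    show "((\<lambda>y. sqrt c * exp ((1 - \<tau>) / 2 * y)) has_real_derivative (1 - \<tau>) / 2 * (sqrt c * exp ((1 - \<tau>) / 2 * y))) (at y)"
      by (auto intro!: derivative_eq_intros)
    show "\<bar>- (\<tau> / 2) * (sqrt c * exp (- (\<tau> / 2 * y)))\<bar> \<le> \<tau> / 2 * sqrt c * A1 / (1 + y\<^sup>2)" if "y \<ge> 0"
    proof -
      have "(\<tau> / 2 * sqrt c) * exp (- (\<tau> / 2 * y)) \<le> (\<tau> / 2 * sqrt c) * (A1 / (1 + y\<^sup>2))"
        using A1[of y] that assms c by (intro mult_left_mono) auto
      then show ?thesis using assms c by (simp add: abs_mult mult.assoc)
    qed
    show "\<bar>(1 - \<tau>) / 2 * (sqrt c * exp ((1 - \<tau>) / 2 * y))\<bar> \<le> (1 - \<tau>) / 2 * sqrt c * A2 / (1 + y\<^sup>2)" if "y \<le> 0"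
    proof -
      have "((1 - \<tau>) / 2 * sqrt c) * exp ((1 - \<tau>) / 2 * y) \<le> ((1 - \<tau>) / 2 * sqrt c) * (A2 / (1 + y\<^sup>2))"
        using A2[of y] that assms c by (intro mult_left_mono) auto
      then show ?thesis using assms c by (simp add: abs_mult mult.assoc)
    qed
    show "0 < sqrt c * exp (- (\<tau> / 2 * y))" "0 < sqrt c * exp ((1 - \<tau>) / 2 * y)" using c by auto
    have e2: "(sqrt c * exp u)\<^sup>2 = c * exp (2 * u)" for u
      using c by (simp add: power_mult_distrib exp_double)
    show "\<tau> * (1 - \<tau>) * exp (- check_loss \<tau> y) = (sqrt c * exp (- (\<tau> / 2 * y)))\<^sup>2" if "y \<ge> 0"
      unfolding e2 using that by (simp add: c_def check_loss_def mult.commute)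
    show "\<tau> * (1 - \<tau>) * exp (- check_loss \<tau> y) = (sqrt c * exp ((1 - \<tau>) / 2 * y))\<^sup>2" if "y < 0"
    proof -
      have "2 * ((1 - \<tau>) / 2 * y) = - check_loss \<tau> y" using that by (simp add: check_loss_def field_simps)
      then show ?thesis unfolding e2 by (simp only: c_def)
    qed
  qed simp
qed

text \<open>For a > 0 the argument u = a + \<open>check_loss \<tau> y\<close> stays at or above a,
  away from the singularity of the power at 0. There the logarithmic derivative a / (2 u) - 1 / 2 of
  the root lies in [- 1 / 2, 0], so the derivative is bounded by the root itself.\<close>

lemma regular_gamma_tail:
  assumes "0 < \<tau>" "\<tau> < 1" "0 < a"
  shows "regular_density (\<lambda>y. \<tau> * (1 - \<tau>) / upper_Gamma (a + 1) a
       * (a + check_loss \<tau> y) powr a * exp (- (a + check_loss \<tau> y)))"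
proof -
  define \<Gamma> where "\<Gamma> = (LBINT x:{a..}. x powr a * exp (- x))"
  have \<Gamma>: "\<Gamma> > 0" "upper_Gamma (a + 1) a = \<Gamma>"
    using gamma_tail(2)[of a a] assms by (auto simp: \<Gamma>_def upper_Gamma_def)
  define c where "c = \<tau> * (1 - \<tau>) / \<Gamma>"
  have c: "c > 0" using assms \<Gamma> by (simp add: c_def)
  \<comment> \<open>The root of \<open>u powr a * exp (- u)\<close>. Half of its exponential factor
    absorbs the power, the other half is kept for the decay in y.\<close>
  define w where "w u = u powr (a / 2) * exp (- u / 2)" for u
  obtain K where K: "K > 0" "\<And>u::real. u \<ge> 0 \<Longrightarrow> u powr (a/2) \<le> K * exp (1/4 * u)"
    using powr_le_exp[of "1/4" "a/2"] assms by auto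
  obtain A where A: "\<And>s y::real. s \<in> {\<tau>, 1 - \<tau>} \<Longrightarrow> exp (- (s / 4 * \<bar>y\<bar>)) \<le> A / (1 + y\<^sup>2)"
  proof -
    obtain A1 where A1: "\<And>y::real. exp (- (\<tau> / 4 * \<bar>y\<bar>)) \<le> A1 / (1 + y\<^sup>2)"
      using exp_decay_bound[of "\<tau> / 4"] assms by auto
    obtain A2 where A2: "\<And>y::real. exp (- ((1 - \<tau>) / 4 * \<bar>y\<bar>)) \<le> A2 / (1 + y\<^sup>2)"
      using exp_decay_bound[of "(1 - \<tau>) / 4"] assms by auto
    show ?thesis
    proof (rule that[of "max A1 A2"])
      fix s y :: real assume s: "s \<in> {\<tau>, 1 - \<tau>}"
      have "A1 / (1 + y\<^sup>2) \<le> max A1 A2 / (1 + y\<^sup>2)" "A2 / (1 + y\<^sup>2) \<le> max A1 A2 / (1 + y\<^sup>2)"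
        by (intro divide_right_mono; simp)+
      then show "exp (- (s / 4 * \<bar>y\<bar>)) \<le> max A1 A2 / (1 + y\<^sup>2)"
        using s A1[of y] A2[of y] by auto
    qed
  qed
  have wd: "(w has_real_derivative w u * (a / (2 * u) - 1 / 2)) (at u)" if "u > 0" for u
  proof -
    have "(w has_real_derivative a / 2 * u powr (a / 2 - 1) * exp (- u / 2) + u powr (a / 2) * (exp (- u / 2) * (- 1 / 2))) (at u)"
      unfolding w_def[abs_def] using that by (auto intro!: derivative_eq_intros)
    moreover have "u powr (a / 2 - 1) = u powr (a / 2) / u" using that by (simp add: powr_diff)
    ultimately show ?thesis by (simp add: w_def algebra_simps)
  qed
  have wpos: "w u > 0" if "u > 0" for u using that by (simp add: w_def)
  have wb: "\<bar>w (a + s * z) * (a / (2 * (a + s * z)) - 1 / 2)\<bar> \<le> K * A / (1 + z\<^sup>2)"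
    if "s \<in> {\<tau>, 1 - \<tau>}" "z \<ge> 0" for s z
  proof -
    define u where "u = a + s * z"
    have s: "s > 0" using that assms by auto
    have u: "u \<ge> a" "u > 0" "u \<ge> s * z" using that s assms by (auto simp: u_def add_pos_nonneg)
    have "a / (2 * u) \<le> 1 / 2" "a / (2 * u) \<ge> 0" using u assms by (auto simp: field_simps)
    then have "\<bar>a / (2 * u) - 1 / 2\<bar> \<le> 1" by linarith
    then have "\<bar>w u * (a / (2 * u) - 1 / 2)\<bar> \<le> w u * 1"
      unfolding abs_mult using wpos[OF u(2)] by (intro mult_mono) auto
    also have "w u * 1 \<le> K * exp (1/4 * u) * exp (- u / 2)"
      using K(2)[of u] u by (auto simp: w_def)
    also have "\<dots> = K * exp (- (u / 4))" by (simp flip: exp_add)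
    also have "\<dots> \<le> K * exp (- (s / 4 * \<bar>z\<bar>))" using u that K by simp
    also have "\<dots> \<le> K * (A / (1 + z\<^sup>2))" using A[OF that(1), of z] K by (intro mult_left_mono) auto
    finally show ?thesis by (simp add: u_def)
  qed
  \<comment> \<open>Shifting by a turns the integral over the positive half-line into the incomplete
    gamma integral starting at a.\<close>
  have i: "has_bochner_integral lborel (\<lambda>x. indicator {0..} x *\<^sub>R (c * ((a + x) powr a * exp (- (a + x))))) (c * \<Gamma>)"
  proof -
    have "has_bochner_integral lborel (\<lambda>x. indicator {a..} x *\<^sub>R (x powr a * exp (- x))) \<Gamma>"
      using gamma_tail(1)[of a a] assms
      by (simp add: has_bochner_integral_iff \<Gamma>_def set_lebesgue_integral_def set_integrable_def)
    then have "has_bochner_integral lborel (\<lambda>x. indicator {a..} (a + 1 * x) *\<^sub>R ((a + 1 * x) powr a * exp (- (a + 1 * x)))) (\<Gamma> /\<^sub>R \<bar>1\<bar>)"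
      by (subst (asm) lborel_has_bochner_integral_real_affine_iff[of 1 _ _ a]) auto
    from has_bochner_integral_mult_right[OF this, of c]
    have "has_bochner_integral lborel (\<lambda>x. c * (indicator {a..} (a + 1 * x) *\<^sub>R ((a + 1 * x) powr a * exp (- (a + 1 * x))))) (c * \<Gamma>)"
      by simp
    also have "(\<lambda>x. c * (indicator {a..} (a + 1 * x) *\<^sub>R ((a + 1 * x) powr a * exp (- (a + 1 * x)))))
      = (\<lambda>x. indicator {0..} x *\<^sub>R (c * ((a + x) powr a * exp (- (a + x)))))"
      by (auto simp: fun_eq_iff indicator_def)
    finally show ?thesis .
  qed
  have "has_bochner_integral lborel (\<lambda>y. if y \<ge> 0 then c * ((a + \<tau> * y) powr a * exp (- (a + \<tau> * y)))
      else c * ((a + - (1 - \<tau>) * y) powr a * exp (- (a + - (1 - \<tau>) * y)))) (c * \<Gamma> / \<tau> + c * \<Gamma> / (1 - \<tau>))"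
    by (rule two_sided_integral[OF i i]) (use assms in auto)
  also have "c * \<Gamma> / \<tau> + c * \<Gamma> / (1 - \<tau>) = 1" using assms \<Gamma> by (simp add: c_def field_simps)
  also have "(\<lambda>y. if y \<ge> 0 then c * ((a + \<tau> * y) powr a * exp (- (a + \<tau> * y)))
      else c * ((a + - (1 - \<tau>) * y) powr a * exp (- (a + - (1 - \<tau>) * y)))) =
      (\<lambda>y. c * (a + check_loss \<tau> y) powr a * exp (- (a + check_loss \<tau> y)))"
    by (auto simp: check_loss_def fun_eq_iff algebra_simps)
  finally have int: "has_bochner_integral lborel (\<lambda>y. c * (a + check_loss \<tau> y) powr a * exp (- (a + check_loss \<tau> y))) 1" .
  have "regular_density (\<lambda>y. c * (a + check_loss \<tau> y) powr a * exp (- (a + check_loss \<tau> y)))"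
  proof (rule regular_densityI[where ?g1.0 = "\<lambda>y. sqrt c * w (a + \<tau> * y)"
        and ?e1.0 = "\<lambda>y. sqrt c * (w (a + \<tau> * y) * (a / (2 * (a + \<tau> * y)) - 1 / 2) * \<tau>)"
        and ?g2.0 = "\<lambda>y. sqrt c * w (a + (1 - \<tau>) * (- y))"
        and ?e2.0 = "\<lambda>y. sqrt c * (w (a + (1 - \<tau>) * (- y)) * (a / (2 * (a + (1 - \<tau>) * (- y))) - 1 / 2) * (- (1 - \<tau>)))"
        and ?A1.0 = "sqrt c * (K * A * \<tau>)" and ?A2.0 = "sqrt c * (K * A * (1 - \<tau>))", OF _ _ _ _ _ _ _ _ _ int])
    fix y :: real
    have u1: "a + \<tau> * y > 0" if "y \<ge> 0" using that assms by (simp add: add_pos_nonneg)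
    have u2: "a + (1 - \<tau>) * (- y) > 0" if "y \<le> 0"
      using mult_nonneg_nonneg[of "1 - \<tau>" "- y"] that assms by linarith
    show "((\<lambda>y. sqrt c * w (a + \<tau> * y)) has_real_derivative sqrt c * (w (a + \<tau> * y) * (a / (2 * (a + \<tau> * y)) - 1 / 2) * \<tau>)) (at y)"
      if "y \<ge> 0"
      by (intro DERIV_cmult DERIV_chain2[where f = w and g = "\<lambda>y. a + \<tau> * y", OF wd[OF u1[OF that]]]) (auto intro!: derivative_eq_intros)
    show "((\<lambda>y. sqrt c * w (a + (1 - \<tau>) * (- y))) has_real_derivative
        sqrt c * (w (a + (1 - \<tau>) * (- y)) * (a / (2 * (a + (1 - \<tau>) * (- y))) - 1 / 2) * (- (1 - \<tau>)))) (at y)" if "y \<le> 0"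
      by (intro DERIV_cmult DERIV_chain2[where f = w and g = "\<lambda>y. a + (1 - \<tau>) * (- y)", OF wd[OF u2[OF that]]]) (auto intro!: derivative_eq_intros)
    show "\<bar>sqrt c * (w (a + \<tau> * y) * (a / (2 * (a + \<tau> * y)) - 1 / 2) * \<tau>)\<bar> \<le> sqrt c * (K * A * \<tau>) / (1 + y\<^sup>2)"
      if "y \<ge> 0"
      using mult_left_mono[OF mult_right_mono[OF wb[of \<tau> y], of \<tau>], of "sqrt c"] that assms c
      by (simp add: abs_mult)
    show "\<bar>sqrt c * (w (a + (1 - \<tau>) * (- y)) * (a / (2 * (a + (1 - \<tau>) * (- y))) - 1 / 2) * (- (1 - \<tau>)))\<bar>
        \<le> sqrt c * (K * A * (1 - \<tau>)) / (1 + y\<^sup>2)" if "y \<le> 0"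
      using mult_left_mono[OF mult_right_mono[OF wb[of "1 - \<tau>" "- y"], of "1 - \<tau>"], of "sqrt c"] that assms c
      by (simp add: abs_mult del: mult_minus_right)
    show "0 < sqrt c * w (a + \<tau> * y)" if "y \<ge> 0" using c wpos[OF u1[OF that]] by simp
    show "0 < sqrt c * w (a + (1 - \<tau>) * (- y))" if "y \<le> 0" using c wpos[OF u2[OF that]] by simp
    have e2: "(sqrt c * w u)\<^sup>2 = c * u powr a * exp (- u)" if "u > 0" for u
    proof -
      have "(u powr (a / 2))\<^sup>2 = u powr a" using that by (simp add: power2_eq_square flip: powr_add)
      moreover have "(exp (- u / 2))\<^sup>2 = exp (- u)" by (simp add: power2_eq_square flip: exp_add)
      ultimately show ?thesis using c by (simp add: w_def power_mult_distrib)
    qed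
    show "c * (a + check_loss \<tau> y) powr a * exp (- (a + check_loss \<tau> y)) = (sqrt c * w (a + \<tau> * y))\<^sup>2" if "y \<ge> 0"
      unfolding e2[OF u1[OF that]] using that by (simp add: check_loss_def mult.commute)
    show "c * (a + check_loss \<tau> y) powr a * exp (- (a + check_loss \<tau> y)) = (sqrt c * w (a + (1 - \<tau>) * (- y)))\<^sup>2" if "y < 0"
    proof -
      have "y \<le> 0" using that by simp
      have "check_loss \<tau> y = (1 - \<tau>) * (- y)" using that by (simp add: check_loss_def algebra_simps)
      then show ?thesis unfolding e2[OF u2[OF \<open>y \<le> 0\<close>]] by simp
    qed
  qed simp
  then show ?thesis unfolding c_def \<Gamma>(2) .
qed

text \<open>The equation between the two constants is continuity at 0, where the branches meet, and
  lets one constant c serve both sides. The masses of the two sides are \<tau> on the left and 1 -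
  \<tau> on the right.\<close>

lemma regular_half_normal_exponential:
  assumes "0 < \<tau>" "\<tau> < 1" "0 < \<beta>" and eq: "(1 - \<tau>) / \<beta> = 2 * \<tau> / sqrt (2 * pi)"
  shows "regular_density (\<lambda>y. if y \<le> 0 then 2 * \<tau> / sqrt (2 * pi) * exp (- (y\<^sup>2) / 2)
                        else (1 - \<tau>) / \<beta> * exp (- y / \<beta>))" (is "regular_density ?f")
proof -
  define c where "c = 2 * \<tau> / sqrt (2 * pi)"
  have c: "c > 0" using assms by (simp add: c_def)
  obtain A1 where A1: "\<And>y::real. exp (- (1 / (2 * \<beta>) * \<bar>y\<bar>)) \<le> A1 / (1 + y\<^sup>2)"
    using exp_decay_bound[of "1 / (2 * \<beta>)"] assms by auto
  obtain A2 where A2: "\<And>y::real. \<bar>y\<bar> * exp (- (1 / 4 * y\<^sup>2)) \<le> A2 / (1 + y\<^sup>2)"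
    using gaussian_decay_bound[of "1 / 4"] by auto
  have i1: "has_bochner_integral lborel (\<lambda>x. indicator {0..} x *\<^sub>R (c * exp (- x))) c"
    using has_bochner_integral_mult_right[OF exp_half_line[of 1], of c] by (simp add: mult.left_commute)
  have i2: "has_bochner_integral lborel (\<lambda>x. indicator {0..} x *\<^sub>R (c * exp (- x\<^sup>2))) (c * (sqrt pi / 2))"
    using has_bochner_integral_mult_right[OF gaussian_moment_0, of c] by (simp add: mult.left_commute)
  have "has_bochner_integral lborel (\<lambda>y. if y \<ge> 0 then c * exp (- ((1 / \<beta>) * y)) else c * exp (- (- (1 / sqrt 2) * y)\<^sup>2))
      (c / (1 / \<beta>) + c * (sqrt pi / 2) / (1 / sqrt 2))"
    by (rule two_sided_integral[OF i1 i2]) (use assms in auto)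
  also have "c / (1 / \<beta>) + c * (sqrt pi / 2) / (1 / sqrt 2) = 1"
  proof -
    have "c / (1 / \<beta>) = 1 - \<tau>" using eq assms by (simp add: c_def field_simps)
    moreover have "c * (sqrt pi / 2) / (1 / sqrt 2) = \<tau>" by (simp add: c_def real_sqrt_mult)
    ultimately show ?thesis by simp
  qed
  also have "(\<lambda>y. if y \<ge> 0 then c * exp (- ((1 / \<beta>) * y)) else c * exp (- (- (1 / sqrt 2) * y)\<^sup>2)) = ?f"
    unfolding eq c_def[symmetric] by (auto simp: fun_eq_iff power_mult_distrib power_divide)
  finally have int: "has_bochner_integral lborel ?f 1" .
  show ?thesis
  proof (rule regular_densityI[where ?g1.0 = "\<lambda>y. sqrt c * exp (- (1 / (2 * \<beta>) * y))"
        and ?e1.0 = "\<lambda>y. - (1 / (2 * \<beta>)) * (sqrt c * exp (- (1 / (2 * \<beta>) * y)))"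
        and ?g2.0 = "\<lambda>y. sqrt c * exp (- (1 / 4 * y\<^sup>2))" and ?e2.0 = "\<lambda>y. - (y / 2) * (sqrt c * exp (- (1 / 4 * y\<^sup>2)))"
        and ?A1.0 = "1 / (2 * \<beta>) * sqrt c * A1" and ?A2.0 = "1 / 2 * sqrt c * A2", OF _ _ _ _ _ _ _ _ _ int])
    fix y :: real
    show "((\<lambda>y. sqrt c * exp (- (1 / (2 * \<beta>) * y))) has_real_derivative - (1 / (2 * \<beta>)) * (sqrt c * exp (- (1 / (2 * \<beta>) * y)))) (at y)"
      using assms(3) by (auto intro!: derivative_eq_intros)
    show "((\<lambda>y. sqrt c * exp (- (1 / 4 * y\<^sup>2))) has_real_derivative - (y / 2) * (sqrt c * exp (- (1 / 4 * y\<^sup>2)))) (at y)"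
      by (auto intro!: derivative_eq_intros)
    show "\<bar>- (1 / (2 * \<beta>)) * (sqrt c * exp (- (1 / (2 * \<beta>) * y)))\<bar> \<le> 1 / (2 * \<beta>) * sqrt c * A1 / (1 + y\<^sup>2)" if "y \<ge> 0"
    proof -
      have "(1 / (2 * \<beta>) * sqrt c) * exp (- (1 / (2 * \<beta>) * y)) \<le> (1 / (2 * \<beta>) * sqrt c) * (A1 / (1 + y\<^sup>2))"
        using A1[of y] that assms c by (intro mult_left_mono) auto
      then show ?thesis using assms c by (simp add: abs_mult mult.assoc)
    qed
    show "\<bar>- (y / 2) * (sqrt c * exp (- (1 / 4 * y\<^sup>2)))\<bar> \<le> 1 / 2 * sqrt c * A2 / (1 + y\<^sup>2)"
    proof -
      have "(1 / 2 * sqrt c) * (\<bar>y\<bar> * exp (- (1 / 4 * y\<^sup>2))) \<le> (1 / 2 * sqrt c) * (A2 / (1 + y\<^sup>2))"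
        using A2[of y] c by (intro mult_left_mono) auto
      then show ?thesis using c by (simp add: abs_mult mult_ac)
    qed
    show "0 < sqrt c * exp (- (1 / (2 * \<beta>) * y))" "0 < sqrt c * exp (- (1 / 4 * y\<^sup>2))" using c by auto
    have e2: "(sqrt c * exp u)\<^sup>2 = c * exp (2 * u)" for u
      using c by (simp add: power_mult_distrib exp_double)
    show "?f y = (sqrt c * exp (- (1 / (2 * \<beta>) * y)))\<^sup>2" if "y \<ge> 0"
      unfolding e2 eq c_def[symmetric] using that by (cases "y = 0") (auto simp: mult.commute)
    show "?f y = (sqrt c * exp (- (1 / 4 * y\<^sup>2)))\<^sup>2" if "y < 0"
      unfolding e2 eq c_def[symmetric] using that by simp
  qed simp
qed

lemma regular_cauchy: "regular_density (\<lambda>y. 1 / (pi * (1 + y\<^sup>2)))" (is "regular_density ?f")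
proof -
  have pos: "1 + (x::real)\<^sup>2 > 0" for x by (simp add: add_pos_nonneg)
  have "(\<integral>\<^sup>+x. ennreal (1 / (1 + x\<^sup>2)) * indicator {0..} x \<partial>lborel) = ennreal (pi / 2 - arctan 0)"
  proof (rule nn_integral_FTC_atLeast)
    show "DERIV arctan x :> 1 / (1 + x\<^sup>2)" for x using DERIV_arctan[of x] by (simp add: inverse_eq_divide)
  qed (use pos tendsto_arctan_at_top in \<open>auto simp: less_imp_le\<close>)
  also have "(\<integral>\<^sup>+x. ennreal (1 / (1 + x\<^sup>2)) * indicator {0..} x \<partial>lborel)
      = (\<integral>\<^sup>+x. ennreal (indicator {0..} x *\<^sub>R (1 / (1 + x\<^sup>2))) \<partial>lborel)"
    by (intro nn_integral_cong) (auto simp: indicator_def)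
  finally have "has_bochner_integral lborel (\<lambda>x. indicator {0..} x *\<^sub>R (1 / (1 + x\<^sup>2))) (pi / 2)"
    using pos by (intro has_bochner_integral_nn_integral) (auto simp: less_imp_le)
  from has_bochner_integral_mult_right[OF this, of "1 / pi"]
  have i: "has_bochner_integral lborel (\<lambda>x. indicator {0..} x *\<^sub>R (1 / (pi * (1 + x\<^sup>2)))) (1 / 2)"
    by (simp add: mult.left_commute)
  have "has_bochner_integral lborel (\<lambda>y. if y \<ge> 0 then 1 / (pi * (1 + (1 * y)\<^sup>2)) else 1 / (pi * (1 + (- 1 * y)\<^sup>2))) (1 / 2 / 1 + 1 / 2 / 1)"
    by (rule two_sided_integral[OF i i]) auto
  also have "(\<lambda>y. if y \<ge> 0 then 1 / (pi * (1 + (1 * y)\<^sup>2)) else 1 / (pi * (1 + (- 1 * y)\<^sup>2))) = ?f"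
    by (auto simp: fun_eq_iff)
  finally have int: "has_bochner_integral lborel ?f 1" by simp
  let ?g = "\<lambda>y::real. 1 / sqrt (pi * (1 + y\<^sup>2))"
  let ?e = "\<lambda>y::real. - y / sqrt pi / (sqrt (1 + y\<^sup>2) * (1 + y\<^sup>2))"
  have d: "(?g has_real_derivative ?e y) (at y)" for y
  proof -
    have "((\<lambda>y. 1 / (sqrt pi * sqrt (1 + y\<^sup>2))) has_real_derivative
        - (sqrt pi * ((2 * y) * (inverse (sqrt (1 + y\<^sup>2)) / 2))) / (sqrt pi * sqrt (1 + y\<^sup>2))\<^sup>2) (at y)"
      using pos[of y] by (auto intro!: derivative_eq_intros simp: power2_eq_square)
    moreover have "- (sqrt pi * ((2 * y) * (inverse (sqrt (1 + y\<^sup>2)) / 2))) / (sqrt pi * sqrt (1 + y\<^sup>2))\<^sup>2 = ?e y"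
    proof -
      have sp: "(sqrt pi * sqrt (1 + y\<^sup>2))\<^sup>2 = sqrt pi * sqrt pi * (1 + y\<^sup>2)"
        using pos[of y] by (simp add: power_mult_distrib)
      show ?thesis unfolding sp using pos[of y] by (simp add: divide_simps)
    qed
    ultimately show ?thesis by (simp add: real_sqrt_mult)
  qed
  have b: "\<bar>?e y\<bar> \<le> (1 / sqrt pi) / (1 + y\<^sup>2)" for y
  proof -
    have "\<bar>y\<bar> \<le> sqrt (1 + y\<^sup>2)" by (rule real_le_rsqrt) simp
    then have "\<bar>y\<bar> / sqrt (1 + y\<^sup>2) \<le> 1" using pos[of y] by (simp add: field_simps)
    then have "(1 / (sqrt pi * (1 + y\<^sup>2))) * (\<bar>y\<bar> / sqrt (1 + y\<^sup>2)) \<le> (1 / (sqrt pi * (1 + y\<^sup>2))) * 1"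
      using pos[of y] by (intro mult_left_mono) auto
    then show ?thesis using pos[of y] by (simp add: abs_mult mult_ac)
  qed
  show ?thesis
  proof (rule regular_densityI[OF d d b b _ _ _ _ _ int])
    fix y :: real
    show "0 < ?g y" "0 < ?g y" using pos[of y] by auto
    show "?f y = (?g y)\<^sup>2" "?f y = (?g y)\<^sup>2" using pos[of y] by (auto simp: power_divide)
  qed simp
qed

lemma regular_asymmetric_normal:
  assumes "0 < \<phi>" "\<phi> < 1"
  shows "regular_density (\<lambda>y. 2 / sqrt pi * (sqrt (\<phi> * (1 - \<phi>)) / (sqrt \<phi> + sqrt (1 - \<phi>)))
       * exp (if y \<ge> 0 then - \<phi> * y\<^sup>2 else - (1 - \<phi>) * y\<^sup>2))" (is "regular_density ?f")
proof -
  define c where "c = 2 / sqrt pi * (sqrt (\<phi> * (1 - \<phi>)) / (sqrt \<phi> + sqrt (1 - \<phi>)))"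
  have c: "c > 0" using assms by (simp add: c_def add_pos_pos)
  obtain A1 where A1: "\<And>y::real. \<bar>y\<bar> * exp (- (\<phi> / 2 * y\<^sup>2)) \<le> A1 / (1 + y\<^sup>2)"
    using gaussian_decay_bound[of "\<phi> / 2"] assms by auto
  obtain A2 where A2: "\<And>y::real. \<bar>y\<bar> * exp (- ((1 - \<phi>) / 2 * y\<^sup>2)) \<le> A2 / (1 + y\<^sup>2)"
    using gaussian_decay_bound[of "(1 - \<phi>) / 2"] assms by auto
  have i: "has_bochner_integral lborel (\<lambda>x. indicator {0..} x *\<^sub>R (c * exp (- x\<^sup>2))) (c * (sqrt pi / 2))"
    using has_bochner_integral_mult_right[OF gaussian_moment_0, of c] by (simp add: mult.left_commute)
  have "has_bochner_integral lborel (\<lambda>y. if y \<ge> 0 then c * exp (- (sqrt \<phi> * y)\<^sup>2) else c * exp (- (- sqrt (1 - \<phi>) * y)\<^sup>2))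
      (c * (sqrt pi / 2) / sqrt \<phi> + c * (sqrt pi / 2) / sqrt (1 - \<phi>))"
    by (rule two_sided_integral[OF i i]) (use assms in auto)
  also have "c * (sqrt pi / 2) / sqrt \<phi> + c * (sqrt pi / 2) / sqrt (1 - \<phi>) = 1"
  proof -
    define p q where "p = sqrt \<phi>" and "q = sqrt (1 - \<phi>)"
    have pq: "p > 0" "q > 0" using assms by (auto simp: p_def q_def)
    have "2 / sqrt pi * X * (sqrt pi / 2) = X" for X by simp
    then have c': "c * (sqrt pi / 2) = p * q / (p + q)" by (simp only: c_def real_sqrt_mult p_def q_def)
    show ?thesis unfolding c' p_def[symmetric] q_def[symmetric] using pq
      by (simp add: divide_simps add_pos_pos)
  qed
  also have "(\<lambda>y. if y \<ge> 0 then c * exp (- (sqrt \<phi> * y)\<^sup>2) else c * exp (- (- sqrt (1 - \<phi>) * y)\<^sup>2)) = ?f"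
    unfolding c_def[symmetric] using assms by (auto simp: fun_eq_iff power_mult_distrib algebra_simps)
  finally have int: "has_bochner_integral lborel ?f 1" .
  show ?thesis
  proof (rule regular_densityI[where ?g1.0 = "\<lambda>y. sqrt c * exp (- (\<phi> / 2 * y\<^sup>2))"
        and ?e1.0 = "\<lambda>y. - (\<phi> * y) * (sqrt c * exp (- (\<phi> / 2 * y\<^sup>2)))"
        and ?g2.0 = "\<lambda>y. sqrt c * exp (- ((1 - \<phi>) / 2 * y\<^sup>2))"
        and ?e2.0 = "\<lambda>y. - ((1 - \<phi>) * y) * (sqrt c * exp (- ((1 - \<phi>) / 2 * y\<^sup>2)))"
        and ?A1.0 = "\<phi> * sqrt c * A1" and ?A2.0 = "(1 - \<phi>) * sqrt c * A2", OF _ _ _ _ _ _ _ _ _ int])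
    fix y :: real
    show "((\<lambda>y. sqrt c * exp (- (\<phi> / 2 * y\<^sup>2))) has_real_derivative - (\<phi> * y) * (sqrt c * exp (- (\<phi> / 2 * y\<^sup>2)))) (at y)"
      by (auto intro!: derivative_eq_intros)
    show "((\<lambda>y. sqrt c * exp (- ((1 - \<phi>) / 2 * y\<^sup>2))) has_real_derivative - ((1 - \<phi>) * y) * (sqrt c * exp (- ((1 - \<phi>) / 2 * y\<^sup>2)))) (at y)"
      by (auto intro!: derivative_eq_intros)
    have b: "\<bar>- (s * y) * (sqrt c * exp (- (s / 2 * y\<^sup>2)))\<bar> \<le> s * sqrt c * A / (1 + y\<^sup>2)"
      if "s > 0" "\<bar>y\<bar> * exp (- (s / 2 * y\<^sup>2)) \<le> A / (1 + y\<^sup>2)" for s A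
    proof -
      have "(s * sqrt c) * (\<bar>y\<bar> * exp (- (s / 2 * y\<^sup>2))) \<le> (s * sqrt c) * (A / (1 + y\<^sup>2))"
        using that c by (intro mult_left_mono) auto
      then show ?thesis using that c by (simp add: abs_mult mult_ac)
    qed
    show "\<bar>- (\<phi> * y) * (sqrt c * exp (- (\<phi> / 2 * y\<^sup>2)))\<bar> \<le> \<phi> * sqrt c * A1 / (1 + y\<^sup>2)"
      using b[OF _ A1] assms by simp
    show "\<bar>- ((1 - \<phi>) * y) * (sqrt c * exp (- ((1 - \<phi>) / 2 * y\<^sup>2)))\<bar> \<le> (1 - \<phi>) * sqrt c * A2 / (1 + y\<^sup>2)"
      by (rule b[OF _ A2]) (use assms in simp)
    show "0 < sqrt c * exp (- (\<phi> / 2 * y\<^sup>2))" "0 < sqrt c * exp (- ((1 - \<phi>) / 2 * y\<^sup>2))" using c by auto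
    have e2: "(sqrt c * exp u)\<^sup>2 = c * exp (2 * u)" for u
      using c by (simp add: power_mult_distrib exp_double)
    show "?f y = (sqrt c * exp (- (\<phi> / 2 * y\<^sup>2)))\<^sup>2" if "y \<ge> 0"
      unfolding e2 c_def[symmetric] using that by simp
    show "?f y = (sqrt c * exp (- ((1 - \<phi>) / 2 * y\<^sup>2)))\<^sup>2" if "y < 0"
      unfolding e2 c_def[symmetric] using that by (simp add: field_simps)
  qed simp
qed

text \<open>The gamma family at a = 0 forces the detour through almost everywhere equality: since
  \<open>0 powr 0 = 0\<close>, it is an asymmetric Laplace density with its value at y = 0 replaced
  by 0, so it is not continuous, but its law is that of a regular density.\<close>

lemma error_density_regular:
  assumes "error_density f" shows "\<exists>g. regular_density g \<and> (AE y in lborel. f y = g y) \<and> f \<in> borel_measurable borel"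
  using assms
proof cases
  case (asymmetric_laplace \<tau>)
  then show ?thesis using regular_asymmetric_laplace[of \<tau>] by (auto simp: check_loss_def)
next
  case (gamma_tail \<tau> a)
  have m: "f \<in> borel_measurable borel" unfolding gamma_tail by (auto simp: check_loss_def)
  show ?thesis
  proof (cases "a = 0")
    case True
    have "upper_Gamma (0 + 1) 0 = (\<integral>x. indicator {0..} x *\<^sub>R exp (- (1 * x)) \<partial>lborel)"
      unfolding upper_Gamma_def set_lebesgue_integral_def
    proof (rule integral_cong_AE)
      show "AE x in lborel. indicat_real {0..} x *\<^sub>R (x powr (0 + 1 - 1) * exp (- x)) = indicat_real {0..} x *\<^sub>R exp (- (1 * x))"
        by (rule AE_mp[OF AE_lborel_singleton[of 0]]) (auto intro!: AE_I2)
    qed auto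
    also have "\<dots> = 1" using exp_half_line[of 1] by (simp add: has_bochner_integral_iff)
    finally have \<Gamma>1: "upper_Gamma (0 + 1) 0 = 1" .
    have "AE y in lborel. f y = \<tau> * (1 - \<tau>) * exp (- check_loss \<tau> y)"
      unfolding gamma_tail(1) True \<Gamma>1
      by (rule AE_mp[OF AE_lborel_singleton[of 0] AE_I2]) (use gamma_tail in \<open>auto simp: check_loss_def\<close>)
    then show ?thesis using regular_asymmetric_laplace[of \<tau>] gamma_tail m by blast
  next
    case False
    then show ?thesis using regular_gamma_tail[of \<tau> a] gamma_tail m by auto
  qed
next
  case (half_normal_exponential \<tau> \<beta>)
  have "f \<in> borel_measurable borel" unfolding half_normal_exponential by measurable
  then show ?thesis using regular_half_normal_exponential[of \<tau> \<beta>] half_normal_exponential by auto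
next
  case cauchy
  have "f \<in> borel_measurable borel" unfolding cauchy by measurable
  then show ?thesis using regular_cauchy cauchy by auto
next
  case (asymmetric_normal \<phi>)
  have "f \<in> borel_measurable borel" unfolding asymmetric_normal by measurable
  then show ?thesis using regular_asymmetric_normal[of \<phi>] asymmetric_normal by auto
qed

section \<open>Metric entropy of the regression classes\<close>

text \<open>In the Leibniz sum the l-th derivative of the cutoff meets the derivative of
  \<open>p j\<close> of order \<open>m j - l\<close>, which keeps a factor \<open>hump ^ l\<close>
  because \<open>p j\<close> vanishes to order \<open>m j\<close> at both ends. The growth of the
  cutoff is thus compensated, all products stay bounded, and dominated convergence removes the
  cutoff.\<close>

lemma cutoff_tens_limit:
  fixes u :: "real ^ 'a::finite \<Rightarrow> real" and p :: "'a \<Rightarrow> real poly"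
  assumes H: "\<And>n. derivs (H n)"
      "\<And>x k. 0 < x \<Longrightarrow> x < 1 \<Longrightarrow> \<forall>\<^sub>F n in sequentially. H n k x = (if k = 0 then 1 else 0)"
      "\<And>k. \<exists>K. \<forall>n. \<forall>x\<in>{0..1}. \<bar>H n k x\<bar> * (x * (1 - x)) ^ k \<le> K"
    and u: "square_integrable u" and p: "\<And>j. hump ^ m j dvd p j"
  shows "(\<lambda>n. \<integral>z. u z * tens (\<lambda>j. leibniz (H n) (\<lambda>k. poly ((pderiv ^^ k) (p j)))) m z \<partial>cube_measure)
    \<longlonglongrightarrow> (\<integral>z. u z * tpoly (\<lambda>j. (pderiv ^^ m j) (p j)) z \<partial>cube_measure)"
proof -
  let ?F = "\<lambda>n j. leibniz (H n) (\<lambda>k. poly ((pderiv ^^ k) (p j)))"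
  obtain K where K: "\<And>k n x. x \<in> {0..1} \<Longrightarrow> \<bar>H n k x\<bar> * (x * (1 - x)) ^ k \<le> K k" using H(3) by metis
  have "\<exists>L. \<forall>n. \<forall>x\<in>{0..1}. \<bar>?F n j (m j) x\<bar> \<le> L" for j
  proof -
    obtain q where q: "p j = hump ^ m j * q" using p[of j] by (auto elim: dvdE)
    have "\<exists>t. (pderiv ^^ (m j - l)) (p j) = hump ^ l * t" if "l \<le> m j" for l
      using hump_power_dvd_pderiv[of "m j - l" "m j" q] that by (auto simp: q elim: dvdE)
    then obtain t where t: "\<And>l. l \<le> m j \<Longrightarrow> (pderiv ^^ (m j - l)) (p j) = hump ^ l * t l" by metis
    have "\<exists>M. \<forall>x\<in>{0..1}. \<bar>poly (t l) x\<bar> \<le> M" for l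
    proof -
      have "compact (poly (t l) ` {0..1})" by (intro compact_continuous_image continuous_intros) auto
      then show ?thesis using compact_imp_bounded bounded_iff by (metis image_eqI real_norm_def)
    qed
    then obtain M where M: "\<And>l x. x \<in> {0..1} \<Longrightarrow> \<bar>poly (t l) x\<bar> \<le> M l" by metis
    have "\<bar>?F n j (m j) x\<bar> \<le> (\<Sum>l\<le>m j. real (m j choose l) * (K l * M l))" if x: "x \<in> {0..1}" for n x
    proof -
      have "\<bar>?F n j (m j) x\<bar> \<le> (\<Sum>l\<le>m j. \<bar>real (m j choose l) * (H n l x * poly ((pderiv ^^ (m j - l)) (p j)) x)\<bar>)"
        unfolding leibniz_def by (rule sum_abs)
      also have "\<dots> = (\<Sum>l\<le>m j. real (m j choose l) * ((\<bar>H n l x\<bar> * (x * (1 - x)) ^ l) * \<bar>poly (t l) x\<bar>))"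
      proof (intro sum.cong refl)
        fix l assume "l \<in> {..m j}"
        then have "\<bar>poly ((pderiv ^^ (m j - l)) (p j)) x\<bar> = (x * (1 - x)) ^ l * \<bar>poly (t l) x\<bar>"
          using x by (simp add: t poly_power poly_hump abs_mult power_abs del: poly_pCons)
        then show "\<bar>real (m j choose l) * (H n l x * poly ((pderiv ^^ (m j - l)) (p j)) x)\<bar>
          = real (m j choose l) * ((\<bar>H n l x\<bar> * (x * (1 - x)) ^ l) * \<bar>poly (t l) x\<bar>)"
          by (simp add: abs_mult mult_ac)
      qed
      also have "\<dots> \<le> (\<Sum>l\<le>m j. real (m j choose l) * (K l * M l))"
      proof (intro sum_mono mult_left_mono mult_mono)
        fix l
        show "0 \<le> K l" using K[of 0 0 l] by (auto intro: order_trans[rotated])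
      qed (use x K M in auto)
      finally show ?thesis .
    qed
    then show ?thesis by blast
  qed
  then obtain L where L: "\<And>j n x. x \<in> {0..1} \<Longrightarrow> \<bar>?F n j (m j) x\<bar> \<le> L j" by metis
  have mu: "u \<in> borel_measurable cube_measure" using u by (simp add: square_integrable_def)
  have iu: "integrable cube_measure u"
    using square_integrable_mult[OF u square_integrable_continuous[of "\<lambda>z. 1"]] by simp
  have mt: "tens (?F n) m \<in> borel_measurable cube_measure" for n
    by (intro measurable_cube_measure_borel borel_measurable_continuous_onI smooth_continuous smooth_tens
        derivs_leibniz H derivs_poly)
  show ?thesis
  proof (rule integral_dominated_convergence[where w = "\<lambda>z. (\<Prod>j\<in>UNIV. L j) * \<bar>u z\<bar>"])
    show "(\<lambda>z. u z * tpoly (\<lambda>j. (pderiv ^^ m j) (p j)) z) \<in> borel_measurable cube_measure"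
      using mu measurable_cube_measure_borel[OF borel_measurable_tpoly] by measurable
    show "(\<lambda>z. u z * tens (?F n) m z) \<in> borel_measurable cube_measure" for n
      using mu mt[of n] by measurable
    show "integrable cube_measure (\<lambda>z. (\<Prod>j\<in>UNIV. L j) * \<bar>u z\<bar>)" using iu by simp
    show "AE z in cube_measure. (\<lambda>n. u z * tens (?F n) m z) \<longlonglongrightarrow> u z * tpoly (\<lambda>j. (pderiv ^^ m j) (p j)) z"
      using AE_cube_interior
    proof eventually_elim
      case (elim z)
      have "(\<lambda>n. ?F n j (m j) (z $ j)) \<longlonglongrightarrow> poly ((pderiv ^^ m j) (p j)) (z $ j)" for j
      proof -
        have "\<forall>\<^sub>F n in sequentially. \<forall>l\<in>{..m j}. H n l (z $ j) = (if l = 0 then 1 else 0)"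
          using elim H(2) by (intro eventually_ball_finite) auto
        then have "\<forall>\<^sub>F n in sequentially. ?F n j (m j) (z $ j) = poly ((pderiv ^^ m j) (p j)) (z $ j)"
        proof eventually_elim
          case (elim n)
          have "?F n j (m j) (z $ j) = (\<Sum>l\<le>m j. if l = 0 then poly ((pderiv ^^ m j) (p j)) (z $ j) else 0)"
            unfolding leibniz_def using elim by (intro sum.cong) auto
          then show ?case by simp
        qed
        then show ?thesis by (rule tendsto_eventually)
      qed
      then show ?case unfolding tens_def tpoly_def by (intro tendsto_intros)
    qed
    show "AE z in cube_measure. norm (u z * tens (?F n) m z) \<le> (\<Prod>j\<in>UNIV. L j) * \<bar>u z\<bar>" for n
    proof (rule AE_I2)
      fix z :: "real ^ 'a" assume "z \<in> space cube_measure"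
      then have "z $ j \<in> {0..1}" for j by (auto simp: mem_box_cart)
      then have "\<bar>tens (?F n) m z\<bar> \<le> (\<Prod>j\<in>UNIV. L j)"
        unfolding tens_def abs_prod using L by (intro prod_mono) auto
      then show "norm (u z * tens (?F n) m z) \<le> (\<Prod>j\<in>UNIV. L j) * \<bar>u z\<bar>"
        by (simp add: abs_mult mult.commute[of "\<bar>u z\<bar>"] mult_right_mono)
    qed
  qed
qed

lemma cutoff_test_function:
  assumes "derivs (H n)" "\<And>k x. x \<le> 1 / real (Suc n) \<or> x \<ge> 1 - 1 / real (Suc n) \<Longrightarrow> H n k x = 0"
  shows "test_function (tens (\<lambda>j. leibniz (H n) (\<lambda>k. poly ((pderiv ^^ k) (p j)))) (\<lambda>_. 0))"
  by (rule test_function_tens[where a = "1 / real (Suc n)" and b = "1 - 1 / real (Suc n)"])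
    (use assms in \<open>auto intro!: derivs_leibniz derivs_poly simp del: of_nat_Suc\<close>)

text \<open>Extends the defining identity of a weak derivative from compactly supported test
  functions to polynomials vanishing to order \<open>k j\<close> on the faces of coordinate j. No
  boundary value of \<open>g\<close> appears, so none has to be defined.\<close>

lemma weak_deriv_tpoly:
  assumes w: "has_weak_deriv k g v" and g: "square_integrable g" and p: "\<And>j. hump ^ k j dvd p j"
  shows "(\<integral>z. g z * tpoly (\<lambda>j. (pderiv ^^ k j) (p j)) z \<partial>cube_measure)
    = (- 1) ^ (\<Sum>j\<in>UNIV. k j) * (\<integral>z. v z * tpoly p z \<partial>cube_measure)"
proof -
  obtain H :: "nat \<Rightarrow> nat \<Rightarrow> real \<Rightarrow> real" where H: "\<And>n. derivs (H n)"
    "\<And>n k x. x \<le> 1 / real (Suc n) \<or> x \<ge> 1 - 1 / real (Suc n) \<Longrightarrow> H n k x = 0"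
    "\<And>x k. 0 < x \<Longrightarrow> x < 1 \<Longrightarrow> \<forall>\<^sub>F n in sequentially. H n k x = (if k = 0 then 1 else 0)"
    "\<And>k. \<exists>K. \<forall>n. \<forall>x\<in>{0..1}. \<bar>H n k x\<bar> * (x * (1 - x)) ^ k \<le> K"
    using cutoff_exists by blast
  let ?F = "\<lambda>n j. leibniz (H n) (\<lambda>k. poly ((pderiv ^^ k) (p j)))"
  have v: "square_integrable v" using w by (simp add: has_weak_deriv_def)
  have eq: "(\<integral>z. g z * tens (?F n) k z \<partial>cube_measure)
    = (- 1) ^ (\<Sum>j\<in>UNIV. k j) * (\<integral>z. v z * tens (?F n) (\<lambda>_. 0) z \<partial>cube_measure)" for n
  proof -
    have t: "test_function (tens (?F n) (\<lambda>_. 0))" by (rule cutoff_test_function[OF H(1,2)])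
    have "multi_partial k (tens (?F n) (\<lambda>_. 0)) = tens (?F n) k"
      by (subst multi_partial_tens) (auto intro!: derivs_leibniz derivs_poly H)
    then show ?thesis using w t by (auto simp: has_weak_deriv_def)
  qed
  have "(\<lambda>n. (- 1) ^ (\<Sum>j\<in>UNIV. k j) * (\<integral>z. v z * tens (?F n) (\<lambda>_. 0) z \<partial>cube_measure))
    \<longlonglongrightarrow> (- 1) ^ (\<Sum>j\<in>UNIV. k j) * (\<integral>z. v z * tpoly p z \<partial>cube_measure)"
    using cutoff_tens_limit[OF H(1,3,4) v, of "\<lambda>_. 0" p] by (intro tendsto_intros) simp
  moreover have "(\<lambda>n. \<integral>z. g z * tens (?F n) k z \<partial>cube_measure)
    \<longlonglongrightarrow> (\<integral>z. g z * tpoly (\<lambda>j. (pderiv ^^ k j) (p j)) z \<partial>cube_measure)"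
    by (rule cutoff_tens_limit[OF H(1,3,4) g p])
  ultimately show ?thesis unfolding eq using LIMSEQ_unique by blast
qed

text \<open>The difference of two weak derivatives is orthogonal to all test functions. Read as a
  weak derivative of order zero, it may be tested against all Legendre products, so its coefficients
  vanish. This permits replacing the arbitrary choice in \<open>weak_deriv\<close> by an explicit
  derivative when norms are computed.\<close>

lemma weak_deriv_unique:
  assumes "has_weak_deriv k g v" "has_weak_deriv k g v'" "square_integrable g"
  shows "(\<integral>z. (v z)\<^sup>2 \<partial>cube_measure) = (\<integral>z. (v' z)\<^sup>2 \<partial>cube_measure)"
proof -
  let ?u = "\<lambda>z. v z - v' z"
  have v: "square_integrable v" "square_integrable v'" using assms by (auto simp: has_weak_deriv_def)
  have u: "square_integrable ?u" using v by (rule square_integrable_diff)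
  have "has_weak_deriv (\<lambda>_. 0) ?u (\<lambda>z. 0)"
    unfolding has_weak_deriv_def
  proof (intro conjI allI impI)
    fix \<phi> :: "(real, 'a) vec \<Rightarrow> real" assume \<phi>: "test_function \<phi>"
    have s: "square_integrable \<phi>" using test_function_square_integrable(2)[OF \<phi>] .
    have "(\<integral>z. v z * \<phi> z \<partial>cube_measure) = (\<integral>z. v' z * \<phi> z \<partial>cube_measure)"
      using assms(1,2) \<phi> by (simp add: has_weak_deriv_def) 
    then have "(\<integral>z. ?u z * \<phi> z \<partial>cube_measure) = 0"
      using square_integrable_mult[OF v(1) s] square_integrable_mult[OF v(2) s] by (simp add: left_diff_distrib)
    moreover have "multi_partial (\<lambda>_. 0) \<phi> = \<phi>"
    proof -
      have "concat (map (\<lambda>i. replicate 0 i) xs) = []" for xs :: "'a list" by (induction xs) auto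
      then show ?thesis by (simp only: multi_partial_foldr foldr.simps id_apply)
    qed
    ultimately show "(\<integral>z. ?u z * multi_partial (\<lambda>_. 0) \<phi> z \<partial>cube_measure)
      = (- 1) ^ (\<Sum>i\<in>(UNIV :: 'a set). 0) * (\<integral>z. 0 * \<phi> z \<partial>cube_measure)" by simp
  qed (simp add: square_integrable_def)
  from weak_deriv_tpoly[OF this u] have "leg_coeff ?u N = 0" for N
    unfolding leg_coeff_def by simp
  from leg_coeff_eq_0_imp[OF u this] have "AE z in cube_measure. (?u z)\<^sup>2 = 0"
    using u by (subst (asm) integral_nonneg_eq_0_iff_AE) (auto simp: square_integrable_def)
  then have "AE z in cube_measure. (v z)\<^sup>2 = (v' z)\<^sup>2" by eventually_elim simp
  then show ?thesis
    using v by (intro integral_cong_AE) (auto simp: square_integrable_def)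
qed

section \<open>The coefficient ellipsoid of a Sobolev ball\<close>

definition max_index :: "('a::finite \<Rightarrow> nat) \<Rightarrow> nat" where "max_index N = Max (range N)"

lemma max_index_ge: "N j \<le> max_index N"
  by (simp add: max_index_def)

lemma max_index_attained: obtains j where "N j = max_index N"
  using Max_in[of "range N"] unfolding max_index_def by (metis finite finite_imageI image_is_empty rangeE UNIV_not_empty)

lemma below_max_index: "N \<in> below m \<longleftrightarrow> max_index N < m"
  by (auto simp: below_iff max_index_def)

text \<open>A Bessel inequality for \<open>v\<close> with the weight
  \<open>(z $ i * (1 - z $ i)) ^ \<alpha>\<close>: the functions \<open>tpoly (q N)\<close> are
  orthogonal for it with squared norms \<open>leg_weight\<close>, and integration by parts
  identifies the weighted inner products of \<open>v\<close> with them as the coefficients of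
  \<open>g\<close> up to sign. As the weight is at most 1 on the cube, the plain norm of
  \<open>v\<close> dominates.\<close>

lemma leg_coeff_weak_deriv:
  fixes g :: "(real, 'a::{finite,linorder}) vec \<Rightarrow> real"
  assumes w: "has_weak_deriv (\<lambda>j. if j = i then \<alpha> else 0) g v" and g: "square_integrable g"
    and S: "finite S" "\<And>N. N \<in> S \<Longrightarrow> \<alpha> \<le> N i"
  shows "(\<Sum>N\<in>S. (leg_coeff g N)\<^sup>2 / leg_weight \<alpha> (N i)) \<le> (\<integral>z. (v z)\<^sup>2 \<partial>cube_measure)"
proof -
  have v: "square_integrable v" using w by (simp add: has_weak_deriv_def)
  \<comment> \<open>Only the coordinate of differentiation carries the \<alpha>-fold primitive;
    dividing out its boundary zeros gives \<open>q\<close>, so that \<open>tpoly (P N)\<close> is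
    the weight times \<open>tpoly (q N)\<close>.\<close>
  define P where "P N j = (if j = i then coleg \<alpha> (N j) else leg (N j))" for N :: "'a \<Rightarrow> nat" and j
  define q where "q N j = (if j = i then coleg_quot \<alpha> (N j) else leg (N j))" for N :: "'a \<Rightarrow> nat" and j
  define w where "w z = (z $ i * (1 - z $ i)) ^ \<alpha>" for z :: "(real, 'a) vec"
  have Pq: "tpoly (P N) z = w z * tpoly (q N) z" if "N \<in> S" for N z
  proof -
    have "tpoly (P N) z = poly (coleg \<alpha> (N i)) (z $ i) * (\<Prod>j\<in>UNIV - {i}. poly (leg (N j)) (z $ j))"
      unfolding tpoly_def by (subst prod.remove[of _ i]) (auto simp: P_def intro!: prod.cong)
    moreover have "tpoly (q N) z = poly (coleg_quot \<alpha> (N i)) (z $ i) * (\<Prod>j\<in>UNIV - {i}. poly (leg (N j)) (z $ j))"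
      unfolding tpoly_def by (subst prod.remove[of _ i]) (auto simp: q_def intro!: prod.cong)
    ultimately show ?thesis
      by (simp add: coleg_factor[OF S(2)[OF that]] poly_power poly_hump w_def mult.assoc del: poly_pCons)
  qed
  have coeff: "leg_coeff g N = (- 1) ^ \<alpha> * (\<integral>z. v z * tpoly (P N) z \<partial>cube_measure)" if "N \<in> S" for N
  proof -
    have "(\<lambda>j. (pderiv ^^ (if j = i then \<alpha> else 0)) (P N j)) = (\<lambda>j. leg (N j))"
      using S(2)[OF that] by (auto simp: P_def pderiv_coleg fun_eq_iff)
    moreover have "hump ^ (if j = i then \<alpha> else 0) dvd P N j" for j
      using coleg_factor[OF S(2)[OF that]] by (auto simp: P_def)
    ultimately show ?thesis
      using weak_deriv_tpoly[OF assms(1) g, of "P N"] by (simp add: leg_coeff_def sum.delta cong: if_cong)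
  qed
  have orth: "(\<integral>z. tpoly (P N) z * tpoly (q M) z \<partial>cube_measure) = (if N = M then leg_weight \<alpha> (N i) else 0)"
    if "N \<in> S" "M \<in> S" for N M
  proof -
    have "(\<integral>z. tpoly (P N) z * tpoly (q M) z \<partial>cube_measure) = (\<Prod>j\<in>UNIV. pint (P N j * q M j))"
      unfolding tpoly_mult integral_tpoly ..
    also have "\<dots> = pint (coleg \<alpha> (N i) * coleg_quot \<alpha> (M i)) * (\<Prod>j\<in>UNIV - {i}. pint (leg (N j) * leg (M j)))"
      by (subst prod.remove[of _ i]) (auto simp: P_def q_def intro!: prod.cong)
    also have "\<dots> = (if N = M then leg_weight \<alpha> (N i) else 0)"
      using that S(2) by (auto simp: pint_coleg pint_leg fun_eq_iff)
    finally show ?thesis .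
  qed
  \<comment> \<open>The Fourier coefficients of \<open>v\<close> in the weighted space, so that
    \<open>p\<close> is the orthogonal projection of \<open>v\<close> onto the chosen functions and
    the mixed and the square term below coincide.\<close>
  define a where "a N = (- 1) ^ \<alpha> * leg_coeff g N / leg_weight \<alpha> (N i)" for N
  define p where "p z = (\<Sum>N\<in>S. a N * tpoly (q N) z)" for z
  have sp: "square_integrable p"
    unfolding p_def by (intro square_integrable_sum square_integrable_cmult square_integrable_tpoly S)
  have w01: "0 \<le> w z \<and> w z \<le> 1" if "z \<in> unit_cube" for z
    using that unfolding w_def by (auto simp: mem_box_cart intro!: zero_le_power power_le_one mult_nonneg_nonneg mult_le_one)
  have mw: "w \<in> borel_measurable cube_measure"
    unfolding w_def by (intro measurable_cube_measure_borel borel_measurable_continuous_onI continuous_intros)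
  have sw: "square_integrable (\<lambda>z. w z * f z)" if "square_integrable f" for f
  proof -
    have "integrable cube_measure (\<lambda>z. (w z * f z)\<^sup>2)"
    proof (rule Bochner_Integration.integrable_bound)
      show "integrable cube_measure (\<lambda>z. (f z)\<^sup>2)" using that by (simp add: square_integrable_def)
      show "AE z in cube_measure. norm ((w z * f z)\<^sup>2) \<le> norm ((f z)\<^sup>2)"
        using w01 by (intro AE_I2) (auto simp: power_mult_distrib intro!: mult_left_le_one_le power_le_one)
    qed (use that mw in \<open>auto simp: square_integrable_def\<close>)
    then show ?thesis using that mw by (auto simp: square_integrable_def)
  qed
  have i: "integrable cube_measure (\<lambda>z. w z * f z * h z)" if "square_integrable f" "square_integrable h" for f h
    using square_integrable_mult[OF sw[OF that(1)] that(2)] .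
  have vp: "(\<integral>z. w z * v z * p z \<partial>cube_measure) = (\<Sum>N\<in>S. (leg_coeff g N)\<^sup>2 / leg_weight \<alpha> (N i))"
  proof -
    have "(\<integral>z. w z * v z * p z \<partial>cube_measure) = (\<integral>z. (\<Sum>N\<in>S. a N * (v z * tpoly (P N) z)) \<partial>cube_measure)"
      unfolding p_def sum_distrib_left
      by (intro Bochner_Integration.integral_cong sum.cong) (auto simp: Pq mult_ac)
    also have "\<dots> = (\<Sum>N\<in>S. a N * (\<integral>z. v z * tpoly (P N) z \<partial>cube_measure))"
      by (subst Bochner_Integration.integral_sum)
        (auto intro!: integrable_mult_right square_integrable_mult v square_integrable_tpoly)
    also have "\<dots> = (\<Sum>N\<in>S. (leg_coeff g N)\<^sup>2 / leg_weight \<alpha> (N i))"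
    proof (intro sum.cong refl)
      fix N assume "N \<in> S"
      have "(\<integral>z. v z * tpoly (P N) z \<partial>cube_measure) = (- 1) ^ \<alpha> * leg_coeff g N"
        unfolding coeff[OF \<open>N \<in> S\<close>] by (simp add: mult.assoc[symmetric] flip: power_mult_distrib)
      then show "a N * (\<integral>z. v z * tpoly (P N) z \<partial>cube_measure) = (leg_coeff g N)\<^sup>2 / leg_weight \<alpha> (N i)"
        by (simp add: a_def power2_eq_square mult_ac)
    qed
    finally show ?thesis .
  qed
  have pp: "(\<integral>z. w z * p z * p z \<partial>cube_measure) = (\<Sum>N\<in>S. (leg_coeff g N)\<^sup>2 / leg_weight \<alpha> (N i))"
  proof -
    have "(\<integral>z. w z * p z * p z \<partial>cube_measure) = (\<integral>z. (\<Sum>N\<in>S. \<Sum>M\<in>S. a N * a M * (tpoly (P N) z * tpoly (q M) z)) \<partial>cube_measure)"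
    proof (intro Bochner_Integration.integral_cong refl)
      fix z
      have "w z * p z = (\<Sum>N\<in>S. a N * tpoly (P N) z)"
        unfolding p_def sum_distrib_left by (intro sum.cong) (auto simp: Pq mult_ac)
      then show "w z * p z * p z = (\<Sum>N\<in>S. \<Sum>M\<in>S. a N * a M * (tpoly (P N) z * tpoly (q M) z))"
        by (simp add: p_def sum_product mult_ac)
    qed
    also have "\<dots> = (\<Sum>N\<in>S. \<Sum>M\<in>S. a N * a M * (\<integral>z. tpoly (P N) z * tpoly (q M) z \<partial>cube_measure))"
    proof -
      have "integrable cube_measure (\<lambda>z. tpoly (P N) z * tpoly (q M) z)" for N M
        by (intro square_integrable_mult square_integrable_tpoly)
      then show ?thesis by (simp add: Bochner_Integration.integral_sum Bochner_Integration.integrable_sum)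
    qed
    also have "\<dots> = (\<Sum>N\<in>S. \<Sum>M\<in>S. if N = M then a N * a M * leg_weight \<alpha> (N i) else 0)"
      by (intro sum.cong refl) (auto simp: orth)
    also have "\<dots> = (\<Sum>N\<in>S. a N * a N * leg_weight \<alpha> (N i))"
      using S(1) by (simp add: sum.delta')
    also have "\<dots> = (\<Sum>N\<in>S. (leg_coeff g N)\<^sup>2 / leg_weight \<alpha> (N i))"
    proof (intro sum.cong refl)
      fix N
      have "a N * a N * leg_weight \<alpha> (N i) = ((- 1) ^ \<alpha> * (- 1) ^ \<alpha>) * (leg_coeff g N)\<^sup>2 / leg_weight \<alpha> (N i)"
        using leg_weight_pos[of \<alpha> "N i"] by (simp add: a_def power2_eq_square field_simps)
      then show "a N * a N * leg_weight \<alpha> (N i) = (leg_coeff g N)\<^sup>2 / leg_weight \<alpha> (N i)"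
        by (simp flip: power_mult_distrib)
    qed
    finally show ?thesis .
  qed
  have "0 \<le> (\<integral>z. w z * (v z - p z)\<^sup>2 \<partial>cube_measure)"
    using w01 by (intro integral_nonneg_AE AE_I2) auto
  also have "\<dots> = (\<integral>z. w z * v z * v z - 2 * (w z * v z * p z) + w z * p z * p z \<partial>cube_measure)"
    by (intro Bochner_Integration.integral_cong) (auto simp: power2_eq_square algebra_simps)
  also have "\<dots> = (\<integral>z. w z * v z * v z \<partial>cube_measure) - 2 * (\<integral>z. w z * v z * p z \<partial>cube_measure)
      + (\<integral>z. w z * p z * p z \<partial>cube_measure)"
    using i[OF v v] i[OF v sp] i[OF sp sp] by simp
  finally have "(\<Sum>N\<in>S. (leg_coeff g N)\<^sup>2 / leg_weight \<alpha> (N i)) \<le> (\<integral>z. w z * v z * v z \<partial>cube_measure)"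
    unfolding vp pp by simp
  also have "\<dots> \<le> (\<integral>z. (v z)\<^sup>2 \<partial>cube_measure)"
  proof (rule integral_mono[OF i[OF v v]])
    show "integrable cube_measure (\<lambda>z. (v z)\<^sup>2)" using v by (simp add: square_integrable_def)
    fix z :: "(real, 'a) vec" assume "z \<in> space cube_measure"
    then show "w z * v z * v z \<le> (v z)\<^sup>2"
      using w01[of z] by (auto simp: power2_eq_square mult.assoc intro!: mult_left_le_one_le)
  qed
  finally show ?thesis .
qed

text \<open>Each multi-index is charged to a coordinate attaining its maximum, through the pure
  derivative of order \<alpha> in that coordinate. If the maximum is below \<alpha>, no primitive of
  this order is available; then the factor is at most the constant A, and the multi-index is charged
  to the L2 norm. This explains the count CARD('a) + 1.\<close>

lemma sobolev_ball_ellipsoid: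
  fixes g :: "(real, 'a::{finite,linorder}) vec \<Rightarrow> real"
  assumes g: "g \<in> sobolev_ball \<alpha> C" and S: "finite S"
  shows "(\<Sum>N\<in>S. (leg_coeff g N)\<^sup>2 * real (Suc (max_index N)) ^ (2 * \<alpha>))
    \<le> real (Suc \<alpha>) ^ (2 * \<alpha>) * (real CARD('a) + 1) * C\<^sup>2"
proof -
  let ?c = "\<lambda>N. (leg_coeff g N)\<^sup>2" and ?k = "\<lambda>i j. if j = (i :: 'a) then \<alpha> else 0"
  have sg: "square_integrable g" and ex: "\<And>k. k \<in> multi_indices \<alpha> \<Longrightarrow> \<exists>v. has_weak_deriv k g v"
    and norm: "sobolev_norm \<alpha> g \<le> C"
    using g by (auto simp: sobolev_ball_def sobolev_space_def)
  have wd: "has_weak_deriv k g (weak_deriv k g)" if "k \<in> multi_indices \<alpha>" for k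
    unfolding weak_deriv_def using ex[OF that] by (rule someI_ex)
  have ki: "?k i \<in> multi_indices \<alpha>" for i by (simp add: multi_indices_def sum.delta)
  have s0: "0 \<le> (\<Sum>k\<in>multi_indices \<alpha>. \<integral>z. \<bar>weak_deriv k g z\<bar>\<^sup>2 \<partial>cube_measure)" by (intro sum_nonneg) simp
  have n1: "(\<integral>z. (g z)\<^sup>2 \<partial>cube_measure) \<le> C\<^sup>2"
    and n2: "(\<Sum>k\<in>multi_indices \<alpha>. \<integral>z. \<bar>weak_deriv k g z\<bar>\<^sup>2 \<partial>cube_measure) \<le> C\<^sup>2"
  proof -
    have "sqrt (\<integral>z. (g z)\<^sup>2 \<partial>cube_measure) \<ge> 0"
      "sqrt (\<Sum>k\<in>multi_indices \<alpha>. \<integral>z. \<bar>weak_deriv k g z\<bar>\<^sup>2 \<partial>cube_measure) \<ge> 0"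
      using s0 by auto
    then have 1: "sqrt (\<integral>z. (g z)\<^sup>2 \<partial>cube_measure) \<le> C"
      and 2: "sqrt (\<Sum>k\<in>multi_indices \<alpha>. \<integral>z. \<bar>weak_deriv k g z\<bar>\<^sup>2 \<partial>cube_measure) \<le> C"
      using norm unfolding sobolev_norm_def by linarith+
    show "(\<integral>z. (g z)\<^sup>2 \<partial>cube_measure) \<le> C\<^sup>2" by (rule sqrt_le_D[OF 1])
    show "(\<Sum>k\<in>multi_indices \<alpha>. \<integral>z. \<bar>weak_deriv k g z\<bar>\<^sup>2 \<partial>cube_measure) \<le> C\<^sup>2" by (rule sqrt_le_D[OF 2])
  qed
  have n3: "(\<integral>z. (weak_deriv (?k i) g z)\<^sup>2 \<partial>cube_measure) \<le> C\<^sup>2" for i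
  proof -
    have "(\<integral>z. \<bar>weak_deriv (?k i) g z\<bar>\<^sup>2 \<partial>cube_measure) \<le> (\<Sum>k\<in>multi_indices \<alpha>. \<integral>z. \<bar>weak_deriv k g z\<bar>\<^sup>2 \<partial>cube_measure)"
      by (rule member_le_sum[OF ki]) (auto simp: finite_multi_indices)
    then show ?thesis using n2 by simp
  qed
  define A where "A = real (Suc \<alpha>) ^ (2 * \<alpha>)"
  have A: "A \<ge> 0" by (simp add: A_def)
  let ?S = "\<lambda>i. {N \<in> S. \<alpha> \<le> N i}"
  have "(\<Sum>N\<in>S. ?c N * real (Suc (max_index N)) ^ (2 * \<alpha>))
    \<le> (\<Sum>N\<in>S. A * ?c N + A * (\<Sum>i\<in>UNIV. if \<alpha> \<le> N i then ?c N / leg_weight \<alpha> (N i) else 0))"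
  proof (rule sum_mono)
    fix N
    have nn: "0 \<le> (if \<alpha> \<le> N i then ?c N / leg_weight \<alpha> (N i) else 0)" for i
      using leg_weight_pos[of \<alpha> "N i"] by (simp add: less_imp_le)
    show "?c N * real (Suc (max_index N)) ^ (2 * \<alpha>)
      \<le> A * ?c N + A * (\<Sum>i\<in>UNIV. if \<alpha> \<le> N i then ?c N / leg_weight \<alpha> (N i) else 0)"
    proof (cases "max_index N < \<alpha>")
      case True
      then have "real (Suc (max_index N)) ^ (2 * \<alpha>) \<le> A" unfolding A_def by (intro power_mono) auto
      then have "?c N * real (Suc (max_index N)) ^ (2 * \<alpha>) \<le> ?c N * A"
        by (rule mult_left_mono) simp
      also have "\<dots> = A * ?c N" by (rule mult.commute)
      finally have "?c N * real (Suc (max_index N)) ^ (2 * \<alpha>) \<le> A * ?c N" .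
      moreover have "0 \<le> A * (\<Sum>i\<in>UNIV. if \<alpha> \<le> N i then ?c N / leg_weight \<alpha> (N i) else 0)"
        using nn A by (intro mult_nonneg_nonneg sum_nonneg) auto
      ultimately show ?thesis by linarith
    next
      case False
      obtain i where i: "N i = max_index N" using max_index_attained by blast
      have "(real (N i + 1) / real (\<alpha> + 1)) ^ (2 * \<alpha>) \<le> 1 / leg_weight \<alpha> (N i)"
        using False i by (intro leg_weight_bound) simp
      then have "real (Suc (max_index N)) ^ (2 * \<alpha>) / A \<le> 1 / leg_weight \<alpha> (N i)"
        by (simp only: power_divide A_def i Suc_eq_plus1)
      moreover have "A > 0" by (simp add: A_def)
      ultimately have "real (Suc (max_index N)) ^ (2 * \<alpha>) \<le> A * (1 / leg_weight \<alpha> (N i))"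
        by (simp only: pos_divide_le_eq mult.commute)
      then have "?c N * real (Suc (max_index N)) ^ (2 * \<alpha>) \<le> ?c N * (A * (1 / leg_weight \<alpha> (N i)))"
        by (intro mult_left_mono) auto
      also have "\<dots> = A * (if \<alpha> \<le> N i then ?c N / leg_weight \<alpha> (N i) else 0)" using False i by simp
      also have "\<dots> \<le> A * (\<Sum>i\<in>UNIV. if \<alpha> \<le> N i then ?c N / leg_weight \<alpha> (N i) else 0)"
        using A nn by (intro mult_left_mono member_le_sum) auto
      finally have "?c N * real (Suc (max_index N)) ^ (2 * \<alpha>)
        \<le> A * (\<Sum>i\<in>UNIV. if \<alpha> \<le> N i then ?c N / leg_weight \<alpha> (N i) else 0)" .
      moreover have "0 \<le> A * ?c N" using A by simp
      ultimately show ?thesis by linarith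
    qed
  qed
  also have "\<dots> = A * (\<Sum>N\<in>S. ?c N) + A * (\<Sum>i\<in>UNIV. \<Sum>N\<in>S. if \<alpha> \<le> N i then ?c N / leg_weight \<alpha> (N i) else 0)"
    unfolding sum.distrib sum_distrib_left[symmetric] by (subst (2) sum.swap) (rule refl)
  also have "\<dots> = A * (\<Sum>N\<in>S. ?c N) + A * (\<Sum>i\<in>UNIV. \<Sum>N\<in>?S i. ?c N / leg_weight \<alpha> (N i))"
    unfolding sum.inter_filter[OF S] ..
  also have "\<dots> \<le> A * C\<^sup>2 + A * (\<Sum>i\<in>(UNIV :: 'a set). C\<^sup>2)"
  proof (intro add_mono mult_left_mono sum_mono A)
    show "(\<Sum>N\<in>S. ?c N) \<le> C\<^sup>2" using leg_coeff_bessel[OF sg S] n1 by linarith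
    show "(\<Sum>N\<in>?S i. ?c N / leg_weight \<alpha> (N i)) \<le> C\<^sup>2" for i
    proof (rule order_trans[OF leg_coeff_weak_deriv[OF wd[OF ki[of i]] sg] n3[of i]])
      show "finite (?S i)" using S by simp
    qed simp
  qed
  also have "\<dots> = A * (real CARD('a) + 1) * C\<^sup>2" by (simp add: algebra_simps)
  finally show ?thesis by (simp add: A_def)
qed

section \<open>Counting rounded coefficient vectors\<close>

lemma exp_sum_bound:
  assumes "A > 0" shows "(\<Sum>k\<in>{- int n..int n}. exp (- (\<bar>real_of_int k\<bar> / A))) \<le> 1 + 2 * A"
proof -
  \<comment> \<open>A two-sided geometric series. From 1 + 1 / A \<le> exp (1 / A) comes q \<le> A
    (1 - q), and carrying the factor 1 - q^n through the induction makes the bound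
    telescope.\<close>
  define q where "q = exp (- (1 / A))"
  have q: "0 < q" "q \<le> A * (1 - q)"
  proof -
    have "(1 + 1 / A) * q \<le> exp (1 / A) * q" unfolding q_def by (intro mult_right_mono exp_ge_add_one_self) auto
    also have "\<dots> = 1" by (simp add: q_def flip: exp_add)
    finally have "q + q / A \<le> 1" by (simp add: distrib_right)
    then show "q \<le> A * (1 - q)" using assms by (simp add: field_simps)
  qed (simp add: q_def)
  have qk: "exp (- (\<bar>real_of_int k\<bar> / A)) = q ^ nat \<bar>k\<bar>" for k
    by (simp add: q_def flip: exp_of_nat_mult)
  have "(\<Sum>k\<in>{- int n..int n}. q ^ nat \<bar>k\<bar>) \<le> 1 + 2 * A * (1 - q ^ n)"
  proof (induction n)
    case (Suc n)
    have "{- int (Suc n)..int (Suc n)} = insert (- int (Suc n)) (insert (int (Suc n)) {- int n..int n})" by auto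
    then have "(\<Sum>k\<in>{- int (Suc n)..int (Suc n)}. q ^ nat \<bar>k\<bar>) = 2 * q ^ Suc n + (\<Sum>k\<in>{- int n..int n}. q ^ nat \<bar>k\<bar>)"
      by (simp add: nat_add_distrib)
    also have "\<dots> \<le> 2 * (q ^ n * (A * (1 - q))) + (1 + 2 * A * (1 - q ^ n))"
    proof (intro add_mono Suc.IH)
      have "q ^ n * q \<le> q ^ n * (A * (1 - q))" using q by (intro mult_left_mono) auto
      then show "2 * q ^ Suc n \<le> 2 * (q ^ n * (A * (1 - q)))" by (simp add: mult.commute[of q])
    qed
    also have "\<dots> = 1 + 2 * A * (1 - q ^ Suc n)" by (simp add: algebra_simps)
    finally show ?case .
  qed simp
  also have "\<dots> \<le> 1 + 2 * A" using assms q by simp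
  finally show ?thesis unfolding qk .
qed

text \<open>Chernoff's bound: the indicator of the constraint is dominated by \<open>exp (S - \<Sum> \<bar>z\<^sub>i\<bar> / A\<^sub>i)\<close>,
  which factorises.\<close>

lemma card_integer_points:
  fixes A :: "'i \<Rightarrow> real" and S :: real
  assumes I: "finite I" and A: "\<And>i. i \<in> I \<Longrightarrow> A i > 0"
  defines "Z \<equiv> {z \<in> (\<Pi>\<^sub>E i\<in>I. (UNIV :: int set)). (\<Sum>i\<in>I. \<bar>real_of_int (z i)\<bar> / A i) \<le> S}"
  shows "finite Z" "real (card Z) \<le> exp S * (\<Prod>i\<in>I. 1 + 2 * A i)"
proof -
  \<comment> \<open>The box makes the set finite and the sum factorise; its size drops out, since
    each one-dimensional sum is bounded independently of it.\<close>
  define b where "b i = nat \<lceil>S * A i\<rceil>" for i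
  let ?P = "\<Pi>\<^sub>E i\<in>I. {- int (b i)..int (b i)}"
  have sub: "Z \<subseteq> ?P"
  proof
    fix z assume z: "z \<in> Z"
    have "z i \<in> {- int (b i)..int (b i)}" if i: "i \<in> I" for i
    proof -
      have "\<bar>real_of_int (z i)\<bar> / A i \<le> (\<Sum>i\<in>I. \<bar>real_of_int (z i)\<bar> / A i)"
        using A I i by (intro member_le_sum) (auto simp: less_imp_le)
      also have "\<dots> \<le> S" using z by (simp add: Z_def)
      finally have "\<bar>real_of_int (z i)\<bar> \<le> S * A i" using A[OF i] by (simp add: field_simps)
      then have "\<bar>z i\<bar> \<le> \<lceil>S * A i\<rceil>" by linarith
      then have "\<bar>z i\<bar> \<le> int (b i)" unfolding b_def by linarith
      then show ?thesis by auto
    qed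
    then show "z \<in> ?P" using z by (auto simp: Z_def PiE_iff)
  qed
  have fP: "finite ?P" using I by (intro finite_PiE) auto
  show fZ: "finite Z" using finite_subset[OF sub fP] .
  have "real (card Z) = (\<Sum>z\<in>Z. 1)" by simp
  also have "\<dots> \<le> (\<Sum>z\<in>Z. exp (S - (\<Sum>i\<in>I. \<bar>real_of_int (z i)\<bar> / A i)))"
    by (intro sum_mono) (auto simp: Z_def)
  also have "\<dots> \<le> (\<Sum>z\<in>?P. exp (S - (\<Sum>i\<in>I. \<bar>real_of_int (z i)\<bar> / A i)))"
    by (intro sum_mono2 sub fP) auto
  also have "\<dots> = (\<Sum>z\<in>?P. exp S * (\<Prod>i\<in>I. exp (- (\<bar>real_of_int (z i)\<bar> / A i))))"
    using I by (intro sum.cong refl) (simp add: exp_diff exp_sum sum_negf[symmetric] exp_minus prod_inversef[symmetric] divide_inverse)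
  also have "\<dots> = exp S * (\<Prod>i\<in>I. \<Sum>k\<in>{- int (b i)..int (b i)}. exp (- (\<bar>real_of_int k\<bar> / A i)))"
    unfolding sum_distrib_left[symmetric] using I by (subst prod_sum_PiE) auto
  also have "\<dots> \<le> exp S * (\<Prod>i\<in>I. 1 + 2 * A i)"
    using A by (intro mult_left_mono prod_mono conjI exp_sum_bound sum_nonneg) auto
  finally show "real (card Z) \<le> exp S * (\<Prod>i\<in>I. 1 + 2 * A i)" .
qed

text \<open>The bound m^m / m! \<le> exp m is one term of the exponential series. The average of ln
  (m / a) over a = 1, ..., m is thus at most 1, which is why the net carries no logarithmic
  factor.\<close>

lemma sum_ln_quotient_le: "m \<ge> 1 \<Longrightarrow> (\<Sum>a<m. ln (real m / real (Suc a))) \<le> real m"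
proof -
  assume m: "m \<ge> 1"
  have ln_fact: "ln (fact k) = (\<Sum>a<k. ln (real (Suc a)))" for k
    by (induction k) (simp_all add: ln_mult)
  have "(\<Sum>a<m. ln (real m / real (Suc a))) = real m * ln (real m) - ln (fact m)"
    using m by (simp add: ln_div sum_subtractf ln_fact)
  also have "\<dots> = ln (real m ^ m / fact m)" using m by (simp add: ln_div ln_realpow)
  also have "\<dots> \<le> ln (exp (real m))"
    using m power_le_fact_exp[of "real m" m] by (intro ln_mono) (auto simp: field_simps)
  finally show ?thesis by simp
qed

lemma sum_below_coord:
  fixes i :: "'a::finite" and \<phi> :: "nat \<Rightarrow> real"
  shows "(\<Sum>N\<in>below m. \<phi> (N i)) = real m ^ (CARD('a) - 1) * (\<Sum>a<m. \<phi> a)"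
proof -
  let ?f = "\<lambda>j a. if j = i then \<phi> a else 1"
  have "(\<Sum>N\<in>below m. \<phi> (N i)) = (\<Sum>N\<in>below m. \<Prod>j\<in>UNIV. ?f j (N j))"
    by (intro sum.cong refl) (simp add: prod.delta)
  also have "\<dots> = (\<Prod>j\<in>UNIV. \<Sum>a<m. ?f j a)"
    unfolding below_def by (rule prod_sum_PiE[symmetric]) auto
  also have "\<dots> = (\<Sum>a<m. \<phi> a) * (\<Prod>j\<in>UNIV - {i}. real m)"
    by (subst prod.remove[of _ i]) (auto intro!: prod.cong)
  finally show ?thesis by (simp add: card_Diff_singleton mult.commute)
qed

text \<open>\<open>A N\<close> is the scale on which the rounded coefficient of index N ranges.
  Replacing the maximum of N by a single coordinate i only enlarges the logarithm and reduces the
  sum over the grid to a one-dimensional one.\<close>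

lemma card_coeff_grid:
  fixes m \<alpha> :: nat
  assumes m: "m \<ge> 1"
  defines "A \<equiv> \<lambda>N :: 'a::finite \<Rightarrow> nat. (real m / real (Suc (max_index N))) ^ \<alpha>"
  shows "(\<Prod>N\<in>below m. 1 + 2 * A N) \<le> exp ((ln 3 + real \<alpha>) * real m ^ CARD('a))"
proof -
  have A1: "A N \<ge> 1" if "N \<in> below m" for N
    using that unfolding A_def below_max_index by (intro one_le_power) (simp add: field_simps)
  have lnA: "ln (1 + 2 * A N) \<le> ln 3 + real \<alpha> * ln (real m / real (Suc (N i)))" if "N \<in> below m" for N i
  proof -
    have "ln (1 + 2 * A N) \<le> ln (3 * A N)" using A1[OF that] by (intro ln_mono) auto
    also have "\<dots> = ln 3 + real \<alpha> * ln (real m / real (Suc (max_index N)))"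
      using A1[OF that] m by (subst ln_mult) (auto simp: A_def ln_realpow simp del: of_nat_Suc)
    also have "\<dots> \<le> ln 3 + real \<alpha> * ln (real m / real (Suc (N i)))"
      using m max_index_ge[of N i] by (intro add_left_mono mult_left_mono ln_mono divide_left_mono) auto
    finally show ?thesis .
  qed
  have pos: "1 + 2 * A N > 0" if "N \<in> below m" for N using A1[OF that] by linarith
  fix i :: 'a
  have "ln (\<Prod>N\<in>below m. 1 + 2 * A N) = (\<Sum>N\<in>below m. ln (1 + 2 * A N))"
    using pos by (intro ln_prod) (auto simp: less_imp_neq[symmetric])
  also have "\<dots> \<le> (\<Sum>N\<in>below m. ln 3 + real \<alpha> * ln (real m / real (Suc (N i))))"
    by (intro sum_mono lnA)
  also have "\<dots> = real m ^ CARD('a) * ln 3 + real \<alpha> * (\<Sum>N\<in>below m. ln (real m / real (Suc (N i))))"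
    by (simp add: sum.distrib sum_distrib_left card_below del: of_nat_Suc)
  finally have 1: "ln (\<Prod>N\<in>below m. 1 + 2 * A N)
    \<le> real m ^ CARD('a) * ln 3 + real \<alpha> * (\<Sum>N\<in>below m. ln (real m / real (Suc (N i))))" .
  have "(\<Sum>N\<in>below m. ln (real m / real (Suc (N i)))) \<le> real m ^ (CARD('a) - 1) * real m"
    unfolding sum_below_coord[of "\<lambda>a. ln (real m / real (Suc a))"] using sum_ln_quotient_le[OF m]
    by (intro mult_left_mono) auto
  also have "real m ^ (CARD('a) - 1) * real m = real m ^ CARD('a)"
    by (metis Suc_pred' mult.commute power_Suc zero_less_card_finite)
  finally have "real \<alpha> * (\<Sum>N\<in>below m. ln (real m / real (Suc (N i)))) \<le> real \<alpha> * real m ^ CARD('a)"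
    by (intro mult_left_mono) auto
  with 1 have "ln (\<Prod>N\<in>below m. 1 + 2 * A N) \<le> (ln 3 + real \<alpha>) * real m ^ CARD('a)"
    by (simp add: algebra_simps)
  moreover have "(\<Prod>N\<in>below m. 1 + 2 * A N) > 0"
    using pos by (intro prod_pos) auto
  ultimately show ?thesis by (metis exp_le_cancel_iff exp_ln)
qed

text \<open>Coefficient vectors are truncated to \<open>below m\<close> and rounded down to
  multiples of \<open>h\<close>, where h^2 = m^(- 2 \<alpha>) / D and D is the number of
  coefficients kept. Truncation costs E / m^(2 \<alpha>) by the ellipsoid, rounding costs D h^2 = 1
  / m^(2 \<alpha>). The number of rounded vectors is controlled by a weighted sum of their absolute
  values.\<close>

lemma sobolev_ball_net:
  fixes C :: real
  obtains K where "K \<ge> 0" "\<And>m. m \<ge> 1 \<Longrightarrow> \<exists>U :: ((real, 'a::{finite,linorder}) vec \<Rightarrow> real) set.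
      finite U \<and> U \<noteq> {} \<and> (\<forall>u\<in>U. continuous_on UNIV u) \<and> real (card U) \<le> exp (K * real m ^ CARD('a)) \<and>
      (\<forall>g\<in>sobolev_ball \<alpha> C. \<exists>u\<in>U. (\<integral>z. (g z - u z)\<^sup>2 \<partial>cube_measure) \<le> K / real m ^ (2 * \<alpha>))"
proof -
  define E where "E = real (Suc \<alpha>) ^ (2 * \<alpha>) * (real CARD('a) + 1) * C\<^sup>2"
  have E0: "E \<ge> 0" by (simp add: E_def)
  \<comment> \<open>One constant for two purposes: (E + 3) / 2 + ln 3 + \<alpha> bounds the exponent
    of the cardinality, and E + 1 bounds the squared error.\<close>
  define K where "K = (E + 3) / 2 + ln 3 + real \<alpha> + E + 1"
  have ln3: "ln 3 \<ge> (0::real)" by simp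
  show ?thesis
  proof (rule that[of K])
    show "K \<ge> 0" using E0 ln3 by (simp add: K_def)
    fix m :: nat assume m: "m \<ge> 1"
    let ?I = "below m :: ('a \<Rightarrow> nat) set"
    define D where "D = real m ^ CARD('a)"
    have D1: "D \<ge> 1" using m by (simp add: D_def)
    have cI: "real (card ?I) = D" by (simp add: card_below D_def)
    define A where "A N = (real m / real (Suc (max_index N))) ^ \<alpha>" for N :: "'a \<Rightarrow> nat"
    define h where "h = 1 / sqrt (real m ^ (2 * \<alpha>) * D)"
    have h: "h > 0" "h\<^sup>2 = 1 / (real m ^ (2 * \<alpha>) * D)"
      using m D1 by (auto simp: h_def power_divide)
    have A1: "A N \<ge> 1" if "N \<in> ?I" for N
      using that unfolding A_def below_max_index by (intro one_le_power) (simp add: field_simps)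
    \<comment> \<open>With x = |c| \<nu> sqrt D, where \<nu> is the Sobolev weight of the index, a
      rounded coefficient contributes at most x + 1 \<le> (x^2 + 3) / 2. Summing over D indices and
      using the ellipsoid bound E gives this value.\<close>
    define S where "S = D * ((E + 3) / 2)"
    define Z where "Z = {z \<in> (\<Pi>\<^sub>E N\<in>?I. (UNIV :: int set)). (\<Sum>N\<in>?I. \<bar>real_of_int (z N)\<bar> / A N) \<le> S}"
    have Z: "finite Z" "real (card Z) \<le> exp S * (\<Prod>N\<in>?I. 1 + 2 * A N)"
      unfolding Z_def using A1 by (intro card_integer_points; force)+
    define u where "u z x = (\<Sum>N\<in>?I. (h * real_of_int (z N)) * tleg N x)" for z x
    have appr: "\<exists>z\<in>Z. (\<integral>x. (g x - u z x)\<^sup>2 \<partial>cube_measure) \<le> K / real m ^ (2 * \<alpha>)" if g: "g \<in> sobolev_ball \<alpha> C" for g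
    proof -
      let ?c = "leg_coeff g"
      have sg: "square_integrable g" using g by (simp add: sobolev_ball_def sobolev_space_def)
      have ell: "(\<Sum>N\<in>S. (?c N)\<^sup>2 * real (Suc (max_index N)) ^ (2 * \<alpha>)) \<le> E" if "finite S" for S
        using sobolev_ball_ellipsoid[OF g that] by (simp add: E_def)
      define z where "z = (\<lambda>N\<in>?I. \<lfloor>?c N / h\<rfloor>)"
      have zc: "\<bar>?c N / h - real_of_int (z N)\<bar> \<le> 1" if "N \<in> ?I" for N
        using that unfolding z_def restrict_apply by simp linarith
      have "(\<Sum>N\<in>?I. \<bar>real_of_int (z N)\<bar> / A N) \<le> (\<Sum>N\<in>?I. (D * ((?c N)\<^sup>2 * real (Suc (max_index N)) ^ (2 * \<alpha>)) + 3) / 2)"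
      proof (rule sum_mono)
        fix N assume N: "N \<in> ?I"
        define \<nu> where "\<nu> = real (Suc (max_index N)) ^ \<alpha>"
        have \<nu>: "\<nu> > 0" "real (Suc (max_index N)) ^ (2 * \<alpha>) = \<nu>\<^sup>2"
          by (auto simp: \<nu>_def power_mult mult.commute[of 2])
        have "\<bar>real_of_int (z N)\<bar> / A N \<le> (\<bar>?c N\<bar> / h + 1) / A N"
        proof (rule divide_right_mono)
          have "\<bar>?c N / h\<bar> = \<bar>?c N\<bar> / h" using h by simp
          then show "\<bar>real_of_int (z N)\<bar> \<le> \<bar>?c N\<bar> / h + 1" using zc[OF N] by linarith
        qed (use A1[OF N] in simp)
        also have "\<dots> \<le> \<bar>?c N\<bar> / h / A N + 1" using A1[OF N] by (simp add: add_divide_distrib)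
        also have "\<bar>?c N\<bar> / h / A N = \<bar>?c N\<bar> * \<nu> * sqrt D"
        proof -
          have "sqrt (real m ^ (2 * \<alpha>)) = real m ^ \<alpha>" by (metis power_mult mult.commute of_nat_0_le_iff real_sqrt_abs abs_of_nonneg zero_le_power)
          then have "1 / h = real m ^ \<alpha> * sqrt D" by (simp add: h_def real_sqrt_mult)
          moreover have "1 / A N = \<nu> / real m ^ \<alpha>" by (simp add: A_def \<nu>_def power_divide)
          ultimately have "1 / h * (1 / A N) = \<nu> * sqrt D" using m by simp
          then show ?thesis by (metis (no_types, lifting) divide_divide_eq_left mult.assoc mult.right_neutral times_divide_eq_right times_divide_times_eq)
        qed
        also have "\<bar>?c N\<bar> * \<nu> * sqrt D + 1 \<le> (D * ((?c N)\<^sup>2 * \<nu>\<^sup>2) + 3) / 2"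
        proof -
          have "0 \<le> (\<bar>?c N\<bar> * \<nu> * sqrt D - 1)\<^sup>2" by simp
          also have "\<dots> = (?c N)\<^sup>2 * \<nu>\<^sup>2 * D - 2 * (\<bar>?c N\<bar> * \<nu> * sqrt D) + 1"
            using D1 by (simp add: power2_diff power_mult_distrib)
          finally show ?thesis by (simp add: mult_ac)
        qed
        finally show "\<bar>real_of_int (z N)\<bar> / A N \<le> (D * ((?c N)\<^sup>2 * real (Suc (max_index N)) ^ (2 * \<alpha>)) + 3) / 2"
          unfolding \<nu>(2) .
      qed
      also have "\<dots> = (D * (\<Sum>N\<in>?I. (?c N)\<^sup>2 * real (Suc (max_index N)) ^ (2 * \<alpha>)) + 3 * D) / 2"
        by (simp add: sum.distrib sum_distrib_left cI add_divide_distrib flip: sum_divide_distrib)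
      also have "\<dots> \<le> (D * E + 3 * D) / 2" using ell[of ?I] D1 by (intro divide_right_mono add_mono mult_left_mono) auto
      also have "\<dots> = S" by (simp add: S_def algebra_simps)
      finally have zZ: "z \<in> Z" by (simp add: Z_def z_def)
      have "(\<integral>x. (g x - u z x)\<^sup>2 \<partial>cube_measure) \<le> E / real m ^ (2 * \<alpha>) + (\<Sum>N\<in>?I. (h * real_of_int (z N) - ?c N)\<^sup>2)"
        unfolding u_def
      proof (rule leg_approx[OF sg])
        fix M assume "m \<le> M"
        have "(\<Sum>N\<in>below M - ?I. (?c N)\<^sup>2) * real m ^ (2 * \<alpha>)
            \<le> (\<Sum>N\<in>below M - ?I. (?c N)\<^sup>2 * real (Suc (max_index N)) ^ (2 * \<alpha>))"
          unfolding sum_distrib_right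
          by (intro sum_mono mult_left_mono power_mono) (auto simp: below_max_index)
        also have "\<dots> \<le> E" by (intro ell) auto
        finally show "(\<Sum>N\<in>below M - ?I. (?c N)\<^sup>2) \<le> E / real m ^ (2 * \<alpha>)" using m by (simp add: field_simps)
      qed
      also have "(\<Sum>N\<in>?I. (h * real_of_int (z N) - ?c N)\<^sup>2) \<le> (\<Sum>N\<in>?I. h\<^sup>2)"
      proof (rule sum_mono)
        fix N assume N: "N \<in> ?I"
        have "\<bar>h * real_of_int (z N) - ?c N\<bar> = h * \<bar>?c N / h - real_of_int (z N)\<bar>"
          using h by (simp add: abs_minus_commute[of "h * _"] field_simps flip: abs_mult_pos)
        also have "\<dots> \<le> h * 1" using h zc[OF N] by (intro mult_left_mono) auto
        finally have "\<bar>h * real_of_int (z N) - ?c N\<bar>\<^sup>2 \<le> h\<^sup>2" by (intro power_mono) auto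
        then show "(h * real_of_int (z N) - ?c N)\<^sup>2 \<le> h\<^sup>2" by simp
      qed
      also have "(\<Sum>N\<in>?I. h\<^sup>2) = 1 / real m ^ (2 * \<alpha>)" using D1 by (simp add: cI h(2))
      also have "E / real m ^ (2 * \<alpha>) + 1 / real m ^ (2 * \<alpha>) \<le> K / real m ^ (2 * \<alpha>)"
        unfolding add_divide_distrib[symmetric] K_def using E0 ln3 by (intro divide_right_mono) auto
      finally show ?thesis using zZ by auto
    qed
    have "(\<lambda>_\<in>?I. 0) \<in> Z" using E0 D1 by (simp add: Z_def S_def)
    then have "u ` Z \<noteq> {}" by auto
    moreover have "continuous_on UNIV (u z)" for z
      unfolding u_def by (intro continuous_intros continuous_on_tpoly)
    moreover have "real (card (u ` Z)) \<le> exp (K * D)"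
    proof -
      have "real (card (u ` Z)) \<le> real (card Z)" using card_image_le[OF Z(1)] by simp
      also have "\<dots> \<le> exp S * exp ((ln 3 + real \<alpha>) * D)"
        using Z(2) card_coeff_grid[OF m, where ?'a = 'a and \<alpha> = \<alpha>] unfolding A_def D_def
        by (meson exp_ge_zero mult_left_mono order_trans)
      also have "\<dots> = exp (((E + 3) / 2 + ln 3 + real \<alpha>) * D)" by (simp add: S_def algebra_simps flip: exp_add)
      also have "\<dots> \<le> exp (K * D)" using E0 D1 by (simp add: K_def mult_right_mono)
      finally show ?thesis .
    qed
    ultimately show "\<exists>U :: ((real, 'a) vec \<Rightarrow> real) set. finite U \<and> U \<noteq> {} \<and> (\<forall>u\<in>U. continuous_on UNIV u) \<and> real (card U) \<le> exp (K * real m ^ CARD('a)) \<and>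
      (\<forall>g\<in>sobolev_ball \<alpha> C. \<exists>u\<in>U. (\<integral>z. (g z - u z)\<^sup>2 \<partial>cube_measure) \<le> K / real m ^ (2 * \<alpha>))"
      using Z(1) appr unfolding D_def by (intro exI[of _ "u ` Z"]) auto
  qed
qed

section \<open>From the components to the interaction class\<close>

definition proj :: "('r \<Rightarrow> 'd) \<Rightarrow> real ^ 'd::finite \<Rightarrow> real ^ 'r::finite" where
  "proj \<iota> x = (\<chi> j. x $ \<iota> j)"

lemma proj_nth [simp]: "proj \<iota> x $ j = x $ \<iota> j"
  by (simp add: proj_def)

lemma continuous_on_proj: "continuous_on A (proj \<iota>)"
  unfolding proj_def[abs_def] by (intro continuous_intros)

lemma proj_in_cube: "x \<in> unit_cube \<Longrightarrow> proj \<iota> x \<in> unit_cube"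
  by (auto simp: mem_box_cart)

lemma indicator_unit_cube: "indicator unit_cube z = (\<Prod>j\<in>UNIV. indicator {0..1} (z $ j) :: real)"
proof (cases "z \<in> unit_cube")
  case False
  then obtain j where "z $ j \<notin> {0..1}" by (auto simp: mem_box_cart)
  then have "(\<Prod>j\<in>UNIV. indicator {0..1} (z $ j) :: real) = 0" by (intro prod_zero bexI[of _ j]) auto
  then show ?thesis using False by simp
qed (auto simp: mem_box_cart)

text \<open>Coordinates outside the range of \<iota> are free and contribute the factor 1; by
  injectivity every other coordinate belongs to a unique j.\<close>

lemma integral_cube_prod_proj:
  fixes \<iota> :: "'r::finite \<Rightarrow> 'd::finite" and B :: "'r \<Rightarrow> real set"
  assumes inj: "inj \<iota>" and B: "\<And>j. B j \<in> sets borel"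
  shows "(\<integral>x. (\<Prod>j\<in>UNIV. indicator (B j) (x $ \<iota> j) :: real) \<partial>(cube_measure :: (real ^ 'd) measure))
    = (\<Prod>j\<in>UNIV. measure lborel ({0..1} \<inter> B j))"
proof -
  define C where "C i = (if i \<in> range \<iota> then {0..1} \<inter> B (inv \<iota> i) else {0..1})" for i
  have C: "C i \<in> sets borel" for i using B by (auto simp: C_def)
  have split: "(\<Prod>i\<in>UNIV. if i \<in> range \<iota> then \<phi> (inv \<iota> i) i else 1) = (\<Prod>j\<in>UNIV. \<phi> j (\<iota> j))" for \<phi> :: "'r \<Rightarrow> 'd \<Rightarrow> real"
  proof -
    have "(\<Prod>i\<in>UNIV. if i \<in> range \<iota> then \<phi> (inv \<iota> i) i else 1) = (\<Prod>i\<in>range \<iota>. \<phi> (inv \<iota> i) i)"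
      by (rule prod.mono_neutral_cong_right) auto
    also have "\<dots> = (\<Prod>j\<in>UNIV. \<phi> j (\<iota> j))"
      using inj by (subst prod.reindex) auto
    finally show ?thesis .
  qed
  have "indicator unit_cube x *\<^sub>R (\<Prod>j\<in>UNIV. indicator (B j) (x $ \<iota> j)) = (\<Prod>i\<in>UNIV. indicator (C i) (x $ i) :: real)" for x :: "real ^ 'd"
  proof -
    have "(\<Prod>i\<in>UNIV. indicator (C i) (x $ i) :: real)
      = (\<Prod>i\<in>UNIV. indicator {0..1} (x $ i) * (if i \<in> range \<iota> then indicator (B (inv \<iota> i)) (x $ i) else 1))"
      by (intro prod.cong) (auto simp: C_def indicator_inter_arith)
    also have "\<dots> = indicator unit_cube x * (\<Prod>j\<in>UNIV. indicator (B j) (x $ \<iota> j))"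
      unfolding prod.distrib indicator_unit_cube split[of "\<lambda>j i. indicator (B j) (x $ i)"] ..
    finally show ?thesis by simp
  qed
  then have "(\<integral>x. (\<Prod>j\<in>UNIV. indicator (B j) (x $ \<iota> j) :: real) \<partial>(cube_measure :: (real ^ 'd) measure))
    = (\<integral>x. (\<Prod>i\<in>UNIV. indicator (C i) (x $ i) :: real) \<partial>(lborel :: (real ^ 'd) measure))"
    by (simp add: integral_cube_measure)
  also have "\<dots> = (\<Prod>i\<in>UNIV. integral\<^sup>L lborel (indicator (C i)) :: real)"
  proof (rule integral_lborel_prod_vec)
    fix i
    have "emeasure lborel (C i) \<le> emeasure lborel {0..1::real}" by (intro emeasure_mono) (auto simp: C_def)
    then have "emeasure lborel (C i) < \<infinity>" by (simp add: le_less_trans)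
    then show "integrable lborel (indicator (C i) :: real \<Rightarrow> real)" using C by (intro integrable_real_indicator) auto
  qed
  also have "\<dots> = (\<Prod>i\<in>UNIV. if i \<in> range \<iota> then measure lborel ({0..1} \<inter> B (inv \<iota> i)) else 1)"
    using C by (intro prod.cong) (auto simp: C_def)
  also have "\<dots> = (\<Prod>j\<in>UNIV. measure lborel ({0..1} \<inter> B j))"
    by (rule split)
  finally show ?thesis .
qed

lemma measure_cube_proj_box:
  fixes \<iota> :: "'r::finite \<Rightarrow> 'd::finite" and B :: "'r \<Rightarrow> real set"
  assumes "inj \<iota>" "\<And>j. B j \<in> sets borel"
  shows "measure cube_measure {x \<in> unit_cube. \<forall>j. x $ \<iota> j \<in> B j} = (\<Prod>j\<in>UNIV. measure lborel ({0..1} \<inter> B j))"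
proof -
  have ind: "indicator {x \<in> unit_cube. \<forall>j. x $ \<iota> j \<in> B j} x = (\<Prod>j\<in>UNIV. indicator (B j) (x $ \<iota> j) :: real)"
    if "x \<in> unit_cube" for x :: "real ^ 'd"
  proof (cases "\<forall>j. x $ \<iota> j \<in> B j")
    case False
    then obtain j where "x $ \<iota> j \<notin> B j" by blast
    then have "(\<Prod>j\<in>UNIV. indicator (B j) (x $ \<iota> j) :: real) = 0" by (intro prod_zero bexI[of _ j]) auto
    then show ?thesis using False by simp
  qed (use that in auto)
  have "(\<integral>x. (\<Prod>j\<in>UNIV. indicator (B j) (x $ \<iota> j) :: real) \<partial>(cube_measure :: (real ^ 'd) measure))
      = (\<integral>x. (indicator {x \<in> unit_cube. \<forall>j. x $ \<iota> j \<in> B j} x :: real) \<partial>cube_measure)"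
    by (intro Bochner_Integration.integral_cong) (auto simp: ind)
  also have "\<dots> = measure cube_measure ({x \<in> unit_cube. \<forall>j. x $ \<iota> j \<in> B j} \<inter> space cube_measure)"
    by (rule Bochner_Integration.integral_indicator)
  also have "{x \<in> unit_cube. \<forall>j. x $ \<iota> j \<in> B j} \<inter> space cube_measure = {x \<in> unit_cube. \<forall>j. x $ \<iota> j \<in> B j}" by auto
  finally show ?thesis using integral_cube_prod_proj[OF assms] by simp
qed

text \<open>Marginals of the uniform law on the cube are uniform. Both laws agree on open boxes, a
  generator stable under intersections; the right-hand side is the case of the identity
  projection.\<close>

lemma distr_cube_proj:
  fixes \<iota> :: "'r::finite \<Rightarrow> 'd::finite"
  assumes inj: "inj \<iota>"
  shows "distr (cube_measure :: (real ^ 'd) measure) borel (proj \<iota>) = distr (cube_measure :: (real ^ 'r) measure) borel (\<lambda>x. x)"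
proof (rule measure_eqI_generator_eq)
  let ?E = "range (\<lambda>(a, b). box a b :: (real ^ 'r) set)"
  show "Int_stable ?E" by (auto simp: Int_stable_def box_Int_box)
  show "?E \<subseteq> Pow UNIV" "sets (distr cube_measure borel (proj \<iota>)) = sigma_sets UNIV ?E"
    "sets (distr (cube_measure :: (real ^ 'r) measure) borel (\<lambda>x. x)) = sigma_sets UNIV ?E"
    by (simp_all add: borel_eq_box)
  let ?A = "\<lambda>n::nat. box (- (real n *\<^sub>R One)) (real n *\<^sub>R One) :: (real ^ 'r) set"
  show "range ?A \<subseteq> ?E" "(\<Union>i. ?A i) = UNIV" unfolding UN_box_eq_UNIV by auto
  have mp: "proj \<iota> \<in> borel_measurable cube_measure" and mi: "(\<lambda>x. x) \<in> borel_measurable (cube_measure :: (real ^ 'r) measure)"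
    by (auto intro!: measurable_cube_measure_borel borel_measurable_continuous_onI continuous_on_proj)
  show "emeasure (distr cube_measure borel (proj \<iota>)) (?A i) \<noteq> \<infinity>" for i
    using mp by (simp add: emeasure_distr)
  fix X assume "X \<in> ?E"
  then obtain a b where X: "X = box a b" by auto
  have 1: "proj \<iota> -` X \<inter> space cube_measure = {x \<in> unit_cube. \<forall>j. x $ \<iota> j \<in> {a $ j<..<b $ j}}"
    by (auto simp: X mem_box_cart)
  have 2: "(\<lambda>x. x) -` X \<inter> space cube_measure = {x \<in> unit_cube. \<forall>j. x $ id j \<in> {a $ j<..<b $ j}}"
    by (auto simp: X mem_box_cart)
  have "measure cube_measure (proj \<iota> -` X \<inter> space cube_measure) = measure cube_measure ((\<lambda>x. x) -` X \<inter> space (cube_measure :: (real ^ 'r) measure))"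
    unfolding 1 2 by (subst measure_cube_proj_box[OF inj], simp, subst measure_cube_proj_box[of id], simp_all)
  then show "emeasure (distr cube_measure borel (proj \<iota>)) X = emeasure (distr (cube_measure :: (real ^ 'r) measure) borel (\<lambda>x. x)) X"
    using mp mi by (simp add: emeasure_distr X cube.emeasure_eq_measure)
qed

lemma borel_measurable_cube_extend:
  fixes G :: "real ^ 'r::finite \<Rightarrow> real"
  assumes "G \<in> borel_measurable cube_measure"
  shows "(\<lambda>x. indicator unit_cube x *\<^sub>R G x) \<in> borel_measurable borel"
  using assms unfolding cube_measure_def by (subst (asm) borel_measurable_restrict_space_iff) auto

lemma
  fixes \<iota> :: "'r::finite \<Rightarrow> 'd::finite" and G :: "real ^ 'r \<Rightarrow> real"
  assumes inj: "inj \<iota>" and G: "G \<in> borel_measurable cube_measure"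
  shows measurable_cube_proj: "(\<lambda>x. G (proj \<iota> x)) \<in> borel_measurable cube_measure"
    and integrable_cube_proj: "integrable cube_measure G \<Longrightarrow> integrable cube_measure (\<lambda>x. G (proj \<iota> x))"
    and integral_cube_proj: "(\<integral>x. G (proj \<iota> x) \<partial>cube_measure) = (\<integral>x. G x \<partial>cube_measure)"
proof -
  let ?G = "\<lambda>x. indicator unit_cube x *\<^sub>R G x"
  note mG = borel_measurable_cube_extend[OF G]
  have mp: "proj \<iota> \<in> borel_measurable cube_measure" and mi: "(\<lambda>x. x) \<in> borel_measurable (cube_measure :: (real ^ 'r) measure)"
    by (auto intro!: measurable_cube_measure_borel borel_measurable_continuous_onI continuous_on_proj)
  have eq: "G (proj \<iota> x) = ?G (proj \<iota> x)" if "x \<in> space cube_measure" for x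
    using proj_in_cube[of x \<iota>] that by simp
  have eq': "G x = ?G x" if "x \<in> space cube_measure" for x using that by simp
  have "(\<lambda>x. ?G (proj \<iota> x)) \<in> borel_measurable cube_measure" by (rule measurable_compose[OF mp mG])
  then show "(\<lambda>x. G (proj \<iota> x)) \<in> borel_measurable cube_measure"
    by (subst measurable_cong[OF eq])
  have "integrable cube_measure (\<lambda>x. ?G (proj \<iota> x)) = integrable cube_measure ?G"
    using integrable_distr_eq[OF mp mG] integrable_distr_eq[OF mi mG] distr_cube_proj[OF inj] by simp
  moreover have "integrable cube_measure (\<lambda>x. G (proj \<iota> x)) = integrable cube_measure (\<lambda>x. ?G (proj \<iota> x))"
    by (rule Bochner_Integration.integrable_cong[OF refl eq])
  moreover have "integrable cube_measure G = integrable cube_measure ?G"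
    by (rule Bochner_Integration.integrable_cong[OF refl eq'])
  ultimately show "integrable cube_measure G \<Longrightarrow> integrable cube_measure (\<lambda>x. G (proj \<iota> x))" by simp
  have "(\<integral>x. ?G (proj \<iota> x) \<partial>cube_measure) = (\<integral>x. ?G x \<partial>cube_measure)"
    using integral_distr[OF mp mG] integral_distr[OF mi mG] distr_cube_proj[OF inj] by simp
  moreover have "(\<integral>x. G (proj \<iota> x) \<partial>cube_measure) = (\<integral>x. ?G (proj \<iota> x) \<partial>cube_measure)"
    by (rule Bochner_Integration.integral_cong[OF refl eq])
  moreover have "(\<integral>x. G x \<partial>cube_measure) = (\<integral>x. ?G x \<partial>cube_measure)"
    by (rule Bochner_Integration.integral_cong[OF refl eq'])
  ultimately show "(\<integral>x. G (proj \<iota> x) \<partial>cube_measure) = (\<integral>x. G x \<partial>cube_measure)" by simp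
qed

lemma square_integrable_proj:
  assumes "inj \<iota>" "square_integrable g" shows "square_integrable (\<lambda>x. g (proj \<iota> x))"
  using assms measurable_cube_proj[of \<iota> g] integrable_cube_proj[of \<iota> "\<lambda>x. (g x)\<^sup>2"] by (auto simp: square_integrable_def)

text \<open>Nets of the components are added up. The number \<open>card J\<close> of index tuples
  does not depend on m, so the logarithm of the cardinality grows by the factor
  \<open>card J\<close> and the squared error by its square: once from Cauchy-Schwarz, once from
  summation.\<close>

lemma interaction_class_net:
  fixes C :: real
  obtains K where "K \<ge> 0"
    "\<And>\<mu> :: (real, 'd::{finite,linorder}) vec \<Rightarrow> real. \<mu> \<in> interaction_class TYPE('r::{finite,linorder}) \<alpha> C \<Longrightarrow> square_integrable \<mu>"
    "\<And>m. m \<ge> 1 \<Longrightarrow> \<exists>V :: ((real, 'd::{finite,linorder}) vec \<Rightarrow> real) set.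
      finite V \<and> V \<noteq> {} \<and> (\<forall>u\<in>V. continuous_on UNIV u) \<and> ln (real (card V)) \<le> K * real m ^ CARD('r) \<and>
      (\<forall>\<mu>\<in>interaction_class TYPE('r) \<alpha> C. \<exists>u\<in>V. (\<integral>x. (\<mu> x - u x)\<^sup>2 \<partial>cube_measure) \<le> K / real m ^ (2 * \<alpha>))"
proof -
  let ?T = "interaction_class TYPE('r) \<alpha> C :: ((real, 'd) vec \<Rightarrow> real) set"
  define J where "J = {\<iota> :: 'r \<Rightarrow> 'd. strict_mono \<iota>}"
  have J: "finite J" "\<And>\<iota>. \<iota> \<in> J \<Longrightarrow> inj \<iota>"
    by (auto simp: J_def strict_mono_imp_inj_on)
  show ?thesis
  proof (rule sobolev_ball_net[of \<alpha> C, where ?'a = 'r])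
    fix K0 :: real
    assume K0: "K0 \<ge> 0" "\<And>m. m \<ge> 1 \<Longrightarrow> \<exists>U :: ((real, 'r) vec \<Rightarrow> real) set.
        finite U \<and> U \<noteq> {} \<and> (\<forall>u\<in>U. continuous_on UNIV u) \<and> real (card U) \<le> exp (K0 * real m ^ CARD('r)) \<and>
        (\<forall>g\<in>sobolev_ball \<alpha> C. \<exists>u\<in>U. (\<integral>z. (g z - u z)\<^sup>2 \<partial>cube_measure) \<le> K0 / real m ^ (2 * \<alpha>))"
    define K where "K = K0 * real (card J) + real (card J) * real (card J) * K0"
    have T: "\<exists>g. (\<forall>\<iota>\<in>J. g \<iota> \<in> sobolev_ball \<alpha> C) \<and> (\<forall>x\<in>unit_cube. \<mu> x = (\<Sum>\<iota>\<in>J. g \<iota> (proj \<iota> x)))" if mu: "\<mu> \<in> ?T" for \<mu>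
    proof -
      obtain g :: "('r \<Rightarrow> 'd) \<Rightarrow> (real, 'r) vec \<Rightarrow> real" where "\<forall>\<iota>. strict_mono \<iota> \<longrightarrow> g \<iota> \<in> sobolev_ball \<alpha> C"
        "\<forall>x\<in>unit_cube. \<mu> x = (\<Sum>\<iota> | strict_mono \<iota>. g \<iota> (\<chi> j. x $ \<iota> j))"
        using mu unfolding interaction_class_def by blast
      then show ?thesis by (intro exI[of _ g]) (simp add: J_def proj_def)
    qed
    have sb: "square_integrable g" if "g \<in> sobolev_ball \<alpha> C" for g :: "(real, 'r) vec \<Rightarrow> real"
      using that by (simp add: sobolev_ball_def sobolev_space_def)
    have cong: "square_integrable f = square_integrable g" if "\<And>x. x \<in> unit_cube \<Longrightarrow> f x = g x" for f g :: "(real, 'd) vec \<Rightarrow> real"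
    proof -
      have "f \<in> borel_measurable cube_measure \<longleftrightarrow> g \<in> borel_measurable cube_measure"
        by (rule measurable_cong) (simp add: that)
      moreover have "integrable cube_measure (\<lambda>z. (f z)\<^sup>2) \<longleftrightarrow> integrable cube_measure (\<lambda>z. (g z)\<^sup>2)"
        by (rule Bochner_Integration.integrable_cong) (simp_all add: that)
      ultimately show ?thesis by (simp add: square_integrable_def)
    qed
    show thesis
    proof (rule that[of K])
      show "K \<ge> 0" using K0 by (simp add: K_def)
      show "square_integrable \<mu>" if mu: "\<mu> \<in> ?T" for \<mu>
      proof -
        obtain g where g: "\<forall>\<iota>\<in>J. g \<iota> \<in> sobolev_ball \<alpha> C" "\<forall>x\<in>unit_cube. \<mu> x = (\<Sum>\<iota>\<in>J. g \<iota> (proj \<iota> x))"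
          using T[OF mu] by blast
        have "square_integrable (\<lambda>x. \<Sum>\<iota>\<in>J. g \<iota> (proj \<iota> x))"
          using g J by (intro square_integrable_sum square_integrable_proj sb) auto
        then show ?thesis using cong[of \<mu>] g(2) by simp
      qed
      fix m :: nat assume m: "m \<ge> 1"
      obtain U :: "((real, 'r) vec \<Rightarrow> real) set" where U: "finite U" "U \<noteq> {}" "\<forall>u\<in>U. continuous_on UNIV u"
        "real (card U) \<le> exp (K0 * real m ^ CARD('r))"
        "\<forall>g\<in>sobolev_ball \<alpha> C. \<exists>u\<in>U. (\<integral>z. (g z - u z)\<^sup>2 \<partial>cube_measure) \<le> K0 / real m ^ (2 * \<alpha>)"
        using K0(2)[OF m] by blast
      define v where "v w x = (\<Sum>\<iota>\<in>J. w \<iota> (proj \<iota> x))" for w :: "('r \<Rightarrow> 'd) \<Rightarrow> (real, 'r) vec \<Rightarrow> real" and x :: "(real, 'd) vec"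
      define V where "V = v ` (\<Pi>\<^sub>E \<iota>\<in>J. U)"
      have fin: "finite (\<Pi>\<^sub>E \<iota>\<in>J. U)" using J U by (intro finite_PiE) auto
      have V: "finite V" "V \<noteq> {}" using fin U by (auto simp: V_def PiE_eq_empty_iff)
      have "real (card V) \<le> real (card (\<Pi>\<^sub>E \<iota>\<in>J. U))" unfolding V_def using card_image_le[OF fin] by simp
      also have "\<dots> = real (card U) ^ card J" using J by (simp add: card_PiE)
      also have "\<dots> \<le> exp (K0 * real m ^ CARD('r)) ^ card J" using U by (intro power_mono) auto
      also have "\<dots> = exp (real (card J) * (K0 * real m ^ CARD('r)))" by (simp add: exp_of_nat_mult)
      finally have "ln (real (card V)) \<le> ln (exp (real (card J) * (K0 * real m ^ CARD('r))))"
        using V by (intro ln_mono) (auto simp: card_gt_0_iff)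
      also have "\<dots> = real (card J) * (K0 * real m ^ CARD('r))" by simp
      also have "\<dots> \<le> K * real m ^ CARD('r)"
      proof -
        have "real (card J) * K0 \<le> K" using K0 by (simp add: K_def)
        then show ?thesis by (simp add: mult.assoc[symmetric] mult_right_mono)
      qed
      finally have lnV: "ln (real (card V)) \<le> K * real m ^ CARD('r)" .
      have cV: "continuous_on UNIV u" if uV: "u \<in> V" for u
      proof -
        obtain w where w: "w \<in> (\<Pi>\<^sub>E \<iota>\<in>J. U)" "u = v w" using uV by (auto simp: V_def)
        have "continuous_on UNIV (\<lambda>x. w \<iota> (proj \<iota> x))" if "\<iota> \<in> J" for \<iota>
          using w that U(3) by (intro continuous_on_compose2[OF _ continuous_on_proj]) auto
        then show ?thesis unfolding w(2) v_def[abs_def] by (intro continuous_on_sum)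
      qed
      have appr: "\<exists>u\<in>V. (\<integral>x. (\<mu> x - u x)\<^sup>2 \<partial>cube_measure) \<le> K / real m ^ (2 * \<alpha>)" if mu: "\<mu> \<in> ?T" for \<mu>
      proof -
        obtain g where g: "\<forall>\<iota>\<in>J. g \<iota> \<in> sobolev_ball \<alpha> C" "\<forall>x\<in>unit_cube. \<mu> x = (\<Sum>\<iota>\<in>J. g \<iota> (proj \<iota> x))"
          using T[OF mu] by blast
        have "\<forall>\<iota>\<in>J. \<exists>u. u \<in> U \<and> (\<integral>z. (g \<iota> z - u z)\<^sup>2 \<partial>cube_measure) \<le> K0 / real m ^ (2 * \<alpha>)"
          using g(1) U(5) by blast
        from bchoice[OF this] obtain w where w: "\<And>\<iota>. \<iota> \<in> J \<Longrightarrow> w \<iota> \<in> U"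
          "\<And>\<iota>. \<iota> \<in> J \<Longrightarrow> (\<integral>z. (g \<iota> z - w \<iota> z)\<^sup>2 \<partial>cube_measure) \<le> K0 / real m ^ (2 * \<alpha>)"
          by blast
        have sd: "square_integrable (\<lambda>z. g \<iota> z - w \<iota> z)" if "\<iota> \<in> J" for \<iota>
          using g(1) w(1) U(3) that by (intro square_integrable_diff sb square_integrable_continuous) auto
        have id: "integrable cube_measure (\<lambda>z. (g \<iota> (proj \<iota> z) - w \<iota> (proj \<iota> z))\<^sup>2)" if "\<iota> \<in> J" for \<iota>
          using square_integrable_proj[OF J(2)[OF that] sd[OF that]] by (simp add: square_integrable_def)
        have vr: "v (restrict w J) = v w" unfolding v_def[abs_def] by (intro ext sum.cong) auto
        have "(\<integral>x. (\<mu> x - v w x)\<^sup>2 \<partial>cube_measure) = (\<integral>x. (\<Sum>\<iota>\<in>J. g \<iota> (proj \<iota> x) - w \<iota> (proj \<iota> x))\<^sup>2 \<partial>cube_measure)"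
          using g(2) by (intro Bochner_Integration.integral_cong) (auto simp: v_def sum_subtractf)
        also have "\<dots> \<le> (\<integral>x. (\<Sum>\<iota>\<in>J. (g \<iota> (proj \<iota> x) - w \<iota> (proj \<iota> x))\<^sup>2) * real (card J) \<partial>cube_measure)"
        proof (rule integral_mono)
          have "square_integrable (\<lambda>x. \<Sum>\<iota>\<in>J. g \<iota> (proj \<iota> x) - w \<iota> (proj \<iota> x))"
            using J sd square_integrable_proj by (intro square_integrable_sum) auto
          then show "integrable cube_measure (\<lambda>x. (\<Sum>\<iota>\<in>J. g \<iota> (proj \<iota> x) - w \<iota> (proj \<iota> x))\<^sup>2)"
            by (simp add: square_integrable_def)
        qed (use id sum_squared_le_sum_of_squares in auto)
        also have "\<dots> = (\<Sum>\<iota>\<in>J. (\<integral>x. (g \<iota> (proj \<iota> x) - w \<iota> (proj \<iota> x))\<^sup>2 \<partial>cube_measure)) * real (card J)"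
          using id by (simp add: Bochner_Integration.integral_sum)
        also have "(\<Sum>\<iota>\<in>J. (\<integral>x. (g \<iota> (proj \<iota> x) - w \<iota> (proj \<iota> x))\<^sup>2 \<partial>cube_measure)) \<le> (\<Sum>\<iota>\<in>J. K0 / real m ^ (2 * \<alpha>))"
        proof (rule sum_mono)
          fix \<iota> assume i: "\<iota> \<in> J"
          have "(\<lambda>z. (g \<iota> z - w \<iota> z)\<^sup>2) \<in> borel_measurable cube_measure"
            using sd[OF i] by (auto simp: square_integrable_def)
          from integral_cube_proj[OF J(2)[OF i] this] w(2)[OF i]
          show "(\<integral>x. (g \<iota> (proj \<iota> x) - w \<iota> (proj \<iota> x))\<^sup>2 \<partial>cube_measure) \<le> K0 / real m ^ (2 * \<alpha>)" by simp
        qed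
        finally have "(\<integral>x. (\<mu> x - v w x)\<^sup>2 \<partial>cube_measure) \<le> (\<Sum>\<iota>\<in>J. K0 / real m ^ (2 * \<alpha>)) * real (card J)"
          by (simp add: mult_right_mono)
        also have "\<dots> = real (card J) * real (card J) * K0 / real m ^ (2 * \<alpha>)" by simp
        also have "\<dots> \<le> K / real m ^ (2 * \<alpha>)" using K0 by (intro divide_right_mono) (auto simp: K_def)
        finally have "(\<integral>x. (\<mu> x - v w x)\<^sup>2 \<partial>cube_measure) \<le> K / real m ^ (2 * \<alpha>)" .
        moreover have "v w \<in> V" unfolding V_def vr[symmetric] using w(1) by (intro imageI) auto
        ultimately show ?thesis by blast
      qed
      show "\<exists>V :: ((real, 'd) vec \<Rightarrow> real) set.
        finite V \<and> V \<noteq> {} \<and> (\<forall>u\<in>V. continuous_on UNIV u) \<and> ln (real (card V)) \<le> K * real m ^ CARD('r) \<and>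
        (\<forall>\<mu>\<in>?T. \<exists>u\<in>V. (\<integral>x. (\<mu> x - u x)\<^sup>2 \<partial>cube_measure) \<le> K / real m ^ (2 * \<alpha>))"
        using V lnV cV appr by (intro exI[of _ V]) blast
    qed
  qed
qed

section \<open>Empirical risk minimisation\<close>

text \<open>For negative x = - y the claim is multiplied by exp y \<ge> 1 + y and follows from (1 +
  y) (1 - y + y^2) = 1 + y^3.\<close>

lemma exp_le_quadratic:
  fixes x :: real assumes "x \<le> 1" shows "exp x \<le> 1 + x + x\<^sup>2"
proof (cases "x \<ge> 0")
  case True
  then show ?thesis using exp_bound assms by blast
next
  case False
  define y where "y = - x"
  have y: "y > 0" using False by (simp add: y_def)
  have "(1 + y) * exp x \<le> exp y * exp x" by (intro mult_right_mono exp_ge_add_one_self) auto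
  also have "\<dots> = 1" by (simp add: y_def flip: exp_add)
  also have "1 \<le> (1 + y) * (1 + x + x\<^sup>2)"
  proof -
    have "(1 + y) * (1 + x + x\<^sup>2) = 1 + y ^ 3" by (simp add: y_def algebra_simps power2_eq_square power3_eq_cube)
    then show ?thesis using y by simp
  qed
  finally show ?thesis using y by simp
qed

text \<open>Since \<open>ln x \<le> x - 1\<close>, the maximum over the candidates of the exponentially normalised
  log-likelihood gaps costs only \<open>ln (card U)\<close> in expectation.\<close>

lemma erm_risk:
  fixes L :: "'u \<Rightarrow> 'z \<Rightarrow> real" and D :: "'u \<Rightarrow> real"
  assumes P: "prob_space P" and U: "finite U" "U \<noteq> {}" "u0 \<in> U" and n: "n \<ge> (1::nat)"
    and m: "\<And>u. u \<in> U \<Longrightarrow> (\<lambda>z. L u z - L0 z) \<in> borel_measurable P"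
    and b: "\<And>u z. u \<in> U \<Longrightarrow> z \<in> space P \<Longrightarrow> \<bar>L u z - L0 z\<bar> \<le> b"
    and e: "\<And>u. u \<in> U \<Longrightarrow> (\<integral>z. exp (- (l * (L u z - L0 z))) \<partial>P) \<le> exp (- (\<kappa> * D u))"
    and q: "(\<integral>z. L u0 z - L0 z \<partial>P) \<le> c * D u0" and pos: "l > 0" "\<kappa> > 0"
    and D: "\<And>u. D u \<ge> 0"
    and sel: "\<And>s. s \<in> space (\<Pi>\<^sub>M i\<in>{..<n}. P) \<Longrightarrow> sel s \<in> U \<and> (\<Sum>i<n. L (sel s) (s i)) \<le> (\<Sum>i<n. L u0 (s i))"
  shows "(\<integral>\<^sup>+s. ennreal (D (sel s)) \<partial>(\<Pi>\<^sub>M i\<in>{..<n}. P))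
    \<le> ennreal ((ln (real (card U)) / real n + l * c * D u0) / \<kappa>)"
proof -
  interpret pr: prob_space P by fact
  interpret PS: product_prob_space "\<lambda>i. P" "{..<n}" by unfold_locales
  let ?Q = "\<Pi>\<^sub>M i\<in>{..<n}. P"
  have Q1: "measure ?Q (space ?Q) = 1"
    by (rule prob_space.prob_space, rule prob_space_PiM, rule P)
  define Z where "Z u z = L u z - L0 z" for u z
  have cU: "card U \<ge> 1" using U by (simp add: Suc_leI card_gt_0_iff)
  have iZ: "integrable P (Z u)" if "u \<in> U" for u
    using m[OF that] b[OF that] by (intro pr.integrable_const_bound[where B = b]) (auto simp: Z_def[abs_def])
  have iE: "integrable P (\<lambda>z. exp (- (l * Z u z)))" if "u \<in> U" for u
  proof (rule pr.integrable_const_bound[where B = "exp (l * b)"])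
    show "AE z in P. norm (exp (- (l * Z u z))) \<le> exp (l * b)"
    proof (rule AE_I2)
      fix z assume "z \<in> space P"
      then have "\<bar>Z u z\<bar> \<le> b" using b[OF that] by (simp add: Z_def)
      then have "- Z u z \<le> b" by linarith
      then have "l * (- Z u z) \<le> l * b" using pos by (intro mult_left_mono) auto
      then show "norm (exp (- (l * Z u z))) \<le> exp (l * b)" by simp
    qed
    show "(\<lambda>z. exp (- (l * Z u z))) \<in> borel_measurable P"
      using m[OF that] unfolding Z_def by measurable
  qed
  \<comment> \<open>The exponential weight of candidate u on the whole sample; by independence its
    mean is at most exp (- n \<kappa> D u).\<close>
  define W where "W u s = (\<Prod>i<n. exp (- (l * Z u (s i))))" for u s
  have Wi: "integrable ?Q (W u)" "(\<integral>s. W u s \<partial>?Q) \<le> exp (- (real n * \<kappa> * D u))" if "u \<in> U" for u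
  proof -
    show "integrable ?Q (W u)"
      unfolding W_def using iE[OF that] by (intro PS.product_integrable_prod) auto
    have "(\<integral>s. W u s \<partial>?Q) = (\<Prod>i<n. \<integral>z. exp (- (l * Z u z)) \<partial>P)"
      unfolding W_def using iE[OF that] by (intro PS.product_integral_prod) auto
    also have "\<dots> \<le> (\<Prod>i<n. exp (- (\<kappa> * D u)))"
      using e[OF that] by (intro prod_mono) (auto simp: Z_def)
    also have "\<dots> = exp (- (real n * \<kappa> * D u))" by (simp flip: exp_of_nat_mult)
    finally show "(\<integral>s. W u s \<partial>?Q) \<le> exp (- (real n * \<kappa> * D u))" .
  qed
  have iZn: "integrable ?Q (\<lambda>s. Z u0 (s i))" "(\<integral>s. Z u0 (s i) \<partial>?Q) = (\<integral>z. Z u0 z \<partial>P)" if "i < n" for i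
  proof -
    have d: "distr ?Q P (\<lambda>s. s i) = P" by (rule PS.PiM_component) (use that in auto)
    have mi: "(\<lambda>s. s i) \<in> measurable ?Q P" using that by (intro measurable_component_singleton) auto
    have "integrable (distr ?Q P (\<lambda>s. s i)) (Z u0)" unfolding d by (rule iZ[OF U(3)])
    then show "integrable ?Q (\<lambda>s. Z u0 (s i))" by (rule integrable_distr[OF mi])
    show "(\<integral>s. Z u0 (s i) \<partial>?Q) = (\<integral>z. Z u0 z \<partial>P)"
      using integral_distr[OF mi, of "Z u0"] iZ[OF U(3)] by (simp add: d)
  qed
  \<comment> \<open>A bound for the distance of the selected candidate that no longer depends on the
    selection: the weights are summed over all candidates, and the empirical gap of the selected one
    is replaced by the larger gap of \<open>u0\<close>.\<close>
  define R where "R s = (ln (real (card U)) - 1 + (\<Sum>u\<in>U. exp (real n * \<kappa> * D u) * W u s) / real (card U)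
    + l * (\<Sum>i<n. Z u0 (s i))) / (real n * \<kappa>)" for s
  have nk: "real n * \<kappa> > 0" using n pos by simp
  have DR: "D (sel s) \<le> R s" if s: "s \<in> space ?Q" for s
  proof -
    let ?u = "sel s"
    have u: "?u \<in> U" "(\<Sum>i<n. L ?u (s i)) \<le> (\<Sum>i<n. L u0 (s i))" using sel[OF s] by auto
    have Zs: "(\<Sum>i<n. Z ?u (s i)) \<le> (\<Sum>i<n. Z u0 (s i))" using u(2) by (simp add: Z_def sum_subtractf)
    define w where "w = real n * \<kappa> * D ?u - l * (\<Sum>i<n. Z ?u (s i))"
    have "exp w = exp (real n * \<kappa> * D ?u) * W ?u s"
      by (simp add: w_def W_def exp_diff exp_minus sum_distrib_left exp_sum prod_inversef[symmetric] divide_inverse)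
    also have "\<dots> \<le> (\<Sum>u\<in>U. exp (real n * \<kappa> * D u) * W u s)"
      using U u(1) by (intro member_le_sum) (auto simp: W_def intro!: mult_nonneg_nonneg prod_nonneg)
    finally have ew: "exp w \<le> (\<Sum>u\<in>U. exp (real n * \<kappa> * D u) * W u s)" .
    have "w - ln (real (card U)) = ln (exp w / real (card U))" using cU by (simp add: ln_div)
    also have "\<dots> \<le> exp w / real (card U) - 1" using cU by (intro ln_le_minus_one) auto
    also have "\<dots> \<le> (\<Sum>u\<in>U. exp (real n * \<kappa> * D u) * W u s) / real (card U) - 1"
      using ew by (intro diff_right_mono divide_right_mono) auto
    finally have "real n * \<kappa> * D ?u \<le> ln (real (card U)) - 1 + (\<Sum>u\<in>U. exp (real n * \<kappa> * D u) * W u s) / real (card U)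
       + l * (\<Sum>i<n. Z ?u (s i))" by (simp add: w_def)
    also have "l * (\<Sum>i<n. Z ?u (s i)) \<le> l * (\<Sum>i<n. Z u0 (s i))" using Zs pos by (intro mult_left_mono) auto
    finally have "D ?u * (real n * \<kappa>) \<le> ln (real (card U)) - 1 + (\<Sum>u\<in>U. exp (real n * \<kappa> * D u) * W u s) / real (card U)
       + l * (\<Sum>i<n. Z u0 (s i))" by (simp add: mult_ac)
    then show ?thesis unfolding R_def using nk by (simp add: pos_le_divide_eq)
  qed
  have iR: "integrable ?Q R"
    unfolding R_def using Wi(1) iZn(1) by (auto intro!: Bochner_Integration.integrable_add Bochner_Integration.integrable_sum integrable_mult_right integrable_divide)
  have "(\<integral>s. R s \<partial>?Q) = (ln (real (card U)) - 1 + (\<Sum>u\<in>U. exp (real n * \<kappa> * D u) * (\<integral>s. W u s \<partial>?Q)) / real (card U)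
    + l * (\<Sum>i<n. \<integral>z. Z u0 z \<partial>P)) / (real n * \<kappa>)"
  proof -
    have 1: "(\<integral>s. (\<Sum>u\<in>U. exp (real n * \<kappa> * D u) * W u s) \<partial>?Q) = (\<Sum>u\<in>U. exp (real n * \<kappa> * D u) * (\<integral>s. W u s \<partial>?Q))"
      using Wi(1) by (subst Bochner_Integration.integral_sum) auto
    have 2: "(\<integral>s. (\<Sum>i<n. Z u0 (s i)) \<partial>?Q) = (\<Sum>i<n. \<integral>z. Z u0 z \<partial>P)"
      using iZn by (subst Bochner_Integration.integral_sum) auto
    have i1: "integrable ?Q (\<lambda>s. \<Sum>u\<in>U. exp (real n * \<kappa> * D u) * W u s)" using Wi(1) by auto
    have i2: "integrable ?Q (\<lambda>s. \<Sum>i<n. Z u0 (s i))" using iZn(1) by auto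
    show ?thesis unfolding R_def using i1 i2 by (simp add: 1 2 Q1)
  qed
  \<comment> \<open>Each normalised weight has mean at most 1, so their average cancels the - 1 that
    comes from ln x \<le> x - 1.\<close>
  also have "\<dots> \<le> (ln (real (card U)) - 1 + (\<Sum>u\<in>U. 1) / real (card U) + l * (\<Sum>i<n. c * D u0)) / (real n * \<kappa>)"
  proof (intro divide_right_mono add_mono mult_left_mono sum_mono order_refl)
    fix u assume "u \<in> U"
    have "exp (real n * \<kappa> * D u) * (\<integral>s. W u s \<partial>?Q) \<le> exp (real n * \<kappa> * D u) * exp (- (real n * \<kappa> * D u))"
      using Wi(2)[OF \<open>u \<in> U\<close>] by (intro mult_left_mono) auto
    then show "exp (real n * \<kappa> * D u) * (\<integral>s. W u s \<partial>?Q) \<le> 1" by (simp flip: exp_add)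
  qed (use q nk pos in \<open>auto simp: Z_def\<close>)
  also have "\<dots> = (ln (real (card U)) / real n + l * c * D u0) / \<kappa>"
    using n pos cU by (simp add: field_simps)
  finally have R: "(\<integral>s. R s \<partial>?Q) \<le> (ln (real (card U)) / real n + l * c * D u0) / \<kappa>" .
  have "(\<integral>\<^sup>+s. ennreal (D (sel s)) \<partial>?Q) \<le> (\<integral>\<^sup>+s. ennreal (R s) \<partial>?Q)"
    using DR by (intro nn_integral_mono ennreal_leI)
  also have "\<dots> = ennreal (\<integral>s. R s \<partial>?Q)"
    using DR D by (intro nn_integral_eq_integral iR AE_I2) (meson order_trans)
  also have "\<dots> \<le> ennreal ((ln (real (card U)) / real n + l * c * D u0) / \<kappa>)"
    using R by (intro ennreal_leI)
  finally show ?thesis .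
qed

text \<open>Knight's identity. The first part is linear in t; the second is nonnegative and lives
  between w = 0 and w = t.\<close>

lemma check_loss_diff:
  "check_loss p (w - t) - check_loss p w = t * ((if w < 0 then 1 else 0) - p)
    + (if 0 \<le> w \<and> w < t then t - w else if t \<le> w \<and> w < 0 then w - t else 0)"
  by (auto simp: check_loss_def algebra_simps)

lemma check_loss_lipschitz:
  assumes "0 \<le> p" "p \<le> 1" shows "\<bar>check_loss p x - check_loss p y\<bar> \<le> \<bar>x - y\<bar>"
proof -
  have eq: "check_loss p x = p * max x 0 + (1 - p) * max (- x) 0" for x
    by (auto simp: check_loss_def max_def algebra_simps)
  have "check_loss p x - check_loss p y = p * (max x 0 - max y 0) + (1 - p) * (max (- x) 0 - max (- y) 0)"
    by (simp add: eq algebra_simps)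
  also have "\<bar>\<dots>\<bar> \<le> p * \<bar>max x 0 - max y 0\<bar> + (1 - p) * \<bar>max (- x) 0 - max (- y) 0\<bar>"
    using assms by (intro order_trans[OF abs_triangle_ineq]) (simp add: abs_mult)
  also have "\<dots> \<le> p * \<bar>x - y\<bar> + (1 - p) * \<bar>x - y\<bar>"
    using assms by (intro add_mono mult_left_mono) (auto simp: max_def)
  finally show ?thesis by (simp add: algebra_simps)
qed

lemma check_loss_measurable [measurable]: "check_loss p \<in> borel_measurable borel"
  unfolding check_loss_def[abs_def] by measurable

text \<open>The nonlinear part of a check loss difference, as a function of the error, is a triangle
  of base t / \<sigma> and height t; the second statement is its mirror image for negative
  shifts.\<close>

lemma triangle_integral:
  assumes "t \<ge> 0" "\<sigma> > (0::real)"
  shows "has_bochner_integral lborel (\<lambda>e. (t - \<sigma> * e) * indicator {0..t / \<sigma>} e) (t\<^sup>2 / (2 * \<sigma>))"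
    and "has_bochner_integral lborel (\<lambda>e. (t + \<sigma> * e) * indicator {- t / \<sigma>..0} e) (t\<^sup>2 / (2 * \<sigma>))"
proof -
  have "has_bochner_integral lborel (\<lambda>e. (t - \<sigma> * e) * indicator {0..t / \<sigma>} e)
      ((t * (t / \<sigma>) - \<sigma> * (t / \<sigma>)\<^sup>2 / 2) - (t * 0 - \<sigma> * 0\<^sup>2 / 2))"
    by (rule has_bochner_integral_FTC_Icc_real[where F = "\<lambda>e. t * e - \<sigma> * e\<^sup>2 / 2"])
      (use assms in \<open>auto intro!: derivative_eq_intros\<close>)
  then show 1: "has_bochner_integral lborel (\<lambda>e. (t - \<sigma> * e) * indicator {0..t / \<sigma>} e) (t\<^sup>2 / (2 * \<sigma>))"
    using assms by (simp add: power2_eq_square field_simps)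
  have "(\<lambda>e. (t + \<sigma> * e) * indicator {- t / \<sigma>..0} e) = (\<lambda>e. (t - \<sigma> * (0 + (- 1) * e)) * indicator {0..t / \<sigma>} (0 + (- 1) * e))"
    by (auto simp: fun_eq_iff indicator_def field_simps)
  then show "has_bochner_integral lborel (\<lambda>e. (t + \<sigma> * e) * indicator {- t / \<sigma>..0} e) (t\<^sup>2 / (2 * \<sigma>))"
    using 1 lborel_has_bochner_integral_real_affine_iff[of "- 1" "\<lambda>e. (t - \<sigma> * e) * indicator {0..t / \<sigma>} e" "t\<^sup>2 / (2 * \<sigma>)" 0]
    by simp
qed

text \<open>Excess check loss at level \<open>p = P(\<epsilon> < 0)\<close>: its linear part has mean zero, its nonnegative
  part is supported where the density is bounded above and below.\<close>

lemma check_loss_excess: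
  fixes f :: "real \<Rightarrow> real"
  assumes f: "continuous_on UNIV f" "\<And>y. 0 < f y" "has_bochner_integral lborel f 1"
    and s: "0 < s1" "s1 \<le> s2" and M: "M > 0"
  defines "p \<equiv> \<integral>e. indicator {..<0} e * f e \<partial>lborel"
  obtains c1 c2 where "c1 > 0" "c2 > 0"
    "\<And>t \<sigma>. \<bar>t\<bar> \<le> M \<Longrightarrow> s1 \<le> \<sigma> \<Longrightarrow> \<sigma> \<le> s2 \<Longrightarrow>
       c1 * t\<^sup>2 \<le> (\<integral>e. f e * (check_loss p (\<sigma> * e - t) - check_loss p (\<sigma> * e)) \<partial>lborel) \<and>
       (\<integral>e. f e * (check_loss p (\<sigma> * e - t) - check_loss p (\<sigma> * e)) \<partial>lborel) \<le> c2 * t\<^sup>2"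
    "0 \<le> p" "p \<le> 1"
proof -
  have int: "integrable lborel f" "integral\<^sup>L lborel f = 1" using f(3) by (auto simp: has_bochner_integral_iff)
  have mf [measurable]: "f \<in> borel_measurable borel" using f(1) by (rule borel_measurable_continuous_onI)
  \<comment> \<open>The nonlinear part vanishes unless \<sigma> e lies between 0 and t, hence |e|
    \<le> M / s1. On this compact interval the positive continuous density has a positive minimum
    and a finite maximum.\<close>
  let ?J = "{- (M / s1)..M / s1}"
  have J: "compact ?J" "?J \<noteq> {}" using M s by auto
  obtain a where a: "\<And>y. y \<in> ?J \<Longrightarrow> f a \<le> f y"
    using continuous_attains_inf[OF J continuous_on_subset[OF f(1)]] by blast
  obtain b where b: "\<And>y. y \<in> ?J \<Longrightarrow> f y \<le> f b"
    using continuous_attains_sup[OF J continuous_on_subset[OF f(1)]] by blast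
  have i0: "integrable lborel (\<lambda>e. indicator {..<0} e * f e)"
    using int by (intro Bochner_Integration.integrable_bound[OF int(1)]) (auto simp: indicator_def)
  have p0: "0 \<le> p" unfolding p_def using f(2) by (intro Bochner_Integration.integral_nonneg) (auto simp: less_imp_le)
  have "p \<le> integral\<^sup>L lborel f" unfolding p_def
    using f(2) by (intro integral_mono i0 int) (auto simp: indicator_def less_imp_le)
  then have p1: "p \<le> 1" using int by simp
  have main: "f a / (2 * s2) * t\<^sup>2 \<le> (\<integral>e. f e * (check_loss p (\<sigma> * e - t) - check_loss p (\<sigma> * e)) \<partial>lborel) \<and>
       (\<integral>e. f e * (check_loss p (\<sigma> * e - t) - check_loss p (\<sigma> * e)) \<partial>lborel) \<le> f b / (2 * s1) * t\<^sup>2"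
    if t: "\<bar>t\<bar> \<le> M" and \<sigma>: "s1 \<le> \<sigma>" "\<sigma> \<le> s2" for t \<sigma>
  proof -
    have sp: "\<sigma> > 0" using s \<sigma> by simp
    define q where "q e = (if t \<ge> 0 then (t - \<sigma> * e) * indicator {0..t / \<sigma>} e else (- t + \<sigma> * e) * indicator {t / \<sigma>..0} e)" for e
    have hq: "has_bochner_integral lborel q (t\<^sup>2 / (2 * \<sigma>))"
      using triangle_integral(1)[of t \<sigma>] triangle_integral(2)[of "- t" \<sigma>] sp
      by (cases "t \<ge> 0") (simp_all add: q_def[abs_def])
    have iq: "integrable lborel q" using hq by (simp add: has_bochner_integral_iff)
    have qpos: "q e \<ge> 0" for e
      using sp by (auto simp: q_def indicator_def field_simps)
    have qJ: "e \<in> ?J" if "q e \<noteq> 0" for e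
    proof -
      have "\<bar>e\<bar> \<le> \<bar>t\<bar> / \<sigma>" using that sp by (auto simp: q_def indicator_def field_simps split: if_splits)
      also have "\<dots> \<le> M / s1" using t \<sigma> s M by (intro frac_le) auto
      finally show ?thesis by auto
    qed
    have bnd: "f a * q e \<le> f e * q e" "f e * q e \<le> f b * q e" for e
    proof -
      show "f a * q e \<le> f e * q e" using a qJ qpos by (cases "q e = 0") (auto intro: mult_right_mono)
      show "f e * q e \<le> f b * q e" using b qJ qpos by (cases "q e = 0") (auto intro: mult_right_mono)
    qed
    have mq [measurable]: "q \<in> borel_measurable borel" using iq by auto
    have ifq: "integrable lborel (\<lambda>e. f e * q e)"
    proof (rule Bochner_Integration.integrable_bound[of _ "\<lambda>e. f b * q e"])
      show "AE e in lborel. norm (f e * q e) \<le> norm (f b * q e)"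
      proof (rule AE_I2)
        fix e
        have "0 \<le> f e * q e" using f(2)[of e] qpos[of e] by simp
        then show "norm (f e * q e) \<le> norm (f b * q e)" using bnd(2)[of e] by simp
      qed
    qed (use iq in auto)
    \<comment> \<open>For t < 0 the closed indicator in \<open>q\<close> includes e = 0, where the
      nonlinear part is zero, so this point is discarded. At \<sigma> e = t both expressions
      vanish.\<close>
    have ae: "AE e in lborel. f e * (check_loss p (\<sigma> * e - t) - check_loss p (\<sigma> * e))
        = t * (indicator {..<0} e * f e - p * f e) + f e * q e"
    proof (rule AE_mp[OF AE_lborel_singleton[of 0] AE_I2], rule impI)
      fix e :: real assume e: "e \<noteq> 0"
      have "(if 0 \<le> \<sigma> * e \<and> \<sigma> * e < t then t - \<sigma> * e else if t \<le> \<sigma> * e \<and> \<sigma> * e < 0 then \<sigma> * e - t else 0) = q e"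
      proof -
        define w where "w = \<sigma> * e"
        have w: "w \<noteq> 0" "e \<in> {0..t / \<sigma>} \<longleftrightarrow> 0 \<le> w \<and> w \<le> t" "e \<in> {t / \<sigma>..0} \<longleftrightarrow> t \<le> w \<and> w \<le> 0"
          using e sp by (auto simp: w_def field_simps zero_le_mult_iff mult_le_0_iff)
        show ?thesis unfolding q_def w_def[symmetric] indicator_def w(2,3) using w(1) by auto
      qed
      moreover have "(if \<sigma> * e < 0 then 1 else 0) = (indicator {..<0} e :: real)"
        using sp by (auto simp: indicator_def mult_less_0_iff)
      ultimately show "f e * (check_loss p (\<sigma> * e - t) - check_loss p (\<sigma> * e))
        = t * (indicator {..<0} e * f e - p * f e) + f e * q e"
        unfolding check_loss_diff by (simp add: algebra_simps)
    qed
    have "(\<integral>e. f e * (check_loss p (\<sigma> * e - t) - check_loss p (\<sigma> * e)) \<partial>lborel)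
       = (\<integral>e. t * (indicator {..<0} e * f e - p * f e) + f e * q e \<partial>lborel)"
      by (rule integral_cong_AE[OF _ _ ae]) measurable
    also have "\<dots> = t * (p - p * 1) + (\<integral>e. f e * q e \<partial>lborel)"
      using i0 int ifq by (simp add: p_def)
    finally have eq: "(\<integral>e. f e * (check_loss p (\<sigma> * e - t) - check_loss p (\<sigma> * e)) \<partial>lborel) = (\<integral>e. f e * q e \<partial>lborel)" by simp
    have "(\<integral>e. f a * q e \<partial>lborel) \<le> (\<integral>e. f e * q e \<partial>lborel)"
      using iq ifq bnd by (intro integral_mono) auto
    moreover have "(\<integral>e. f e * q e \<partial>lborel) \<le> (\<integral>e. f b * q e \<partial>lborel)"
      using iq ifq bnd by (intro integral_mono) auto
    moreover have "(\<integral>e. f a * q e \<partial>lborel) = f a * (t\<^sup>2 / (2 * \<sigma>))" "(\<integral>e. f b * q e \<partial>lborel) = f b * (t\<^sup>2 / (2 * \<sigma>))"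
      using hq by (simp_all add: has_bochner_integral_iff)
    moreover have "f a / (2 * s2) * t\<^sup>2 \<le> f a * (t\<^sup>2 / (2 * \<sigma>))"
    proof -
      have "t\<^sup>2 / (2 * s2) \<le> t\<^sup>2 / (2 * \<sigma>)" using sp \<sigma> by (intro divide_left_mono) auto
      then have "f a * (t\<^sup>2 / (2 * s2)) \<le> f a * (t\<^sup>2 / (2 * \<sigma>))" using f(2)[of a] by (intro mult_left_mono) auto
      then show ?thesis by simp
    qed
    moreover have "f b * (t\<^sup>2 / (2 * \<sigma>)) \<le> f b / (2 * s1) * t\<^sup>2"
    proof -
      have "t\<^sup>2 / (2 * \<sigma>) \<le> t\<^sup>2 / (2 * s1)" using sp s \<sigma> by (intro divide_left_mono) auto
      then have "f b * (t\<^sup>2 / (2 * \<sigma>)) \<le> f b * (t\<^sup>2 / (2 * s1))" using f(2)[of b] by (intro mult_left_mono) auto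
      then show ?thesis by simp
    qed
    ultimately show ?thesis unfolding eq by simp
  qed
  show ?thesis
    by (rule that[of "f a / (2 * s2)" "f b / (2 * s1)"]) (use main f(2) s p0 p1 in auto)
qed

section \<open>The law of an observation\<close>

lemma density_classD:
  fixes h :: "real ^ 'd::finite \<Rightarrow> real"
  assumes "h \<in> density_class B" "B > 1"
  shows "h \<in> borel_measurable cube_measure" "\<And>x. x \<in> unit_cube \<Longrightarrow> 0 < h x"
    "\<And>x. x \<in> unit_cube \<Longrightarrow> h x \<le> B" "integrable cube_measure h" "integral\<^sup>L cube_measure h = 1"
proof -
  show m: "h \<in> borel_measurable cube_measure" and "integral\<^sup>L cube_measure h = 1"
    using assms by (auto simp: density_class_def)
  have hb: "1 / B \<le> h x \<and> h x \<le> B" if "x \<in> unit_cube" for x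
    using assms that by (auto simp: density_class_def)
  have pB: "0 < 1 / B" using assms by simp
  show p: "0 < h x" if "x \<in> unit_cube" for x using less_le_trans[OF pB] hb[OF that] by blast
  show B: "h x \<le> B" if "x \<in> unit_cube" for x using hb[OF that] by blast
  show "integrable cube_measure h"
  proof (rule cube.integrable_const_bound[where B = B])
    show "AE x in cube_measure. norm (h x) \<le> B"
    proof (rule AE_I2)
      fix x :: "real ^ 'd" assume "x \<in> space cube_measure"
      then show "norm (h x) \<le> B" using p[of x] B[of x] by simp
    qed
  qed (rule m)
qed

lemma emeasure_density_space:
  "f \<in> borel_measurable M \<Longrightarrow> emeasure (density M f) (space (density M f)) = (\<integral>\<^sup>+x. f x \<partial>M)"
  by (subst emeasure_density) (auto intro!: nn_integral_cong)

lemma prob_space_design: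
  assumes "h \<in> density_class B" "B > 1" shows "prob_space (density cube_measure (\<lambda>x. ennreal (h x)))"
proof
  note h = density_classD[OF assms]
  have "(\<integral>\<^sup>+x. ennreal (h x) \<partial>cube_measure) = ennreal (integral\<^sup>L cube_measure h)"
    using h by (intro nn_integral_eq_integral AE_I2) (auto simp: less_imp_le)
  then show "emeasure (density cube_measure (\<lambda>x. ennreal (h x))) (space (density cube_measure (\<lambda>x. ennreal (h x)))) = 1"
    using h(1,5) by (subst emeasure_density_space) auto
qed

lemma prob_space_error:
  assumes "f \<in> borel_measurable borel" "\<And>y. 0 \<le> f y" "has_bochner_integral lborel f 1"
  shows "prob_space (density lborel (\<lambda>e. ennreal (f e)))"
proof
  have "(\<integral>\<^sup>+x. ennreal (f x) \<partial>lborel) = ennreal (integral\<^sup>L lborel f)"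
    using assms by (intro nn_integral_eq_integral AE_I2) (auto simp: has_bochner_integral_iff)
  then show "emeasure (density lborel (\<lambda>e. ennreal (f e))) (space (density lborel (\<lambda>e. ennreal (f e)))) = 1"
    using assms(1,3) by (subst emeasure_density_space) (auto simp: has_bochner_integral_iff)
qed

lemma scale_classD:
  assumes "\<sigma> \<in> scale_class B"
  shows "continuous_on UNIV (\<sigma> :: real ^ 'd::finite \<Rightarrow> real)"
    "\<And>x. x \<in> unit_cube \<Longrightarrow> exp (- (real CARD('d) * B)) \<le> \<sigma> x \<and> \<sigma> x \<le> exp (real CARD('d) * B)"
proof -
  obtain c :: "real ^ 'd" where c: "Max (range (\<lambda>i. \<bar>c $ i\<bar>)) \<le> B" "\<sigma> = (\<lambda>x. exp (\<Sum>i\<in>UNIV. c $ i * x $ i))"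
    using assms by (auto simp: scale_class_def)
  show "continuous_on UNIV \<sigma>" unfolding c(2) by (intro continuous_intros)
  fix x :: "real ^ 'd" assume x: "x \<in> unit_cube"
  have ci: "\<bar>c $ i\<bar> \<le> B" for i using c(1) by simp
  have "\<bar>\<Sum>i\<in>UNIV. c $ i * x $ i\<bar> \<le> (\<Sum>i\<in>(UNIV :: 'd set). B)"
  proof (rule order_trans[OF sum_abs sum_mono])
    fix i
    have "\<bar>c $ i\<bar> * \<bar>x $ i\<bar> \<le> B * 1"
      using x ci[of i] by (intro mult_mono) (auto simp: mem_box_cart intro: order_trans[OF abs_ge_zero])
    then show "\<bar>c $ i * x $ i\<bar> \<le> B" by (simp add: abs_mult)
  qed
  then have "\<bar>\<Sum>i\<in>UNIV. c $ i * x $ i\<bar> \<le> real CARD('d) * B" by simp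
  then show "exp (- (real CARD('d) * B)) \<le> \<sigma> x \<and> \<sigma> x \<le> exp (real CARD('d) * B)"
    unfolding c(2) by (simp add: abs_le_iff)
qed

text \<open>Collects what the law of one observation requires, so that it can be instantiated with
  the true \<mu>, with a bounded version of it, and with \<sigma> = h = 1 in the lower
  bound.\<close>

locale regression =
  fixes f :: "real \<Rightarrow> real" and \<mu> \<sigma> h :: "real ^ 'd::finite \<Rightarrow> real"
  assumes mf [measurable]: "f \<in> borel_measurable borel" and f0: "\<And>y. 0 \<le> f y" and f1: "has_bochner_integral lborel f 1"
    and m\<mu>: "\<mu> \<in> borel_measurable cube_measure" and m\<sigma>: "\<sigma> \<in> borel_measurable cube_measure"
    and mh: "h \<in> borel_measurable cube_measure" and h0: "\<And>x. x \<in> unit_cube \<Longrightarrow> 0 \<le> h x"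
    and h1: "prob_space (density cube_measure (\<lambda>x. ennreal (h x)))"
begin

abbreviation "MX \<equiv> density cube_measure (\<lambda>x. ennreal (h x))"
abbreviation "ME \<equiv> density lborel (\<lambda>e. ennreal (f e))"

sublocale X: prob_space MX by (rule h1)
sublocale E: prob_space ME by (rule prob_space_error[OF mf f0 f1])
sublocale XE: pair_prob_space MX ME ..

lemma measurable_obs:
  "(\<lambda>(x, e). (x, \<mu> x + \<sigma> x * e)) \<in> measurable (MX \<Otimes>\<^sub>M ME) borel"
proof -
  have 1: "fst \<in> borel_measurable (MX \<Otimes>\<^sub>M ME)"
  proof (rule measurable_compose[OF measurable_fst])
    show "(\<lambda>x. x) \<in> measurable MX borel"
      by (auto simp: measurable_cong_sets[OF sets_density refl] cube_measure_def intro!: measurable_restrict_space1)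
  qed
  have 2: "(\<lambda>z. \<mu> (fst z)) \<in> borel_measurable (MX \<Otimes>\<^sub>M ME)" "(\<lambda>z. \<sigma> (fst z)) \<in> borel_measurable (MX \<Otimes>\<^sub>M ME)"
    using m\<mu> m\<sigma> by (auto intro!: measurable_compose[OF measurable_fst] simp: measurable_cong_sets[OF sets_density refl])
  have 3: "snd \<in> borel_measurable (MX \<Otimes>\<^sub>M ME)"
    by (rule measurable_compose[OF measurable_snd]) simp
  have "(\<lambda>z. (fst z, \<mu> (fst z) + \<sigma> (fst z) * snd z)) \<in> measurable (MX \<Otimes>\<^sub>M ME) (borel \<Otimes>\<^sub>M borel)"
    by (intro measurable_Pair borel_measurable_add borel_measurable_times 1 2 3)
  then show ?thesis by (simp add: borel_prod case_prod_beta')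
qed

lemma prob_space_obs: "prob_space (obs_law f \<mu> \<sigma> h)"
  unfolding obs_law_def by (rule XE.prob_space_distr[OF measurable_obs])

text \<open>Regression functions of the class are bounded only almost everywhere; this allows
  passing to a bounded Borel version without changing the law of the data.\<close>

lemma obs_law_AE_cong:
  assumes "AE x in cube_measure. \<mu> x = \<mu>' x" "\<mu>' \<in> borel_measurable cube_measure"
  shows "obs_law f \<mu> \<sigma> h = obs_law f \<mu>' \<sigma> h"
proof -
  have r: "regression f \<mu>' \<sigma> h" using regression_axioms assms(2) by (simp add: regression_def)
  have mm: "(\<lambda>x. \<mu> x - \<mu>' x) \<in> borel_measurable MX" using m\<mu> assms(2) by simp
  have "AE x in MX. \<mu> x = \<mu>' x"
    using assms(1) mh by (subst AE_density) auto
  then have "AE x in MX. AE e in ME. (\<lambda>z. \<mu> (fst z) = \<mu>' (fst z)) (x, e)" by eventually_elim simp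
  then have "AE z in MX \<Otimes>\<^sub>M ME. \<mu> (fst z) = \<mu>' (fst z)"
  proof (rule XE.AE_pair_measure[rotated])
    have "(\<lambda>z. \<mu> (fst z) - \<mu>' (fst z)) \<in> borel_measurable (MX \<Otimes>\<^sub>M ME)"
      by (rule measurable_compose[OF measurable_fst mm])
    then have "{z \<in> space (MX \<Otimes>\<^sub>M ME). \<mu> (fst z) - \<mu>' (fst z) = 0} \<in> sets (MX \<Otimes>\<^sub>M ME)" by measurable
    then show "{z \<in> space (MX \<Otimes>\<^sub>M ME). \<mu> (fst z) = \<mu>' (fst z)} \<in> sets (MX \<Otimes>\<^sub>M ME)" by simp
  qed
  then show ?thesis
    unfolding obs_law_def using measurable_obs regression.measurable_obs[OF r]
    by (intro distr_cong_AE) (auto simp: case_prod_beta')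
qed

text \<open>Fubini with the error integrated first, so that estimates at a fixed design point, such
  as the excess check loss, apply under the integral over x.\<close>

lemma integral_obs:
  fixes \<phi> :: "(real ^ 'd) \<times> real \<Rightarrow> real"
  assumes m: "\<phi> \<in> borel_measurable borel" and b: "\<And>x e. x \<in> unit_cube \<Longrightarrow> \<bar>\<phi> (x, \<mu> x + \<sigma> x * e)\<bar> \<le> b"
  shows "(\<integral>z. \<phi> z \<partial>obs_law f \<mu> \<sigma> h) = (\<integral>x. h x * (\<integral>e. f e * \<phi> (x, \<mu> x + \<sigma> x * e) \<partial>lborel) \<partial>cube_measure)"
    and "integrable cube_measure (\<lambda>x. h x * (\<integral>e. f e * \<phi> (x, \<mu> x + \<sigma> x * e) \<partial>lborel))"
proof -
  let ?\<psi> = "\<lambda>z. \<phi> (fst z, \<mu> (fst z) + \<sigma> (fst z) * snd z)"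
  have mo: "(\<lambda>z. (fst z, \<mu> (fst z) + \<sigma> (fst z) * snd z)) \<in> measurable (MX \<Otimes>\<^sub>M ME) borel"
    using measurable_obs by (simp add: case_prod_beta')
  have m\<psi>: "?\<psi> \<in> borel_measurable (MX \<Otimes>\<^sub>M ME)" by (rule measurable_compose[OF mo m])
  have i: "integrable (MX \<Otimes>\<^sub>M ME) ?\<psi>"
    using m\<psi> b by (intro XE.integrable_const_bound[where B = b] AE_I2) (auto simp: space_pair_measure)
  have sl: "(\<lambda>e. \<phi> (x, \<mu> x + \<sigma> x * e)) \<in> borel_measurable borel" for x
    using m by (intro measurable_compose[OF _ m]) (simp add: borel_prod[symmetric])
  have inner: "(\<integral>e. \<phi> (x, \<mu> x + \<sigma> x * e) \<partial>ME) = (\<integral>e. f e * \<phi> (x, \<mu> x + \<sigma> x * e) \<partial>lborel)" for x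
    using sl[of x] f0 by (subst integral_density) auto
  have "(\<integral>z. \<phi> z \<partial>obs_law f \<mu> \<sigma> h) = (\<integral>z. ?\<psi> z \<partial>(MX \<Otimes>\<^sub>M ME))"
    unfolding obs_law_def using measurable_obs m by (subst integral_distr) (auto simp: case_prod_beta')
  also have "\<dots> = (\<integral>x. (\<integral>e. \<phi> (x, \<mu> x + \<sigma> x * e) \<partial>ME) \<partial>MX)"
    using XE.integral_fst'[OF i] by simp
  also have "\<dots> = (\<integral>x. (\<integral>e. f e * \<phi> (x, \<mu> x + \<sigma> x * e) \<partial>lborel) \<partial>MX)" by (simp only: inner)
  finally have 1: "(\<integral>z. \<phi> z \<partial>obs_law f \<mu> \<sigma> h) = (\<integral>x. (\<integral>e. f e * \<phi> (x, \<mu> x + \<sigma> x * e) \<partial>lborel) \<partial>MX)" .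
  have i2: "integrable MX (\<lambda>x. \<integral>e. f e * \<phi> (x, \<mu> x + \<sigma> x * e) \<partial>lborel)"
    using XE.integrable_fst'[OF i] by (simp only: inner fst_conv snd_conv)
  then have m2: "(\<lambda>x. \<integral>e. f e * \<phi> (x, \<mu> x + \<sigma> x * e) \<partial>lborel) \<in> borel_measurable cube_measure" by auto
  have ae: "AE x in cube_measure. 0 \<le> h x" using h0 by (intro AE_I2) simp
  show "(\<integral>z. \<phi> z \<partial>obs_law f \<mu> \<sigma> h) = (\<integral>x. h x * (\<integral>e. f e * \<phi> (x, \<mu> x + \<sigma> x * e) \<partial>lborel) \<partial>cube_measure)"
    unfolding 1 using integral_density[OF m2 mh ae] by simp
  show "integrable cube_measure (\<lambda>x. h x * (\<integral>e. f e * \<phi> (x, \<mu> x + \<sigma> x * e) \<partial>lborel))"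
    using i2 integrable_density[OF m2 mh ae] by simp
qed

end

text \<open>Candidates are enumerated by natural numbers and ties are resolved by the least index,
  so that the selection is a measurable map into a countable set.\<close>

definition erm_index :: "real \<Rightarrow> nat \<Rightarrow> (nat \<Rightarrow> real ^ 'd::finite \<Rightarrow> real) \<Rightarrow> nat \<Rightarrow> (nat \<Rightarrow> (real ^ 'd) \<times> real) \<Rightarrow> nat" where
  "erm_index p n u N s = (LEAST k. k < N \<and> (\<forall>j<N. (\<Sum>i<n. check_loss p (snd (s i) - u k (fst (s i))))
      \<le> (\<Sum>i<n. check_loss p (snd (s i) - u j (fst (s i))))))"

lemma erm_index:
  assumes "N > 0"
  shows "erm_index p n u N s < N" "j < N \<Longrightarrow> (\<Sum>i<n. check_loss p (snd (s i) - u (erm_index p n u N s) (fst (s i))))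
      \<le> (\<Sum>i<n. check_loss p (snd (s i) - u j (fst (s i))))"
proof -
  let ?R = "\<lambda>k. \<Sum>i<n. check_loss p (snd (s i) - u k (fst (s i)))"
  have "Min (?R ` {..<N}) \<in> ?R ` {..<N}" using assms by (intro Min_in) auto
  then obtain k where "k < N" "?R k = Min (?R ` {..<N})" by auto
  then have "k < N \<and> (\<forall>j<N. ?R k \<le> ?R j)" by (auto intro!: Min_le)
  then have "\<exists>k. k < N \<and> (\<forall>j<N. ?R k \<le> ?R j)" by (rule exI)
  from LeastI_ex[OF this] show "erm_index p n u N s < N" "j < N \<Longrightarrow> ?R (erm_index p n u N s) \<le> ?R j"
    unfolding erm_index_def by auto
qed

lemma measurable_argmin:
  fixes R :: "nat \<Rightarrow> 'z \<Rightarrow> real"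
  assumes [measurable]: "\<And>k. R k \<in> borel_measurable M"
  shows "(\<lambda>s. LEAST k. k < N \<and> (\<forall>j<N. R k s \<le> R j s)) \<in> measurable M (count_space UNIV)"
proof (rule measurable_Least)
  fix k
  have "Measurable.pred M (\<lambda>s. \<forall>j\<in>{..<N}. R k s \<le> R j s)" by measurable
  then have "Measurable.pred M (\<lambda>s. \<forall>j<N. R k s \<le> R j s)" by (simp add: Ball_def)
  then show "Measurable.pred M (\<lambda>s. k < N \<and> (\<forall>j<N. R k s \<le> R j s))" by simp
qed

text \<open>The index takes countably many values and every candidate is Borel, which gives joint
  measurability in the sample and the evaluation point.\<close>

lemma erm_estimator:
  assumes u: "\<And>k. u k \<in> borel_measurable borel"
  shows "(\<lambda>s. u (erm_index p n u N s)) \<in> estimators n"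
proof -
  let ?S = "\<Pi>\<^sub>M i\<in>{..<n}. (borel :: ((real ^ 'd) \<times> real) measure)"
  have R: "(\<lambda>s. \<Sum>i<n. check_loss p (snd (s i) - u k (fst (s i)))) \<in> borel_measurable ?S" for k
  proof (intro borel_measurable_sum)
    fix i assume "i \<in> {..<n}"
    then have si: "(\<lambda>s. s i) \<in> measurable ?S (borel \<Otimes>\<^sub>M borel)" by (simp add: borel_prod measurable_component_singleton)
    have "(\<lambda>z. check_loss p (snd z - u k (fst z))) \<in> borel_measurable (borel \<Otimes>\<^sub>M borel)" using u[of k] by measurable
    from measurable_compose[OF si this] show "(\<lambda>s. check_loss p (snd (s i) - u k (fst (s i)))) \<in> borel_measurable ?S" .
  qed
  have sel: "erm_index p n u N \<in> measurable ?S (count_space UNIV)"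
    unfolding erm_index_def[abs_def] by (rule measurable_argmin[OF R])
  have "(\<lambda>z. u (erm_index p n u N (fst z)) (snd z)) \<in> borel_measurable (?S \<Otimes>\<^sub>M cube_measure)"
  proof (rule measurable_compose_countable[where g = "\<lambda>z. erm_index p n u N (fst z)" and f = "\<lambda>k z. u k (snd z)"])
    show "(\<lambda>z. u k (snd z)) \<in> borel_measurable (?S \<Otimes>\<^sub>M cube_measure)" for k
      by (rule measurable_compose[OF measurable_snd measurable_cube_measure_borel[OF u]])
    show "(\<lambda>z. erm_index p n u N (fst z)) \<in> measurable (?S \<Otimes>\<^sub>M cube_measure) (count_space UNIV)"
      by (rule measurable_compose[OF measurable_fst sel])
  qed
  then show ?thesis by (simp add: estimators_def case_prod_beta')
qed

text \<open>The estimator is chosen before \<mu>, \<sigma>, h and the comparison candidate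
  \<open>u0\<close>, so the bound holds for the best candidate and uniformly over scales and design
  densities. The constant K is chosen before n and V, so it cannot depend on the net.\<close>

lemma regression_upper:
  fixes f :: "real \<Rightarrow> real" and B C' Cbar :: real
  assumes f: "continuous_on UNIV f" "\<And>y. 0 < f y" "has_bochner_integral lborel f 1"
    and B: "B > 0" and C': "C' > 0" and Cbar: "Cbar > 1"
  shows "\<exists>K\<ge>0. \<forall>n\<ge>1. \<forall>V :: (real ^ 'd::finite \<Rightarrow> real) set. finite V \<longrightarrow> V \<noteq> {} \<longrightarrow>
      (\<forall>u\<in>V. u \<in> borel_measurable borel \<and> (\<forall>x. \<bar>u x\<bar> \<le> B)) \<longrightarrow>
      (\<exists>m\<in>estimators n. \<forall>\<mu> \<sigma> h u0. \<mu> \<in> borel_measurable cube_measure \<longrightarrow> (AE x in cube_measure. \<bar>\<mu> x\<bar> \<le> B) \<longrightarrow>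
         \<sigma> \<in> scale_class C' \<longrightarrow> h \<in> density_class Cbar \<longrightarrow> u0 \<in> V \<longrightarrow>
         (\<integral>\<^sup>+s. sq_dist h \<mu> (m s) \<partial>sample_law f n \<mu> \<sigma> h)
           \<le> ennreal (K * (ln (real (card V)) / real n + (\<integral>x. (\<mu> x - u0 x)\<^sup>2 \<partial>cube_measure))))"
proof -
  define s1 s2 where "s1 = exp (- (real CARD('d) * C'))" and "s2 = exp (real CARD('d) * C')"
  have s: "0 < s1" "s1 \<le> s2" using C' by (auto simp: s1_def s2_def)
  define p where "p = (\<integral>e. indicator {..<0} e * f e \<partial>lborel)"
  \<comment> \<open>The range of shifts: two functions bounded by B differ by at most 2 B.\<close>
  have M: "2 * B > 0" using B by simp
  show ?thesis
  proof (rule check_loss_excess[OF f s M, folded p_def])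
    fix c1 c2 :: real
    assume c: "c1 > 0" "c2 > 0" and G: "\<And>t \<sigma>. \<bar>t\<bar> \<le> 2 * B \<Longrightarrow> s1 \<le> \<sigma> \<Longrightarrow> \<sigma> \<le> s2 \<Longrightarrow>
         c1 * t\<^sup>2 \<le> (\<integral>e. f e * (check_loss p (\<sigma> * e - t) - check_loss p (\<sigma> * e)) \<partial>lborel) \<and>
         (\<integral>e. f e * (check_loss p (\<sigma> * e - t) - check_loss p (\<sigma> * e)) \<partial>lborel) \<le> c2 * t\<^sup>2"
      and p01: "0 \<le> p" "p \<le> 1"
    \<comment> \<open>The bound 1 / (2 B) keeps the exponents at most 1, as the quadratic bound of
      exp requires; the bound c1 / 2 makes the second-order term l^2 t^2 at most half of the
      first-order gain l c1 t^2. What remains is \<kappa> t^2.\<close>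
    define l where "l = min (c1 / 2) (1 / (2 * B))"
    define \<kappa> where "\<kappa> = l * c1 / 2"
    have l: "l > 0" "l \<le> c1 / 2" "l * (2 * B) \<le> 1"
      using c B by (auto simp: l_def min_def field_simps)
    have \<kappa>: "\<kappa> > 0" using l c by (simp add: \<kappa>_def)
    define K where "K = (1 + l * c2 * Cbar) / \<kappa>"
    have K0: "K \<ge> 0" using l c Cbar \<kappa> by (simp add: K_def)
    have intf: "integrable lborel f" "integral\<^sup>L lborel f = 1" using f(3) by (auto simp: has_bochner_integral_iff)
    have mf [measurable]: "f \<in> borel_measurable borel" using f(1) by (rule borel_measurable_continuous_onI)
    have expo: "(\<integral>e. f e * exp (- (l * (check_loss p (\<sigma> * e - t) - check_loss p (\<sigma> * e)))) \<partial>lborel) \<le> 1 - \<kappa> * t\<^sup>2"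
      if t: "\<bar>t\<bar> \<le> 2 * B" and \<sigma>: "s1 \<le> \<sigma>" "\<sigma> \<le> s2" for t \<sigma>
    proof -
      define \<zeta> where "\<zeta> e = check_loss p (\<sigma> * e - t) - check_loss p (\<sigma> * e)" for e
      have m\<zeta> [measurable]: "\<zeta> \<in> borel_measurable borel" unfolding \<zeta>_def by measurable
      have z: "\<bar>\<zeta> e\<bar> \<le> \<bar>t\<bar>" for e
        using check_loss_lipschitz[OF p01, of "\<sigma> * e - t" "\<sigma> * e"] by (simp add: \<zeta>_def)
      have i\<zeta>: "integrable lborel (\<lambda>e. f e * \<zeta> e)"
      proof (rule Bochner_Integration.integrable_bound[of _ "\<lambda>e. \<bar>t\<bar> * f e"])
        show "AE e in lborel. norm (f e * \<zeta> e) \<le> norm (\<bar>t\<bar> * f e)"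
          using z f(2) by (intro AE_I2) (simp add: abs_mult mult.commute mult_right_mono)
      qed (use intf in auto)
      have pt: "exp (- (l * \<zeta> e)) \<le> 1 - l * \<zeta> e + l\<^sup>2 * t\<^sup>2" for e
      proof -
        have "\<bar>l * \<zeta> e\<bar> \<le> l * (2 * B)" using z[of e] t l by (simp add: abs_mult mult_left_mono)
        then have "- (l * \<zeta> e) \<le> 1" using l(3) by linarith
        from exp_le_quadratic[OF this] have "exp (- (l * \<zeta> e)) \<le> 1 - l * \<zeta> e + l\<^sup>2 * (\<zeta> e)\<^sup>2"
          by (simp add: power_mult_distrib)
        moreover have "l\<^sup>2 * (\<zeta> e)\<^sup>2 \<le> l\<^sup>2 * t\<^sup>2"
          using z[of e] by (intro mult_left_mono) (auto simp: abs_le_square_iff)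
        ultimately show ?thesis by linarith
      qed
      have "(\<integral>e. f e * exp (- (l * \<zeta> e)) \<partial>lborel) \<le> (\<integral>e. f e - l * (f e * \<zeta> e) + l\<^sup>2 * t\<^sup>2 * f e \<partial>lborel)"
      proof (rule integral_mono)
        show i: "integrable lborel (\<lambda>e. f e - l * (f e * \<zeta> e) + l\<^sup>2 * t\<^sup>2 * f e)" using intf i\<zeta> by auto
        have le: "f e * exp (- (l * \<zeta> e)) \<le> f e - l * (f e * \<zeta> e) + l\<^sup>2 * t\<^sup>2 * f e" for e
          using mult_left_mono[OF pt[of e], of "f e"] f(2)[of e] by (simp add: algebra_simps)
        then show "f e * exp (- (l * \<zeta> e)) \<le> f e - l * (f e * \<zeta> e) + l\<^sup>2 * t\<^sup>2 * f e" for e .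
        show "integrable lborel (\<lambda>e. f e * exp (- (l * \<zeta> e)))"
        proof (rule Bochner_Integration.integrable_bound[OF i])
          show "AE e in lborel. norm (f e * exp (- (l * \<zeta> e))) \<le> norm (f e - l * (f e * \<zeta> e) + l\<^sup>2 * t\<^sup>2 * f e)"
          proof (rule AE_I2)
            fix e
            have "0 \<le> f e * exp (- (l * \<zeta> e))" using f(2)[of e] by simp
            then show "norm (f e * exp (- (l * \<zeta> e))) \<le> norm (f e - l * (f e * \<zeta> e) + l\<^sup>2 * t\<^sup>2 * f e)"
              using le[of e] unfolding real_norm_def by linarith
          qed
        qed measurable
      qed
      also have "\<dots> = 1 - l * (\<integral>e. f e * \<zeta> e \<partial>lborel) + l\<^sup>2 * t\<^sup>2" using intf i\<zeta> by simp
      also have "\<dots> \<le> 1 - l * (c1 * t\<^sup>2) + l * (c1 / 2) * t\<^sup>2"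
      proof -
        have "l * (c1 * t\<^sup>2) \<le> l * (\<integral>e. f e * \<zeta> e \<partial>lborel)"
          using G[OF t \<sigma>] l by (intro mult_left_mono) (auto simp: \<zeta>_def)
        moreover have "l\<^sup>2 * t\<^sup>2 \<le> l * (c1 / 2) * t\<^sup>2"
          using l by (intro mult_right_mono) (auto simp: power2_eq_square intro!: mult_left_mono)
        ultimately show ?thesis by linarith
      qed
      also have "\<dots> = 1 - \<kappa> * t\<^sup>2" by (simp add: \<kappa>_def field_simps)
      finally show ?thesis by (simp add: \<zeta>_def)
    qed
    have main: "\<exists>m\<in>estimators n. \<forall>\<mu> \<sigma> h u0. \<mu> \<in> borel_measurable cube_measure \<longrightarrow> (AE x in cube_measure. \<bar>\<mu> x\<bar> \<le> B) \<longrightarrow>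
           \<sigma> \<in> scale_class C' \<longrightarrow> h \<in> density_class Cbar \<longrightarrow> u0 \<in> V \<longrightarrow>
           (\<integral>\<^sup>+s. sq_dist h \<mu> (m s) \<partial>sample_law f n \<mu> \<sigma> h)
             \<le> ennreal (K * (ln (real (card V)) / real n + (\<integral>x. (\<mu> x - u0 x)\<^sup>2 \<partial>cube_measure)))"
      if n: "n \<ge> 1" and V: "finite V" "V \<noteq> {}" and Vu: "\<And>u. u \<in> V \<Longrightarrow> u \<in> borel_measurable borel"
        "\<And>u x. u \<in> V \<Longrightarrow> \<bar>u x\<bar> \<le> B" for n and V :: "(real ^ 'd \<Rightarrow> real) set"
    proof -
      define N where "N = card V"
      have N: "N > 0" using V by (simp add: N_def card_gt_0_iff)
      obtain e where e: "bij_betw e {0..<N} V" using ex_bij_betw_nat_finite[OF V(1)] by (auto simp: N_def)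
      define u where "u k = (if k < N then e k else (\<lambda>_. 0))" for k
      have uV: "u k \<in> V" if "k < N" for k using bij_betwE[OF e] that by (auto simp: u_def)
      have Vu': "\<exists>k<N. u k = v" if v: "v \<in> V" for v
      proof -
        obtain k where "k \<in> {0..<N}" "v = e k" using e v unfolding bij_betw_def by blast
        then show ?thesis by (intro exI[of _ k]) (simp add: u_def)
      qed
      have um: "u k \<in> borel_measurable borel" for k using uV[of k] Vu(1) by (cases "k < N") (auto simp: u_def)
      define m where "m s = u (erm_index p n u N s)" for s
      have "m \<in> estimators n" unfolding m_def by (rule erm_estimator[OF um])
      moreover have "(\<integral>\<^sup>+s. sq_dist h \<mu> (m s) \<partial>sample_law f n \<mu> \<sigma> h)
             \<le> ennreal (K * (ln (real (card V)) / real n + (\<integral>x. (\<mu> x - u0 x)\<^sup>2 \<partial>cube_measure)))"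
        if mu: "\<mu> \<in> borel_measurable cube_measure" and muB: "AE x in cube_measure. \<bar>\<mu> x\<bar> \<le> B"
          and sig: "\<sigma> \<in> scale_class C'" and h: "h \<in> density_class Cbar" and u0: "u0 \<in> V" for \<mu> \<sigma> h u0
      proof -
        \<comment> \<open>The bounded Borel version of \<mu>: extended by zero outside the cube and
          clamped to [- B, B].\<close>
        define \<mu>' where "\<mu>' x = clamp B (indicator unit_cube x *\<^sub>R \<mu> x)" for x
        have mm [measurable]: "\<mu>' \<in> borel_measurable borel"
          unfolding \<mu>'_def by (rule measurable_compose[OF borel_measurable_cube_extend[OF mu] clamp_measurable])
        have mB: "\<bar>\<mu>' x\<bar> \<le> B" for x unfolding \<mu>'_def using B by (intro clamp_bound) auto
        have ae: "AE x in cube_measure. \<mu> x = \<mu>' x"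
          using muB AE_space by eventually_elim (simp add: \<mu>'_def clamp_eq)
        note hD = density_classD[OF h Cbar]
        have sm: "\<sigma> \<in> borel_measurable cube_measure"
          by (intro measurable_cube_measure_borel borel_measurable_continuous_onI scale_classD(1)[OF sig])
        have sb: "s1 \<le> \<sigma> x" "\<sigma> x \<le> s2" if "x \<in> unit_cube" for x
          using scale_classD(2)[OF sig that] by (auto simp: s1_def s2_def)
        interpret R: regression f \<mu> \<sigma> h
          by (rule regression.intro[OF mf less_imp_le[OF f(2)] f(3) mu sm hD(1) less_imp_le[OF hD(2)] prob_space_design[OF h Cbar]])
        interpret R': regression f \<mu>' \<sigma> h
          by (rule regression.intro[OF mf less_imp_le[OF f(2)] f(3) measurable_cube_measure_borel[OF mm] sm hD(1)
              less_imp_le[OF hD(2)] prob_space_design[OF h Cbar]])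
        have obs: "obs_law f \<mu> \<sigma> h = obs_law f \<mu>' \<sigma> h"
          by (rule R.obs_law_AE_cong[OF ae measurable_cube_measure_borel[OF mm]])
        let ?P = "obs_law f \<mu>' \<sigma> h"
        define L where "L u z = check_loss p (snd z - u (fst z))" for u :: "real ^ 'd \<Rightarrow> real" and z
        define D where "D v = (\<integral>x. h x * (v x - \<mu>' x)\<^sup>2 \<partial>cube_measure)" for v
        have mL: "L v \<in> borel_measurable (borel :: ((real ^ 'd) \<times> real) measure)" if [measurable]: "v \<in> borel_measurable borel" for v
          unfolding L_def[abs_def] borel_prod[symmetric] by measurable
        have setsP: "sets ?P = sets borel" by (simp add: obs_law_def)
        have Lb: "\<bar>L v z - L \<mu>' z\<bar> \<le> 2 * B" if "v \<in> V" for v z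
        proof -
          have "\<bar>L v z - L \<mu>' z\<bar> \<le> \<bar>(snd z - v (fst z)) - (snd z - \<mu>' (fst z))\<bar>"
            unfolding L_def by (rule check_loss_lipschitz[OF p01])
          then show ?thesis using Vu(2)[OF that, of "fst z"] mB[of "fst z"] by linarith
        qed
        have tb: "\<bar>v x - \<mu>' x\<bar> \<le> 2 * B" if "v \<in> V" for v x
          using Vu(2)[OF that, of x] mB[of x] by linarith
        have Leq: "L v (x, \<mu>' x + \<sigma> x * e) - L \<mu>' (x, \<mu>' x + \<sigma> x * e)
            = check_loss p (\<sigma> x * e - (v x - \<mu>' x)) - check_loss p (\<sigma> x * e)" for v x e
          by (simp add: L_def algebra_simps)
        have iD: "integrable cube_measure (\<lambda>x. h x * (v x - \<mu>' x)\<^sup>2)" if v: "v \<in> V" for v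
        proof (rule Bochner_Integration.integrable_bound[of _ "\<lambda>x. (2 * B)\<^sup>2 * h x"])
          show "AE x in cube_measure. norm (h x * (v x - \<mu>' x)\<^sup>2) \<le> norm ((2 * B)\<^sup>2 * h x)"
          proof (rule AE_I2)
            fix x :: "real ^ 'd" assume "x \<in> space cube_measure"
            then have "0 < h x" using hD(2) by simp
            moreover have "\<bar>v x - \<mu>' x\<bar>\<^sup>2 \<le> (2 * B)\<^sup>2" using tb[OF v] by (intro power_mono) auto
            ultimately show "norm (h x * (v x - \<mu>' x)\<^sup>2) \<le> norm ((2 * B)\<^sup>2 * h x)"
              by (simp add: abs_mult mult.commute mult_right_mono)
          qed
          show "(\<lambda>x. h x * (v x - \<mu>' x)\<^sup>2) \<in> borel_measurable cube_measure"
            using hD(1) measurable_cube_measure_borel[OF mm] measurable_cube_measure_borel[OF Vu(1)[OF v]] by measurable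
        qed (use hD(4) in simp)
        have "(\<integral>\<^sup>+s. ennreal (D (u (erm_index p n u N s))) \<partial>(\<Pi>\<^sub>M i\<in>{..<n}. ?P))
          \<le> ennreal ((ln (real (card V)) / real n + l * c2 * D u0) / \<kappa>)"
        proof (rule erm_risk[where L = L and ?L0.0 = "L \<mu>'" and b = "2 * B", OF R'.prob_space_obs V u0 n])
          show "(\<lambda>z. L v z - L \<mu>' z) \<in> borel_measurable ?P" if "v \<in> V" for v
            unfolding measurable_cong_sets[OF setsP refl] by (intro borel_measurable_diff mL Vu(1) that mm)
          show "\<bar>L v z - L \<mu>' z\<bar> \<le> 2 * B" if "v \<in> V" for v z using Lb[OF that] .
          show "(\<integral>z. exp (- (l * (L v z - L \<mu>' z))) \<partial>?P) \<le> exp (- (\<kappa> * D v))" if v: "v \<in> V" for v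
          proof -
            have me: "(\<lambda>z. exp (- (l * (L v z - L \<mu>' z)))) \<in> borel_measurable borel"
              using mL[OF Vu(1)[OF v]] mL[OF mm] by measurable
            have be: "\<bar>exp (- (l * (L v z - L \<mu>' z)))\<bar> \<le> exp (l * (2 * B))" for z
            proof -
              have "- (L v z - L \<mu>' z) \<le> 2 * B" using Lb[OF v, of z] by linarith
              then have "l * (- (L v z - L \<mu>' z)) \<le> l * (2 * B)" using l by (intro mult_left_mono) auto
              then show ?thesis by (simp only: mult_minus_right abs_exp_cancel exp_le_cancel_iff)
            qed
            note io = R'.integral_obs[OF me be]
            have "(\<integral>z. exp (- (l * (L v z - L \<mu>' z))) \<partial>?P)
              \<le> (\<integral>x. h x - \<kappa> * (h x * (v x - \<mu>' x)\<^sup>2) \<partial>cube_measure)"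
              unfolding io(1)
            proof (rule integral_mono[OF io(2)])
              show "integrable cube_measure (\<lambda>x. h x - \<kappa> * (h x * (v x - \<mu>' x)\<^sup>2))" using hD(4) iD[OF v] by simp
              fix x :: "real ^ 'd" assume "x \<in> space cube_measure"
              then have x: "x \<in> unit_cube" by simp
              have "h x * (\<integral>e. f e * exp (- (l * (L v (x, \<mu>' x + \<sigma> x * e) - L \<mu>' (x, \<mu>' x + \<sigma> x * e)))) \<partial>lborel)
                  \<le> h x * (1 - \<kappa> * (v x - \<mu>' x)\<^sup>2)"
                unfolding Leq using hD(2)[OF x] by (intro mult_left_mono expo tb[OF v] sb[OF x]) auto
              also have "\<dots> = h x - \<kappa> * (h x * (v x - \<mu>' x)\<^sup>2)" by (simp add: algebra_simps)
              finally show "h x * (\<integral>e. f e * exp (- (l * (L v (x, \<mu>' x + \<sigma> x * e) - L \<mu>' (x, \<mu>' x + \<sigma> x * e)))) \<partial>lborel)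
                \<le> h x - \<kappa> * (h x * (v x - \<mu>' x)\<^sup>2)" .
            qed
            also have "\<dots> = 1 - \<kappa> * D v" using hD(4,5) iD[OF v] by (simp add: D_def)
            also have "\<dots> \<le> exp (- (\<kappa> * D v))" using exp_ge_add_one_self[of "- (\<kappa> * D v)"] by simp
            finally show ?thesis .
          qed
          show "(\<integral>z. L u0 z - L \<mu>' z \<partial>?P) \<le> c2 * D u0"
          proof -
            have me: "(\<lambda>z. L u0 z - L \<mu>' z) \<in> borel_measurable borel"
              using mL[OF Vu(1)[OF u0]] mL[OF mm] by measurable
            note io = R'.integral_obs[OF me Lb[OF u0]]
            have "(\<integral>z. L u0 z - L \<mu>' z \<partial>?P) \<le> (\<integral>x. c2 * (h x * (u0 x - \<mu>' x)\<^sup>2) \<partial>cube_measure)"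
              unfolding io(1)
            proof (rule integral_mono[OF io(2)])
              show "integrable cube_measure (\<lambda>x. c2 * (h x * (u0 x - \<mu>' x)\<^sup>2))" using iD[OF u0] by simp
              fix x :: "real ^ 'd" assume "x \<in> space cube_measure"
              then have x: "x \<in> unit_cube" by simp
              have "h x * (\<integral>e. f e * (L u0 (x, \<mu>' x + \<sigma> x * e) - L \<mu>' (x, \<mu>' x + \<sigma> x * e)) \<partial>lborel)
                \<le> h x * (c2 * (u0 x - \<mu>' x)\<^sup>2)"
                unfolding Leq using hD(2)[OF x] G[OF tb[OF u0, of x] sb[OF x]] by (intro mult_left_mono) auto
              then show "h x * (\<integral>e. f e * (L u0 (x, \<mu>' x + \<sigma> x * e) - L \<mu>' (x, \<mu>' x + \<sigma> x * e)) \<partial>lborel)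
                \<le> c2 * (h x * (u0 x - \<mu>' x)\<^sup>2)" by (simp add: mult_ac)
            qed
            then show ?thesis by (simp add: D_def)
          qed
          show "D v \<ge> 0" for v
            unfolding D_def using hD(2) by (intro integral_nonneg_AE AE_I2) (auto simp: less_imp_le)
          fix s
          obtain k where k: "k < N" "u k = u0" using Vu'[OF u0] by blast
          show "u (erm_index p n u N s) \<in> V \<and> (\<Sum>i<n. L (u (erm_index p n u N s)) (s i)) \<le> (\<Sum>i<n. L u0 (s i))"
            using uV[OF erm_index(1)[OF N]] erm_index(2)[where p = p and n = n and u = u and s = s, OF N k(1)] k(2) by (simp add: L_def)
        qed (use l \<kappa> in auto)
        also have "(\<Pi>\<^sub>M i\<in>{..<n}. ?P) = sample_law f n \<mu> \<sigma> h" by (simp add: sample_law_def obs)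
        also have "(\<integral>\<^sup>+s. ennreal (D (u (erm_index p n u N s))) \<partial>sample_law f n \<mu> \<sigma> h) = (\<integral>\<^sup>+s. sq_dist h \<mu> (m s) \<partial>sample_law f n \<mu> \<sigma> h)"
        proof (rule nn_integral_cong)
          fix s
          have v: "m s \<in> V" unfolding m_def by (rule uV[OF erm_index(1)[OF N]])
          have "sq_dist h \<mu> (m s) = (\<integral>\<^sup>+x. ennreal (h x * (m s x - \<mu>' x)\<^sup>2) \<partial>cube_measure)"
            unfolding sq_dist_def
          proof (rule nn_integral_cong_AE)
            show "AE x in cube_measure. ennreal ((\<mu> x - m s x)\<^sup>2 * h x) = ennreal (h x * (m s x - \<mu>' x)\<^sup>2)"
              using ae by eventually_elim (simp add: mult.commute power2_commute)
          qed
          also have "\<dots> = ennreal (D (m s))"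
            unfolding D_def using hD(2) by (intro nn_integral_eq_integral iD[OF v] AE_I2) (auto simp: less_imp_le)
          finally show "ennreal (D (u (erm_index p n u N s))) = sq_dist h \<mu> (m s)" by (simp add: m_def)
        qed
        also have "ennreal ((ln (real (card V)) / real n + l * c2 * D u0) / \<kappa>)
            \<le> ennreal (K * (ln (real (card V)) / real n + (\<integral>x. (\<mu> x - u0 x)\<^sup>2 \<partial>cube_measure)))"
        proof (rule ennreal_leI)
          let ?I = "\<integral>x. (\<mu> x - u0 x)\<^sup>2 \<partial>cube_measure"
          have eqI: "?I = (\<integral>x. (u0 x - \<mu>' x)\<^sup>2 \<partial>cube_measure)"
          proof (rule integral_cong_AE)
            show "AE x in cube_measure. (\<mu> x - u0 x)\<^sup>2 = (u0 x - \<mu>' x)\<^sup>2"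
              using ae by eventually_elim (simp add: power2_commute)
          qed (use mu measurable_cube_measure_borel[OF mm] measurable_cube_measure_borel[OF Vu(1)[OF u0]] in measurable)
          have "D u0 \<le> (\<integral>x. Cbar * (u0 x - \<mu>' x)\<^sup>2 \<partial>cube_measure)"
            unfolding D_def
          proof (rule integral_mono[OF iD[OF u0]])
            have "square_integrable (\<lambda>x. u0 x - \<mu>' x)"
              using tb[OF u0] measurable_cube_measure_borel[OF mm] measurable_cube_measure_borel[OF Vu(1)[OF u0]]
              by (intro square_integrable_bounded[where K = "2 * B"]) auto
            then show "integrable cube_measure (\<lambda>x. Cbar * (u0 x - \<mu>' x)\<^sup>2)" by (simp add: square_integrable_def)
            fix x :: "real ^ 'd" assume "x \<in> space cube_measure"
            then show "h x * (u0 x - \<mu>' x)\<^sup>2 \<le> Cbar * (u0 x - \<mu>' x)\<^sup>2" using hD(3) by (intro mult_right_mono) auto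
          qed
          then have D: "D u0 \<le> Cbar * ?I" by (simp add: eqI)
          have I0: "0 \<le> ?I" by simp
          have ln0: "0 \<le> ln (real (card V)) / real n" using N by (simp add: N_def)
          have "l * c2 * D u0 \<le> l * c2 * (Cbar * ?I)" using D l c by (intro mult_left_mono) auto
          also have "\<dots> \<le> (1 + l * c2 * Cbar) * ?I" using I0 by (simp add: algebra_simps)
          finally have "ln (real (card V)) / real n + l * c2 * D u0 \<le> (1 + l * c2 * Cbar) * (ln (real (card V)) / real n + ?I)"
            using ln0 mult_right_mono[of 1 "1 + l * c2 * Cbar" "ln (real (card V)) / real n"] l c Cbar
            by (simp add: distrib_left)
          then show "(ln (real (card V)) / real n + l * c2 * D u0) / \<kappa> \<le> K * (ln (real (card V)) / real n + ?I)"
            using \<kappa> by (simp add: K_def divide_right_mono)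
        qed
        finally show ?thesis .
      qed
      ultimately show ?thesis by blast
    qed
    show ?thesis using K0 main by (intro exI[of _ K]) blast
  qed
qed

section \<open>Minimax lower bound\<close>

text \<open>The bump rescaled to the interval from k j / m to (k j + 1) / m, as a derivative
  sequence: the chain rule produces the factor m^l at order l.\<close>

definition cell_bump :: "nat \<Rightarrow> ('r::finite \<Rightarrow> nat) \<Rightarrow> 'r \<Rightarrow> nat \<Rightarrow> real \<Rightarrow> real" where
  "cell_bump m k j l x = real m ^ l * bump l (real m * x + - real (k j))"

lemma derivs_cell_bump: "derivs (cell_bump m k j)"
  unfolding cell_bump_def[abs_def] by (rule derivs_affine[OF derivs_bump])

abbreviation tbump :: "nat \<Rightarrow> ('r::finite \<Rightarrow> nat) \<Rightarrow> ('r \<Rightarrow> nat) \<Rightarrow> real ^ 'r \<Rightarrow> real" where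
  "tbump m k \<equiv> tens (cell_bump m k)"

lemma tbump_support:
  assumes "tbump m k l z \<noteq> 0" shows "real (k j) < real m * z $ j \<and> real m * z $ j < real (k j) + 1"
proof (rule ccontr)
  assume "\<not> ?thesis"
  then have "cell_bump m k j (l j) (z $ j) = 0" by (auto simp: cell_bump_def intro!: bump_eq_0)
  then have "tbump m k l z = 0" unfolding tens_def by (intro prod_zero bexI[of _ j]) auto
  then show False using assms by simp
qed

lemma tbump_disjoint:
  assumes "tbump m k l z \<noteq> 0" "tbump m k' l' z \<noteq> 0" shows "k = k'"
proof
  fix j
  have "real (k j) < real (k' j) + 1" "real (k' j) < real (k j) + 1"
    using tbump_support[OF assms(1), of j] tbump_support[OF assms(2), of j] by linarith+
  then show "k j = k' j" by linarith
qed

lemma bump_bound_upto: obtains M where "M \<ge> 1" "\<And>l x. l \<le> \<alpha> \<Longrightarrow> \<bar>bump l x\<bar> \<le> M"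
proof -
  obtain B where B: "\<And>l x. \<bar>bump l x\<bar> \<le> B l" using bump_bounded by metis
  show ?thesis
  proof (rule that[of "1 + (\<Sum>l\<le>\<alpha>. \<bar>B l\<bar>)"])
    fix l x assume "l \<le> \<alpha>"
    have "\<bar>bump l x\<bar> \<le> \<bar>B l\<bar>" using B[of l x] by linarith
    also have "\<dots> \<le> (\<Sum>l\<le>\<alpha>. \<bar>B l\<bar>)" using \<open>l \<le> \<alpha>\<close> by (intro member_le_sum) auto
    finally show "\<bar>bump l x\<bar> \<le> 1 + (\<Sum>l\<le>\<alpha>. \<bar>B l\<bar>)" by simp
  qed (simp add: sum_nonneg)
qed

lemma tbump_bound:
  fixes z :: "real ^ 'r::finite"
  assumes M: "\<And>l x. l \<le> \<alpha> \<Longrightarrow> \<bar>bump l x\<bar> \<le> M" and l: "\<And>j. l j \<le> \<alpha>"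
  shows "\<bar>tbump m k l z\<bar> \<le> real m ^ (\<Sum>j\<in>UNIV. l j) * M ^ CARD('r)"
proof -
  have "\<bar>tbump m k l z\<bar> = (\<Prod>j\<in>UNIV. \<bar>cell_bump m k j (l j) (z $ j)\<bar>)" by (simp add: tens_def abs_prod)
  also have "\<dots> \<le> (\<Prod>j\<in>(UNIV :: 'r set). real m ^ l j * M)"
    using M l by (intro prod_mono) (auto simp: cell_bump_def abs_mult intro!: mult_left_mono)
  also have "\<dots> = real m ^ (\<Sum>j\<in>UNIV. l j) * M ^ CARD('r)" by (simp add: prod.distrib power_sum)
  finally show ?thesis .
qed

text \<open>At most one summand is nonzero, so the number of bumps does not enter the bound.\<close>

lemma disjoint_sum_bound:
  fixes F :: "'k \<Rightarrow> real"
  assumes "finite S" "\<And>k k'. k \<in> S \<Longrightarrow> k' \<in> S \<Longrightarrow> F k \<noteq> 0 \<Longrightarrow> F k' \<noteq> 0 \<Longrightarrow> k = k'" "\<And>k. k \<in> S \<Longrightarrow> \<bar>F k\<bar> \<le> B" "0 \<le> B"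
  shows "\<bar>\<Sum>k\<in>S. F k\<bar> \<le> B"
proof (cases "\<exists>k\<in>S. F k \<noteq> 0")
  case True
  then obtain k where k: "k \<in> S" "F k \<noteq> 0" by blast
  have "(\<Sum>k\<in>S. F k) = (\<Sum>k\<in>{k}. F k)"
    using assms(1,2) k by (intro sum.mono_neutral_right) auto
  then show ?thesis using assms(3)[OF k(1)] by simp
next
  case False
  then show ?thesis using assms(4) by (simp add: sum.neutral)
qed

definition bump_sum :: "real \<Rightarrow> nat \<Rightarrow> ('r::finite \<Rightarrow> nat) set \<Rightarrow> real ^ 'r \<Rightarrow> real" where
  "bump_sum c m S z = (\<Sum>k\<in>S. c * tbump m k (\<lambda>_. 0) z)"

lemma continuous_bump_sum: "continuous_on UNIV (bump_sum c m S)"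
  unfolding bump_sum_def[abs_def]
  by (intro continuous_intros smooth_continuous smooth_tens derivs_cell_bump)

lemma integral_le_const_cube:
  fixes f :: "real ^ 'a::finite \<Rightarrow> real"
  assumes "\<And>z. z \<in> unit_cube \<Longrightarrow> \<bar>f z\<bar> \<le> B"
  shows "(\<integral>z. (f z)\<^sup>2 \<partial>cube_measure) \<le> B\<^sup>2"
proof (cases "integrable cube_measure (\<lambda>z. (f z)\<^sup>2)")
  case True
  have "(\<integral>z. (f z)\<^sup>2 \<partial>cube_measure) \<le> (\<integral>z. B\<^sup>2 \<partial>(cube_measure :: (real ^ 'a) measure))"
  proof (rule integral_mono[OF True])
    fix z :: "real ^ 'a" assume "z \<in> space cube_measure"
    then have "\<bar>f z\<bar>\<^sup>2 \<le> B\<^sup>2" using assms by (intro power_mono) auto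
    then show "(f z)\<^sup>2 \<le> B\<^sup>2" by simp
  qed simp
  then show ?thesis by simp
\<comment> \<open>Without integrability the integral is 0 by convention.\<close>
qed (simp add: not_integrable_integral_eq)

text \<open>Each derivative on a cell of side 1 / m costs a factor m, which the height c /
  m^\<alpha> compensates up to order \<alpha>; disjoint supports keep the sum as small as a single
  bump. The threshold is C / R, where R collects the bound for the L2 norm and, with the square root
  of the number of multi-indices, the one for the derivatives.\<close>

lemma bump_sum_in_ball:
  fixes C :: real
  assumes C: "C > 0"
  shows "\<exists>c0>0. \<forall>c m. 0 \<le> c \<longrightarrow> c \<le> c0 \<longrightarrow> m \<ge> 1 \<longrightarrow>
    (\<forall>S\<subseteq>below m. bump_sum (c / real m ^ \<alpha>) m S \<in> (sobolev_ball \<alpha> C :: ((real, 'r::{finite,linorder}) vec \<Rightarrow> real) set))"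
proof -
  obtain M where M: "M \<ge> 1" "\<And>l x. l \<le> \<alpha> \<Longrightarrow> \<bar>bump l x\<bar> \<le> M" using bump_bound_upto by blast
  let ?A = "multi_indices \<alpha> :: ('r \<Rightarrow> nat) set"
  define R where "R = M ^ CARD('r) * (1 + sqrt (real (card ?A)))"
  have MR: "M ^ CARD('r) \<ge> 1" using M(1) by simp
  have R: "R > 0" using MR by (simp add: R_def add_pos_nonneg)
  have "bump_sum (c / real m ^ \<alpha>) m S \<in> sobolev_ball \<alpha> C"
    if c: "0 \<le> c" "c \<le> C / R" and m: "m \<ge> 1" and S: "S \<subseteq> below m" for c m and S :: "('r \<Rightarrow> nat) set"
  proof -
    let ?g = "bump_sum (c / real m ^ \<alpha>) m S"
    have fS: "finite S" using finite_subset[OF S] by simp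
    define v where "v l z = (\<Sum>k\<in>S. c / real m ^ \<alpha> * tbump m k l z)" for l and z :: "(real, 'r) vec"
    have bnd: "\<bar>v l z\<bar> \<le> c * M ^ CARD('r)" if l: "(\<Sum>j\<in>UNIV. l j) \<le> \<alpha>" for l z
      unfolding v_def
    proof (rule disjoint_sum_bound[OF fS])
      fix k assume "k \<in> S"
      have lj: "l j \<le> \<alpha>" for j using member_le_sum[of j UNIV l] l by simp
      have "\<bar>c / real m ^ \<alpha> * tbump m k l z\<bar> \<le> c / real m ^ \<alpha> * (real m ^ (\<Sum>j\<in>UNIV. l j) * M ^ CARD('r))"
      proof -
        have "\<bar>c / real m ^ \<alpha> * tbump m k l z\<bar> = c / real m ^ \<alpha> * \<bar>tbump m k l z\<bar>" using c by (simp add: abs_mult)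
        also have "\<dots> \<le> c / real m ^ \<alpha> * (real m ^ (\<Sum>j\<in>UNIV. l j) * M ^ CARD('r))"
          using c tbump_bound[where m = m and k = k and z = z and l = l, OF M(2) lj] by (intro mult_left_mono) auto
        finally show ?thesis .
      qed
      also have "\<dots> \<le> c / real m ^ \<alpha> * (real m ^ \<alpha> * M ^ CARD('r))"
        using c m l M(1) by (intro mult_left_mono mult_right_mono power_increasing) auto
      finally show "\<bar>c / real m ^ \<alpha> * tbump m k l z\<bar> \<le> c * M ^ CARD('r)" using m by simp
    next
      show "0 \<le> c * M ^ CARD('r)" using c M(1) by simp
    qed (auto dest: tbump_disjoint)
    have g: "?g = v (\<lambda>_. 0)" by (simp add: bump_sum_def[abs_def] v_def[abs_def])
    have wd: "has_weak_deriv l ?g (v l)" for l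
      unfolding bump_sum_def[abs_def] v_def[abs_def]
      using has_weak_deriv_tens[of "cell_bump m k" l "\<lambda>_. 0" for k, OF derivs_cell_bump]
      by (intro has_weak_deriv_cmult_sum fS square_integrable_continuous smooth_continuous smooth_tens derivs_cell_bump) simp
    have sg: "square_integrable ?g" by (intro square_integrable_continuous continuous_bump_sum)
    have space: "?g \<in> sobolev_space \<alpha>" using sg wd by (auto simp: sobolev_space_def)
    have "(\<integral>z. (?g z)\<^sup>2 \<partial>cube_measure) \<le> (c * M ^ CARD('r))\<^sup>2"
      unfolding g by (rule integral_le_const_cube[OF bnd]) simp
    then have n1: "sqrt (\<integral>z. (?g z)\<^sup>2 \<partial>cube_measure) \<le> c * M ^ CARD('r)"
      using c M(1) by (intro real_le_lsqrt) auto
    have "(\<Sum>l\<in>?A. \<integral>z. \<bar>weak_deriv l ?g z\<bar>\<^sup>2 \<partial>cube_measure) \<le> (\<Sum>l\<in>?A. (c * M ^ CARD('r))\<^sup>2)"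
    proof (rule sum_mono)
      fix l :: "'r \<Rightarrow> nat" assume l: "l \<in> ?A"
      \<comment> \<open>The arbitrarily chosen weak derivative is traded for the explicit classical
        one, which has the same norm.\<close>
      have "has_weak_deriv l ?g (weak_deriv l ?g)" unfolding weak_deriv_def by (rule someI[of "has_weak_deriv l ?g", OF wd])
      from weak_deriv_unique[OF this wd sg]
      have "(\<integral>z. \<bar>weak_deriv l ?g z\<bar>\<^sup>2 \<partial>cube_measure) = (\<integral>z. (v l z)\<^sup>2 \<partial>cube_measure)" by simp
      also have "\<dots> \<le> (c * M ^ CARD('r))\<^sup>2"
        using l by (intro integral_le_const_cube bnd) (simp add: multi_indices_def)
      finally show "(\<integral>z. \<bar>weak_deriv l ?g z\<bar>\<^sup>2 \<partial>cube_measure) \<le> (c * M ^ CARD('r))\<^sup>2" .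
    qed
    also have "\<dots> = (c * M ^ CARD('r) * sqrt (real (card ?A)))\<^sup>2" by (simp add: power_mult_distrib)
    finally have n2: "sqrt (\<Sum>l\<in>?A. \<integral>z. \<bar>weak_deriv l ?g z\<bar>\<^sup>2 \<partial>cube_measure) \<le> c * M ^ CARD('r) * sqrt (real (card ?A))"
      using c M(1) by (intro real_le_lsqrt) auto
    have "sobolev_norm \<alpha> ?g \<le> c * M ^ CARD('r) + c * M ^ CARD('r) * sqrt (real (card ?A))"
      unfolding sobolev_norm_def using n1 n2 by (rule add_mono)
    also have "\<dots> = c * R" by (simp add: R_def algebra_simps)
    also have "\<dots> \<le> C" using c(2) R by (simp add: field_simps)
    finally show ?thesis using space by (simp add: sobolev_ball_def)
  qed
  then show ?thesis using C R by (intro exI[of _ "C / R"]) auto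
qed

text \<open>Each element of 'r is sent to the element of the same rank in 'd.\<close>

lemma strict_mono_exists:
  assumes "CARD('r::{finite,linorder}) \<le> CARD('d::{finite,linorder})"
  shows "\<exists>\<iota> :: 'r \<Rightarrow> 'd. strict_mono \<iota>"
proof -
  let ?xs = "sorted_list_of_set (UNIV :: 'd set)"
  define rk where "rk j = card {k :: 'r. k < j}" for j
  have rk: "rk j < CARD('r)" for j
    unfolding rk_def by (rule psubset_card_mono) auto
  have mono: "rk i < rk j" if "i < j" for i j
    unfolding rk_def using that by (intro psubset_card_mono) auto
  have "strict_mono (\<lambda>j. ?xs ! rk j)"
  proof (rule strict_monoI)
    fix i j :: 'r assume "i < j"
    show "?xs ! rk i < ?xs ! rk j"
      using strict_sorted_list_of_set[of "UNIV :: 'd set"] mono[OF \<open>i < j\<close>] rk[of j] assms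
      by (simp add: sorted_wrt_nth_less)
  qed
  then show ?thesis by blast
qed

lemma bump_sum_in_interaction_class:
  fixes \<iota> :: "'r::{finite,linorder} \<Rightarrow> 'd::{finite,linorder}"
  assumes \<iota>: "strict_mono \<iota>" and g: "g \<in> sobolev_ball \<alpha> C" "(\<lambda>z. 0) \<in> (sobolev_ball \<alpha> C :: ((real, 'r) vec \<Rightarrow> real) set)"
  shows "(\<lambda>x. g (proj \<iota> x)) \<in> interaction_class TYPE('r) \<alpha> C"
  unfolding interaction_class_def
proof (intro CollectI exI conjI allI impI ballI)
  let ?G = "\<lambda>\<iota>'. if \<iota>' = \<iota> then g else (\<lambda>z. 0)"
  show "?G \<iota>' \<in> sobolev_ball \<alpha> C" for \<iota>' using g by simp
  fix x :: "(real, 'd) vec"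
  have "(\<Sum>\<iota>' | strict_mono \<iota>'. ?G \<iota>' (\<chi> j. x $ \<iota>' j)) = (\<Sum>\<iota>' | strict_mono \<iota>'. if \<iota>' = \<iota> then g (\<chi> j. x $ \<iota> j) else 0)"
    by (intro sum.cong) auto
  also have "\<dots> = g (proj \<iota> x)" using \<iota> by (simp add: proj_def)
  finally show "g (proj \<iota> x) = (\<Sum>\<iota>' | strict_mono \<iota>'. ?G \<iota>' (\<chi> j. x $ \<iota>' j))" ..
qed

section \<open>Hellinger affinity and two-point risk\<close>

lemma hellinger_shift:
  assumes "regular_density f"
  obtains H where "H > 0" "\<And>a b. \<bar>a - b\<bar> \<le> 1 \<Longrightarrow>
    ennreal (1 - H * (a - b)\<^sup>2) \<le> (\<integral>\<^sup>+y. ennreal (sqrt (f (y - a) * f (y - b))) \<partial>lborel)"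
proof -
  obtain A where c: "continuous_on UNIV f" and p: "\<And>y. 0 < f y" and i: "has_bochner_integral lborel f 1"
    and A: "\<And>y t. \<bar>t\<bar> \<le> 1 \<Longrightarrow> \<bar>sqrt (f (y + t)) - sqrt (f y)\<bar> \<le> A * \<bar>t\<bar> / (1 + y\<^sup>2)"
    using assms unfolding regular_density_def by blast
  have mf [measurable]: "f \<in> borel_measurable borel" using c by (rule borel_measurable_continuous_onI)
  have ca: "integrable lborel (\<lambda>y::real. 1 / (pi * (1 + y\<^sup>2)))" "(\<integral>y. 1 / (pi * (1 + y\<^sup>2)) \<partial>lborel) = (1 :: real)"
    using regular_cauchy by (auto simp: regular_density_def has_bochner_integral_iff)
  \<comment> \<open>The weight 1 / (1 + y^2) integrates to pi, so the roots of two densities shifted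
    against each other by t have squared L2 distance at most A^2 pi t^2, and their affinity is 1
    minus half of that distance. The added 1 makes H positive.\<close>
  define H where "H = A\<^sup>2 * pi / 2 + 1"
  show ?thesis
  proof (rule that[of H])
    show "H > 0" by (simp add: H_def add_nonneg_pos)
    fix a b :: real assume ab: "\<bar>a - b\<bar> \<le> 1"
    define t where "t = b - a"
    have t: "\<bar>t\<bar> \<le> 1" using ab by (simp add: t_def)
    let ?u = "\<lambda>y. sqrt (f (y - a))" and ?v = "\<lambda>y. sqrt (f (y - b))"
    have ish: "integrable lborel (\<lambda>y. f (y - s))" "(\<integral>y. f (y - s) \<partial>lborel) = 1" for s
      using lborel_has_bochner_integral_real_affine_iff[of 1 f 1 "- s"] i by (auto simp: has_bochner_integral_iff)
    have ish': "integrable lborel (\<lambda>y. 1 / (pi * (1 + (y - b)\<^sup>2)))" "(\<integral>y. 1 / (pi * (1 + (y - b)\<^sup>2)) \<partial>lborel) = 1"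
      using lborel_has_bochner_integral_real_affine_iff[of 1 "\<lambda>y::real. 1 / (pi * (1 + y\<^sup>2))" 1 "- b"] ca
      by (auto simp: has_bochner_integral_iff)
    have iuv: "integrable lborel (\<lambda>y. ?u y * ?v y)"
      by (rule integrable_mult_of_squares) (use ish p in \<open>auto simp: less_imp_le\<close>)
    have sq: "(?u y - ?v y)\<^sup>2 = f (y - a) + f (y - b) - 2 * (?u y * ?v y)" for y
      using p by (simp add: power2_diff less_imp_le)
    have pt: "(?u y - ?v y)\<^sup>2 \<le> A\<^sup>2 * pi * t\<^sup>2 * (1 / (pi * (1 + (y - b)\<^sup>2)))" for y
    proof -
      have "\<bar>?u y - ?v y\<bar> \<le> A * \<bar>t\<bar> / (1 + (y - b)\<^sup>2)" using A[OF t, of "y - b"] by (simp add: t_def)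
      then have "\<bar>?u y - ?v y\<bar>\<^sup>2 \<le> (A * \<bar>t\<bar> / (1 + (y - b)\<^sup>2))\<^sup>2" by (intro power_mono) auto
      also have "\<dots> = A\<^sup>2 * t\<^sup>2 * (1 / (1 + (y - b)\<^sup>2)\<^sup>2)" by (simp add: power_divide power_mult_distrib)
      also have "\<dots> \<le> A\<^sup>2 * t\<^sup>2 * (1 / (1 + (y - b)\<^sup>2))"
        by (intro mult_left_mono divide_left_mono) (auto simp: power2_eq_square[of "1 + _"] add_pos_nonneg)
      finally show ?thesis by simp
    qed
    have "(\<integral>y. (?u y - ?v y)\<^sup>2 \<partial>lborel) \<le> (\<integral>y. A\<^sup>2 * pi * t\<^sup>2 * (1 / (pi * (1 + (y - b)\<^sup>2))) \<partial>lborel)"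
    proof (rule integral_mono)
      show "integrable lborel (\<lambda>y. (?u y - ?v y)\<^sup>2)" unfolding sq using ish iuv by auto
      show "integrable lborel (\<lambda>y. A\<^sup>2 * pi * t\<^sup>2 * (1 / (pi * (1 + (y - b)\<^sup>2))))"
        using ish'(1) by (rule integrable_mult_right)
    qed (rule pt)
    also have "\<dots> = A\<^sup>2 * pi * t\<^sup>2 * (\<integral>y. 1 / (pi * (1 + (y - b)\<^sup>2)) \<partial>lborel)"
      by (rule Bochner_Integration.integral_mult_right_zero)
    also have "\<dots> = A\<^sup>2 * pi * t\<^sup>2" unfolding ish'(2) by simp
    finally have "(\<integral>y. (?u y - ?v y)\<^sup>2 \<partial>lborel) \<le> A\<^sup>2 * pi * t\<^sup>2" .
    moreover have "(\<integral>y. (?u y - ?v y)\<^sup>2 \<partial>lborel) = 2 - 2 * (\<integral>y. ?u y * ?v y \<partial>lborel)"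
      unfolding sq using ish iuv by simp
    ultimately have "1 - A\<^sup>2 * pi / 2 * t\<^sup>2 \<le> (\<integral>y. ?u y * ?v y \<partial>lborel)" by simp
    moreover have "H * (a - b)\<^sup>2 = A\<^sup>2 * pi / 2 * t\<^sup>2 + t\<^sup>2"
      by (simp add: H_def t_def power2_commute[of b a] distrib_right)
    ultimately have "1 - H * (a - b)\<^sup>2 \<le> (\<integral>y. ?u y * ?v y \<partial>lborel)"
      using zero_le_power2[of t] by linarith
    then have "ennreal (1 - H * (a - b)\<^sup>2) \<le> ennreal (\<integral>y. ?u y * ?v y \<partial>lborel)" by (rule ennreal_leI)
    also have "\<dots> = (\<integral>\<^sup>+y. ennreal (?u y * ?v y) \<partial>lborel)"
      using p by (intro nn_integral_eq_integral[symmetric] iuv AE_I2) (simp add: less_imp_le)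
    finally show "ennreal (1 - H * (a - b)\<^sup>2) \<le> (\<integral>\<^sup>+y. ennreal (sqrt (f (y - a) * f (y - b))) \<partial>lborel)"
      by (simp add: real_sqrt_mult)
  qed
qed

text \<open>Obtained from \<open>(x - a)\<^sup>2 u\<^sup>2 + (x - b)\<^sup>2 v\<^sup>2 \<ge> (a - b)\<^sup>2 u\<^sup>2 v\<^sup>2 / (u\<^sup>2 + v\<^sup>2)\<close>; with \<open>u\<^sup>2\<close>, \<open>v\<^sup>2\<close> two densities
  the left-hand side integrates to \<open>(a - b)\<^sup>2\<close> times their Hellinger affinity.\<close>

lemma two_point_inequality:
  fixes u v x a b :: real
  assumes "u \<ge> 0" "v \<ge> 0"
  shows "(a - b)\<^sup>2 * (u * v) \<le> (x - a)\<^sup>2 * u\<^sup>2 + (x - b)\<^sup>2 * v\<^sup>2 + (a - b)\<^sup>2 / 4 * (u\<^sup>2 + v\<^sup>2)"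
proof (cases "u\<^sup>2 + v\<^sup>2 = 0")
  case True
  then show ?thesis by simp
next
  case False
  define s where "s = u\<^sup>2 + v\<^sup>2"
  have s: "s > 0" using False by (simp add: s_def sum_power2_gt_zero_iff)
  have "((x - a)\<^sup>2 * u\<^sup>2 + (x - b)\<^sup>2 * v\<^sup>2) * s = ((x - a) * u\<^sup>2 + (x - b) * v\<^sup>2)\<^sup>2 + u\<^sup>2 * v\<^sup>2 * (a - b)\<^sup>2"
    unfolding s_def by (simp add: power2_eq_square algebra_simps)
  then have 1: "u\<^sup>2 * v\<^sup>2 * (a - b)\<^sup>2 \<le> ((x - a)\<^sup>2 * u\<^sup>2 + (x - b)\<^sup>2 * v\<^sup>2) * s" by simp
  \<comment> \<open>This square bounds u^2 v^2 / s below by u v - s / 4, so that the inequality can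
    be integrated against the affinity.\<close>
  have "0 \<le> (a - b)\<^sup>2 * (u * v - s / 2)\<^sup>2" by simp
  also have "\<dots> = u\<^sup>2 * v\<^sup>2 * (a - b)\<^sup>2 + (a - b)\<^sup>2 / 4 * s * s - (a - b)\<^sup>2 * (u * v) * s"
    by (simp add: power2_eq_square field_simps)
  finally have "(a - b)\<^sup>2 * (u * v) * s \<le> ((x - a)\<^sup>2 * u\<^sup>2 + (x - b)\<^sup>2 * v\<^sup>2 + (a - b)\<^sup>2 / 4 * s) * s"
    using 1 by (simp add: distrib_right)
  then show ?thesis using s unfolding s_def by (simp only: mult_le_cancel_right_pos)
qed

text \<open>With affinity at least 3 / 4, the integrated two-point inequality leaves 3 / 4 - 2 / 4 =
  1 / 4 of (a - b)^2: the correction (a - b)^2 / 4 is paid once for each of the two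
  densities.\<close>

lemma two_point_risk:
  fixes p q T :: "'z \<Rightarrow> real"
  assumes [measurable]: "p \<in> borel_measurable M" "q \<in> borel_measurable M" "T \<in> borel_measurable M"
    and p: "\<And>z. p z \<ge> 0" "(\<integral>\<^sup>+z. ennreal (p z) \<partial>M) = 1" and q: "\<And>z. q z \<ge> 0" "(\<integral>\<^sup>+z. ennreal (q z) \<partial>M) = 1"
    and aff: "ennreal (3 / 4) \<le> (\<integral>\<^sup>+z. ennreal (sqrt (p z * q z)) \<partial>M)"
  shows "ennreal ((a - b)\<^sup>2 / 4) \<le> (\<integral>\<^sup>+z. ennreal ((T z - a)\<^sup>2) \<partial>density M (\<lambda>z. ennreal (p z)))
    + (\<integral>\<^sup>+z. ennreal ((T z - b)\<^sup>2) \<partial>density M (\<lambda>z. ennreal (q z)))"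
proof -
  let ?d = "(a - b)\<^sup>2"
  let ?P = "\<integral>\<^sup>+z. ennreal (p z * (T z - a)\<^sup>2) \<partial>M" and ?Q = "\<integral>\<^sup>+z. ennreal (q z * (T z - b)\<^sup>2) \<partial>M"
  have P: "(\<integral>\<^sup>+z. ennreal ((T z - a)\<^sup>2) \<partial>density M (\<lambda>z. ennreal (p z))) = ?P"
    using p(1) by (subst nn_integral_density) (auto simp: ennreal_mult)
  have Q: "(\<integral>\<^sup>+z. ennreal ((T z - b)\<^sup>2) \<partial>density M (\<lambda>z. ennreal (q z))) = ?Q"
    using q(1) by (subst nn_integral_density) (auto simp: ennreal_mult)
  have "ennreal (?d / 4) + ennreal (?d / 2) = ennreal ?d * ennreal (3 / 4)"
    by (simp flip: ennreal_plus ennreal_mult)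
  also have "\<dots> \<le> ennreal ?d * (\<integral>\<^sup>+z. ennreal (sqrt (p z * q z)) \<partial>M)"
    using aff by (rule mult_left_mono) simp
  also have "\<dots> = (\<integral>\<^sup>+z. ennreal (?d * sqrt (p z * q z)) \<partial>M)"
    using p(1) q(1) by (simp add: nn_integral_cmult ennreal_mult)
  also have "\<dots> \<le> (\<integral>\<^sup>+z. ennreal (p z * (T z - a)\<^sup>2) + ennreal (q z * (T z - b)\<^sup>2) + ennreal (?d / 4) * (ennreal (p z) + ennreal (q z)) \<partial>M)"
  proof (rule nn_integral_mono)
    fix z
    have "?d * sqrt (p z * q z) \<le> p z * (T z - a)\<^sup>2 + q z * (T z - b)\<^sup>2 + ?d / 4 * (p z + q z)"
      using two_point_inequality[of "sqrt (p z)" "sqrt (q z)" a b "T z"] p(1)[of z] q(1)[of z]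
      by (simp add: real_sqrt_mult mult.commute)
    then show "ennreal (?d * sqrt (p z * q z)) \<le> ennreal (p z * (T z - a)\<^sup>2) + ennreal (q z * (T z - b)\<^sup>2) + ennreal (?d / 4) * (ennreal (p z) + ennreal (q z))"
      using p(1)[of z] q(1)[of z] by (simp add: ennreal_leI flip: ennreal_plus ennreal_mult)
  qed
  also have "\<dots> = ?P + ?Q + ennreal (?d / 4) * (1 + 1)"
    using p(2) q(2) by (simp add: nn_integral_add nn_integral_cmult)
  also have "ennreal (?d / 4) * (1 + 1) = ennreal (?d / 2)"
  proof -
    have "ennreal (?d / 4) * (1 + 1) = ennreal (?d / 4) + ennreal (?d / 4)" by (simp only: distrib_left mult_1_right)
    also have "\<dots> = ennreal (?d / 2)" by (simp flip: ennreal_plus)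
    finally show ?thesis .
  qed
  finally have "ennreal (?d / 2) + ennreal (?d / 4) \<le> ennreal (?d / 2) + (?P + ?Q)" by (simp add: add.commute)
  then show ?thesis unfolding P Q by (simp add: ennreal_add_left_cancel_le)
qed

text \<open>All hypotheses become densities with respect to the same product measure, so that the
  affinity of two samples is defined and factorises.\<close>

lemma PiM_density_finite:
  fixes p :: "'z \<Rightarrow> real"
  assumes M: "sigma_finite_measure M" and [measurable]: "p \<in> borel_measurable M" and p: "\<And>z. p z \<ge> 0"
    and P: "sigma_finite_measure (density M (\<lambda>z. ennreal (p z)))" and I: "finite I"
  shows "(\<Pi>\<^sub>M i\<in>I. density M (\<lambda>z. ennreal (p z))) = density (\<Pi>\<^sub>M i\<in>I. M) (\<lambda>s. ennreal (\<Prod>i\<in>I. p (s i)))"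
proof -
  interpret M: product_sigma_finite "\<lambda>i. M" using M by (simp add: product_sigma_finite_def)
  interpret P: product_sigma_finite "\<lambda>i. density M (\<lambda>z. ennreal (p z))" using P by (simp add: product_sigma_finite_def)
  have mp: "(\<lambda>s. \<Prod>i\<in>I. p (s i)) \<in> borel_measurable (\<Pi>\<^sub>M i\<in>I. M)"
    by (intro borel_measurable_prod measurable_compose[OF measurable_component_singleton]) auto
  show ?thesis
  proof (rule P.PiM_eqI[OF I, symmetric])
    show "sets (density (\<Pi>\<^sub>M i\<in>I. M) (\<lambda>s. ennreal (\<Prod>i\<in>I. p (s i)))) = sets (\<Pi>\<^sub>M i\<in>I. density M (\<lambda>z. ennreal (p z)))"
      by (simp cong: sets_PiM_cong)
    fix A assume "\<And>i. i \<in> I \<Longrightarrow> A i \<in> sets (density M (\<lambda>z. ennreal (p z)))"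
    then have A: "\<And>i. i \<in> I \<Longrightarrow> A i \<in> sets M" by simp
    have "emeasure (density (\<Pi>\<^sub>M i\<in>I. M) (\<lambda>s. ennreal (\<Prod>i\<in>I. p (s i)))) (Pi\<^sub>E I A)
      = (\<integral>\<^sup>+s. ennreal (\<Prod>i\<in>I. p (s i)) * indicator (Pi\<^sub>E I A) s \<partial>(\<Pi>\<^sub>M i\<in>I. M))"
      using A I mp by (intro emeasure_density) (auto intro!: sets_PiM_I_finite)
    also have "\<dots> = (\<integral>\<^sup>+s. (\<Prod>i\<in>I. ennreal (p (s i)) * indicator (A i) (s i)) \<partial>(\<Pi>\<^sub>M i\<in>I. M))"
    proof (rule nn_integral_cong)
      fix s assume "s \<in> space (\<Pi>\<^sub>M i\<in>I. M)"
      then have ext: "s \<in> extensional I" by (auto simp: space_PiM PiE_def)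
      have "(indicator (Pi\<^sub>E I A) s :: ennreal) = (\<Prod>i\<in>I. indicator (A i) (s i))"
      proof (cases "s \<in> Pi\<^sub>E I A")
        case True
        then have "(\<Prod>i\<in>I. indicator (A i) (s i)) = (1 :: ennreal)" by (intro prod.neutral ballI) (auto simp: PiE_iff)
        then show ?thesis using True by simp
      next
        case False
        then obtain i where "i \<in> I" "s i \<notin> A i" using ext by (auto simp: PiE_def)
        then have "(\<Prod>i\<in>I. indicator (A i) (s i)) = (0 :: ennreal)" using I by (intro prod_zero bexI[of _ i]) auto
        then show ?thesis using False by simp
      qed
      then show "ennreal (\<Prod>i\<in>I. p (s i)) * indicator (Pi\<^sub>E I A) s = (\<Prod>i\<in>I. ennreal (p (s i)) * indicator (A i) (s i))"
        using p by (simp add: prod.distrib prod_ennreal)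
    qed
    also have "\<dots> = (\<Prod>i\<in>I. \<integral>\<^sup>+z. ennreal (p z) * indicator (A i) z \<partial>M)"
      using A I by (intro M.product_nn_integral_prod) auto
    also have "\<dots> = (\<Prod>i\<in>I. emeasure (density M (\<lambda>z. ennreal (p z))) (A i))"
      using A by (intro prod.cong refl) (simp add: emeasure_density)
    finally show "emeasure (density (\<Pi>\<^sub>M i\<in>I. M) (\<lambda>s. ennreal (\<Prod>i\<in>I. p (s i)))) (Pi\<^sub>E I A)
      = (\<Prod>i\<in>I. emeasure (density M (\<lambda>z. ennreal (p z))) (A i))" .
  qed
qed

text \<open>With unit scale and uniform design an observation has the error density shifted by \<mu>
  as its density over the cube times the line. The lower bound is proved within this
  submodel.\<close>

lemma obs_law_unit:
  fixes f :: "real \<Rightarrow> real" and \<mu> :: "real ^ 'd::finite \<Rightarrow> real"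
  assumes f [measurable]: "f \<in> borel_measurable borel" "\<And>y. f y \<ge> 0" "has_bochner_integral lborel f 1"
    and \<mu> [measurable]: "\<mu> \<in> borel_measurable borel"
  shows "obs_law f \<mu> (\<lambda>_. 1) (\<lambda>_. 1) = density lborel (\<lambda>z. ennreal (indicator unit_cube (fst z) * f (snd z - \<mu> (fst z))))"
proof (rule measure_eqI)
  have one: "density cube_measure (\<lambda>x::real ^ 'd. ennreal 1) = cube_measure"
    using density_1[of "cube_measure :: (real ^ 'd) measure"] by simp
  interpret R: regression f \<mu> "\<lambda>_. 1" "\<lambda>_. 1"
    by (rule regression.intro) (use f \<mu> one prob_space_cube_measure in \<open>auto intro: measurable_cube_measure_borel\<close>)
  let ?T = "\<lambda>z. (fst z, \<mu> (fst z) + 1 * snd z)"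
  have mT: "?T \<in> measurable (R.MX \<Otimes>\<^sub>M R.ME) borel" using R.measurable_obs by (simp add: case_prod_beta')
  show "sets (obs_law f \<mu> (\<lambda>_. 1) (\<lambda>_. 1)) = sets (density lborel (\<lambda>z. ennreal (indicator unit_cube (fst z) * f (snd z - \<mu> (fst z)))))"
    by (simp add: obs_law_def)
  fix A assume "A \<in> sets (obs_law f \<mu> (\<lambda>_. 1) (\<lambda>_. 1))"
  then have A [measurable]: "A \<in> sets borel" by (simp add: obs_law_def)
  have A2 [measurable]: "A \<in> sets (borel \<Otimes>\<^sub>M borel)" unfolding borel_prod by (rule A)
  have mi: "(\<lambda>z. indicator A (?T z) :: ennreal) \<in> borel_measurable (R.MX \<Otimes>\<^sub>M R.ME)"
    by (rule measurable_compose[OF mT]) simp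
  have "emeasure (obs_law f \<mu> (\<lambda>_. 1) (\<lambda>_. 1)) A = (\<integral>\<^sup>+z. indicator A z \<partial>obs_law f \<mu> (\<lambda>_. 1) (\<lambda>_. 1))"
    using A by (simp add: obs_law_def)
  also have "\<dots> = (\<integral>\<^sup>+z. indicator A (?T z) \<partial>(R.MX \<Otimes>\<^sub>M R.ME))"
    unfolding obs_law_def using R.measurable_obs by (subst nn_integral_distr) (auto simp: case_prod_beta')
  also have "\<dots> = (\<integral>\<^sup>+x. (\<integral>\<^sup>+e. indicator A (x, \<mu> x + e) \<partial>R.ME) \<partial>R.MX)"
    using R.E.nn_integral_fst[OF mi] by simp
  also have "\<dots> = (\<integral>\<^sup>+x. (\<integral>\<^sup>+y. ennreal (f (y - \<mu> x)) * indicator A (x, y) \<partial>lborel) \<partial>cube_measure)"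
    unfolding one
  proof (rule nn_integral_cong)
    fix x :: "real ^ 'd"
    have "(\<integral>\<^sup>+e. indicator A (x, \<mu> x + e) \<partial>R.ME) = (\<integral>\<^sup>+e. ennreal (f e) * indicator A (x, \<mu> x + e) \<partial>lborel)"
      by (rule nn_integral_density) measurable
    also have "\<dots> = (\<integral>\<^sup>+y. ennreal (f (y - \<mu> x)) * indicator A (x, y) \<partial>lborel)"
      using nn_integral_real_affine[of "\<lambda>y. ennreal (f (y - \<mu> x)) * indicator A (x, y)" 1 "\<mu> x"] by simp
    finally show "(\<integral>\<^sup>+e. indicator A (x, \<mu> x + e) \<partial>R.ME) = (\<integral>\<^sup>+y. ennreal (f (y - \<mu> x)) * indicator A (x, y) \<partial>lborel)" .
  qed
  also have "\<dots> = (\<integral>\<^sup>+x. (\<integral>\<^sup>+y. ennreal (f (y - \<mu> x)) * indicator A (x, y) \<partial>lborel) * indicator unit_cube x \<partial>lborel)"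
    unfolding cube_measure_def by (rule nn_integral_restrict_space) simp
  also have "\<dots> = (\<integral>\<^sup>+x. (\<integral>\<^sup>+y. ennreal (indicator unit_cube x * f (y - \<mu> x)) * indicator A (x, y) \<partial>lborel) \<partial>lborel)"
    by (intro nn_integral_cong) (auto simp: indicator_def)
  also have "\<dots> = (\<integral>\<^sup>+z. ennreal (indicator unit_cube (fst z) * f (snd z - \<mu> (fst z))) * indicator A z \<partial>(lborel \<Otimes>\<^sub>M lborel))"
  proof -
    have [measurable]: "unit_cube \<in> sets (borel :: (real ^ 'd) measure)" by simp
    have "(\<lambda>z. ennreal (indicator unit_cube (fst z) * f (snd z - \<mu> (fst z))) * indicator A z) \<in> borel_measurable (lborel \<Otimes>\<^sub>M lborel)"
      by measurable
    from lborel.nn_integral_fst[OF this] show ?thesis by simp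
  qed
  also have "\<dots> = emeasure (density lborel (\<lambda>z. ennreal (indicator unit_cube (fst z) * f (snd z - \<mu> (fst z))))) A"
    unfolding lborel_prod by (subst emeasure_density) (auto simp: borel_prod[symmetric])
  finally show "emeasure (obs_law f \<mu> (\<lambda>_. 1) (\<lambda>_. 1)) A
    = emeasure (density lborel (\<lambda>z. ennreal (indicator unit_cube (fst z) * f (snd z - \<mu> (fst z))))) A" .
qed

text \<open>Assouad's lemma; adding or removing a single bump must be undetectable from the sample.\<close>

lemma assouad_lower:
  fixes f :: "real \<Rightarrow> real" and \<beta> :: "'k \<Rightarrow> real ^ 'd::finite \<Rightarrow> real"
  assumes f: "continuous_on UNIV f" "\<And>y. 0 < f y" "has_bochner_integral lborel f 1"
    and H: "H > 0" "\<And>a b. \<bar>a - b\<bar> \<le> 1 \<Longrightarrow> ennreal (1 - H * (a - b)\<^sup>2) \<le> (\<integral>\<^sup>+y. ennreal (sqrt (f (y - a) * f (y - b))) \<partial>lborel)"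
    and I: "finite I" and \<beta>: "\<And>k. k \<in> I \<Longrightarrow> continuous_on UNIV (\<beta> k)" "\<And>k x. k \<in> I \<Longrightarrow> \<bar>\<beta> k x\<bar> \<le> 1"
    and disj: "\<And>k k' x. k \<in> I \<Longrightarrow> k' \<in> I \<Longrightarrow> \<beta> k x \<noteq> 0 \<Longrightarrow> \<beta> k' x \<noteq> 0 \<Longrightarrow> k = k'"
    and small: "\<And>k. k \<in> I \<Longrightarrow> real n * H * (\<integral>x. (\<beta> k x)\<^sup>2 \<partial>cube_measure) \<le> 1 / 4"
    and m: "m \<in> estimators n"
    and R: "\<And>S. S \<subseteq> I \<Longrightarrow> (\<integral>\<^sup>+s. sq_dist (\<lambda>_. 1) (\<lambda>x. \<Sum>k\<in>S. \<beta> k x) (m s) \<partial>sample_law f n (\<lambda>x. \<Sum>k\<in>S. \<beta> k x) (\<lambda>_. 1) (\<lambda>_. 1)) \<le> R"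
  shows "ennreal (1 / 8 * (\<Sum>k\<in>I. \<integral>x. (\<beta> k x)\<^sup>2 \<partial>cube_measure)) \<le> R"
proof -
  define \<mu> where "\<mu> S x = (\<Sum>k\<in>S. \<beta> k x)" for S x
  have mf [measurable]: "f \<in> borel_measurable borel" using f(1) by (rule borel_measurable_continuous_onI)
  have c\<mu>: "continuous_on UNIV (\<mu> S)" if "S \<subseteq> I" for S
    unfolding \<mu>_def[abs_def] using that \<beta>(1) by (intro continuous_on_sum) auto
  have m\<mu>: "\<mu> S \<in> borel_measurable borel" if "S \<subseteq> I" for S
    using c\<mu>[OF that] by (rule borel_measurable_continuous_onI)
  define p where "p S z = indicator unit_cube (fst z) * f (snd z - \<mu> S (fst z))" for S and z :: "(real ^ 'd) \<times> real"
  have cube_borel [measurable]: "unit_cube \<in> sets (borel :: (real ^ 'd) measure)" by simp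
  have mp: "p S \<in> borel_measurable borel" if S: "S \<subseteq> I" for S
  proof -
    note [measurable] = m\<mu>[OF S]
    show ?thesis unfolding p_def[abs_def] borel_prod[symmetric] by measurable
  qed
  have p0: "p S z \<ge> 0" for S z using f(2)[of "snd z - \<mu> S (fst z)"] by (auto simp: p_def indicator_def less_imp_le)
  have obs: "obs_law f (\<mu> S) (\<lambda>_. 1) (\<lambda>_. 1) = density lborel (\<lambda>z. ennreal (p S z))" if "S \<subseteq> I" for S
    unfolding p_def by (rule obs_law_unit[OF mf less_imp_le[OF f(2)] f(3) m\<mu>[OF that]])
  have prob: "prob_space (density lborel (\<lambda>z. ennreal (p S z)))" if "S \<subseteq> I" for S
  proof -
    have one: "density cube_measure (\<lambda>x::real ^ 'd. ennreal 1) = cube_measure"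
      using density_1[of "cube_measure :: (real ^ 'd) measure"] by simp
    have "regression f (\<mu> S) (\<lambda>_. 1) (\<lambda>_. 1)"
      by (rule regression.intro) (use f m\<mu>[OF that] one prob_space_cube_measure in \<open>auto intro: measurable_cube_measure_borel less_imp_le\<close>)
    from regression.prob_space_obs[OF this] show ?thesis unfolding obs[OF that] .
  qed
  let ?N = "\<Pi>\<^sub>M i\<in>{..<n}. (lborel :: ((real ^ 'd) \<times> real) measure)"
  define pn where "pn S s = (\<Prod>i<n. p S (s i))" for S and s :: "nat \<Rightarrow> (real ^ 'd) \<times> real"
  have samp: "sample_law f n (\<mu> S) (\<lambda>_. 1) (\<lambda>_. 1) = density ?N (\<lambda>s. ennreal (pn S s))" if S: "S \<subseteq> I" for S
    unfolding sample_law_def obs[OF S] pn_def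
    by (rule PiM_density_finite) (use mp[OF S] p0 prob[OF S] in \<open>auto intro: lborel.sigma_finite_measure_axioms prob_space_imp_sigma_finite\<close>)
  interpret LN: product_sigma_finite "\<lambda>i. lborel :: ((real ^ 'd) \<times> real) measure" ..
  have mpn: "pn S \<in> borel_measurable ?N" if S: "S \<subseteq> I" for S
    unfolding pn_def[abs_def] using mp[OF S]
    by (intro borel_measurable_prod measurable_compose[OF measurable_component_singleton]) auto
  have pn0: "pn S s \<ge> 0" for S s unfolding pn_def using p0 by (intro prod_nonneg) auto
  have pn1: "(\<integral>\<^sup>+s. ennreal (pn S s) \<partial>?N) = 1" if S: "S \<subseteq> I" for S
  proof -
    have "prob_space (\<Pi>\<^sub>M i\<in>{..<n}. density lborel (\<lambda>z. ennreal (p S z)))"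
      by (rule prob_space_PiM[OF prob[OF S]])
    then have "prob_space (density ?N (\<lambda>s. ennreal (pn S s)))"
      using samp[OF S] by (simp add: sample_law_def obs[OF S])
    from prob_space.emeasure_space_1[OF this] show ?thesis
      using mpn[OF S] by (subst (asm) emeasure_density_space) auto
  qed
  \<comment> \<open>One observation has affinity at least 1 - \<delta>; independence raises this to
    the n-th power, and Bernoulli's inequality with n \<delta> \<le> 1 / 4 gives 3 / 4.\<close>
  have aff: "ennreal (3 / 4) \<le> (\<integral>\<^sup>+s. ennreal (sqrt (pn S s * pn (insert k S) s)) \<partial>?N)"
    if S: "S \<subseteq> I" and k: "k \<in> I" "k \<notin> S" for S k
  proof -
    have S': "insert k S \<subseteq> I" using S k by simp
    have fS: "finite S" using finite_subset[OF S I] .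
    have diff: "\<mu> S x - \<mu> (insert k S) x = - \<beta> k x" for x using fS k by (simp add: \<mu>_def)
    define \<delta> where "\<delta> = H * (\<integral>x. (\<beta> k x)\<^sup>2 \<partial>cube_measure)"
    have n\<delta>: "real n * \<delta> \<le> 1 / 4" using small[OF k(1)] by (simp add: \<delta>_def mult.assoc)
    have \<delta>0: "\<delta> \<ge> 0" using H(1) by (simp add: \<delta>_def)
    have sb: "square_integrable (\<beta> k)" by (intro square_integrable_continuous \<beta> k)
    have ib: "integrable cube_measure (\<lambda>x. (\<beta> k x)\<^sup>2)" using sb by (simp add: square_integrable_def)
    have one_step: "ennreal (1 - \<delta>) \<le> (\<integral>\<^sup>+z. ennreal (sqrt (p S z * p (insert k S) z)) \<partial>lborel)"
    \<comment> \<open>For \<delta> > 1 the left-hand side is 0, since \<open>ennreal\<close> sends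
      negative numbers to 0.\<close>
    proof (cases "\<delta> \<le> 1")
      case True
      have "ennreal (1 - \<delta>) = ennreal (\<integral>x. 1 - H * (\<beta> k x)\<^sup>2 \<partial>cube_measure)"
        using ib by (simp add: \<delta>_def)
      also have "\<dots> \<le> (\<integral>\<^sup>+x. ennreal (1 - H * (\<beta> k x)\<^sup>2) \<partial>cube_measure)"
      proof -
        have "(\<integral>x. 1 - H * (\<beta> k x)\<^sup>2 \<partial>cube_measure) \<le> (\<integral>x. max 0 (1 - H * (\<beta> k x)\<^sup>2) \<partial>cube_measure)"
          using ib by (intro integral_mono) auto
        then have "ennreal (\<integral>x. 1 - H * (\<beta> k x)\<^sup>2 \<partial>cube_measure) \<le> ennreal (\<integral>x. max 0 (1 - H * (\<beta> k x)\<^sup>2) \<partial>cube_measure)"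
          by (rule ennreal_leI)
        also have "\<dots> = (\<integral>\<^sup>+x. ennreal (max 0 (1 - H * (\<beta> k x)\<^sup>2)) \<partial>cube_measure)"
          using ib by (intro nn_integral_eq_integral[symmetric]) auto
        also have "\<dots> = (\<integral>\<^sup>+x. ennreal (1 - H * (\<beta> k x)\<^sup>2) \<partial>cube_measure)"
          by (intro nn_integral_cong) (auto simp: max_def ennreal_neg)
        finally show ?thesis .
      qed
      also have "\<dots> \<le> (\<integral>\<^sup>+x. (\<integral>\<^sup>+y. ennreal (sqrt (f (y - \<mu> S x) * f (y - \<mu> (insert k S) x))) \<partial>lborel) \<partial>cube_measure)"
      proof (rule nn_integral_mono)
        fix x
        show "ennreal (1 - H * (\<beta> k x)\<^sup>2) \<le> (\<integral>\<^sup>+y. ennreal (sqrt (f (y - \<mu> S x) * f (y - \<mu> (insert k S) x))) \<partial>lborel)"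
          using H(2)[of "\<mu> S x" "\<mu> (insert k S) x"] \<beta>(2)[OF k(1), of x] by (simp add: diff)
      qed
      also have "\<dots> = (\<integral>\<^sup>+x. (\<integral>\<^sup>+y. ennreal (sqrt (f (y - \<mu> S x) * f (y - \<mu> (insert k S) x))) \<partial>lborel) * indicator unit_cube x \<partial>lborel)"
        unfolding cube_measure_def by (rule nn_integral_restrict_space) simp
      also have "\<dots> = (\<integral>\<^sup>+x. (\<integral>\<^sup>+y. ennreal (sqrt (p S (x, y) * p (insert k S) (x, y))) \<partial>lborel) \<partial>lborel)"
        by (intro nn_integral_cong) (auto simp: p_def indicator_def)
      also have "\<dots> = (\<integral>\<^sup>+z. ennreal (sqrt (p S z * p (insert k S) z)) \<partial>(lborel \<Otimes>\<^sub>M lborel))"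
      proof (rule lborel.nn_integral_fst)
        show "(\<lambda>z. ennreal (sqrt (p S z * p (insert k S) z))) \<in> borel_measurable (lborel \<Otimes>\<^sub>M lborel)"
          unfolding lborel_prod using mp[OF S] mp[OF S'] by simp
      qed
      finally show ?thesis unfolding lborel_prod .
    qed (simp add: ennreal_neg)
    have "3 / 4 \<le> 1 - real n * \<delta>" using n\<delta> by simp
    also have "\<dots> \<le> (1 - \<delta>) ^ n"
    proof (cases "n = 0")
      case False
      then have "\<delta> \<le> real n * \<delta>" using \<delta>0 by (intro mult_le_cancel_right1[THEN iffD2]) auto
      then have "- \<delta> \<ge> - 1" using n\<delta> by linarith
      from Bernoulli_inequality[OF this, of n] show ?thesis by simp
    qed simp
    finally have "ennreal (3 / 4) \<le> ennreal ((1 - \<delta>) ^ n)" by (rule ennreal_leI)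
    also have "\<dots> \<le> (ennreal (1 - \<delta>)) ^ n"
    proof (cases "n = 0")
      case False
      then have "\<delta> \<le> real n * \<delta>" using \<delta>0 by (intro mult_le_cancel_right1[THEN iffD2]) auto
      then show ?thesis using n\<delta> by (simp add: ennreal_power)
    qed simp
    also have "\<dots> \<le> (\<integral>\<^sup>+z. ennreal (sqrt (p S z * p (insert k S) z)) \<partial>lborel) ^ n"
      by (rule power_mono[OF one_step]) simp
    also have "\<dots> = (\<Prod>i<n. \<integral>\<^sup>+z. ennreal (sqrt (p S z * p (insert k S) z)) \<partial>lborel)" by simp
    also have "\<dots> = (\<integral>\<^sup>+s. (\<Prod>i<n. ennreal (sqrt (p S (s i) * p (insert k S) (s i)))) \<partial>?N)"
      using mp[OF S] mp[OF S'] by (intro LN.product_nn_integral_prod[symmetric]) auto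
    also have "\<dots> = (\<integral>\<^sup>+s. ennreal (sqrt (pn S s * pn (insert k S) s)) \<partial>?N)"
    proof (rule nn_integral_cong)
      fix s
      have sp: "sqrt (\<Prod>i<j. g i) = (\<Prod>i<j. sqrt (g i))" for g :: "nat \<Rightarrow> real" and j
        by (induction j) (auto simp: real_sqrt_mult)
      show "(\<Prod>i<n. ennreal (sqrt (p S (s i) * p (insert k S) (s i)))) = ennreal (sqrt (pn S s * pn (insert k S) s))"
        using p0 by (simp add: pn_def sp prod.distrib[symmetric] prod_ennreal)
    qed
    finally show ?thesis .
  qed
  have mm: "(\<lambda>(s, x). m s x) \<in> borel_measurable ((\<Pi>\<^sub>M i\<in>{..<n}. borel) \<Otimes>\<^sub>M cube_measure)"
    using m by (simp add: estimators_def)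
  have setsN: "sets ?N = sets (\<Pi>\<^sub>M i\<in>{..<n}. borel)" by (intro sets_PiM_cong) auto
  have mN: "(\<lambda>(s, x). m s x) \<in> borel_measurable (?N \<Otimes>\<^sub>M cube_measure)"
    using mm measurable_cong_sets[OF sets_pair_measure_cong[OF setsN refl] refl] by blast
  have mx: "(\<lambda>s. m s x) \<in> borel_measurable ?N" if x: "x \<in> unit_cube" for x
    using measurable_compose[OF measurable_Pair[OF measurable_ident_sets[OF refl] measurable_const[of x]] mN] x by simp
  \<comment> \<open>The risk at the point x under the hypothesis S. Comparing hypotheses at a fixed
    x avoids any projection of the estimator onto the span of the bumps.\<close>
  define G where "G S x = (\<integral>\<^sup>+s. ennreal ((m s x - \<mu> S x)\<^sup>2) \<partial>density ?N (\<lambda>s. ennreal (pn S s)))" for S x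
  have pair: "ennreal ((\<beta> k x)\<^sup>2 / 4) \<le> G S x + G (insert k S) x"
    if S: "S \<subseteq> I" and k: "k \<in> I" "k \<notin> S" and x: "x \<in> unit_cube" for S k x
  proof -
    have S': "insert k S \<subseteq> I" using S k by simp
    have fS: "finite S" using finite_subset[OF S I] .
    have "(\<mu> S x - \<mu> (insert k S) x)\<^sup>2 = (\<beta> k x)\<^sup>2" using fS k by (simp add: \<mu>_def power2_eq_square)
    moreover have "ennreal ((\<mu> S x - \<mu> (insert k S) x)\<^sup>2 / 4) \<le> G S x + G (insert k S) x"
      unfolding G_def
      by (rule two_point_risk[OF mpn[OF S] mpn[OF S'] mx[OF x] pn0 pn1[OF S] pn0 pn1[OF S'] aff[OF S k]])
    ultimately show ?thesis by simp
  qed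
  \<comment> \<open>At a given x at most one bump is nonzero. The subsets are paired by adding or
    removing its index, which gives 2^(card I - 1) pairs, each subject to the two-point
    bound.\<close>
  have sumG: "ennreal (2 ^ (card I - 1) * ((\<Sum>k\<in>I. (\<beta> k x)\<^sup>2) / 4)) \<le> (\<Sum>S\<in>Pow I. G S x)" if x: "x \<in> unit_cube" for x
  proof (cases "\<exists>k\<in>I. \<beta> k x \<noteq> 0")
    case True
    then obtain k where k: "k \<in> I" "\<beta> k x \<noteq> 0" by blast
    have "(\<Sum>k\<in>I. (\<beta> k x)\<^sup>2) = (\<Sum>k\<in>{k}. (\<beta> k x)\<^sup>2)"
      using I k disj by (intro sum.mono_neutral_right) auto
    then have 1: "(\<Sum>k\<in>I. (\<beta> k x)\<^sup>2) = (\<beta> k x)\<^sup>2" by simp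
    have fI: "finite (Pow (I - {k}))" using I by simp
    have "Pow I = Pow (I - {k}) \<union> insert k ` Pow (I - {k})"
      using Pow_insert[of k "I - {k}"] k(1) by (simp add: insert_absorb)
    moreover have "Pow (I - {k}) \<inter> insert k ` Pow (I - {k}) = {}" by auto
    ultimately have "(\<Sum>S\<in>Pow I. G S x) = (\<Sum>S\<in>Pow (I - {k}). G S x) + (\<Sum>S\<in>insert k ` Pow (I - {k}). G S x)"
      using fI by (simp add: sum.union_disjoint)
    also have "(\<Sum>S\<in>insert k ` Pow (I - {k}). G S x) = (\<Sum>S\<in>Pow (I - {k}). G (insert k S) x)"
      by (subst sum.reindex) (auto simp: inj_on_def)
    also have "(\<Sum>S\<in>Pow (I - {k}). G S x) + (\<Sum>S\<in>Pow (I - {k}). G (insert k S) x) = (\<Sum>S\<in>Pow (I - {k}). G S x + G (insert k S) x)"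
      by (simp add: sum.distrib)
    also have "\<dots> \<ge> (\<Sum>S\<in>Pow (I - {k}). ennreal ((\<beta> k x)\<^sup>2 / 4))"
      using k x by (intro sum_mono pair) auto
    also have "(\<Sum>S\<in>Pow (I - {k}). ennreal ((\<beta> k x)\<^sup>2 / 4)) = ennreal (\<Sum>S\<in>Pow (I - {k}). (\<beta> k x)\<^sup>2 / 4)"
      by (rule sum_ennreal) simp
    also have "(\<Sum>S\<in>Pow (I - {k}). (\<beta> k x)\<^sup>2 / 4) = 2 ^ (card I - 1) * ((\<Sum>k\<in>I. (\<beta> k x)\<^sup>2) / 4)"
      using I k by (simp add: card_Pow 1)
    finally show ?thesis .
  next
    case False
    then show ?thesis by simp
  qed
  have risk: "(\<integral>\<^sup>+s. sq_dist (\<lambda>_. 1) (\<mu> S) (m s) \<partial>sample_law f n (\<mu> S) (\<lambda>_. 1) (\<lambda>_. 1)) = (\<integral>\<^sup>+x. G S x \<partial>cube_measure)"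
    and mG: "G S \<in> borel_measurable cube_measure" if S: "S \<subseteq> I" for S
  proof -
    let ?D = "density ?N (\<lambda>s. ennreal (pn S s))"
    have "prob_space (\<Pi>\<^sub>M i\<in>{..<n}. density lborel (\<lambda>z. ennreal (p S z)))"
      by (rule prob_space_PiM[OF prob[OF S]])
    then have "prob_space ?D" using samp[OF S] by (simp add: sample_law_def obs[OF S])
    then have sD: "sigma_finite_measure ?D" by (rule prob_space_imp_sigma_finite)
    interpret PS: pair_sigma_finite ?D "cube_measure :: (real ^ 'd) measure"
      using sD by (simp add: pair_sigma_finite_def cube.sigma_finite_measure_axioms)
    have mD: "(\<lambda>z. m (fst z) (snd z)) \<in> borel_measurable (?D \<Otimes>\<^sub>M cube_measure)"
      using mN measurable_cong_sets[OF sets_pair_measure_cong[OF sets_density refl] refl] by (auto simp: case_prod_beta')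
    have m\<mu>D: "(\<lambda>z. \<mu> S (snd z)) \<in> borel_measurable (?D \<Otimes>\<^sub>M cube_measure)"
      by (rule measurable_compose[OF measurable_snd measurable_cube_measure_borel[OF m\<mu>[OF S]]])
    have mE: "(\<lambda>(s, x). ennreal ((m s x - \<mu> S x)\<^sup>2)) \<in> borel_measurable (?D \<Otimes>\<^sub>M cube_measure)"
      using mD m\<mu>D unfolding case_prod_beta' by measurable
    have "(\<integral>\<^sup>+s. sq_dist (\<lambda>_. 1) (\<mu> S) (m s) \<partial>sample_law f n (\<mu> S) (\<lambda>_. 1) (\<lambda>_. 1))
      = (\<integral>\<^sup>+s. (\<integral>\<^sup>+x. ennreal ((m s x - \<mu> S x)\<^sup>2) \<partial>cube_measure) \<partial>?D)"
      unfolding samp[OF S] sq_dist_def by (simp add: power2_commute)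
    also have "\<dots> = (\<integral>\<^sup>+x. G S x \<partial>cube_measure)"
      unfolding G_def by (rule PS.Fubini'[OF mE, symmetric])
    finally show "(\<integral>\<^sup>+s. sq_dist (\<lambda>_. 1) (\<mu> S) (m s) \<partial>sample_law f n (\<mu> S) (\<lambda>_. 1) (\<lambda>_. 1)) = (\<integral>\<^sup>+x. G S x \<partial>cube_measure)" .
    show "G S \<in> borel_measurable cube_measure"
    proof -
      have "(\<lambda>(x, s). ennreal ((m s x - \<mu> S x)\<^sup>2)) \<in> borel_measurable (cube_measure \<Otimes>\<^sub>M ?D)"
        using measurable_pair_swap[OF mE] by (simp add: case_prod_beta')
      then show ?thesis unfolding G_def[abs_def] by (rule PS.M1.borel_measurable_nn_integral)
    qed
  qed
  let ?J = "\<Sum>k\<in>I. \<integral>x. (\<beta> k x)\<^sup>2 \<partial>cube_measure"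
  have ib: "integrable cube_measure (\<lambda>x. (\<beta> k x)\<^sup>2)" if "k \<in> I" for k
    using square_integrable_continuous[OF \<beta>(1)[OF that]] by (simp add: square_integrable_def)
  have "ennreal (2 ^ (card I - 1) * (?J / 4)) = ennreal (\<integral>x. 2 ^ (card I - 1) * ((\<Sum>k\<in>I. (\<beta> k x)\<^sup>2) / 4) \<partial>cube_measure)"
    using ib by (simp add: Bochner_Integration.integral_sum)
  also have "\<dots> = (\<integral>\<^sup>+x. ennreal (2 ^ (card I - 1) * ((\<Sum>k\<in>I. (\<beta> k x)\<^sup>2) / 4)) \<partial>cube_measure)"
    using ib by (intro nn_integral_eq_integral[symmetric]) (auto intro!: AE_I2 mult_nonneg_nonneg sum_nonneg)
  also have "\<dots> \<le> (\<integral>\<^sup>+x. (\<Sum>S\<in>Pow I. G S x) \<partial>cube_measure)"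
    using sumG by (intro nn_integral_mono) simp
  also have "\<dots> = (\<Sum>S\<in>Pow I. \<integral>\<^sup>+x. G S x \<partial>cube_measure)"
    using mG by (intro nn_integral_sum) auto
  also have "\<dots> \<le> (\<Sum>S\<in>Pow I. R)"
    using R risk by (intro sum_mono) (auto simp: \<mu>_def[abs_def])
  also have "\<dots> = ennreal (2 ^ card I) * R" using I by (simp add: card_Pow ennreal_power[symmetric])
  \<comment> \<open>R bounds the risk of each of the 2^(card I) hypotheses; half as many pairs with
    the constant 1 / 4 leave the factor 1 / 8.\<close>
  finally have main: "ennreal (2 ^ (card I - 1) * (?J / 4)) \<le> ennreal (2 ^ card I) * R" .
  show ?thesis
  proof (cases "I = {}")
    case False
    then have c: "(2::real) ^ card I = 2 * 2 ^ (card I - 1)"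
      using I by (metis Suc_pred' card_gt_0_iff power_Suc)
    have J0: "?J \<ge> 0" by (intro sum_nonneg) simp
    have "ennreal (2 ^ card I) * ennreal (1 / 8 * ?J) = ennreal (2 ^ (card I - 1) * (?J / 4))"
      using J0 c by (simp flip: ennreal_mult)
    then have "ennreal (2 ^ card I) * ennreal (1 / 8 * ?J) \<le> ennreal (2 ^ card I) * R" using main by simp
    then show ?thesis by (subst (asm) ennreal_mult_le_mult_iff) auto
  qed simp
qed

section \<open>The minimax rate\<close>

lemma minimax_risk_cong_AE:
  assumes "f \<in> borel_measurable borel" "g \<in> borel_measurable borel" "AE y in lborel. f y = g y"
  shows "minimax_risk f = minimax_risk g"
proof -
  have "density lborel (\<lambda>e. ennreal (f e)) = density lborel (\<lambda>e. ennreal (g e))"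
    using assms by (intro density_cong) auto
  then show ?thesis by (simp add: fun_eq_iff minimax_risk_def sample_law_def obs_law_def)
qed

text \<open>m is n^(1 / (2 \<alpha> + r)) rounded up, the size at which the stochastic term m^r / n
  and the squared approximation error m^(- 2 \<alpha>) balance. As n \<ge> 1, rounding up at most
  doubles it, whence the constants 2^r and 4^\<alpha>.\<close>

lemma grid_size_exists:
  assumes n: "n \<ge> (1::nat)" and q: "2 * \<alpha> + r > (0::nat)"
  obtains m :: nat where "m \<ge> 1" "real n \<le> real m ^ (2 * \<alpha> + r)"
    "real m ^ r / real n \<le> 2 ^ r * real n powr (- (2 * real \<alpha> / (2 * real \<alpha> + real r)))"
    "1 / real m ^ (2 * \<alpha>) \<le> real n powr (- (2 * real \<alpha> / (2 * real \<alpha> + real r)))"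
    "real n powr (- (2 * real \<alpha> / (2 * real \<alpha> + real r))) \<le> 4 ^ \<alpha> / real m ^ (2 * \<alpha>)"
proof -
  let ?q = "2 * real \<alpha> + real r"
  have q0: "?q > 0" using q by (metis of_nat_0_less_iff of_nat_add of_nat_mult of_nat_numeral)
  define t where "t = real n powr (1 / ?q)"
  define m where "m = nat \<lceil>t\<rceil>"
  have t1: "t \<ge> 1" using n q0 by (simp add: t_def ge_one_powr_ge_zero)
  have tm: "t \<le> real m" "real m \<le> 2 * t" using t1 unfolding m_def by linarith+
  have tq: "t ^ (2 * \<alpha> + r) = real n"
  proof -
    have "t ^ (2 * \<alpha> + r) = t powr ?q" using t1 by (subst powr_realpow[symmetric]) auto
    also have "\<dots> = real n" using n q0 by (simp add: t_def powr_powr)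
    finally show ?thesis .
  qed
  have rate: "real n powr (- (2 * real \<alpha> / ?q)) = 1 / t ^ (2 * \<alpha>)"
  proof -
    have "t ^ (2 * \<alpha>) = t powr (2 * real \<alpha>)" using t1 by (subst powr_realpow[symmetric]) auto
    also have "\<dots> = real n powr (2 * real \<alpha> / ?q)" by (simp add: t_def powr_powr)
    finally show ?thesis by (simp add: powr_minus_divide)
  qed
  show ?thesis
  proof (rule that[of m])
    show "m \<ge> 1" using t1 tm(1) by linarith
    show "real n \<le> real m ^ (2 * \<alpha> + r)" unfolding tq[symmetric] using tm t1 by (intro power_mono) auto
    have "real m ^ r / real n \<le> (2 * t) ^ r / real n" using tm by (intro divide_right_mono power_mono) auto
    also have "\<dots> = 2 ^ r * (1 / t ^ (2 * \<alpha>))"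
      unfolding tq[symmetric] using t1 by (simp add: power_add power_mult_distrib field_simps)
    finally show "real m ^ r / real n \<le> 2 ^ r * real n powr (- (2 * real \<alpha> / ?q))" unfolding rate .
    show "1 / real m ^ (2 * \<alpha>) \<le> real n powr (- (2 * real \<alpha> / ?q))"
      unfolding rate using tm t1 by (intro divide_left_mono power_mono) auto
    have "real m ^ (2 * \<alpha>) \<le> (2 * t) ^ (2 * \<alpha>)" using tm by (intro power_mono) auto
    also have "\<dots> = 4 ^ \<alpha> * t ^ (2 * \<alpha>)" by (simp add: power_mult_distrib power_mult)
    finally show "real n powr (- (2 * real \<alpha> / ?q)) \<le> 4 ^ \<alpha> / real m ^ (2 * \<alpha>)"
      unfolding rate using t1 tm by (simp add: field_simps)
  qed
qed

text \<open>The net is clamped to [- B, B], so that loss differences become bounded. Clamping is a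
  contraction that fixes the values of \<mu> almost everywhere; hence it neither worsens the
  approximation nor enlarges the net.\<close>

lemma minimax_upper:
  fixes C C' Cbar B :: real and f :: "real \<Rightarrow> real"
    and T :: "(real ^ 'd::{finite,linorder} \<Rightarrow> real) set"
  assumes T: "T = interaction_class TYPE('r::{finite,linorder}) \<alpha> C"
    and C': "C' > 0" "Cbar > 1" and f: "regular_density f"
    and B: "B > 0" "\<And>\<mu>. \<mu> \<in> T \<Longrightarrow> AE x in cube_measure. \<bar>\<mu> x\<bar> \<le> B"
  shows "\<exists>A\<ge>0. \<forall>n\<ge>1. minimax_risk f T (scale_class C') (density_class Cbar) n
    \<le> ennreal (A * real n powr (- (2 * real \<alpha> / (2 * real \<alpha> + real CARD('r)))))"
proof (rule interaction_class_net[where ?'r = 'r and ?'d = 'd and C = C and \<alpha> = \<alpha>])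
  fix K1 :: real
  assume K1: "K1 \<ge> 0"
    and sq: "\<And>\<mu> :: (real, 'd) vec \<Rightarrow> real. \<mu> \<in> interaction_class TYPE('r) \<alpha> C \<Longrightarrow> square_integrable \<mu>"
    and net: "\<And>m. m \<ge> 1 \<Longrightarrow> \<exists>V :: ((real, 'd) vec \<Rightarrow> real) set.
      finite V \<and> V \<noteq> {} \<and> (\<forall>u\<in>V. continuous_on UNIV u) \<and> ln (real (card V)) \<le> K1 * real m ^ CARD('r) \<and>
      (\<forall>\<mu>\<in>interaction_class TYPE('r) \<alpha> C. \<exists>u\<in>V. (\<integral>x. (\<mu> x - u x)\<^sup>2 \<partial>cube_measure) \<le> K1 / real m ^ (2 * \<alpha>))"
  let ?rate = "\<lambda>n. real n powr (- (2 * real \<alpha> / (2 * real \<alpha> + real CARD('r))))"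
  have fr: "continuous_on UNIV f" "\<And>y. 0 < f y" "has_bochner_integral lborel f 1"
    using f by (auto simp: regular_density_def)
  obtain K where K: "K \<ge> 0" and up: "\<forall>n\<ge>1. \<forall>V :: ((real, 'd) vec \<Rightarrow> real) set. finite V \<longrightarrow> V \<noteq> {} \<longrightarrow>
      (\<forall>u\<in>V. u \<in> borel_measurable borel \<and> (\<forall>x. \<bar>u x\<bar> \<le> B)) \<longrightarrow>
      (\<exists>m\<in>estimators n. \<forall>\<mu> \<sigma> h u0. \<mu> \<in> borel_measurable cube_measure \<longrightarrow> (AE x in cube_measure. \<bar>\<mu> x\<bar> \<le> B) \<longrightarrow>
         \<sigma> \<in> scale_class C' \<longrightarrow> h \<in> density_class Cbar \<longrightarrow> u0 \<in> V \<longrightarrow>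
         (\<integral>\<^sup>+s. sq_dist h \<mu> (m s) \<partial>sample_law f n \<mu> \<sigma> h)
           \<le> ennreal (K * (ln (real (card V)) / real n + (\<integral>x. (\<mu> x - u0 x)\<^sup>2 \<partial>cube_measure))))"
    using regression_upper[OF fr B(1) C', where ?'d = 'd] by (elim exE conjE) (rule that)
  define A where "A = K * (K1 * (2 ^ CARD('r) + 1))"
  have "minimax_risk f T (scale_class C') (density_class Cbar) n \<le> ennreal (A * ?rate n)" if n: "n \<ge> 1" for n
  proof -
    obtain m where m: "m \<ge> 1" "real m ^ CARD('r) / real n \<le> 2 ^ CARD('r) * ?rate n" "1 / real m ^ (2 * \<alpha>) \<le> ?rate n"
      using grid_size_exists[OF n, of \<alpha> "CARD('r)"] by (metis add_gr_0 zero_less_card_finite)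
    obtain V :: "((real, 'd) vec \<Rightarrow> real) set" where V: "finite V" "V \<noteq> {}" "\<forall>u\<in>V. continuous_on UNIV u"
      "ln (real (card V)) \<le> K1 * real m ^ CARD('r)"
      "\<forall>\<mu>\<in>interaction_class TYPE('r) \<alpha> C. \<exists>u\<in>V. (\<integral>x. (\<mu> x - u x)\<^sup>2 \<partial>cube_measure) \<le> K1 / real m ^ (2 * \<alpha>)"
      using net[OF m(1)] by blast
    define W where "W = (\<lambda>u x. clamp B (u x)) ` V"
    have W: "finite W" "W \<noteq> {}" using V by (auto simp: W_def)
    have Wm: "\<forall>u\<in>W. u \<in> borel_measurable borel \<and> (\<forall>x. \<bar>u x\<bar> \<le> B)"
    proof
      fix w assume "w \<in> W"
      then obtain u where u: "u \<in> V" "w = (\<lambda>x. clamp B (u x))" by (auto simp: W_def)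
      have "u \<in> borel_measurable borel" using V(3) u(1) by (intro borel_measurable_continuous_onI) auto
      then show "w \<in> borel_measurable borel \<and> (\<forall>x. \<bar>w x\<bar> \<le> B)"
        unfolding u(2) using clamp_bound B(1) by (auto intro: measurable_compose[OF _ clamp_measurable])
    qed
    obtain e where e: "e \<in> estimators n" "\<And>\<mu> \<sigma> h u0. \<mu> \<in> borel_measurable cube_measure \<Longrightarrow> (AE x in cube_measure. \<bar>\<mu> x\<bar> \<le> B) \<Longrightarrow>
         \<sigma> \<in> scale_class C' \<Longrightarrow> h \<in> density_class Cbar \<Longrightarrow> u0 \<in> W \<Longrightarrow>
         (\<integral>\<^sup>+s. sq_dist h \<mu> (e s) \<partial>sample_law f n \<mu> \<sigma> h)
           \<le> ennreal (K * (ln (real (card W)) / real n + (\<integral>x. (\<mu> x - u0 x)\<^sup>2 \<partial>cube_measure)))"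
      using up[rule_format, OF n W] Wm by blast
    have risk: "(\<integral>\<^sup>+s. sq_dist h \<mu> (e s) \<partial>sample_law f n \<mu> \<sigma> h) \<le> ennreal (A * ?rate n)"
      if mu: "\<mu> \<in> T" and sg: "\<sigma> \<in> scale_class C'" and h: "h \<in> density_class Cbar" for \<mu> \<sigma> h
    proof -
      have sm: "square_integrable \<mu>" using sq mu T by blast
      then have mm: "\<mu> \<in> borel_measurable cube_measure" by (simp add: square_integrable_def)
      obtain u where u: "u \<in> V" "(\<integral>x. (\<mu> x - u x)\<^sup>2 \<partial>cube_measure) \<le> K1 / real m ^ (2 * \<alpha>)"
        using V(5) mu T by blast
      let ?w = "\<lambda>x. clamp B (u x)"
      have w: "?w \<in> W" using u(1) by (simp add: W_def)
      have wb: "?w \<in> borel_measurable borel" "\<And>x. \<bar>?w x\<bar> \<le> B" using Wm w by auto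
      have su: "square_integrable u" using V(3) u(1) by (intro square_integrable_continuous) auto
      have sw: "square_integrable ?w"
        by (rule square_integrable_bounded[OF measurable_cube_measure_borel[OF wb(1)] wb(2)])
      have "(\<integral>x. (\<mu> x - ?w x)\<^sup>2 \<partial>cube_measure) \<le> (\<integral>x. (\<mu> x - u x)\<^sup>2 \<partial>cube_measure)"
      proof (rule integral_mono_AE)
        show "integrable cube_measure (\<lambda>x. (\<mu> x - ?w x)\<^sup>2)" "integrable cube_measure (\<lambda>x. (\<mu> x - u x)\<^sup>2)"
          using square_integrable_diff[OF sm sw] square_integrable_diff[OF sm su] by (auto simp: square_integrable_def)
        show "AE x in cube_measure. (\<mu> x - ?w x)\<^sup>2 \<le> (\<mu> x - u x)\<^sup>2"
          using B(2)[OF mu]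
        proof eventually_elim
          case (elim x)
          have "\<bar>\<mu> x - clamp B (u x)\<bar> \<le> \<bar>\<mu> x - u x\<bar>"
            using clamp_contract[of B "\<mu> x" "u x"] clamp_eq[OF elim] by simp
          then show ?case by (simp add: abs_le_square_iff)
        qed
      qed
      with u(2) have i: "(\<integral>x. (\<mu> x - ?w x)\<^sup>2 \<partial>cube_measure) \<le> K1 / real m ^ (2 * \<alpha>)" by linarith
      have cW: "ln (real (card W)) \<le> K1 * real m ^ CARD('r)"
      proof -
        have "real (card W) \<le> real (card V)" unfolding W_def using card_image_le[OF V(1)] by simp
        moreover have "real (card W) > 0" using W by (simp add: card_gt_0_iff)
        ultimately have "ln (real (card W)) \<le> ln (real (card V))" by simp
        then show ?thesis using V(4) by linarith
      qed
      have "ln (real (card W)) / real n + (\<integral>x. (\<mu> x - ?w x)\<^sup>2 \<partial>cube_measure)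
          \<le> K1 * real m ^ CARD('r) / real n + K1 / real m ^ (2 * \<alpha>)"
        using cW i by (intro add_mono divide_right_mono) auto
      also have "\<dots> = K1 * (real m ^ CARD('r) / real n) + K1 * (1 / real m ^ (2 * \<alpha>))" by simp
      also have "\<dots> \<le> K1 * (2 ^ CARD('r) * ?rate n) + K1 * ?rate n"
        using K1 m by (intro add_mono mult_left_mono) auto
      also have "\<dots> = K1 * (2 ^ CARD('r) + 1) * ?rate n" by (simp add: algebra_simps)
      finally have "K * (ln (real (card W)) / real n + (\<integral>x. (\<mu> x - ?w x)\<^sup>2 \<partial>cube_measure)) \<le> K * (K1 * (2 ^ CARD('r) + 1) * ?rate n)"
        using K by (rule mult_left_mono)
      then have "ennreal (K * (ln (real (card W)) / real n + (\<integral>x. (\<mu> x - ?w x)\<^sup>2 \<partial>cube_measure))) \<le> ennreal (A * ?rate n)"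
        by (intro ennreal_leI) (simp add: A_def mult.assoc)
      with e(2)[OF mm B(2)[OF mu] sg h w] show ?thesis by (rule order_trans)
    qed
    show ?thesis
      unfolding minimax_risk_def by (rule INF_lower2[OF e(1)]) (intro SUP_least risk)
  qed
  moreover have "A \<ge> 0" using K K1 by (simp add: A_def)
  ultimately show ?thesis by blast
qed

text \<open>The squared bump is at most a constant on its cell, where a = 0 and b = 1, and at least
  a constant on the middle half, where a = 1 / 4 and b = 3 / 4. Only the r coordinates in the range
  of \<iota> are restricted, so the volumes are r-fold products of side lengths.\<close>

lemma bump_integral_bounds:
  fixes \<iota> :: "'r::{finite,linorder} \<Rightarrow> 'd::{finite,linorder}"
  assumes \<iota>: "inj \<iota>" and k: "k \<in> below m"
    and M: "\<And>x. \<bar>bump 0 x\<bar> \<le> M" and b0: "b0 > 0" "\<And>x. x \<in> {1/4..3/4} \<Longrightarrow> b0 \<le> bump 0 x"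
  shows "(\<integral>x. (c * tbump m k (\<lambda>_. 0) (proj \<iota> x))\<^sup>2 \<partial>(cube_measure :: ((real, 'd) vec) measure)) \<le> (c * M ^ CARD('r))\<^sup>2 / real m ^ CARD('r)"
    and "(c * b0 ^ CARD('r))\<^sup>2 / (2 * real m) ^ CARD('r) \<le> (\<integral>x. (c * tbump m k (\<lambda>_. 0) (proj \<iota> x))\<^sup>2 \<partial>(cube_measure :: ((real, 'd) vec) measure))"
proof -
  let ?F = "\<lambda>x. c * tbump m k (\<lambda>_. 0) (proj \<iota> x)"
  have m: "real m > 0" using k by (force simp: below_iff)
  have tb: "tbump m k (\<lambda>_. 0) (proj \<iota> x) = (\<Prod>j\<in>UNIV. bump 0 (real m * x $ \<iota> j - real (k j)))" for x :: "(real, 'd) vec"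
    by (simp add: tens_def cell_bump_def)
  have cont: "continuous_on UNIV ?F"
    by (intro continuous_intros continuous_on_compose2[OF smooth_continuous[OF smooth_tens[OF derivs_cell_bump]] continuous_on_proj]) auto
  have iF: "integrable cube_measure (\<lambda>x. (?F x)\<^sup>2)"
    using square_integrable_continuous[OF cont] by (simp add: square_integrable_def)
  define A where "A a b = {x \<in> (unit_cube :: ((real, 'd) vec) set). \<forall>j. x $ \<iota> j \<in> {(real (k j) + a) / real m..(real (k j) + b) / real m}}" for a b
  have mA: "measure cube_measure (A a b) = ((b - a) / real m) ^ CARD('r)" if ab: "0 \<le> a" "a \<le> b" "b \<le> 1" for a b
  proof -
    have "{0..1} \<inter> {(real (k j) + a) / real m..(real (k j) + b) / real m} = {(real (k j) + a) / real m..(real (k j) + b) / real m}" for j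
    proof -
      have "Suc (k j) \<le> m" using k by (simp add: below_iff Suc_le_eq)
      then have "real (k j) + 1 \<le> real m" by linarith
      then have "0 \<le> (real (k j) + a) / real m" "(real (k j) + b) / real m \<le> 1" using ab m by (auto simp: field_simps)
      then show ?thesis by auto
    qed
    note inter = this
    have "measure cube_measure (A a b) = (\<Prod>j\<in>UNIV. measure lborel {(real (k j) + a) / real m..(real (k j) + b) / real m})"
      unfolding A_def by (subst measure_cube_proj_box[OF \<iota>]) (simp_all only: inter sets_lborel atLeastAtMost_borel)
    also have "\<dots> = (\<Prod>j\<in>(UNIV :: 'r set). (b - a) / real m)"
    proof (rule prod.cong)
      fix j
      have "(real (k j) + a) / real m \<le> (real (k j) + b) / real m" using ab m by (intro divide_right_mono) auto
      then show "measure lborel {(real (k j) + a) / real m..(real (k j) + b) / real m} = (b - a) / real m"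
        by (simp add: diff_divide_distrib add_divide_distrib)
    qed simp
    finally show ?thesis by simp
  qed
  have sA: "A a b \<in> sets cube_measure" for a b
  proof -
    have "closed {x :: (real, 'd) vec. \<forall>j. x $ \<iota> j \<in> {(real (k j) + a) / real m..(real (k j) + b) / real m}}"
      by (simp add: closed_Collect_all closed_Collect_conj closed_Collect_le continuous_on_component)
    then have "A a b \<in> sets borel" unfolding A_def by (simp add: Collect_conj_eq borel_closed sets.Int)
    then show ?thesis unfolding cube_measure_def sets_restrict_space by (auto simp: A_def image_iff intro!: bexI[of _ "A a b"])
  qed
  have iA: "integrable cube_measure (\<lambda>x. v * indicator (A a b) x)" and vA: "(\<integral>x. v * indicator (A a b) x \<partial>cube_measure) = v * measure cube_measure (A a b)" for v a b
  proof -
    have "integrable cube_measure (indicator (A a b) :: _ \<Rightarrow> real)"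
      using sA by (intro integrable_real_indicator) (auto simp: cube.emeasure_eq_measure)
    then show "integrable cube_measure (\<lambda>x. v * indicator (A a b) x)" by simp
    have "A a b \<inter> space cube_measure = A a b" by (auto simp: A_def)
    then show "(\<integral>x. v * indicator (A a b) x \<partial>cube_measure) = v * measure cube_measure (A a b)" by simp
  qed
  have "(\<integral>x. (?F x)\<^sup>2 \<partial>cube_measure) \<le> (\<integral>x. (c * M ^ CARD('r))\<^sup>2 * indicator (A 0 1) x \<partial>cube_measure)"
  proof (rule integral_mono[OF iF iA])
    fix x :: "(real, 'd) vec" assume "x \<in> space cube_measure"
    then have x: "x \<in> unit_cube" by simp
    show "(?F x)\<^sup>2 \<le> (c * M ^ CARD('r))\<^sup>2 * indicator (A 0 1) x"
    proof (cases "tbump m k (\<lambda>_. 0) (proj \<iota> x) = 0")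
      case False
      have "x \<in> A 0 1"
        unfolding A_def using x tbump_support[OF False] m by (auto simp: field_simps less_imp_le)
      moreover have "\<bar>?F x\<bar> \<le> \<bar>c\<bar> * M ^ CARD('r)"
      proof -
        have "\<bar>tbump m k (\<lambda>_. 0) (proj \<iota> x)\<bar> \<le> (\<Prod>j\<in>(UNIV :: 'r set). M)"
          unfolding tb abs_prod using M by (intro prod_mono) auto
        then show ?thesis by (simp add: abs_mult mult_left_mono)
      qed
      then have "\<bar>?F x\<bar>\<^sup>2 \<le> (\<bar>c\<bar> * M ^ CARD('r))\<^sup>2" by (intro power_mono) auto
      ultimately show ?thesis by (simp add: power_mult_distrib)
    qed simp
  qed
  also have "\<dots> = (c * M ^ CARD('r))\<^sup>2 / real m ^ CARD('r)" unfolding vA by (simp add: mA power_divide)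
  finally show "(\<integral>x. (?F x)\<^sup>2 \<partial>cube_measure) \<le> (c * M ^ CARD('r))\<^sup>2 / real m ^ CARD('r)" .
  have "(c * b0 ^ CARD('r))\<^sup>2 / (2 * real m) ^ CARD('r) = (\<integral>x. (c * b0 ^ CARD('r))\<^sup>2 * indicator (A (1/4) (3/4)) x \<partial>cube_measure)"
    unfolding vA by (simp add: mA power_divide power_mult_distrib)
  also have "\<dots> \<le> (\<integral>x. (?F x)\<^sup>2 \<partial>cube_measure)"
  proof (rule integral_mono[OF iA iF])
    fix x :: "(real, 'd) vec"
    show "(c * b0 ^ CARD('r))\<^sup>2 * indicator (A (1/4) (3/4)) x \<le> (?F x)\<^sup>2"
    proof (cases "x \<in> A (1/4) (3/4)")
      case True
      have "real m * x $ \<iota> j - real (k j) \<in> {1/4..3/4}" for j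
        using True m by (auto simp: A_def field_simps)
      then have "(\<Prod>j\<in>(UNIV :: 'r set). b0) \<le> tbump m k (\<lambda>_. 0) (proj \<iota> x)"
        unfolding tb using b0 by (intro prod_mono) auto
      then have "\<bar>c\<bar> * b0 ^ CARD('r) \<le> \<bar>c\<bar> * tbump m k (\<lambda>_. 0) (proj \<iota> x)"
        by (intro mult_left_mono) auto
      then have "(\<bar>c\<bar> * b0 ^ CARD('r))\<^sup>2 \<le> (\<bar>c\<bar> * tbump m k (\<lambda>_. 0) (proj \<iota> x))\<^sup>2"
        using b0 by (intro power_mono) auto
      then show ?thesis using True by (simp add: power_mult_distrib)
    qed simp
  qed
  finally show "(c * b0 ^ CARD('r))\<^sup>2 / (2 * real m) ^ CARD('r) \<le> (\<integral>x. (?F x)\<^sup>2 \<partial>cube_measure)" .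
qed

lemma minimax_lower:
  fixes C C' Cbar :: real and f :: "real \<Rightarrow> real"
    and T :: "(real ^ 'd::{finite,linorder} \<Rightarrow> real) set"
  assumes T: "T = interaction_class TYPE('r::{finite,linorder}) \<alpha> C"
    and rd: "CARD('r) \<le> CARD('d)" and C: "C > 0" "C' > 0" "Cbar > 1" and f: "regular_density f"
  shows "\<exists>a>0. \<forall>n\<ge>1. ennreal (a * real n powr (- (2 * real \<alpha> / (2 * real \<alpha> + real CARD('r)))))
    \<le> minimax_risk f T (scale_class C') (density_class Cbar) n"
proof -
  let ?r = "CARD('r)"
  let ?rate = "\<lambda>n. real n powr (- (2 * real \<alpha> / (2 * real \<alpha> + real ?r)))"
  have fr: "continuous_on UNIV f" "\<And>y. 0 < f y" "has_bochner_integral lborel f 1"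
    using f by (auto simp: regular_density_def)
  obtain \<iota> :: "'r \<Rightarrow> 'd" where \<iota>: "strict_mono \<iota>" using strict_mono_exists[OF rd] by blast
  then have inj: "inj \<iota>" by (rule strict_mono_imp_inj_on)
  obtain H where H: "H > 0" "\<And>a b. \<bar>a - b\<bar> \<le> 1 \<Longrightarrow>
    ennreal (1 - H * (a - b)\<^sup>2) \<le> (\<integral>\<^sup>+y. ennreal (sqrt (f (y - a) * f (y - b))) \<partial>lborel)"
    using hellinger_shift[OF f] by blast
  obtain c0 where c0: "c0 > 0" "\<forall>c m. 0 \<le> c \<longrightarrow> c \<le> c0 \<longrightarrow> m \<ge> 1 \<longrightarrow>
    (\<forall>S\<subseteq>below m. bump_sum (c / real m ^ \<alpha>) m S \<in> (sobolev_ball \<alpha> C :: ((real, 'r) vec \<Rightarrow> real) set))"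
    using bump_sum_in_ball[OF C(1)] by blast
  obtain M where M: "M \<ge> 1" "\<And>l x. l \<le> 0 \<Longrightarrow> \<bar>bump l x\<bar> \<le> M" using bump_bound_upto[of 0] by blast
  obtain y0 where y0: "y0 \<in> {1/4..3/4}" "\<And>y. y \<in> {1/4..3/4} \<Longrightarrow> bump 0 y0 \<le> bump 0 y"
    using continuous_attains_inf[of "{1/4..3/4::real}" "bump 0"] derivs_continuous[OF derivs_bump] by auto
  define b0 where "b0 = bump 0 y0"
  have b0: "b0 > 0" "\<And>y. y \<in> {1/4..3/4} \<Longrightarrow> b0 \<le> bump 0 y" using y0 by (auto simp: b0_def intro!: bump_pos)
  \<comment> \<open>Small enough for three purposes: the bump sums stay in the Sobolev ball, every
    bump is bounded by 1 as the Hellinger bound requires, and H (\<gamma> M^r)^2 \<le> 1 / 4 makes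
    one bump undetectable from n observations.\<close>
  define \<gamma> where "\<gamma> = min c0 (1 / (M ^ ?r * (1 + 4 * H)))"
  have MR: "M ^ ?r \<ge> 1" using M(1) by simp
  have \<gamma>: "\<gamma> > 0" "\<gamma> \<le> c0" using c0 MR H by (auto simp: \<gamma>_def intro!: divide_pos_pos mult_pos_pos)
  have \<gamma>M: "\<gamma> * M ^ ?r \<le> 1 / (1 + 4 * H)"
  proof -
    have "\<gamma> * M ^ ?r \<le> 1 / (M ^ ?r * (1 + 4 * H)) * M ^ ?r" using MR by (intro mult_right_mono) (auto simp: \<gamma>_def)
    also have "\<dots> = 1 / (1 + 4 * H)"
    proof -
      have "M ^ ?r \<noteq> 0" using MR by linarith
      then show ?thesis by simp
    qed
    finally show ?thesis .
  qed
  have \<gamma>1: "\<gamma> * M ^ ?r \<le> 1" using \<gamma>M H by (rule_tac order_trans) auto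
  have \<gamma>H: "H * (\<gamma> * M ^ ?r)\<^sup>2 \<le> 1 / 4"
  proof -
    have "(\<gamma> * M ^ ?r)\<^sup>2 \<le> 1 / (1 + 4 * H) * 1"
      unfolding power2_eq_square using \<gamma>M \<gamma>1 \<gamma> MR H by (intro mult_mono) auto
    then have "H * (\<gamma> * M ^ ?r)\<^sup>2 \<le> H * (1 / (1 + 4 * H))" using H by (intro mult_left_mono) auto
    also have "\<dots> \<le> 1 / 4" using H by (simp add: field_simps)
    finally show ?thesis .
  qed
  \<comment> \<open>The factor 1 / 8 comes from Assouad's bound,
    \<open>\<gamma>\<^sup>2 * (b0\<^sup>2 / 2) ^ ?r\<close> from the energy of the bumps on the
    middle halves of all cells, and 4^\<alpha> from rounding m up.\<close>
  define a where "a = 1 / 8 * \<gamma>\<^sup>2 * (b0\<^sup>2 / 2) ^ ?r / 4 ^ \<alpha>"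
  have a: "a > 0" using \<gamma> b0 by (simp add: a_def)
  have "ennreal (a * ?rate n) \<le> minimax_risk f T (scale_class C') (density_class Cbar) n" if n: "n \<ge> 1" for n
  proof -
    obtain m where m: "m \<ge> 1" "real n \<le> real m ^ (2 * \<alpha> + ?r)" "?rate n \<le> 4 ^ \<alpha> / real m ^ (2 * \<alpha>)"
      using grid_size_exists[OF n, of \<alpha> ?r] by (metis add_gr_0 zero_less_card_finite)
    let ?I = "below m :: ('r \<Rightarrow> nat) set"
    define c where "c = \<gamma> / real m ^ \<alpha>"
    define \<beta> where "\<beta> k x = c * tbump m k (\<lambda>_. 0) (proj \<iota> x)" for k :: "'r \<Rightarrow> nat" and x :: "(real, 'd) vec"
    have cpos: "c > 0" using \<gamma> m by (simp add: c_def)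
    have c\<gamma>: "c \<le> \<gamma>" using \<gamma> m by (simp add: c_def divide_le_eq)
    have inT: "(\<lambda>x. \<Sum>k\<in>S. \<beta> k x) \<in> T" if S: "S \<subseteq> ?I" for S
    proof -
      have ball: "bump_sum c m S' \<in> sobolev_ball \<alpha> C" if "S' \<subseteq> ?I" for S'
        using c0(2) \<gamma> m(1) that unfolding c_def by auto
      have z: "(\<lambda>z. 0) = bump_sum c m ({} :: ('r \<Rightarrow> nat) set)" by (simp add: bump_sum_def[abs_def])
      have "(\<lambda>x. bump_sum c m S (proj \<iota> x)) \<in> T"
        unfolding T by (rule bump_sum_in_interaction_class[OF \<iota> ball[OF S]]) (simp add: z ball)
      then show ?thesis by (simp add: bump_sum_def \<beta>_def[abs_def])
    qed
    \<comment> \<open>The submodel of the lower bound belongs to the classes: unit scale corresponds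
      to zero exponents, and the uniform density satisfies its bounds because Cbar > 1.\<close>
    have sc: "(\<lambda>_. 1) \<in> (scale_class C' :: ((real, 'd) vec \<Rightarrow> real) set)"
      unfolding scale_class_def using C by (auto intro!: exI[of _ 0])
    have dc: "(\<lambda>_. 1) \<in> (density_class Cbar :: ((real, 'd) vec \<Rightarrow> real) set)"
      using C by (auto simp: density_class_def)
    show ?thesis
      unfolding minimax_risk_def
    proof (rule INF_greatest)
      fix e :: "(nat \<Rightarrow> ((real, 'd) vec) \<times> real) \<Rightarrow> (real, 'd) vec \<Rightarrow> real" assume e: "e \<in> estimators n"
      let ?R = "SUP \<mu>\<in>T. SUP \<sigma>\<in>scale_class C'. SUP h\<in>density_class Cbar. (\<integral>\<^sup>+s. sq_dist h \<mu> (e s) \<partial>sample_law f n \<mu> \<sigma> h)"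
      have "ennreal (1 / 8 * (\<Sum>k\<in>?I. \<integral>x. (\<beta> k x)\<^sup>2 \<partial>cube_measure)) \<le> ?R"
      proof (rule assouad_lower[OF fr H finite_below _ _ _ _ e])
        show "continuous_on UNIV (\<beta> k)" for k
          unfolding \<beta>_def[abs_def]
          by (intro continuous_intros continuous_on_compose2[OF smooth_continuous[OF smooth_tens[OF derivs_cell_bump]] continuous_on_proj]) auto
        show "\<bar>\<beta> k x\<bar> \<le> 1" for k x
        proof -
          have "\<bar>\<beta> k x\<bar> = c * \<bar>tbump m k (\<lambda>_. 0) (proj \<iota> x)\<bar>" using cpos by (simp add: \<beta>_def abs_mult)
          also have "\<dots> \<le> \<gamma> * M ^ ?r"
            using tbump_bound[where l = "\<lambda>_. 0" and m = m and k = k and z = "proj \<iota> x", OF M(2)] cpos c\<gamma> \<gamma> by (intro mult_mono) auto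
          finally show ?thesis using \<gamma>1 by linarith
        qed
        show "k = k'" if "\<beta> k x \<noteq> 0" "\<beta> k' x \<noteq> 0" for k k' x
          using that tbump_disjoint by (auto simp: \<beta>_def)
        show "real n * H * (\<integral>x. (\<beta> k x)\<^sup>2 \<partial>cube_measure) \<le> 1 / 4" if k: "k \<in> ?I" for k
        proof -
          have "(\<integral>x. (\<beta> k x)\<^sup>2 \<partial>cube_measure) \<le> (c * M ^ ?r)\<^sup>2 / real m ^ ?r"
            unfolding \<beta>_def by (rule bump_integral_bounds(1)[OF inj k M(2) b0]) auto
          also have "\<dots> = (\<gamma> * M ^ ?r)\<^sup>2 / real m ^ (2 * \<alpha> + ?r)"
            using m(1) by (simp add: c_def power_add power_mult_distrib power_divide power_mult mult.commute[of 2])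
          finally have "real n * H * (\<integral>x. (\<beta> k x)\<^sup>2 \<partial>cube_measure) \<le> real n * H * ((\<gamma> * M ^ ?r)\<^sup>2 / real m ^ (2 * \<alpha> + ?r))"
            using H by (intro mult_left_mono) auto
          also have "\<dots> = (real n / real m ^ (2 * \<alpha> + ?r)) * (H * (\<gamma> * M ^ ?r)\<^sup>2)" by simp
          also have "\<dots> \<le> 1 * (1 / 4)" using m \<gamma>H H by (intro mult_mono) (auto simp: divide_le_eq)
          finally show ?thesis by simp
        qed
        show "(\<integral>\<^sup>+s. sq_dist (\<lambda>_. 1) (\<lambda>x. \<Sum>k\<in>S. \<beta> k x) (e s) \<partial>sample_law f n (\<lambda>x. \<Sum>k\<in>S. \<beta> k x) (\<lambda>_. 1) (\<lambda>_. 1)) \<le> ?R"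
          if "S \<subseteq> ?I" for S
          by (rule SUP_upper2[OF inT[OF that]], rule SUP_upper2[OF sc], rule SUP_upper2[OF dc], rule order_refl)
      qed
      moreover have "a * ?rate n \<le> 1 / 8 * (\<Sum>k\<in>?I. \<integral>x. (\<beta> k x)\<^sup>2 \<partial>cube_measure)"
      proof -
        have "real m ^ ?r * ((c * b0 ^ ?r)\<^sup>2 / (2 * real m) ^ ?r) \<le> (\<Sum>k\<in>?I. \<integral>x. (\<beta> k x)\<^sup>2 \<partial>cube_measure)"
        proof -
          have "(\<Sum>k\<in>?I. (c * b0 ^ ?r)\<^sup>2 / (2 * real m) ^ ?r) \<le> (\<Sum>k\<in>?I. \<integral>x. (\<beta> k x)\<^sup>2 \<partial>cube_measure)"
            unfolding \<beta>_def by (intro sum_mono bump_integral_bounds(2)[OF inj _ M(2) b0]) auto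
          then show ?thesis by (simp add: card_below)
        qed
        moreover have "real m ^ ?r * ((c * b0 ^ ?r)\<^sup>2 / (2 * real m) ^ ?r) = \<gamma>\<^sup>2 * (b0\<^sup>2 / 2) ^ ?r / real m ^ (2 * \<alpha>)"
        proof -
          have "(c * b0 ^ ?r)\<^sup>2 = \<gamma>\<^sup>2 / real m ^ (2 * \<alpha>) * (b0\<^sup>2) ^ ?r"
            by (simp add: c_def power_mult_distrib power_divide power_mult[symmetric] mult.commute)
          then show ?thesis using m(1) by (simp add: power_mult_distrib power_divide)
        qed
        moreover have "a * ?rate n \<le> a * (4 ^ \<alpha> / real m ^ (2 * \<alpha>))" using a m(3) by (intro mult_left_mono) auto
        moreover have "a * (4 ^ \<alpha> / real m ^ (2 * \<alpha>)) = 1 / 8 * (\<gamma>\<^sup>2 * (b0\<^sup>2 / 2) ^ ?r / real m ^ (2 * \<alpha>))"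
          by (simp add: a_def)
        ultimately show ?thesis by linarith
      qed
      ultimately show "ennreal (a * ?rate n) \<le> ?R" using ennreal_leI order_trans by blast
    qed
  qed
  then show ?thesis using a by blast
qed

theorem corollary3:
  fixes \<alpha> :: nat and C C' Cbar :: real and f :: "real \<Rightarrow> real"
    and T :: "(real ^ 'd::{finite,linorder} \<Rightarrow> real) set"
  assumes "T = interaction_class TYPE('r::{finite,linorder}) \<alpha> C"
    and "\<alpha> \<ge> 1" and "CARD('r) \<le> CARD('d)" and "C > 0" and "C' > 0" and "Cbar > 1"
    and "error_density f"
    and "(SUP \<mu>\<in>T. esssup cube_measure (\<lambda>x. ennreal \<bar>\<mu> x\<bar>)) < \<infinity>"
  shows "(\<forall>\<^sub>F n in sequentially. minimax_risk f T (scale_class C') (density_class Cbar) n < \<infinity>) \<and>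
    (\<lambda>n. enn2real (minimax_risk f T (scale_class C') (density_class Cbar) n))
      \<in> \<Theta>(\<lambda>n. real n powr (- (2 * real \<alpha> / (2 * real \<alpha> + real CARD('r)))))"
proof -
  let ?rate = "\<lambda>n. real n powr (- (2 * real \<alpha> / (2 * real \<alpha> + real CARD('r))))"
  let ?risk = "\<lambda>n. minimax_risk f T (scale_class C') (density_class Cbar) n"
  obtain g where g: "regular_density g" "AE y in lborel. f y = g y" "f \<in> borel_measurable borel"
    using error_density_regular[OF assms(7)] by blast
  have mg: "g \<in> borel_measurable borel"
    using g(1) by (auto simp: regular_density_def intro: borel_measurable_continuous_onI)
  have fg: "minimax_risk f = minimax_risk g" by (rule minimax_risk_cong_AE[OF g(3) mg g(2)])
  let ?b = "SUP \<mu>\<in>T. esssup cube_measure (\<lambda>x. ennreal \<bar>\<mu> x\<bar>)"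
  \<comment> \<open>The hypothesis bounds essential suprema, so the bound on \<mu> holds almost
    everywhere; the added 1 keeps B positive even if the supremum is 0.\<close>
  define B where "B = enn2real ?b + 1"
  have B: "B > 0" by (simp add: B_def add_nonneg_pos)
  have TB: "AE x in cube_measure. \<bar>\<mu> x\<bar> \<le> B" if mu: "\<mu> \<in> T" for \<mu>
    using esssup_AE[of "\<lambda>x. ennreal \<bar>\<mu> x\<bar>" cube_measure]
  proof eventually_elim
    case (elim x)
    also have "esssup cube_measure (\<lambda>x. ennreal \<bar>\<mu> x\<bar>) \<le> ?b" by (rule SUP_upper[OF mu])
    also have "?b = ennreal (enn2real ?b)" using assms(8) by simp
    finally have "\<bar>\<mu> x\<bar> \<le> enn2real ?b" by (simp add: ennreal_le_iff)
    then show ?case by (simp add: B_def)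
  qed
  obtain A where A: "A \<ge> 0" "\<And>n. n \<ge> 1 \<Longrightarrow> ?risk n \<le> ennreal (A * ?rate n)"
    using minimax_upper[OF assms(1,5,6) g(1) B TB] unfolding fg by blast
  obtain a where a: "a > 0" "\<And>n. n \<ge> 1 \<Longrightarrow> ennreal (a * ?rate n) \<le> ?risk n"
    using minimax_lower[OF assms(1,3,4,5,6) g(1)] unfolding fg by blast
  \<comment> \<open>Finiteness makes the passage to real numbers faithful, since
    \<open>enn2real\<close> sends \<infinity> to 0.\<close>
  have fin: "?risk n < \<infinity>" if "n \<ge> 1" for n
    using A(2)[OF that] by (simp add: le_less_trans)
  have up: "enn2real (?risk n) \<le> A * ?rate n" if "n \<ge> 1" for n
    using A(2)[OF that] A(1) by (intro enn2real_leI) auto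
  have low: "a * ?rate n \<le> enn2real (?risk n)" if "n \<ge> 1" for n
  proof -
    have "enn2real (ennreal (a * ?rate n)) \<le> enn2real (?risk n)"
      using a(2)[OF that] fin[OF that] by (intro enn2real_mono) auto
    then show ?thesis using a(1) by simp
  qed
  have ev: "\<forall>\<^sub>F n in sequentially. n \<ge> (1::nat)" by (rule eventually_ge_at_top)
  have "(\<lambda>n. enn2real (?risk n)) \<in> O(?rate)"
    
  proof (rule bigoI[of _ A])
    show "\<forall>\<^sub>F n in sequentially. norm (enn2real (?risk n)) \<le> A * norm (?rate n)"
      using ev by eventually_elim (use up in simp)
  qed
  moreover have "?rate \<in> O(\<lambda>n. enn2real (?risk n))"
  proof (rule bigoI[of _ "1 / a"])
    show "\<forall>\<^sub>F n in sequentially. norm (?rate n) \<le> 1 / a * norm (enn2real (?risk n))"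
      using ev by eventually_elim (use low a(1) in \<open>simp add: field_simps\<close>)
  qed
  ultimately have "(\<lambda>n. enn2real (?risk n)) \<in> \<Theta>(?rate)"
    by (simp add: bigtheta_def bigomega_iff_bigo)
  moreover have "\<forall>\<^sub>F n in sequentially. ?risk n < \<infinity>"
    using ev by eventually_elim (rule fin)
  ultimately show ?thesis by blast
qed

end
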